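(* Suppose that, almost surely, there exists $N$ such that the family $\{\widehat g\mid n\ge N\}\cup\{g\}$ (with observable $h$) satisfies Assumptions A, B, C and D (stated in the context) with $p_0\ge2$, and that $h$ is not $g$-cohomologous to a constant in $L^2(m)$ (i.e. there do not exist $\ell\in L^2(m)$ and a constant $c$ with $h=\ell\circ g-\ell+c$). Let $\mathcal C$ be a space in the chain ( * ) of the context such that $\mathcal C\hookrightarrow\mathcal X_3\hookrightarrow\mathcal X_3^{(+)}$, and assume that $\|\rho_{\mu^*}-\rho_\mu\|_{\mathcal C}\to0$ as $n\to\infty$. Let $$T_n=\frac{1}{\sqrt n}\big(S_n(h)-nA\big),\qquad T_n^*=\frac{1}{\sqrt n}\big(S_n^*(h)-nA^*\big).$$ Then $$\sup_{z\in\mathbb R}\Big|\mathbb P_\mu(T_n\le z)-\mathbb P\big(T_n^*\le z\mid x_0,\dots,x_{n-1}\big)\Big|=o_{\text{a.s.}}(1).$$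
   Context: **Setting.** $X$ is a metric space with a reference Borel probability measure $m$; $g:X\to X$ is a Borel map, $x_0\sim\mu$ and $x_k=g^k(x_0)$, where $\mu$ is a Borel probability measure with density $\rho_\mu$ with respect to $m$; $h:X\to\mathbb R$, $h\in L^3(m)$, is a known observable. For each sample size $n$, $\widehat g=\widehat g_n:X\to X$ is an estimator of $g$ built from the data $x_0,\dots,x_{n-1}$, and $\mu^*=\mu^*_n$ is a probability measure (bootstrap initial distribution), possibly depending on $x_0,\dots,x_{n-1}$, with density $\rho_{\mu^*}$ with respect to $m$. Given the data, the bootstrap sample is $x_0^*\sim\mu^*$, $x_k^*=\widehat g^{\,k}(x_0^* )$. Put $S_n(h)=\sum_{k=0}^{n-1}h\circ g^k(x_0)$ and $A=\lim_n\mathbb E_\mu(S_n(h)/n)$. For the bootstrap, with $\widehat g$ and $\mu^*$ fixed (computed from the sample of size $n$) and $\mathbb E^*$ the expectation conditional on $x_0,\dots,x_{n-1}$, put $S^*_{n^*}(h)=\sum_{k=0}^{n^*-1}h\circ\widehat g^{\,k}(x_0^* )$ and $A^*=\lim_{n^*\to\infty}\mathbb E^*_{\mu^*}(S^*_{n^*}(h)/n^* )$; $S^*_n(h)$ is $S^*_{n^*}(h)$ with $n^*=n$. $R_n=o_{\text{a.s.}}(1)$ means $R_n\to0$ almost surely. **Identification with a family.** One views $g$ as $g_0$, $\widehat g_n$ as $g_{\theta_n}$, where $\{\theta_n\}$ is a sequence with $\theta_n\to0$, and $h_\theta=h$ for all $\theta$. In the assumptions below, $\theta$ ranges over the parameters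 $\{\theta_n: n\ge N\}\cup\{0\}$, and continuity/limits in $\theta$ are along this set; the maps $g_\theta$ are non-singular ($m(U)=0\Rightarrow m(g_\theta^{-1}U)=0$). Put $S_{\theta,n}(h_\theta)=\sum_{k=0}^{n-1}h_\theta\circ g_\theta^k$ and $H_\theta(\psi)=h_\theta\psi$. The transfer operator $\mathcal L_\theta$ on $L^1(m)$ is given by $m(\mathcal L_\theta(\varphi)\psi)=m(\varphi\cdot\psi\circ g_\theta)$, $\varphi\in L^1(m)$, $\psi\in L^\infty(m)$ (where $m(f)=\int f\,dm$), and $\mathcal L_{\theta,is}(\cdot)=\mathcal L_\theta(e^{ish_\theta}\,\cdot)$, $s\in\mathbb R$. **Notation.** $\mathcal L(\mathcal B_1,\mathcal B_2)$: bounded linear operators between Banach spaces, norm $\|\cdot\|_{\mathcal B_1,\mathcal B_2}$. $\hookrightarrow$: continuous embedding. An operator has a spectral gap of $(1-\kappa)$ on $\mathcal B_1$ if $1$ is a dominating simple eigenvalue on $\mathcal B_1$ and the rest of its spectrum is strictly inside the disk of radius $\kappa$ centred at $0$. **Assumption A.** There exist $\delta>0$, $p_0\ge1$ and Banach spaces $\mathcal B\hookrightarrow\widetilde{\mathcal B}\hookrightarrow L^{p_0}(m)$, each containing $\mathbf 1_X$, such that: (1) for all $\theta\in(-\delta,\delta)$, $s\in\mathbb R$, $\mathcal L_{\theta,is}\in\mathcal L(\mathcal B,\mathcal B)\cap\mathcal L(\widetilde{\mathcal B},\widetilde{\mathcal B})$ and $(\theta,s)\mapsto\mathcal L_{\theta,is}\in\mathcal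 L(\mathcal B,\widetilde{\mathcal B})$ is continuous; (2) either $\mathcal B=\widetilde{\mathcal B}$, or there are $c,C>0$, $\kappa\in(0,1)$ with $\sup_{|\theta|,|s|\in[0,\delta]}\|\mathcal L_{\theta,is}^n\psi\|_{\mathcal B}\le c\kappa^n\|\psi\|_{\mathcal B}+C^n\|\psi\|_{\widetilde{\mathcal B}}$ for all $\psi\in\mathcal B$ and all $n$. **Assumption B.** There exist $\delta>0$ and Banach spaces, each containing $\mathbf 1_X$, $$( * )\quad \mathcal B=\mathcal X_0\hookrightarrow\mathcal X_0^{(+)}\hookrightarrow\mathcal X_1\hookrightarrow\mathcal X_1^{(+)}\hookrightarrow\mathcal X_2\hookrightarrow\mathcal X_2^{(+)}\hookrightarrow\mathcal X_3\hookrightarrow\mathcal X_3^{(+)}\hookrightarrow\mathcal X_4=\widetilde{\mathcal B}$$ such that: (1) for $a=0,1,2,3$, $\theta\in(-\delta,\delta)$, $s\in\mathbb R$: $\mathcal L_{\theta,is}\in\mathcal L(\mathcal X_a,\mathcal X_a)\cap\mathcal L(\mathcal X_a^{(+)},\mathcal X_a^{(+)})$; (2) for all $\theta\in(-\delta,\delta)$, $a=0,1,2$, $j=1,\dots,3-a$, the map $s\mapsto\mathcal L_{\theta,is}\in\mathcal L(\mathcal X_a^{(+)},\mathcal X_{a+j})$ is $C^j$ on $(-\delta,\delta)$, with $j$-th derivatives given by $(\mathcal L^n_{\theta,is})^{(j)}(\cdot)=\mathcal L^n_{\theta,is}((iS_{\theta,n}(h_\theta))^j\,\cdot\,)\in\mathcal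 L(\mathcal X_a^{(+)},\mathcal X_{a+j})$; (3) either $\mathcal X_0=\mathcal X_3^{(+)}$, or: $(\theta,s)\mapsto\mathcal L_{\theta,is}\in\mathcal L(\mathcal X_a,\mathcal X_a^{(+)})$ is continuous on $(-\delta,\delta)\times\mathbb R$ and there are $c,C>0$, $\kappa\in(0,1)$ with $\sup_{|\theta|,|s|\in[0,\delta]}\|\mathcal L^n_{\theta,is}\psi\|_{\mathcal C}\le c\kappa^n\|\psi\|_{\mathcal C}+C^n\|\psi\|_{\widetilde{\mathcal B}}$ for all $\psi\in\mathcal C$, all $n$, whenever $\mathcal C=\mathcal X_a$ or $\mathcal X_a^{(+)}$, $a=0,1,2,3$. **Assumption C.** There exist $\kappa\in(0,1)$, $\delta>0$ such that: (1) $\mathcal L_0$ has a spectral gap of $(1-\kappa)$ on $\mathcal B$; (2) for all $\theta\in(-\delta,\delta)$, $1$ is an eigenvalue of $\mathcal L_\theta:\mathcal B\to\mathcal B$; (3) $\mathcal L_0$ has a spectral gap of $(1-\kappa)$ on $\mathcal X_a$ and $\mathcal X_a^{(+)}$ for $a=0,1,2,3$; (4) for all $\theta\in(-\delta,\delta)$ and all $s\ne0$, the spectrum of $\mathcal L_{\theta,is}$ acting on either $\mathcal X_a$ or $\mathcal X_a^{(+)}$ for some $a=0,1,2,3$ is contained in $\{z\in\mathbb C: |z|<1\}$. **Assumption D.** For all pairs $\mathcal C_1\hookrightarrow\mathcal C_2\ne\widetilde{\mathcal B}$ of spaces appearing next to each other in ( * ) and all $\theta$, $H_\theta\in\mathcal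 L(\mathcal C_1,\mathcal C_2)$ and $\lim_{\theta\to0}\|H_\theta-H_0\|_{\mathcal C_1,\mathcal C_2}=0$. *)

theory Defs
  imports "HOL-Probability.Probability"
begin

text \<open>
  A normed space of equivalence classes (modulo equality \<open>m\<close>-almost everywhere) of complex
  functions is given by the set of all representatives of its classes and by the norm as a function
  of the representative. In \<open>banach_space\<close> the set of representatives is
  saturated under a.e. equality, and the kernel of the norm consists of the a.e. null functions.
\<close>

record 'x fspace =
  elems :: "('x \<Rightarrow> complex) set"
  nrm :: "('x \<Rightarrow> complex) \<Rightarrow> real"

definition banach_space :: "'x measure \<Rightarrow> 'x fspace \<Rightarrow> bool" where
  "banach_space m B \<longleftrightarrow>
     elems B \<subseteq> borel_measurable m \<and>
     (\<lambda>_. 0) \<in> elems B \<and>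
     (\<forall>f\<in>elems B. \<forall>g\<in>elems B. (\<lambda>x. f x + g x) \<in> elems B \<and> nrm B (\<lambda>x. f x + g x) \<le> nrm B f + nrm B g) \<and>
     (\<forall>f\<in>elems B. \<forall>c. (\<lambda>x. c * f x) \<in> elems B \<and> nrm B (\<lambda>x. c * f x) = norm c * nrm B f) \<and>
     (\<forall>f\<in>elems B. \<forall>g\<in>borel_measurable m. (AE x in m. f x = g x) \<longrightarrow> g \<in> elems B \<and> nrm B g = nrm B f) \<and>
     (\<forall>f\<in>elems B. 0 \<le> nrm B f \<and> (nrm B f = 0 \<longleftrightarrow> (AE x in m. f x = 0))) \<and>
     (\<forall>F. (\<forall>k::nat. F k \<in> elems B) \<and>
          (\<forall>e>0. \<exists>K. \<forall>k\<ge>K. \<forall>l\<ge>K. nrm B (\<lambda>x. F k x - F l x) < e) \<longrightarrow>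
          (\<exists>f\<in>elems B. (\<lambda>k. nrm B (\<lambda>x. F k x - f x)) \<longlonglongrightarrow> 0))"

definition same_space :: "'x fspace \<Rightarrow> 'x fspace \<Rightarrow> bool" where
  "same_space B1 B2 \<longleftrightarrow> elems B1 = elems B2 \<and> (\<forall>f\<in>elems B1. nrm B1 f = nrm B2 f)"

definition embeds :: "'x fspace \<Rightarrow> 'x fspace \<Rightarrow> bool" where
  "embeds B1 B2 \<longleftrightarrow> elems B1 \<subseteq> elems B2 \<and> (\<exists>K. \<forall>f\<in>elems B1. nrm B2 f \<le> K * nrm B1 f)"

definition Lp :: "'x measure \<Rightarrow> real \<Rightarrow> 'x fspace" where
  "Lp m p = \<lparr> elems = {f \<in> borel_measurable m. integrable m (\<lambda>x. norm (f x) powr p)},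
              nrm = (\<lambda>f. (\<integral>x. norm (f x) powr p \<partial>m) powr (1 / p)) \<rparr>"

definition Linf :: "'x measure \<Rightarrow> ('x \<Rightarrow> complex) set" where
  "Linf m = {f \<in> borel_measurable m. \<exists>K. AE x in m. norm (f x) \<le> K}"

text \<open>
  Operators act on representatives; linearity is required modulo a.e. equality. Together with
  boundedness this makes them well defined on classes.
\<close>

type_synonym 'x oper = "('x \<Rightarrow> complex) \<Rightarrow> ('x \<Rightarrow> complex)"

definition bounded_op :: "'x measure \<Rightarrow> 'x fspace \<Rightarrow> 'x fspace \<Rightarrow> 'x oper \<Rightarrow> bool" where
  "bounded_op m B1 B2 T \<longleftrightarrow>
     (\<forall>f\<in>elems B1. T f \<in> elems B2) \<and>
     (\<forall>f\<in>elems B1. \<forall>g\<in>elems B1. AE x in m. T (\<lambda>y. f y + g y) x = T f x + T g x) \<and>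
     (\<forall>f\<in>elems B1. \<forall>c. AE x in m. T (\<lambda>y. c * f y) x = c * T f x) \<and>
     (\<exists>K. \<forall>f\<in>elems B1. nrm B2 (T f) \<le> K * nrm B1 f)"

definition opnorm :: "'x fspace \<Rightarrow> 'x fspace \<Rightarrow> 'x oper \<Rightarrow> real" where
  "opnorm B1 B2 T = Sup {nrm B2 (T f) |f. f \<in> elems B1 \<and> nrm B1 f \<le> 1}"

definition op_continuous_on ::
  "'x measure \<Rightarrow> 'x fspace \<Rightarrow> 'x fspace \<Rightarrow> 'p::topological_space set \<Rightarrow> ('p \<Rightarrow> 'x oper) \<Rightarrow> bool" where
  "op_continuous_on m B1 B2 S F \<longleftrightarrow>
     (\<forall>p\<in>S. bounded_op m B1 B2 (F p)) \<and>
     (\<forall>p\<in>S. ((\<lambda>q. opnorm B1 B2 (\<lambda>f x. F q f x - F p f x)) \<longlongrightarrow> 0) (at p within S))"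

definition op_has_derivative ::
  "'x fspace \<Rightarrow> 'x fspace \<Rightarrow> (real \<Rightarrow> 'x oper) \<Rightarrow> 'x oper \<Rightarrow> real \<Rightarrow> bool" where
  "op_has_derivative B1 B2 F F' s \<longleftrightarrow>
     ((\<lambda>t. opnorm B1 B2 (\<lambda>f x. (F t f x - F s f x) / of_real (t - s) - F' f x)) \<longlongrightarrow> 0) (at s)"

definition op_higher_derivative ::
  "'x measure \<Rightarrow> 'x fspace \<Rightarrow> 'x fspace \<Rightarrow> nat \<Rightarrow> real set \<Rightarrow> (real \<Rightarrow> 'x oper) \<Rightarrow> (real \<Rightarrow> 'x oper) \<Rightarrow> bool" where
  "op_higher_derivative m B1 B2 j I F F' \<longleftrightarrow>
     (\<exists>D. D 0 = F \<and> D j = F' \<and>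
          (\<forall>i\<le>j. \<forall>s\<in>I. bounded_op m B1 B2 (D i s)) \<and>
          (\<forall>i<j. \<forall>s\<in>I. op_has_derivative B1 B2 (D i) (D (Suc i) s) s))"

definition op_spectrum :: "'x measure \<Rightarrow> 'x fspace \<Rightarrow> 'x oper \<Rightarrow> complex set" where
  "op_spectrum m B T = {z. \<not> (\<exists>R. bounded_op m B B R \<and>
     (\<forall>f\<in>elems B. AE x in m. R (\<lambda>y. z * f y - T f y) x = f x) \<and>
     (\<forall>f\<in>elems B. AE x in m. z * R f x - T (R f) x = f x))}"

definition op_eigenvalue :: "'x measure \<Rightarrow> 'x fspace \<Rightarrow> 'x oper \<Rightarrow> complex \<Rightarrow> bool" where
  "op_eigenvalue m B T z \<longleftrightarrow>
     (\<exists>f\<in>elems B. \<not> (AE x in m. f x = 0) \<and> (AE x in m. T f x = z * f x))"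

text \<open>
  Simple means algebraically simple: the eigenspace is a line and \<open>B\<close> is the direct sum of the
  eigenspace and the range of \<open>z - T\<close>. (One-dimensionality of the generalised eigenspace alone
  would be too weak in infinite dimension: the Riesz projection could still have infinite rank.)
\<close>

definition op_simple_eigenvalue :: "'x measure \<Rightarrow> 'x fspace \<Rightarrow> 'x oper \<Rightarrow> complex \<Rightarrow> bool" where
  "op_simple_eigenvalue m B T z \<longleftrightarrow>
     (\<exists>v\<in>elems B. \<not> (AE x in m. v x = 0) \<and>
        (\<forall>f\<in>elems B. (AE x in m. T f x = z * f x) \<longleftrightarrow> (\<exists>c. AE x in m. f x = c * v x)) \<and>
        (\<forall>f\<in>elems B. \<exists>!c. \<exists>w\<in>elems B. AE x in m. f x = c * v x + (z * w x - T w x)))"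

definition spectral_gap :: "'x measure \<Rightarrow> 'x fspace \<Rightarrow> 'x oper \<Rightarrow> real \<Rightarrow> bool" where
  "spectral_gap m B T \<kappa> \<longleftrightarrow>
     op_simple_eigenvalue m B T 1 \<and> (\<forall>z\<in>op_spectrum m B T - {1}. norm z < \<kappa>)"

definition nonsingular :: "'x measure \<Rightarrow> ('x \<Rightarrow> 'x) \<Rightarrow> bool" where
  "nonsingular m g \<longleftrightarrow> g \<in> measurable m m \<and>
     (\<forall>U\<in>sets m. emeasure m U = 0 \<longrightarrow> emeasure m (g -` U \<inter> space m) = 0)"

text \<open>The defining property determines \<open>transfer_op m g \<phi>\<close> only up to a.e. equality.\<close>

definition transfer_op :: "'x measure \<Rightarrow> ('x \<Rightarrow> 'x) \<Rightarrow> 'x oper" where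
  "transfer_op m g \<phi> = (SOME f. integrable m f \<and>
     (\<forall>\<psi>\<in>Linf m. (\<integral>x. f x * \<psi> x \<partial>m) = (\<integral>x. \<phi> x * \<psi> (g x) \<partial>m)))"

definition twisted_op :: "'x measure \<Rightarrow> ('x \<Rightarrow> 'x) \<Rightarrow> ('x \<Rightarrow> real) \<Rightarrow> real \<Rightarrow> 'x oper" where
  "twisted_op m g h s \<phi> = transfer_op m g (\<lambda>x. exp (\<i> * of_real s * of_real (h x)) * \<phi> x)"

definition mult_op :: "('x \<Rightarrow> real) \<Rightarrow> 'x oper" where
  "mult_op h \<psi> = (\<lambda>x. of_real (h x) * \<psi> x)"

definition birkhoff_sum :: "('x \<Rightarrow> 'x) \<Rightarrow> ('x \<Rightarrow> real) \<Rightarrow> nat \<Rightarrow> 'x \<Rightarrow> real" where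
  "birkhoff_sum g h n x = (\<Sum>k<n. h ((g ^^ k) x))"

text \<open>
  \<open>\<Theta>\<close> is the set of parameters; \<open>G \<theta>\<close> and \<open>H \<theta>\<close> are the map and the observable with parameter
  \<open>\<theta>\<close>. The nine spaces \<open>X_0, X_0^(+), X_1, X_1^(+), ..., X_3^(+), X_4\<close> of the chain are
  \<open>X 0, X 1, ..., X 8\<close>, so \<open>X_a\<close> is \<open>X (2*a)\<close> and \<open>X_a^(+)\<close> is \<open>X (2*a+1)\<close>.
\<close>

definition assumption_A ::
  "'x measure \<Rightarrow> real set \<Rightarrow> (real \<Rightarrow> 'x \<Rightarrow> 'x) \<Rightarrow> (real \<Rightarrow> 'x \<Rightarrow> real) \<Rightarrow> real \<Rightarrow> 'x fspace \<Rightarrow> 'x fspace \<Rightarrow> bool" where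
  "assumption_A m \<Theta> G H p0 B B' \<longleftrightarrow>
     1 \<le> p0 \<and> banach_space m B \<and> banach_space m B' \<and>
     (\<lambda>_. 1) \<in> elems B \<and> (\<lambda>_. 1) \<in> elems B' \<and>
     embeds B B' \<and> embeds B' (Lp m p0) \<and>
     (\<exists>\<delta>>0.
       (\<forall>\<theta>\<in>\<Theta> \<inter> {-\<delta><..<\<delta>}. \<forall>s. bounded_op m B B (twisted_op m (G \<theta>) (H \<theta>) s) \<and>
                                bounded_op m B' B' (twisted_op m (G \<theta>) (H \<theta>) s)) \<and>
       op_continuous_on m B B' ((\<Theta> \<inter> {-\<delta><..<\<delta>}) \<times> UNIV)
         (\<lambda>(\<theta>, s). twisted_op m (G \<theta>) (H \<theta>) s) \<and>
       (same_space B B' \<or>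
        (\<exists>c C \<kappa>. 0 < c \<and> 0 < C \<and> 0 < \<kappa> \<and> \<kappa> < 1 \<and>
          (\<forall>\<psi>\<in>elems B. \<forall>n. \<forall>\<theta>\<in>\<Theta>. \<forall>s. \<bar>\<theta>\<bar> \<le> \<delta> \<and> \<bar>s\<bar> \<le> \<delta> \<longrightarrow>
             (twisted_op m (G \<theta>) (H \<theta>) s ^^ n) \<psi> \<in> elems B \<and>
             nrm B ((twisted_op m (G \<theta>) (H \<theta>) s ^^ n) \<psi>) \<le> c * \<kappa> ^ n * nrm B \<psi> + C ^ n * nrm B' \<psi>))))"

definition assumption_B ::
  "'x measure \<Rightarrow> real set \<Rightarrow> (real \<Rightarrow> 'x \<Rightarrow> 'x) \<Rightarrow> (real \<Rightarrow> 'x \<Rightarrow> real) \<Rightarrow> (nat \<Rightarrow> 'x fspace) \<Rightarrow> bool" where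
  "assumption_B m \<Theta> G H X \<longleftrightarrow>
     (\<forall>i\<le>8. banach_space m (X i) \<and> (\<lambda>_. 1) \<in> elems (X i)) \<and>
     (\<forall>i<8. embeds (X i) (X (Suc i))) \<and>
     (\<exists>\<delta>>0.
       (\<forall>a\<le>3. \<forall>\<theta>\<in>\<Theta> \<inter> {-\<delta><..<\<delta>}. \<forall>s.
          bounded_op m (X (2*a)) (X (2*a)) (twisted_op m (G \<theta>) (H \<theta>) s) \<and>
          bounded_op m (X (2*a+1)) (X (2*a+1)) (twisted_op m (G \<theta>) (H \<theta>) s)) \<and>
       (\<forall>\<theta>\<in>\<Theta> \<inter> {-\<delta><..<\<delta>}. \<forall>a\<le>2. \<forall>j\<in>{1..3-a}.
          (\<forall>n. op_higher_derivative m (X (2*a+1)) (X (2*(a+j))) j {-\<delta><..<\<delta>}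
                 (\<lambda>s. twisted_op m (G \<theta>) (H \<theta>) s ^^ n)
                 (\<lambda>s \<phi>. (twisted_op m (G \<theta>) (H \<theta>) s ^^ n)
                          (\<lambda>x. (\<i> * of_real (birkhoff_sum (G \<theta>) (H \<theta>) n x)) ^ j * \<phi> x))) \<and>
          op_continuous_on m (X (2*a+1)) (X (2*(a+j))) {-\<delta><..<\<delta>}
                 (\<lambda>s \<phi>. twisted_op m (G \<theta>) (H \<theta>) s (\<lambda>x. (\<i> * of_real (H \<theta> x)) ^ j * \<phi> x))) \<and>
       (same_space (X 0) (X 7) \<or>
        ((\<forall>a\<le>3. op_continuous_on m (X (2*a)) (X (2*a+1)) ((\<Theta> \<inter> {-\<delta><..<\<delta>}) \<times> UNIV)
                  (\<lambda>(\<theta>, s). twisted_op m (G \<theta>) (H \<theta>) s)) \<and>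
         (\<exists>c C \<kappa>. 0 < c \<and> 0 < C \<and> 0 < \<kappa> \<and> \<kappa> < 1 \<and>
           (\<forall>i\<le>7. \<forall>\<psi>\<in>elems (X i). \<forall>n. \<forall>\<theta>\<in>\<Theta>. \<forall>s. \<bar>\<theta>\<bar> \<le> \<delta> \<and> \<bar>s\<bar> \<le> \<delta> \<longrightarrow>
              (twisted_op m (G \<theta>) (H \<theta>) s ^^ n) \<psi> \<in> elems (X i) \<and>
              nrm (X i) ((twisted_op m (G \<theta>) (H \<theta>) s ^^ n) \<psi>)
                \<le> c * \<kappa> ^ n * nrm (X i) \<psi> + C ^ n * nrm (X 8) \<psi>)))))"

definition assumption_C ::
  "'x measure \<Rightarrow> real set \<Rightarrow> (real \<Rightarrow> 'x \<Rightarrow> 'x) \<Rightarrow> (real \<Rightarrow> 'x \<Rightarrow> real) \<Rightarrow> (nat \<Rightarrow> 'x fspace) \<Rightarrow> bool" where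
  "assumption_C m \<Theta> G H X \<longleftrightarrow>
     (\<exists>\<kappa> \<delta>. 0 < \<kappa> \<and> \<kappa> < 1 \<and> 0 < \<delta> \<and>
       spectral_gap m (X 0) (transfer_op m (G 0)) \<kappa> \<and>
       (\<forall>\<theta>\<in>\<Theta> \<inter> {-\<delta><..<\<delta>}. op_eigenvalue m (X 0) (transfer_op m (G \<theta>)) 1) \<and>
       (\<forall>i\<le>7. spectral_gap m (X i) (transfer_op m (G 0)) \<kappa>) \<and>
       (\<forall>\<theta>\<in>\<Theta> \<inter> {-\<delta><..<\<delta>}. \<forall>s. s \<noteq> 0 \<longrightarrow>
          (\<exists>i\<le>7. \<forall>z\<in>op_spectrum m (X i) (twisted_op m (G \<theta>) (H \<theta>) s). norm z < 1)))"

definition assumption_D ::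
  "'x measure \<Rightarrow> real set \<Rightarrow> (real \<Rightarrow> 'x \<Rightarrow> real) \<Rightarrow> (nat \<Rightarrow> 'x fspace) \<Rightarrow> bool" where
  "assumption_D m \<Theta> H X \<longleftrightarrow>
     (\<forall>i<8. \<not> same_space (X (Suc i)) (X 8) \<longrightarrow>
        (\<forall>\<theta>\<in>\<Theta>. bounded_op m (X i) (X (Suc i)) (mult_op (H \<theta>))) \<and>
        ((\<lambda>\<theta>. opnorm (X i) (X (Suc i)) (\<lambda>f x. mult_op (H \<theta>) f x - mult_op (H 0) f x)) \<longlongrightarrow> 0)
          (at 0 within \<Theta>))"

definition cohomologous_to_constant_L2 :: "'x measure \<Rightarrow> ('x \<Rightarrow> 'x) \<Rightarrow> ('x \<Rightarrow> real) \<Rightarrow> bool" where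
  "cohomologous_to_constant_L2 m g h \<longleftrightarrow>
     (\<exists>l c. l \<in> borel_measurable m \<and> integrable m (\<lambda>x. (l x)\<^sup>2) \<and> (AE x in m. h x = l (g x) - l x + c))"

text \<open>
  Estimators computed from a sample are functions of the data list \<open>[x_0, ..., x_(n-1)]\<close>, whose
  length is the sample size. Given the data, the bootstrap point has law \<open>\<mu>star d\<close>, so the
  conditional probabilities and expectations are those of \<open>\<mu>star d\<close> with \<open>ghat d\<close> fixed.
\<close>

definition sample :: "('x \<Rightarrow> 'x) \<Rightarrow> nat \<Rightarrow> 'x \<Rightarrow> 'x list" where
  "sample g n x0 = map (\<lambda>k. (g ^^ k) x0) [0..<n]"

definition asymptotic_mean :: "'x measure \<Rightarrow> ('x \<Rightarrow> 'x) \<Rightarrow> ('x \<Rightarrow> real) \<Rightarrow> real" where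
  "asymptotic_mean \<mu> g h = lim (\<lambda>n. \<integral>x. birkhoff_sum g h n x / real n \<partial>\<mu>)"

definition T_stat :: "'x measure \<Rightarrow> ('x \<Rightarrow> 'x) \<Rightarrow> ('x \<Rightarrow> real) \<Rightarrow> nat \<Rightarrow> 'x \<Rightarrow> real" where
  "T_stat \<mu> g h n x = (birkhoff_sum g h n x - real n * asymptotic_mean \<mu> g h) / sqrt (real n)"

definition has_prob_density :: "'x measure \<Rightarrow> 'x measure \<Rightarrow> ('x \<Rightarrow> real) \<Rightarrow> bool" where
  "has_prob_density m \<mu> \<rho> \<longleftrightarrow> prob_space \<mu> \<and> \<rho> \<in> borel_measurable m \<and> (\<forall>x. 0 \<le> \<rho> x) \<and>
     \<mu> = density m (\<lambda>x. ennreal (\<rho> x))"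

end

theory Submission
 imports Defs "HOL-Library.Function_Algebras" "HOL-Real_Asymp.Real_Asymp"
begin

text \<open>For small \<open>\<theta>\<close> the Lasota--Yorke inequality and the weak continuity of \<open>\<theta> \<mapsto> L\<^sub>\<theta>\<close> turn the spectral gap of
  \<open>L\<^sub>0\<close> on \<open>X\<^sub>0\<close> and on \<open>X\<^sub>3\<close> into a gap for all \<open>g\<^sub>\<theta>\<close>, with uniform constants. Hence each \<open>g\<^sub>\<theta>\<close> has an
  invariant density and decorrelates \<open>exp (i u S\<^sub>p)\<close> from the future exponentially fast, uniformly in \<open>\<theta>\<close>; as
  \<open>s \<mapsto> L\<^sub>i\<^sub>s\<close> is three times differentiable, \<open>h\<close> has uniform moments of order 5/2. Bernstein blocks then give the
  central limit theorem for the stationary laws along every array \<open>g\<^sub>\<theta>\<close>, \<open>\<theta> \<rightarrow> 0\<close>, and the asymptotic variances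
  converge to that of \<open>g\<close>. If the latter were \<open>0\<close>, the Birkhoff sums of \<open>h\<close> would be bounded in \<open>L\<^sup>2(m)\<close>, making
  \<open>h\<close> cohomologous to a constant. An initial density bounded in \<open>X\<^sub>3\<close> is forgotten after a few steps, so both
  distribution functions converge to that of the same normal law, uniformly because the latter is continuous.\<close>

text \<open>The leading eigenvalue of the twisted operators is never expanded: they enter through
  bounds on their powers, through duality with \<open>exp (i u S_p)\<close>, and through derivatives
  in \<open>s\<close>. The main obstacle is integrability. With \<open>h\<close> in L^3 and
  densities known only to be in L^2, \<open>h^2 * \<rho>\<close> need not be integrable a priori.
  Three derivatives in \<open>s\<close> bound the integral of \<open>f (1 - cos (s h))^2\<close> by
  a multiple of \<open>s^3\<close>; summing over the scales \<open>s / 4^j\<close> yields all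
  moments below order 3, and 5/2 is a convenient choice. Covariances of the unbounded
  \<open>h\<close> are reached from bounded observables by replacing \<open>h\<close> with
  \<open>sin (u h) / u\<close>, where \<open>u\<close> shrinks like \<open>\<eta>^(4 k)\<close>;
  mixing rates are carried as \<open>\<eta>^(8 n)\<close> so that they survive division by
  \<open>u\<close>. The gap of \<open>L_0\<close> is given only as solvability of resolvent
  equations, so its conversion into decay of powers is elementary: a bounded inverse theorem, a
  continuation in the radius along dyadic powers, and a deflation of the eigenvalue 1. Positivity of
  the variance needs a transfer from the invariant law back to \<open>m\<close>, since the
  coboundary has to be found in L^2 of the non-invariant measure \<open>m\<close>.\<close>

abbreviation ei :: "real \<Rightarrow> real \<Rightarrow> complex" where "ei u x \<equiv> exp (\<i> * of_real u * of_real x)"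
abbreviation sqi :: "'x measure \<Rightarrow> ('x \<Rightarrow> complex) \<Rightarrow> bool" where "sqi m f \<equiv> integrable m (\<lambda>x. (norm (f x))^2)"
lemmas dominated = Bochner_Integration.integrable_bound
abbreviation cr :: "('x \<Rightarrow> real) \<Rightarrow> 'x \<Rightarrow> complex" where "cr f \<equiv> (\<lambda>x. of_real (f x))"

definition scl :: "complex \<Rightarrow> ('x \<Rightarrow> complex) \<Rightarrow> 'x \<Rightarrow> complex" (infixr \<open>\<odot>\<close> 75) where
 "c \<odot> f = (\<lambda>x. c * f x)"

lemma scl_apply [simp]: "(c \<odot> f) x = c * f x" by (simp add: scl_def)

lemma scl_one [simp]: "1 \<odot> f = f" and scl_zero [simp]: "0 \<odot> f = 0" "c \<odot> 0 = 0" by (auto simp: fun_eq_iff)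

lemma diff_eq_scl: "f - g = f + (-1) \<odot> g" by (auto simp: fun_eq_iff)

section \<open>Stability of spectral gaps\<close>

text \<open>Elements of \<open>V\<close> are functions rather than classes modulo null functions; \<open>\<doteq>\<close> below is equality of classes.\<close>

locale seminormed =
 fixes V :: "('x \<Rightarrow> complex) set" and N :: "('x \<Rightarrow> complex) \<Rightarrow> real"
 assumes zero_mem [simp]: "0 \<in> V"
  and add_mem [simp]: "[|f \<in> V; g \<in> V|] ==> f + g \<in> V"
  and scl_mem [simp]: "f \<in> V ==> c \<odot> f \<in> V"
  and N_nonneg [simp]: "f \<in> V ==> 0 \<le> N f"
  and N_add: "[|f \<in> V; g \<in> V|] ==> N (f + g) \<le> N f + N g"
  and N_scl: "f \<in> V ==> N (c \<odot> f) = cmod c * N f"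
begin

lemma diff_mem [simp]: "[|f \<in> V; g \<in> V|] ==> f - g \<in> V" unfolding diff_eq_scl by (intro add_mem scl_mem)

lemma N_zero [simp]: "N 0 = 0" using N_scl[of 0 0] by simp

lemma N_zero' [simp]: "N (\<lambda>_. 0) = 0" using N_zero by (simp add: zero_fun_def)

lemma N_minus_commute: "[|f \<in> V; g \<in> V|] ==> N (f - g) = N (g - f)"
proof -
 assume *: "f \<in> V" "g \<in> V"
 have "f - g = (-1) \<odot> (g - f)" by (auto simp: fun_eq_iff)
 then show ?thesis using * N_scl[of "g - f" "-1"] by simp
qed

lemma N_diff: "[|f \<in> V; g \<in> V|] ==> N (f - g) \<le> N f + N g"
proof -
 assume *: "f \<in> V" "g \<in> V"
 then show ?thesis using N_add[of f "(-1) \<odot> g"] N_scl[of g "-1"] unfolding diff_eq_scl[of f g] by simp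
qed

lemma N_tri: "[|f \<in> V; g \<in> V; k \<in> V|] ==> N (f - k) \<le> N (f - g) + N (g - k)" using N_add[of "f - g" "g - k"] by (simp add: fun_eq_iff)

lemma N_le_add_diff: "[|f \<in> V; g \<in> V|] ==> N f \<le> N g + N (f - g)" using N_add[of g "f - g"] by simp

definition eqv :: "('x \<Rightarrow> complex) \<Rightarrow> ('x \<Rightarrow> complex) \<Rightarrow> bool" (infix \<open>\<doteq>\<close> 50) where
 "f \<doteq> g \<longleftrightarrow> f \<in> V \<and> g \<in> V \<and> N (f - g) = 0"

lemma eqv_refl [simp]: "f \<in> V ==> f \<doteq> f" by (simp add: eqv_def)

lemma eqv_sym: "f \<doteq> g ==> g \<doteq> f" by (auto simp: eqv_def N_minus_commute)

lemma eqv_trans [trans]: "[|f \<doteq> g; g \<doteq> k|] ==> f \<doteq> k"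
proof -
 assume *: "f \<doteq> g" "g \<doteq> k"
 then have "N (f - k) \<le> 0" "0 \<le> N (f - k)" using N_tri[of f g k] by (auto simp: eqv_def)
 then show ?thesis using * by (auto simp: eqv_def)
qed

lemma eqv_mem: "f \<doteq> g ==> f \<in> V" "f \<doteq> g ==> g \<in> V" by (auto simp: eqv_def)

lemma eqv_N: "f \<doteq> g ==> N f = N g" using N_le_add_diff[of f g] N_le_add_diff[of g f] N_minus_commute[of f g] by (auto simp: eqv_def)

lemma eqv_add: "[|f \<doteq> g; f' \<doteq> g'|] ==> f + f' \<doteq> g + g'"
proof -
 assume *: "f \<doteq> g" "f' \<doteq> g'"
 have "N ((f - g) + (f' - g')) \<le> 0" using * N_add[of "f - g" "f' - g'"] by (auto simp: eqv_def)
 moreover have "(f - g) + (f' - g') = f + f' - (g + g')" by simp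
 moreover have "0 \<le> N (f + f' - (g + g'))" using * by (auto simp: eqv_def)
 ultimately show ?thesis using * by (auto simp: eqv_def)
qed

lemma eqv_scl: "f \<doteq> g ==> c \<odot> f \<doteq> c \<odot> g"
proof -
 assume *: "f \<doteq> g"
 have "c \<odot> f - c \<odot> g = c \<odot> (f - g)" by (auto simp: fun_eq_iff algebra_simps)
 then show ?thesis using * by (auto simp: eqv_def N_scl)
qed

lemma eqv_diff: "[|f \<doteq> g; f' \<doteq> g'|] ==> f - f' \<doteq> g - g'"
proof -
 assume *: "f \<doteq> g" "f' \<doteq> g'"
 show ?thesis unfolding diff_eq_scl[of f] diff_eq_scl[of g] using * by (intro eqv_add eqv_scl)
qed

lemma eqv_zero_iff: "f \<doteq> 0 \<longleftrightarrow> f \<in> V \<and> N f = 0" by (auto simp: eqv_def)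

lemma eqv_diff_zero_iff: "[|f \<in> V; g \<in> V|] ==> f - g \<doteq> 0 \<longleftrightarrow> f \<doteq> g" by (auto simp: eqv_def)

definition linop :: "(('x \<Rightarrow> complex) \<Rightarrow> 'x \<Rightarrow> complex) \<Rightarrow> bool" where
 "linop T \<longleftrightarrow> (\<forall>f\<in>V. T f \<in> V) \<and> (\<forall>f\<in>V. \<forall>g\<in>V. T (f + g) \<doteq> T f + T g) \<and>
  (\<forall>f\<in>V. \<forall>c. T (c \<odot> f) \<doteq> c \<odot> T f) \<and> (\<exists>K. \<forall>f\<in>V. N (T f) \<le> K * N f)"

context
 fixes T assumes T: "linop T"
begin

lemma linop_mem [simp]: "f \<in> V ==> T f \<in> V"
 and linop_add: "[|f \<in> V; g \<in> V|] ==> T (f + g) \<doteq> T f + T g"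
 and linop_scl: "f \<in> V ==> T (c \<odot> f) \<doteq> c \<odot> T f" using T by (auto simp: linop_def)

lemma linop_bound: obtains K where "0 < K" "\<And>f. f \<in> V ==> N (T f) \<le> K * N f"
proof -
 obtain K where K: "\<And>f. f \<in> V ==> N (T f) \<le> K * N f" using T unfolding linop_def by blast
 have "N (T f) \<le> max K 1 * N f" if "f \<in> V" for f using K[OF that] mult_right_mono[of K "max K 1" "N f"] that by simp
 then show ?thesis using that[of "max K 1"] by simp
qed

lemma linop_diff: "[|f \<in> V; g \<in> V|] ==> T (f - g) \<doteq> T f - T g"
proof -
 assume *: "f \<in> V" "g \<in> V"
 have "T (f - g) \<doteq> T f + T ((-1) \<odot> g)" unfolding diff_eq_scl using * by (intro linop_add) auto
 also have "... \<doteq> T f + (-1) \<odot> T g" using * by (intro eqv_add linop_scl eqv_refl) auto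
 finally show ?thesis unfolding diff_eq_scl[of "T f"] .
qed

lemma linop_zero: "T 0 \<doteq> 0" using linop_scl[of 0 0] by simp

text \<open>Boundedness is what makes an operator well defined on classes: \<open>T (f - g)\<close>
  has seminorm at most \<open>K * 0\<close>.\<close>

lemma linop_cong: "f \<doteq> g ==> T f \<doteq> T g"
proof -
 assume *: "f \<doteq> g"
 obtain K where K: "\<And>f. f \<in> V ==> N (T f) \<le> K * N f" using T unfolding linop_def by blast
 have "N (T (f - g)) \<le> 0" "0 \<le> N (T (f - g))" using K[of "f - g"] * by (auto simp: eqv_def)
 then have "T f - T g \<doteq> 0" using eqv_trans[OF eqv_sym[OF linop_diff[of f g]], of 0] * by (auto simp: eqv_def)
 then show ?thesis using * eqv_diff_zero_iff[of "T f" "T g"] by (auto simp: eqv_def)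
qed

lemma linop_pow_mem [simp]: "f \<in> V ==> (T ^^ n) f \<in> V" by (induction n) auto

end

lemma linop_comp: "[|linop S; linop T|] ==> linop (\<lambda>f. S (T f))"
proof -
 assume *: "linop S" "linop T"
 have add: "S (T (f + g)) \<doteq> S (T f) + S (T g)" if "f \<in> V" "g \<in> V" for f g
  using eqv_trans[OF linop_cong[OF *(1) linop_add[OF *(2)]] linop_add[OF *(1)]] * that by (auto simp: linop_mem)
 have scl: "S (T (c \<odot> f)) \<doteq> c \<odot> S (T f)" if "f \<in> V" for f c
  using eqv_trans[OF linop_cong[OF *(1) linop_scl[OF *(2)]] linop_scl[OF *(1)]] * that by (auto simp: linop_mem)
 obtain K where K: "0 < K" "\<And>f. f \<in> V ==> N (S f) \<le> K * N f" using linop_bound[OF *(1)] by metis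
 obtain L where L: "0 < L" "\<And>f. f \<in> V ==> N (T f) \<le> L * N f" using linop_bound[OF *(2)] by metis
 have "N (S (T f)) \<le> (K * L) * N f" if "f \<in> V" for f
  using order_trans[OF K(2)[of "T f"] mult_left_mono[OF L(2)[OF that], of K]] K(1) that * by (auto simp: linop_mem mult.assoc)
 then show ?thesis using add scl * unfolding linop_def by (auto simp: linop_mem)
qed

lemma linop_id: "linop (\<lambda>f. f)" unfolding linop_def by (auto intro!: exI[of _ 1])

lemma linop_pow: "linop T ==> linop (T ^^ n)"
proof (induction n)
 case 0 show ?case using linop_id by (simp add: id_def)
next
 case (Suc n) then show ?case using linop_comp[of T "T ^^ n"] by (simp add: comp_def)
qed

lemma linop_add_op: "[|linop S; linop T|] ==> linop (\<lambda>f. S f + T f)"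
proof -
 assume *: "linop S" "linop T"
 note mem = linop_mem[OF *(1)] linop_mem[OF *(2)]
 have add: "S (f + g) + T (f + g) \<doteq> (S f + T f) + (S g + T g)" if "f \<in> V" "g \<in> V" for f g
 proof -
  have "S (f + g) + T (f + g) \<doteq> (S f + S g) + (T f + T g)" using * that by (intro eqv_add linop_add)
  then show ?thesis by (simp add: algebra_simps)
 qed
 have scl: "S (c \<odot> f) + T (c \<odot> f) \<doteq> c \<odot> (S f + T f)" if "f \<in> V" for f c
 proof -
  have "S (c \<odot> f) + T (c \<odot> f) \<doteq> c \<odot> S f + c \<odot> T f" using * that by (intro eqv_add linop_scl)
  moreover have "c \<odot> S f + c \<odot> T f = c \<odot> (S f + T f)" by (auto simp: fun_eq_iff algebra_simps)
  ultimately show ?thesis by simp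
 qed
 obtain K where K: "0 < K" "\<And>f. f \<in> V ==> N (S f) \<le> K * N f" using linop_bound[OF *(1)] by metis
 obtain L where L: "0 < L" "\<And>f. f \<in> V ==> N (T f) \<le> L * N f" using linop_bound[OF *(2)] by metis
 have "N (S f + T f) \<le> (K + L) * N f" if "f \<in> V" for f
  using K(2)[OF that] L(2)[OF that] N_add[of "S f" "T f"] mem that by (auto simp: algebra_simps)
 then show ?thesis using add scl mem unfolding linop_def by (auto intro!: exI[of _ "K + L"])
qed

lemma linop_scl_op: "linop T ==> linop (\<lambda>f. c \<odot> T f)"
proof -
 assume *: "linop T"
 note mem = linop_mem[OF *(1)]
 have add: "c \<odot> T (f + g) \<doteq> c \<odot> T f + c \<odot> T g" if "f \<in> V" "g \<in> V" for f g
 proof -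
  have "c \<odot> T (f + g) \<doteq> c \<odot> (T f + T g)" using * that by (intro eqv_scl linop_add)
  moreover have "c \<odot> (T f + T g) = c \<odot> T f + c \<odot> T g" by (auto simp: fun_eq_iff algebra_simps)
  ultimately show ?thesis by simp
 qed
 have scl: "c \<odot> T (d \<odot> f) \<doteq> d \<odot> c \<odot> T f" if "f \<in> V" for f d
 proof -
  have "c \<odot> T (d \<odot> f) \<doteq> c \<odot> d \<odot> T f" using * that by (intro eqv_scl linop_scl)
  moreover have "c \<odot> d \<odot> T f = d \<odot> c \<odot> T f" by (auto simp: fun_eq_iff algebra_simps)
  ultimately show ?thesis by simp
 qed
 obtain L where L: "0 < L" "\<And>f. f \<in> V ==> N (T f) \<le> L * N f" using linop_bound[OF *(1)] by metis
 have "N (c \<odot> T f) \<le> (cmod c * L) * N f" if "f \<in> V" for f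
  using mult_left_mono[OF L(2)[OF that], of "cmod c"] mem that by (auto simp: N_scl mult.assoc)
 then show ?thesis using add scl mem unfolding linop_def by auto
qed

lemma linop_diff_op: "[|linop S; linop T|] ==> linop (\<lambda>f. S f - T f)"
proof -
 assume *: "linop S" "linop T"
 have "(\<lambda>f. S f - T f) = (\<lambda>f. S f + (-1) \<odot> T f)" by (auto simp: fun_eq_iff)
 then show ?thesis using linop_add_op[OF *(1) linop_scl_op[OF *(2)], of "-1"] by (simp only:)
qed

end

section \<open>The bounded inverse theorem on a complete seminormed space\<close>

locale complete_seminormed = seminormed V N for V :: "('x \<Rightarrow> complex) set" and N +
 assumes complete: "[|\<And>k::nat. F k \<in> V; \<And>e. e > 0 ==> \<exists>K. \<forall>k\<ge>K. \<forall>l\<ge>K. N (F k - F l) < e|]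
  ==> \<exists>f\<in>V. (\<lambda>k. N (F k - f)) \<longlonglongrightarrow> 0"
begin

text \<open>Both uses rely on the explicit distance to every term: the gliding hump must know that
  later terms do not undo stage \<open>k\<close>, and the iteration for \<open>surj_bounded\<close>
  reads off the size of its solution from term 0.\<close>

lemma geometric_limit:
 fixes F :: "nat \<Rightarrow> 'x \<Rightarrow> complex"
 assumes r: "0 < r" "r < 1" and C: "C \<ge> 0"
  and F: "\<And>k. F k \<in> V" and step: "\<And>k. N (F (Suc k) - F k) \<le> C * r ^ k"
 obtains f where "f \<in> V" "\<And>k. N (f - F k) \<le> C * r ^ k / (1 - r)"
proof -
 have tail: "N (F (k + j) - F k) \<le> C * r ^ k / (1 - r) * (1 - r ^ j)" for k j
 proof (induction j)
  case 0 then show ?case by simp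
 next
  case (Suc j)
  have "N (F (k + Suc j) - F k) \<le> N (F (Suc (k + j)) - F (k + j)) + N (F (k + j) - F k)"
   using N_tri[of "F (Suc (k+j))" "F (k+j)" "F k"] F by simp
  also have "... \<le> C * r ^ (k + j) + C * r ^ k / (1 - r) * (1 - r ^ j)" using step Suc by (intro add_mono)
  also have "... = C * r ^ k / (1 - r) * (1 - r ^ Suc j)" using r by (simp add: power_add divide_simps) (simp add: algebra_simps)
  finally show ?case .
 qed
 have tail2: "N (F (k + j) - F k) \<le> C * r ^ k / (1 - r)" for k j
 proof -
  have "C * r ^ k / (1 - r) * (1 - r ^ j) \<le> C * r ^ k / (1 - r)" using r C by (intro mult_left_le) auto
  then show ?thesis using tail[of k j] by simp
 qed
 have cauchy: "\<exists>K. \<forall>k\<ge>K. \<forall>l\<ge>K. N (F k - F l) < e" if "e > 0" for e :: real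
 proof -
  have "(\<lambda>k. 2 * (C * r ^ k / (1 - r))) \<longlonglongrightarrow> 2 * (C * 0 / (1 - r))" using r by (intro tendsto_intros LIMSEQ_realpow_zero) auto
  then have "\<forall>\<^sub>F k in sequentially. 2 * (C * r ^ k / (1 - r)) < e" using that by (intro order_tendstoD(2)) auto
  then obtain K where K: "2 * (C * r ^ K / (1 - r)) < e" by (auto simp: eventually_sequentially)
  have "N (F k - F l) < e" if "k \<ge> K" "l \<ge> K" for k l
  proof -
   have "N (F k - F l) \<le> N (F k - F K) + N (F K - F l)" using F by (intro N_tri)
   moreover have "N (F K - F l) = N (F l - F K)" using F by (intro N_minus_commute)
   moreover have "N (F k - F K) \<le> C * r ^ K / (1 - r)" "N (F l - F K) \<le> C * r ^ K / (1 - r)"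
    using tail2[of K "k - K"] tail2[of K "l - K"] that by auto
   ultimately show ?thesis using K by linarith
  qed
  then show ?thesis by blast
 qed
 obtain f where f: "f \<in> V" "(\<lambda>k. N (F k - f)) \<longlonglongrightarrow> 0" using complete[OF F cauchy] by blast
 have "N (f - F k) \<le> C * r ^ k / (1 - r)" for k
 proof (rule LIMSEQ_le_const)
  show "(\<lambda>j. C * r ^ k / (1 - r) + N (F (k + j) - f)) \<longlonglongrightarrow> C * r ^ k / (1 - r)"
   using tendsto_add[OF tendsto_const[of "C * r ^ k / (1 - r)"] LIMSEQ_ignore_initial_segment[OF f(2), of k]]
   by (simp only: add.commute[of k] add_0_right)
  have "N (f - F k) \<le> C * r ^ k / (1 - r) + N (F (k + j) - f)" for j
   using N_tri[of f "F (k+j)" "F k"] tail2[of k j] F f(1) N_minus_commute[of f "F (k+j)"] by simp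
  then show "\<exists>N'. \<forall>n\<ge>N'. N (f - F k) \<le> C * r ^ k / (1 - r) + N (F (k + n) - f)" by blast
 qed
 then show ?thesis using that f(1) by blast
qed

context
 fixes S assumes S: "linop S"
  and surj: "\<And>f. f \<in> V ==> \<exists>w\<in>V. f \<doteq> S w"
begin

lemma S_mem: "f \<in> V ==> S f \<in> V" by (rule linop_mem[OF S])

lemma N_residual_add: "[|y \<in> V; u \<in> V; v \<in> V|] ==> N (y - S (u + v)) = N ((y - S u) - S v)"
proof -
 assume *: "y \<in> V" "u \<in> V" "v \<in> V"
 then have "y - S (u + v) \<doteq> y - (S u + S v)" by (intro eqv_diff linop_add[OF S] eqv_refl) auto
 also have "y - (S u + S v) = (y - S u) - S v" by simp
 finally show ?thesis by (rule eqv_N)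
qed

lemma N_residual_scl: "[|y \<in> V; u \<in> V|] ==> N (c \<odot> y - S (c \<odot> u)) = cmod c * N (y - S u)"
proof -
 assume *: "y \<in> V" "u \<in> V"
 then have "c \<odot> y - S (c \<odot> u) \<doteq> c \<odot> y - c \<odot> S u" by (intro eqv_diff linop_scl[OF S] eqv_refl) auto
 also have "c \<odot> y - c \<odot> S u = c \<odot> (y - S u)" by (auto simp: fun_eq_iff algebra_simps)
 finally have "N (c \<odot> y - S (c \<odot> u)) = N (c \<odot> (y - S u))" by (rule eqv_N)
 also have "... = cmod c * N (y - S u)" using * S_mem by (intro N_scl diff_mem) auto
 finally show ?thesis .
qed

text \<open>Instead of the Baire category theorem, a gliding hump: if the claim failed for every \<open>K\<close>, one could
  choose signs in a series \<open>\<Sum> \<plusminus>5\<^sup>-\<^sup>k y\<^sub>k\<close> so that its sum has distance at least \<open>5\<^sup>-\<^sup>k/4\<close>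
 from the image of the ball of radius \<open>k\<close>, for every \<open>k\<close>.\<close>

lemma surj_approx:
 "\<exists>K>0. \<forall>y\<in>V. \<exists>x\<in>V. N x \<le> K * N y \<and> N (y - S x) \<le> N y / 2"
proof (rule ccontr)
 assume *: "\<not> ?thesis"
 have hump: "\<exists>y\<in>V. N y = 1 \<and> (\<forall>x\<in>V. N x \<le> K \<longrightarrow> N (y - S x) > 1/2)" if K: "K > 0" for K
 proof -
  obtain y where y: "y \<in> V" "\<And>x. [|x \<in> V; N x \<le> K * N y|] ==> N (y - S x) > N y / 2" using * K by (meson not_le)
  \<comment> \<open>Testing \<open>x = 0\<close> shows that the bad vector is not null, so it can be
    scaled to norm 1.\<close>
  have "N (y - S 0) = N (y - 0)" using y(1) by (intro eqv_N eqv_diff linop_zero S) auto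
  then have pos: "N y > 0" using y(2)[of 0] y(1) N_nonneg[of y] K by auto
  define c where "c = complex_of_real (N y)"
  have c: "c \<noteq> 0" "cmod c = N y" using pos by (auto simp: c_def)
  have 1: "N (inverse c \<odot> y) = 1" using pos y(1) c by (simp add: N_scl norm_inverse)
  have "N (inverse c \<odot> y - S x) > 1/2" if "x \<in> V" "N x \<le> K" for x
  proof -
   have "N (c \<odot> x) \<le> K * N y" using that c pos by (simp add: N_scl mult.commute)
   then have "N y / 2 < N (y - S (c \<odot> x))" using y(2) that by simp
   also have "N (y - S (c \<odot> x)) = N (c \<odot> (inverse c \<odot> y) - S (c \<odot> x))" using c by (intro arg_cong[where f = N]) (auto simp: fun_eq_iff)
   also have "... = N y * N (inverse c \<odot> y - S x)" using N_residual_scl[of "inverse c \<odot> y" x c] y(1) that c by simp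
   finally show ?thesis using pos by (simp add: field_simps)
  qed
  then show ?thesis using 1 y(1) by (intro bexI[of _ "inverse c \<odot> y"]) auto
 qed
 \<comment> \<open>The ratio 1/5 is small enough: all terms after stage \<open>k\<close> together
   move the sum by at most \<open>(1/5)^(k+1) / (1 - 1/5) = (1/5)^k / 4\<close>, less than the
   distance \<open>(1/5)^k / 2\<close> secured at stage \<open>k\<close>.\<close>
 let ?Q = "\<lambda>k s s'. N (s' - s) \<le> 1 * (1/5) ^ k \<and> (\<forall>x\<in>V. N x \<le> real k \<longrightarrow> N (s' - S x) \<ge> (1/5) ^ k / 2)"
 have "\<exists>s. \<forall>k. s k \<in> V \<and> ?Q k (s k) (s (Suc k))"
 proof (rule dependent_nat_choice)
  show "\<exists>s. s \<in> V" using zero_mem by blast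
  fix s k assume s: "s \<in> V"
  obtain y where y: "y \<in> V" "N y = 1" "\<And>x. [|x \<in> V; N x \<le> (real k + 1) * 5 ^ k|] ==> N (y - S x) > 1/2"
   using hump[of "(real k + 1) * 5 ^ k"] by auto
  define a where "a = complex_of_real ((1/5) ^ k)"
  have a: "cmod a = (1/5) ^ k" "a \<noteq> 0" by (auto simp: a_def norm_power)
  show "\<exists>s'. s' \<in> V \<and> ?Q k s s'"
  proof (rule ccontr)
   assume no: "\<nexists>s'. s' \<in> V \<and> ?Q k s s'"
   have "\<exists>x\<in>V. N x \<le> real k \<and> N (s + b \<odot> y - S x) < (1/5) ^ k / 2" if "cmod b = (1/5) ^ k" for b
    using no[unfolded not_ex, rule_format, of "s + b \<odot> y"] that s y by (auto simp: N_scl not_le)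
   from this[of a] this[of "- a"] a obtain x x' where
    x: "x \<in> V" "N x \<le> real k" "N (s + a \<odot> y - S x) < (1/5) ^ k / 2" and
    x': "x' \<in> V" "N x' \<le> real k" "N (s + (- a) \<odot> y - S x') < (1/5) ^ k / 2" by auto
   \<comment> \<open>If both signs fail, subtracting the two near-solutions cancels \<open>s\<close>
     and leaves a near-preimage of \<open>2 a y\<close>. Rescaled, it misses \<open>y\<close> by
     less than 1/2 and has norm at most \<open>k * 5^k\<close>, inside the radius of the hump; the
     \<open>+ 1\<close> in that radius only keeps it positive at \<open>k = 0\<close>.\<close>
   define d where "d = inverse (2 * a) \<odot> (x - x')"
   have d: "d \<in> V" using x x' by (simp add: d_def)
   have "N (x - x') \<le> 2 * real k" using N_diff[of x x'] x x' by simp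
   moreover have "cmod (inverse (2 * a)) = 5 ^ k / 2" using a by (simp add: norm_inverse norm_mult power_one_over)
   moreover have "N d = cmod (inverse (2 * a)) * N (x - x')" unfolding d_def using x(1) x'(1) by (intro N_scl diff_mem)
   ultimately have "N d \<le> 5 ^ k / 2 * (2 * real k)" by (simp only:) (intro mult_left_mono, auto)
   also have "... \<le> (real k + 1) * 5 ^ k" by (simp add: field_simps)
   finally have "N (y - S d) > 1/2" using y(3) d by blast
   moreover have "(s + a \<odot> y - S x) - (s + (- a) \<odot> y - S x') \<doteq> (2 * a) \<odot> y - S (x - x')"
   proof -
    have "(2 * a) \<odot> y - S (x - x') \<doteq> (2 * a) \<odot> y - (S x - S x')" using x x' y by (intro eqv_diff linop_diff[OF S] eqv_refl) auto
    also have "(2 * a) \<odot> y - (S x - S x') = (s + a \<odot> y - S x) - (s + (- a) \<odot> y - S x')" by (auto simp: fun_eq_iff algebra_simps)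
    finally show ?thesis by (rule eqv_sym)
   qed
   moreover have "(2 * a) \<odot> d = x - x'" using a by (auto simp: d_def fun_eq_iff)
   ultimately have "cmod (2 * a) * N (y - S d) = N ((s + a \<odot> y - S x) - (s + (- a) \<odot> y - S x'))"
    using N_residual_scl[of y d "2 * a"] y(1) d eqv_N by metis
   also have "... \<le> N (s + a \<odot> y - S x) + N (s + (- a) \<odot> y - S x')" using x x' y s S_mem by (intro N_diff) auto
   also have "... < (1/5) ^ k" using x x' by simp
   finally have "2 * N (y - S d) < 1" using a by (simp add: norm_mult)
   then show False using \<open>N (y - S d) > 1/2\<close> by simp
  qed
 qed
 then obtain s where s: "\<And>k. s k \<in> V" "\<And>k. ?Q k (s k) (s (Suc k))" by metis
 obtain f where f: "f \<in> V" "\<And>k. N (f - s k) \<le> 1 * (1/5) ^ k / (1 - 1/5)" using geometric_limit[of "1/5" 1 s] s by auto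
 obtain w where w: "w \<in> V" "f \<doteq> S w" using surj f by blast
 obtain k where k: "N w \<le> real k" using real_arch_simple by blast
 have "(1/5) ^ k / 2 \<le> N (s (Suc k) - S w)" using s(2)[of k] w k by simp
 also have "... = N (s (Suc k) - f)" using w s by (intro eqv_N eqv_diff eqv_sym[OF w(2)]) auto
 also have "... \<le> (1/5) ^ k / 4" using f(2)[of "Suc k"] N_minus_commute[of "s (Suc k)" f] s f(1) by simp
 finally show False by simp
qed

text \<open>Successive approximation: each use of \<open>surj_approx\<close> halves the residual at
  a cost of \<open>K\<close> times the current residual, so the corrections add up to at most
  \<open>2 * K * N y\<close>, and completeness supplies the exact solution.\<close>

lemma surj_bounded:
 obtains K where "0 < K" "\<And>y. y \<in> V ==> \<exists>x\<in>V. N x \<le> K * N y \<and> y \<doteq> S x"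
proof -
 obtain K where K: "0 < K" "\<And>y. y \<in> V ==> \<exists>x\<in>V. N x \<le> K * N y \<and> N (y - S x) \<le> N y / 2" using surj_approx by blast
 obtain L where L: "0 < L" "\<And>f. f \<in> V ==> N (S f) \<le> L * N f" using linop_bound[OF S] by metis
 have "\<exists>x\<in>V. N x \<le> (2 * K) * N y \<and> y \<doteq> S x" if y: "y \<in> V" for y
 proof -
  have "\<exists>X. \<forall>n. (X n \<in> V \<and> N (y - S (X n)) \<le> N y * (1/2) ^ n \<and> (n = 0 \<longrightarrow> X n = 0)) \<and>
   N (X (Suc n) - X n) \<le> (K * N y) * (1/2) ^ n"
  proof (rule dependent_nat_choice)
   have S0: "N (y - S 0) = N (y - 0)" using y by (intro eqv_N eqv_diff linop_zero S) auto
   then show "\<exists>x. x \<in> V \<and> N (y - S x) \<le> N y * (1/2) ^ 0 \<and> (0 = (0::nat) \<longrightarrow> x = 0)" by (intro exI[of _ 0]) simp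
   fix x and n :: nat assume x: "x \<in> V \<and> N (y - S x) \<le> N y * (1/2) ^ n \<and> (n = 0 \<longrightarrow> x = 0)"
   obtain d where d: "d \<in> V" "N d \<le> K * N (y - S x)" "N ((y - S x) - S d) \<le> N (y - S x) / 2" using K(2)[of "y - S x"] x y S_mem by auto
   have "N (y - S (x + d)) \<le> N y * (1/2) ^ Suc n" using N_residual_add[of y x d] d x y by simp
   moreover have "N d \<le> (K * N y) * (1/2) ^ n"
    using order_trans[OF d(2) mult_left_mono[of "N (y - S x)" "N y * (1/2) ^ n" K]] x K(1) by (simp add: mult.assoc)
   ultimately show "\<exists>x'. (x' \<in> V \<and> N (y - S x') \<le> N y * (1/2) ^ Suc n \<and> (Suc n = 0 \<longrightarrow> x' = 0)) \<and>
     N (x' - x) \<le> (K * N y) * (1/2) ^ n" using d x by (intro exI[of _ "x + d"]) auto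
  qed
  then obtain X where X: "\<And>n. X n \<in> V" "\<And>n. N (y - S (X n)) \<le> N y * (1/2) ^ n" "X 0 = 0"
   "\<And>n. N (X (Suc n) - X n) \<le> (K * N y) * (1/2) ^ n" by metis
  have "0 \<le> K * N y" using K y by simp
  then obtain x where x: "x \<in> V" "\<And>k. N (x - X k) \<le> (K * N y) * (1/2) ^ k / (1 - 1/2)"
   using geometric_limit[of "1/2" "K * N y" X] X by auto
  have NX: "N x \<le> (2 * K) * N y" using x(2)[of 0] X(3) by simp
  have "N (y - S x) \<le> (N y + L * (2 * K * N y)) * (1/2) ^ k" for k
  proof -
   have "N (S (X k) - S x) = N (S (X k - x))" using x X by (intro eqv_N eqv_sym[OF linop_diff] S) auto
   also have "... \<le> L * N (X k - x)" using x X by (intro L) auto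
   also have "... \<le> L * (2 * K * N y * (1/2) ^ k)"
    using x(2)[of k] N_minus_commute[of x "X k"] x(1) X(1)[of k] L(1) by (intro mult_left_mono) auto
   finally show ?thesis using N_tri[of y "S (X k)" "S x"] X(2)[of k] y x(1) X(1)[of k] S_mem by (simp add: algebra_simps)
  qed
  moreover have "(\<lambda>k. (N y + L * (2 * K * N y)) * (1/2) ^ k) \<longlonglongrightarrow> 0" by (intro tendsto_mult_right_zero LIMSEQ_realpow_zero) auto
  ultimately have "N (y - S x) \<le> 0" by (intro LIMSEQ_le_const) blast+
  then have "y \<doteq> S x" using y x S_mem N_nonneg[OF diff_mem[of y "S x"]] unfolding eqv_def by (auto intro!: antisym)
  then show ?thesis using x(1) NX by blast
 qed
 then show ?thesis using that[of "2 * K"] K(1) by auto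
qed

text \<open>The controlled preimage of \<open>S f\<close> differs from \<open>f\<close> by an
  element of the kernel, which has seminorm zero, so the bound on the former is a bound on
  \<open>N f\<close>.\<close>

lemma bounded_inverse:
 assumes inj: "\<And>w. [|w \<in> V; S w \<doteq> 0|] ==> N w = 0"
 obtains K where "0 < K" "\<And>f. f \<in> V ==> N f \<le> K * N (S f)"
proof -
 obtain K where K: "0 < K" "\<And>y. y \<in> V ==> \<exists>x\<in>V. N x \<le> K * N y \<and> y \<doteq> S x" using surj_bounded by blast
 have "N f \<le> K * N (S f)" if f: "f \<in> V" for f
 proof -
  obtain x where x: "x \<in> V" "N x \<le> K * N (S f)" "S f \<doteq> S x" using K(2)[of "S f"] f S_mem by blast
  have "S (f - x) \<doteq> S f - S x" using f x S by (intro linop_diff)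
  also have "... \<doteq> 0" using x f S_mem by (simp add: eqv_diff_zero_iff)
  finally have "N (f - x) = 0" using inj f x by simp
  then have "N f = N x" using f x by (intro eqv_N) (simp add: eqv_def)
  then show ?thesis using x by simp
 qed
 then show ?thesis using that K(1) by blast
qed

end

end

lemma funpow_one: "f ^^ 1 = (f :: 'a \<Rightarrow> 'a)" by simp

text \<open>Multiplying \<open>z\<close> by this number of modulus 1 flips the sign of
  \<open>z^n\<close>. In this way an equation with \<open>1 + b\<close>,
  \<open>b = T^n / z^n\<close>, becomes one with \<open>1 - b\<close> at another point of the same
  circle.\<close>

lemma cis_half_turn_root: "n > 0 ==> cis (pi / real n) ^ n = -1" by (subst Complex.DeMoivre) simp

section \<open>From solvable resolvent equations outside a disk to decay of powers\<close>

context complete_seminormed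
begin

context
 fixes T :: "('x \<Rightarrow> complex) \<Rightarrow> 'x \<Rightarrow> complex" and \<kappa> :: real
 assumes T: "linop T" and \<kappa>: "0 < \<kappa>" "\<kappa> < 1"
  and surj: "\<And>z f. [|\<kappa> \<le> cmod z; f \<in> V|] ==> \<exists>w\<in>V. f \<doteq> z \<odot> w - T w"
  and inj: "\<And>z w. [|\<kappa> \<le> cmod z; w \<in> V; z \<odot> w - T w \<doteq> 0|] ==> N w = 0"
begin

lemma resolvent_bound_pointwise:
 assumes "\<kappa> \<le> cmod z"
 obtains K where "0 < K" "\<And>f. f \<in> V ==> N f \<le> K * N (z \<odot> f - T f)"
proof -
 have "linop (\<lambda>f. z \<odot> f - T f)" by (intro linop_diff_op linop_scl_op linop_id T)
 then show ?thesis
 proof (rule bounded_inverse)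
  show "\<exists>w\<in>V. f \<doteq> z \<odot> w - T w" if "f \<in> V" for f using surj assms that by blast
  show "N w = 0" if "w \<in> V" "z \<odot> w - T w \<doteq> 0" for w using inj assms that by blast
 qed (rule that)
qed

text \<open>Compactness of the closed annulus: if no common bound existed, the points
  \<open>z\<close> would accumulate at some \<open>l\<close>, and the bound at \<open>l\<close>
  survives a perturbation of size \<open>1 / (2 * K)\<close>.\<close>

lemma resolvent_bound:
 obtains M where "0 < M" "\<And>z f. [|\<kappa> \<le> cmod z; cmod z \<le> R; f \<in> V|] ==> N f \<le> M * N (z \<odot> f - T f)"
proof (rule ccontr)
 assume *: "\<not> thesis"
 have "\<exists>z f. \<kappa> \<le> cmod z \<and> cmod z \<le> R \<and> f \<in> V \<and> N f > real (Suc n) * N (z \<odot> f - T f)" for n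
  using * that[of "real (Suc n)"] by (meson not_le of_nat_0_less_iff zero_less_Suc)
 then obtain z f where z: "\<And>n. \<kappa> \<le> cmod (z n)" "\<And>n. cmod (z n) \<le> R" "\<And>n::nat. f n \<in> V"
  "\<And>n. N (f n) > real (Suc n) * N (z n \<odot> f n - T (f n))" by metis
 have "bounded (range z)" using z(2) by (auto simp: bounded_iff)
 then obtain l r where lr: "strict_mono r" "(z \<circ> r) \<longlonglongrightarrow> l" using bounded_imp_convergent_subsequence by blast
 have "\<kappa> \<le> cmod l" using tendsto_lowerbound[OF tendsto_norm[OF lr(2)], of \<kappa>] z(1) by auto
 then obtain K where K: "0 < K" "\<And>f. f \<in> V ==> N f \<le> K * N (l \<odot> f - T f)" using resolvent_bound_pointwise by blast
 have "\<forall>\<^sub>F n in sequentially. dist ((z \<circ> r) n) l < 1 / (2 * K)" using tendstoD[OF lr(2), of "1 / (2 * K)"] K(1) by simp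
 moreover have "\<forall>\<^sub>F n in sequentially. real (Suc n) \<ge> 2 * K" by real_asymp
 ultimately have "\<forall>\<^sub>F n in sequentially. False"
 proof eventually_elim
  fix n assume n: "dist ((z \<circ> r) n) l < 1 / (2 * K)" "2 * K \<le> real (Suc n)"
  define w \<phi> where "w = z (r n)" and "\<phi> = f (r n)"
  have \<phi>: "\<phi> \<in> V" using z by (simp add: \<phi>_def)
  note mem = \<phi> linop_mem[OF T \<phi>]
  have "l \<odot> \<phi> - T \<phi> = (w \<odot> \<phi> - T \<phi>) + (l - w) \<odot> \<phi>" by (auto simp: fun_eq_iff algebra_simps)
  moreover have "N ((w \<odot> \<phi> - T \<phi>) + (l - w) \<odot> \<phi>) \<le> N (w \<odot> \<phi> - T \<phi>) + N ((l - w) \<odot> \<phi>)" using mem by (intro N_add) auto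
  ultimately have "N (l \<odot> \<phi> - T \<phi>) \<le> N (w \<odot> \<phi> - T \<phi>) + cmod (l - w) * N \<phi>" using N_scl[OF \<phi>, of "l - w"] by metis
  then have "N \<phi> \<le> K * (N (w \<odot> \<phi> - T \<phi>) + cmod (l - w) * N \<phi>)" using K(2)[OF \<phi>] K(1) by (meson mult_left_mono less_imp_le order_trans)
  moreover have "K * (cmod (l - w) * N \<phi>) \<le> K * (1 / (2 * K) * N \<phi>)"
   using n(1) K(1) \<phi> by (intro mult_left_mono mult_right_mono) (auto simp: w_def dist_norm norm_minus_commute)
  ultimately have 1: "N \<phi> \<le> 2 * K * N (w \<odot> \<phi> - T \<phi>)" using K(1) by (simp add: algebra_simps)
  have "2 * K * N (w \<odot> \<phi> - T \<phi>) \<le> real (Suc (r n)) * N (w \<odot> \<phi> - T \<phi>)"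
   using n(2) seq_suble[OF lr(1), of n] mem by (intro mult_right_mono) auto
  then show False using 1 z(4)[of "r n"] by (simp add: w_def \<phi>_def)
 qed
 then show False by simp
qed

text \<open>Writing \<open>b\<close> for \<open>T^n / z^n\<close>, a vector \<open>x\<close> with
  \<open>x = b^2 x\<close> gives \<open>y = x + b x\<close> with \<open>y = b y\<close>, null by
  induction. Then \<open>x = - b x\<close>, which is the same situation at a rotated point
  \<open>z\<close>.\<close>

lemma dyadic_injective:
 assumes "\<kappa> \<le> cmod z" "x \<in> V" "x \<doteq> (1 / z ^ (2 ^ i)) \<odot> (T ^^ (2 ^ i)) x"
 shows "N x = 0" using assms
proof (induction i arbitrary: z x)
 case 0
 have "z \<noteq> 0" using 0 \<kappa> by auto
 then have "z \<odot> (1 / z) \<odot> T x = T x" by (auto simp: fun_eq_iff)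
 then have "z \<odot> x \<doteq> T x" using eqv_scl[OF 0(3), of z] unfolding power_0 funpow_one power_one_right by metis
 then have "z \<odot> x - T x \<doteq> 0" using 0 by (subst eqv_diff_zero_iff) (auto simp: linop_mem[OF T])
 then show ?case using inj 0 by blast
next
 case (Suc i)
 let ?n = "2 ^ i :: nat"
 let ?S = "T ^^ ?n"
 have S: "linop ?S" by (rule linop_pow[OF T])
 define c where "c = 1 / z ^ ?n"
 have c: "1 / z ^ (2 ^ Suc i) = c * c" by (simp add: c_def power_add[symmetric] mult_2)
 have TT: "(T ^^ (2 ^ Suc i)) x = ?S (?S x)" by (simp add: mult_2 funpow_add)
 define y where "y = x + c \<odot> ?S x"
 note mem = Suc.prems(2) linop_mem[OF S]
 have y: "y \<in> V" using mem by (simp add: y_def)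
 have "c \<odot> ?S y \<doteq> c \<odot> (?S x + c \<odot> ?S (?S x))" unfolding y_def using mem
  by (intro eqv_scl eqv_trans[OF linop_add[OF S]] eqv_add linop_scl[OF S] eqv_refl) auto
 also have "... = c \<odot> ?S x + (c * c) \<odot> ?S (?S x)" by (auto simp: fun_eq_iff algebra_simps)
 also have "... \<doteq> c \<odot> ?S x + x"
  using Suc.prems(3) mem unfolding c TT by (intro eqv_add eqv_refl eqv_sym[OF Suc.prems(3)[unfolded c TT]]) auto
 also have "... = y" by (simp add: y_def add.commute)
 finally have "N y = 0" using Suc.IH[OF Suc.prems(1) y] by (simp add: c_def eqv_sym)
 then have y0: "y \<doteq> 0" using y by (simp add: eqv_zero_iff)
 define \<zeta> where "\<zeta> = cis (pi / real ?n)"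
 have \<zeta>: "\<zeta> ^ ?n = -1" "cmod \<zeta> = 1" unfolding \<zeta>_def by (rule cis_half_turn_root, simp, rule norm_cis)
 have 1: "1 / (\<zeta> * z) ^ ?n = - c" by (simp add: power_mult_distrib \<zeta> c_def)
 have "x \<doteq> (- c) \<odot> ?S x"
 proof -
  have "(-c) \<odot> ?S x + y \<doteq> (-c) \<odot> ?S x + 0" using y0 mem by (intro eqv_add eqv_refl) auto
  moreover have "(-c) \<odot> ?S x + y = x" by (auto simp: y_def fun_eq_iff)
  ultimately show ?thesis by simp
 qed
 then have "x \<doteq> (1 / (\<zeta> * z) ^ ?n) \<odot> ?S x" by (simp only: 1)
 moreover have "\<kappa> \<le> cmod (\<zeta> * z)" using Suc.prems(1) by (simp add: norm_mult \<zeta>)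
 ultimately show ?case using Suc.IH Suc.prems(2) by blast
qed

text \<open>Rickart's argument: \<open>(1 - b\<^sup>2)\<^sup>-\<^sup>1\<close> is the average of \<open>(1 - b)\<^sup>-\<^sup>1\<close> and \<open>(1 + b)\<^sup>-\<^sup>1\<close>, so a modulus of
  continuity of \<open>z \<mapsto> (1 - T/z)\<^sup>-\<^sup>1\<close> on circles is inherited by \<open>(1 - (T/z)\<^sup>n)\<^sup>-\<^sup>1\<close> for all \<open>n = 2\<^sup>i\<close>.\<close>

lemma dyadic_resolvent_Lipschitz:
 assumes \<Lambda>: "\<And>z z' f. [|\<kappa> \<le> cmod z; \<kappa> \<le> cmod z'; cmod z \<le> R; cmod z' \<le> R; f \<in> V|] ==>
   \<exists>d\<in>V. \<exists>d'\<in>V. f \<doteq> d - (1 / z) \<odot> T d \<and> f \<doteq> d' - (1 / z') \<odot> T d' \<and> N (d - d') \<le> \<Lambda> * cmod (z - z') * N f"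
  and z: "\<kappa> \<le> cmod z" "\<kappa> \<le> cmod z'" "cmod z \<le> R" "cmod z' \<le> R" and f: "f \<in> V"
 shows "\<exists>d\<in>V. \<exists>d'\<in>V. f \<doteq> d - (1 / z ^ (2 ^ i)) \<odot> (T ^^ (2 ^ i)) d \<and>
   f \<doteq> d' - (1 / z' ^ (2 ^ i)) \<odot> (T ^^ (2 ^ i)) d' \<and> N (d - d') \<le> \<Lambda> * cmod (z - z') * N f" using z
proof (induction i arbitrary: z z')
 case 0 then show ?case using \<Lambda>[of z z' f] f unfolding power_0 funpow_one power_one_right by blast
next
 case (Suc i)
 let ?n = "2 ^ i :: nat"
 let ?S = "T ^^ ?n"
 have S: "linop ?S" by (rule linop_pow[OF T])
 define \<zeta> where "\<zeta> = cis (pi / real ?n)"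
 have \<zeta>: "\<zeta> ^ ?n = -1" "cmod \<zeta> = 1" unfolding \<zeta>_def by (rule cis_half_turn_root, simp, rule norm_cis)
 have \<zeta>z: "1 / (\<zeta> * w) ^ ?n = - (1 / w ^ ?n)" for w by (simp add: power_mult_distrib \<zeta>)
 obtain d d' where d: "d \<in> V" "d' \<in> V" "f \<doteq> d - (1 / z ^ ?n) \<odot> ?S d" "f \<doteq> d' - (1 / z' ^ ?n) \<odot> ?S d'"
   "N (d - d') \<le> \<Lambda> * cmod (z - z') * N f" using Suc.IH[OF Suc.prems] by blast
 have "cmod (\<zeta> * z - \<zeta> * z') = cmod (z - z')" by (simp add: right_diff_distrib[symmetric] norm_mult \<zeta>)
 then obtain e e' where e: "e \<in> V" "e' \<in> V" "f \<doteq> e - (- (1 / z ^ ?n)) \<odot> ?S e" "f \<doteq> e' - (- (1 / z' ^ ?n)) \<odot> ?S e'"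
   "N (e - e') \<le> \<Lambda> * cmod (z - z') * N f" using Suc.IH[of "\<zeta> * z" "\<zeta> * z'"] Suc.prems \<zeta>(2) unfolding \<zeta>z norm_mult by (metis mult_1)
 \<comment> \<open>The identity used is \<open>1 - c^2 S^2 = (1 + c S)(1 - c S)\<close>: applied to
   \<open>a\<close> it gives \<open>(1 + c S) f\<close>, applied to \<open>b\<close> it gives
   \<open>(1 - c S) f\<close>, and half of their sum is \<open>f\<close>.\<close>
 have half: "f \<doteq> h - (1 / w ^ (2 ^ Suc i)) \<odot> (T ^^ (2 ^ Suc i)) h"
  if h: "h = (1/2) \<odot> (a + b)" and a: "a \<in> V" "f \<doteq> a - (1 / w ^ ?n) \<odot> ?S a" and b: "b \<in> V" "f \<doteq> b - (- (1 / w ^ ?n)) \<odot> ?S b"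
  for h w a b
 proof -
  define c where "c = 1 / w ^ ?n"
  have c: "1 / w ^ (2 ^ Suc i) = c * c" by (simp add: c_def power_add[symmetric] mult_2)
  have TT: "(T ^^ (2 ^ Suc i)) h = ?S (?S h)" by (simp add: mult_2 funpow_add)
  note mem = a(1) b(1) f linop_mem[OF S]
  have Sh: "?S h \<doteq> (1/2) \<odot> (?S a + ?S b)" unfolding h using mem by (intro eqv_trans[OF linop_scl[OF S]] eqv_scl linop_add[OF S]) auto
  have SSh: "?S (?S h) \<doteq> (1/2) \<odot> (?S (?S a) + ?S (?S b))"
   using mem by (intro eqv_trans[OF linop_cong[OF S Sh]] eqv_trans[OF linop_scl[OF S]] eqv_scl linop_add[OF S]) auto
  have Sf: "?S f \<doteq> ?S a - c \<odot> ?S (?S a)" "?S f \<doteq> ?S b - (-c) \<odot> ?S (?S b)"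
  proof -
   have 1: "?S f \<doteq> ?S k - ?S (t \<odot> ?S k)" if "k \<in> V" "f \<doteq> k - t \<odot> ?S k" for t k
    using mem that(1) by (intro eqv_trans[OF linop_cong[OF S that(2)]] linop_diff[OF S]) auto
   have 2: "?S k - ?S (t \<odot> ?S k) \<doteq> ?S k - t \<odot> ?S (?S k)" if "k \<in> V" for t k
    using mem that by (intro eqv_diff linop_scl[OF S] eqv_refl) auto
   show "?S f \<doteq> ?S a - c \<odot> ?S (?S a)" "?S f \<doteq> ?S b - (-c) \<odot> ?S (?S b)" using eqv_trans[OF 1 2] a b by (auto simp: c_def)
  qed
  have "h - (c * c) \<odot> ?S (?S h) \<doteq> h - (c * c) \<odot> (1/2) \<odot> (?S (?S a) + ?S (?S b))"
   unfolding h using mem SSh[unfolded h] by (intro eqv_diff eqv_scl eqv_refl) auto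
  also have "... = (1/2) \<odot> (((a - c \<odot> ?S a) + c \<odot> (?S a - c \<odot> ?S (?S a))) + ((b - (-c) \<odot> ?S b) - c \<odot> (?S b - (-c) \<odot> ?S (?S b))))"
   unfolding h by (auto simp: fun_eq_iff algebra_simps)
  also have "... \<doteq> (1/2) \<odot> ((f + c \<odot> ?S f) + (f - c \<odot> ?S f))" using eqv_sym[OF a(2)] eqv_sym[OF b(2)] eqv_sym[OF Sf(1)] eqv_sym[OF Sf(2)]
   unfolding c_def by (intro eqv_scl eqv_add eqv_diff) auto
  also have "... = f" by (auto simp: fun_eq_iff)
  finally show ?thesis unfolding c TT by (rule eqv_sym)
 qed
 have "(1/2) \<odot> (d + e) - (1/2) \<odot> (d' + e') = (1/2) \<odot> ((d - d') + (e - e'))" by (auto simp: fun_eq_iff algebra_simps)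
 then have "N ((1/2) \<odot> (d + e) - (1/2) \<odot> (d' + e')) \<le> \<Lambda> * cmod (z - z') * N f"
  using N_add[of "d - d'" "e - e'"] d e N_scl[of "(d - d') + (e - e')" "1/2"] by simp
 moreover have "(1/2) \<odot> (d + e) \<in> V" "(1/2) \<odot> (d' + e') \<in> V" using d e by auto
 ultimately show ?case using half[OF refl d(1,3) e(1,3)] half[OF refl d(2,4) e(2,4)] by blast
qed

text \<open>The solution of \<open>d - T d / z = f\<close> is \<open>d = z w\<close> with
  \<open>w = (z - T)^-1 f\<close>. The resolvent identity bounds the change of \<open>w\<close> by
  \<open>M * M * cmod (z - z')\<close>; passing from \<open>w\<close> to \<open>z w\<close>
  multiplies this by \<open>R\<close> and adds one further term with \<open>M\<close>.\<close>

lemma resolvent_Lipschitz: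
 assumes R: "0 < R"
 obtains \<Lambda> where "0 < \<Lambda>" "\<And>z z' f. [|\<kappa> \<le> cmod z; \<kappa> \<le> cmod z'; cmod z \<le> R; cmod z' \<le> R; f \<in> V|] ==>
   \<exists>d\<in>V. \<exists>d'\<in>V. f \<doteq> d - (1 / z) \<odot> T d \<and> f \<doteq> d' - (1 / z') \<odot> T d' \<and> N (d - d') \<le> \<Lambda> * cmod (z - z') * N f"
proof -
 obtain M where M: "0 < M" "\<And>z f. [|\<kappa> \<le> cmod z; cmod z \<le> R; f \<in> V|] ==> N f \<le> M * N (z \<odot> f - T f)" using resolvent_bound[of R] by blast
 have "\<exists>d\<in>V. \<exists>d'\<in>V. f \<doteq> d - (1 / z) \<odot> T d \<and> f \<doteq> d' - (1 / z') \<odot> T d' \<and> N (d - d') \<le> (R * M * M + M) * cmod (z - z') * N f"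
  if z: "\<kappa> \<le> cmod z" "\<kappa> \<le> cmod z'" "cmod z \<le> R" "cmod z' \<le> R" and f: "f \<in> V" for z z' f
 proof -
  obtain w where w: "w \<in> V" "f \<doteq> z \<odot> w - T w" using surj z f by blast
  obtain w' where w': "w' \<in> V" "f \<doteq> z' \<odot> w' - T w'" using surj z f by blast
  note mem = w(1) w'(1) f linop_mem[OF T]
  have nz: "z \<noteq> 0" "z' \<noteq> 0" using z \<kappa> by auto
  have sol: "f \<doteq> t \<odot> v - (1 / t) \<odot> T (t \<odot> v)" if "t \<noteq> 0" "v \<in> V" "f \<doteq> t \<odot> v - T v" for t v
  proof -
   have "t \<odot> v - (1 / t) \<odot> T (t \<odot> v) \<doteq> t \<odot> v - (1 / t) \<odot> t \<odot> T v"
    using that mem by (intro eqv_diff eqv_scl linop_scl[OF T] eqv_refl) auto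
   also have "... = t \<odot> v - T v" using that by (auto simp: fun_eq_iff)
   finally show ?thesis using that eqv_sym eqv_trans by blast
  qed
  have Nw': "N w' \<le> M * N f" using M(2)[of z' w'] z w' eqv_N[OF w'(2)] by simp
  have "z \<odot> (w - w') - T (w - w') \<doteq> z \<odot> (w - w') - (T w - T w')" using mem by (intro eqv_diff linop_diff[OF T] eqv_refl) auto
  also have "... = (z \<odot> w - T w) - (z' \<odot> w' - T w') + (z' - z) \<odot> w'" by (auto simp: fun_eq_iff algebra_simps)
  also have "... \<doteq> (f - f) + (z' - z) \<odot> w'" using mem w w' by (intro eqv_add eqv_diff eqv_refl) (auto intro: eqv_sym)
  also have "... = (z' - z) \<odot> w'" by simp
  finally have "N (z \<odot> (w - w') - T (w - w')) = cmod (z - z') * N w'"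
   using N_scl[OF w'(1), of "z' - z"] by (metis eqv_N norm_minus_commute)
  then have "N (w - w') \<le> M * (cmod (z - z') * N w')" using M(2)[of z "w - w'"] z mem by simp
  also have "... \<le> M * (cmod (z - z') * (M * N f))" using Nw' M(1) by (intro mult_left_mono) auto
  finally have ww: "N (w - w') \<le> M * (cmod (z - z') * (M * N f))" .
  have "z \<odot> w - z' \<odot> w' = z \<odot> (w - w') + (z - z') \<odot> w'" by (auto simp: fun_eq_iff algebra_simps)
  then have "N (z \<odot> w - z' \<odot> w') \<le> cmod z * N (w - w') + cmod (z - z') * N w'"
   using N_add[of "z \<odot> (w - w')" "(z - z') \<odot> w'"] mem by (simp add: N_scl)
  also have "... \<le> R * (M * (cmod (z - z') * (M * N f))) + cmod (z - z') * (M * N f)"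
   using ww Nw' z mem R by (intro add_mono mult_mono) auto
  also have "... = (R * M * M + M) * cmod (z - z') * N f" by (simp add: algebra_simps)
  finally have "N (z \<odot> w - z' \<odot> w') \<le> (R * M * M + M) * cmod (z - z') * N f" .
  then show ?thesis using sol[OF nz(1) w] sol[OF nz(2) w'] scl_mem[OF w(1)] scl_mem[OF w'(1)] by blast
 qed
 moreover have "0 < R * M * M + M" using M(1) R by (simp add: add_pos_pos)
 ultimately show ?thesis using that[of "R * M * M + M"] by blast
qed

text \<open>A continuation argument in place of the spectral radius formula. The predicate
  \<open>P r\<close> says that the dyadic powers of \<open>T\<close> are \<open>o(r^(2^i))\<close>.
  It holds for a radius above the operator bound, and the Lipschitz bound for dyadic resolvents,
  which is uniform in \<open>i\<close>, lowers the radius by a fixed amount as long as it is at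
  least 1.\<close>

lemma small_power:
 obtains n where "n > 0" "\<And>f. f \<in> V ==> N ((T ^^ n) f) \<le> N f / 2"
proof -
 obtain K where K: "0 < K" "\<And>f. f \<in> V ==> N (T f) \<le> K * N f" using linop_bound[OF T] by metis
 have Kn: "N ((T ^^ n) f) \<le> K ^ n * N f" if "f \<in> V" for f n
 proof (induction n)
  case (Suc n)
  then show ?case using order_trans[OF K(2)[of "(T ^^ n) f"] mult_left_mono[OF Suc, of K]] K(1) that
   by (simp add: linop_pow_mem[OF T] mult.assoc)
 qed (use that in simp)
 define R where "R = K + 1"
 obtain \<Lambda> where \<Lambda>: "0 < \<Lambda>" and Lip: "\<And>z z' f. [|\<kappa> \<le> cmod z; \<kappa> \<le> cmod z'; cmod z \<le> R; cmod z' \<le> R; f \<in> V|] ==>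
   \<exists>d\<in>V. \<exists>d'\<in>V. f \<doteq> d - (1 / z) \<odot> T d \<and> f \<doteq> d' - (1 / z') \<odot> T d' \<and> N (d - d') \<le> \<Lambda> * cmod (z - z') * N f"
  using resolvent_Lipschitz[of R] K(1) by (auto simp: R_def)
 \<comment> \<open>The first entry makes dyadic resolvents at radii \<open>\<eta>\<close> apart
   differ by at most \<open>N f / 4\<close>; the second keeps \<open>r - \<eta>\<close> at or above
   \<open>\<kappa>\<close> whenever \<open>r\<close> is at least 1.\<close>
 define \<eta> where "\<eta> = min (1 / (4 * \<Lambda>)) (1 - \<kappa>)"
 have \<eta>: "0 < \<eta>" "\<eta> \<le> 1 - \<kappa>" "\<Lambda> * \<eta> \<le> 1/4"
 proof -
  show "0 < \<eta>" "\<eta> \<le> 1 - \<kappa>" using \<Lambda> \<kappa> by (auto simp: \<eta>_def)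
  have "\<Lambda> * \<eta> \<le> \<Lambda> * (1 / (4 * \<Lambda>))" using \<Lambda> by (intro mult_left_mono) (auto simp: \<eta>_def)
  then show "\<Lambda> * \<eta> \<le> 1/4" using \<Lambda> by simp
 qed
 define P where "P r \<longleftrightarrow> (\<forall>e>0. \<exists>i0. \<forall>i\<ge>i0. \<forall>f\<in>V. N ((T ^^ (2 ^ i)) f) \<le> e * r ^ (2 ^ i) * N f)" for r :: real
 \<comment> \<open>A plain bound at radius \<open>r\<close> becomes a little-o at any larger radius,
   because the exponents \<open>2^i\<close> outgrow every constant.\<close>
 have grow: "P s" if r: "0 < r" "r < s" and bd: "\<exists>i0. \<forall>i\<ge>i0. \<forall>f\<in>V. N ((T ^^ (2 ^ i)) f) \<le> r ^ (2 ^ i) * N f" for r s unfolding P_def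
 proof (intro allI impI)
  fix e :: real assume "e > 0"
  obtain i0 where i0: "\<And>i f. [|i \<ge> i0; f \<in> V|] ==> N ((T ^^ (2 ^ i)) f) \<le> r ^ (2 ^ i) * N f" using bd by blast
  obtain n0 where n0: "(r / s) ^ n0 < e" using real_arch_pow_inv[of e "r / s"] \<open>e > 0\<close> r by auto
  have "N ((T ^^ (2 ^ i)) f) \<le> e * s ^ (2 ^ i) * N f" if i: "i \<ge> max i0 n0" and f: "f \<in> V" for i f
  proof -
   have "n0 \<le> 2 ^ i" using i less_exp[of i] by linarith
   then have "(r / s) ^ (2 ^ i) \<le> (r / s) ^ n0" using r by (intro power_decreasing) auto
   then have "(r / s) ^ (2 ^ i) \<le> e" using n0 by linarith
   then have "r ^ (2 ^ i) / s ^ (2 ^ i) \<le> e" by (simp only: power_divide)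
   then have "r ^ (2 ^ i) \<le> e * s ^ (2 ^ i)" using r by (subst (asm) pos_divide_le_eq) auto
   then have "r ^ (2 ^ i) * N f \<le> e * s ^ (2 ^ i) * N f" using f by (intro mult_right_mono) auto
   then show ?thesis using i0[of i f] i f by simp
  qed
  then show "\<exists>i0. \<forall>i\<ge>i0. \<forall>f\<in>V. N ((T ^^ (2 ^ i)) f) \<le> e * s ^ (2 ^ i) * N f" by blast
 qed
 have step: "\<exists>i0. \<forall>i\<ge>i0. \<forall>f\<in>V. N ((T ^^ (2 ^ i)) f) \<le> s ^ (2 ^ i) * N f"
  if r: "P r" "r \<le> R" "\<kappa> \<le> s" "s \<le> r" "r - s \<le> \<eta>" for r s
 proof -
  obtain i0 where i0: "\<And>i f. [|i \<ge> i0; f \<in> V|] ==> N ((T ^^ (2 ^ i)) f) \<le> (1/8) * r ^ (2 ^ i) * N f"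
   using r(1)[unfolded P_def, rule_format, of "1/8"] by auto
  have "N ((T ^^ (2 ^ i)) x) \<le> s ^ (2 ^ i) * N x" if i: "i \<ge> i0" and x: "x \<in> V" for i x
  proof -
   let ?n = "2 ^ i :: nat"
   let ?S = "T ^^ ?n"
   have S: "linop ?S" by (rule linop_pow[OF T])
   define b where "b = (1 / complex_of_real s ^ ?n)"
   define a where "a = (1 / complex_of_real r ^ ?n)"
   note mem = x linop_mem[OF S]
   \<comment> \<open>With this \<open>f\<close>, the vector \<open>x\<close> itself solves the
     dyadic equation at radius \<open>s\<close>; \<open>dyadic_injective\<close> then identifies it
     with the solution \<open>d'\<close> that the Lipschitz bound controls.\<close>
   define f where "f = x - b \<odot> ?S x"
   have f: "f \<in> V" using mem by (simp add: f_def)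
   have pos: "0 < s" "0 < r" using r \<kappa> by auto
   have LL: "\<exists>d\<in>V. \<exists>d'\<in>V. f \<doteq> d - (1 / complex_of_real r ^ ?n) \<odot> ?S d \<and>
     f \<doteq> d' - (1 / complex_of_real s ^ ?n) \<odot> ?S d' \<and> N (d - d') \<le> \<Lambda> * cmod (complex_of_real r - complex_of_real s) * N f"
   proof (rule dyadic_resolvent_Lipschitz[where R = R])
    show "\<kappa> \<le> cmod (complex_of_real r)" "\<kappa> \<le> cmod (complex_of_real s)"
     "cmod (complex_of_real r) \<le> R" "cmod (complex_of_real s) \<le> R" using r pos by simp_all
   qed (use Lip f in blast)+
   obtain d d' where d: "d \<in> V" "d' \<in> V" "f \<doteq> d - a \<odot> ?S d" "f \<doteq> d' - b \<odot> ?S d'"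
    "N (d - d') \<le> \<Lambda> * cmod (complex_of_real r - complex_of_real s) * N f" using LL unfolding a_def b_def by blast
   have "cmod (complex_of_real r - complex_of_real s) = r - s" using r by (simp add: of_real_diff[symmetric] del: of_real_diff)
   then have "\<Lambda> * cmod (complex_of_real r - complex_of_real s) \<le> 1/4" using order_trans[OF mult_left_mono[OF r(5), of \<Lambda>] \<eta>(3)] \<Lambda> by simp
   then have "\<Lambda> * cmod (complex_of_real r - complex_of_real s) * N f \<le> 1/4 * N f" using N_nonneg[OF f] by (rule mult_right_mono)
   then have dd: "N (d - d') \<le> 1/4 * N f" by (rule order_trans[OF d(5)])
   have "cmod a * N (?S d) \<le> cmod a * ((1/8) * r ^ ?n * N d)" using i0[OF i d(1)] by (intro mult_left_mono) auto
   also have "... = N d / 8" using pos by (simp add: a_def norm_divide norm_power)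
   finally have ad: "N (a \<odot> ?S d) \<le> N d / 8" using d mem by (simp add: N_scl)
   have mem2: "a \<odot> ?S d \<in> V" "b \<odot> ?S d' \<in> V" using d mem by auto
   have fd: "N (d - f) = N (a \<odot> ?S d)"
   proof -
    have "d - f \<doteq> d - (d - a \<odot> ?S d)" using d by (intro eqv_diff eqv_refl)
    also have "... = a \<odot> ?S d" by simp
    finally show ?thesis by (rule eqv_N)
   qed
   have fd': "N (d' - f) = N (b \<odot> ?S d')"
   proof -
    have "d' - f \<doteq> d' - (d' - b \<odot> ?S d')" using d by (intro eqv_diff eqv_refl)
    also have "... = b \<odot> ?S d'" by simp
    finally show ?thesis by (rule eqv_N)
   qed
   \<comment> \<open>At radius \<open>r\<close> the scaled dyadic power has norm at most 1/8, so
     \<open>d\<close> lies within \<open>N f / 4\<close> of \<open>f\<close>. Hence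
     \<open>d'\<close> lies within \<open>N f / 2\<close>, which bounds \<open>b S d'\<close> by
     \<open>N f / 2\<close> and therefore by \<open>N d'\<close>.\<close>
   have "N d \<le> N f + N (d - f)" using d f by (intro N_le_add_diff)
   then have "N (d - f) \<le> 1/4 * N f" using ad fd N_nonneg[OF mem2(1)] by simp
   moreover have "N (d' - f) \<le> N (d' - d) + N (d - f)" using d f by (intro N_tri)
   ultimately have 1: "N (b \<odot> ?S d') \<le> 1/2 * N f" using dd fd' N_minus_commute[of d d'] d by simp
   have "N f \<le> N d' + N (f - d')" using d f by (intro N_le_add_diff)
   then have 2: "N f \<le> N d' + N (b \<odot> ?S d')" using fd' N_minus_commute[of f d'] d f by simp
   have 3: "N (b \<odot> ?S d') \<le> N d'" using 1 2 by simp
   have "(x - d') - b \<odot> ?S (x - d') \<doteq> (x - d') - b \<odot> (?S x - ?S d')"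
    using mem d by (intro eqv_diff eqv_scl linop_diff[OF S] eqv_refl) auto
   also have "... = f - (d' - b \<odot> ?S d')" by (auto simp: f_def fun_eq_iff algebra_simps)
   also have "... \<doteq> f - f" using d f by (intro eqv_diff eqv_refl) (auto intro: eqv_sym)
   finally have "(x - d') - b \<odot> ?S (x - d') \<doteq> 0" unfolding diff_self .
   then have "(x - d') \<doteq> b \<odot> ?S (x - d')" using mem d by (subst (asm) eqv_diff_zero_iff) auto
   then have "N (x - d') = 0" using dyadic_injective[of "complex_of_real s" "x - d'" i] r pos mem d by (simp add: b_def)
   then have xd: "x \<doteq> d'" using x d by (simp add: eqv_def)
   have "N (b \<odot> ?S x) = N (b \<odot> ?S d')" by (intro eqv_N eqv_scl linop_cong[OF S] xd)
   then have "cmod b * N (?S x) \<le> N x" using 3 eqv_N[OF xd] mem by (simp add: N_scl)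
   moreover have "cmod b = 1 / s ^ ?n" using pos by (simp add: b_def norm_divide norm_power)
   ultimately have "N (?S x) / s ^ ?n \<le> N x" by simp
   then show ?thesis using pos by (subst (asm) pos_divide_le_eq) (auto simp: mult.commute)
  qed
  then show ?thesis by blast
 qed
 have PR: "P R" using K(1) Kn by (intro grow[of K R]) (auto simp: R_def)
 \<comment> \<open>Each round gains \<open>\<eta>\<close> from \<open>step\<close> and returns half
   of it to \<open>grow\<close> to regain the little-o. After finitely many rounds the radius is 1,
   where the little-o property gives a dyadic power of norm at most 1/2.\<close>
 have "P (max 1 (R - real n * (\<eta> / 2)))" for n
 proof (induction n)
  case 0
  have "max 1 R = R" using K(1) by (simp add: R_def)
  then show ?case using PR by simp
 next
  case (Suc n)
  let ?r = "max 1 (R - real n * (\<eta> / 2))"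
  let ?r' = "max 1 (R - real (Suc n) * (\<eta> / 2))"
  have eq: "R - real (Suc n) * (\<eta> / 2) = R - real n * (\<eta> / 2) - \<eta> / 2" by (simp add: algebra_simps)
  have 1: "?r - \<eta> < ?r'" unfolding eq using \<eta>(1) by linarith
  have 2: "1 \<le> ?r" "?r \<le> R" using \<eta>(1) K(1) by (auto simp: R_def)
  then have 3: "\<kappa> \<le> ?r - \<eta>" using \<eta>(2) by linarith
  show ?case
  proof (rule grow)
   show "0 < ?r - \<eta>" using 3 \<kappa>(1) by linarith
   show "\<exists>i0. \<forall>i\<ge>i0. \<forall>f\<in>V. N ((T ^^ (2 ^ i)) f) \<le> (?r - \<eta>) ^ (2 ^ i) * N f" using \<eta>(1) by (intro step[OF Suc 2(2) 3]) auto
  qed (rule 1)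
 qed
 moreover obtain n where "R / (\<eta> / 2) \<le> real n" using real_arch_simple by blast
 then have "max 1 (R - real n * (\<eta> / 2)) = 1" using \<eta>(1) by (simp add: field_simps)
 ultimately have "P 1" by metis
 from this[unfolded P_def, rule_format, of "1/2"] obtain i where
  "\<forall>f\<in>V. N ((T ^^ (2 ^ i)) f) \<le> (1/2) * 1 ^ (2 ^ i) * N f" by auto
 then show ?thesis using that[of "2 ^ i"] by simp
qed

end

end

section \<open>Mean-zero decay, mixing and stability; \<open>I\<close> models integration and
  \<open>e\<close> the constant 1\<close>

locale functional_space = complete_seminormed V N for V :: "('x \<Rightarrow> complex) set" and N +
 fixes I :: "('x \<Rightarrow> complex) \<Rightarrow> complex" and e
 assumes I_add: "[|f \<in> V; g \<in> V|] ==> I (f + g) = I f + I g"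
  and I_scl: "f \<in> V ==> I (c \<odot> f) = c * I f"
  and I_bound: "\<exists>K. \<forall>f\<in>V. cmod (I f) \<le> K * N f"
  and e_mem [simp]: "e \<in> V" and I_e [simp]: "I e = 1"
begin

lemma N_not_less_zero [simp]: "f \<in> V ==> \<not> N f < 0" by (simp add: not_less)

lemma I_diff: "[|f \<in> V; g \<in> V|] ==> I (f - g) = I f - I g" unfolding diff_eq_scl by (subst I_add) (auto simp: I_scl)

lemma I_zero [simp]: "I 0 = 0" using I_scl[of 0 0] by simp

lemma I_cong: "f \<doteq> g ==> I f = I g"
proof -
 assume *: "f \<doteq> g"
 obtain K where K: "\<And>f. f \<in> V ==> cmod (I f) \<le> K * N f" using I_bound by blast
 have "cmod (I (f - g)) \<le> 0" using K[of "f - g"] * by (auto simp: eqv_def)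
 then show ?thesis using * by (auto simp: eqv_def I_diff)
qed

lemma I_bound': obtains K where "0 < K" "\<And>f. f \<in> V ==> cmod (I f) \<le> K * N f"
proof -
 obtain K where K: "\<And>f. f \<in> V ==> cmod (I f) \<le> K * N f" using I_bound by blast
 have "cmod (I f) \<le> max K 1 * N f" if "f \<in> V" for f using K[OF that] mult_right_mono[of K "max K 1" "N f"] that by simp
 then show ?thesis using that[of "max K 1"] by simp
qed

lemma I_pow: "[|linop T; \<And>f. f \<in> V ==> I (T f) = I f; f \<in> V|] ==> I ((T ^^ n) f) = I f" by (induction n) (auto simp: linop_pow_mem)

text \<open>Deflation: subtracting the eigenprojection \<open>f \<mapsto> I f \<odot> v\<close> from \<open>T\<close> removes \<open>1\<close> from the spectrum
  and does not change \<open>T\<close> on the kernel of \<open>I\<close>.\<close>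

lemma mean_zero_decay:
 assumes T: "linop T" and IT: "\<And>f. f \<in> V ==> I (T f) = I f" and \<kappa>: "0 < \<kappa>" "\<kappa> < 1"
  and v: "v \<in> V" "T v \<doteq> v"
  and eig: "\<And>f. [|f \<in> V; T f \<doteq> f|] ==> \<exists>c. f \<doteq> c \<odot> v"
  and dec: "\<And>f. f \<in> V ==> \<exists>c. \<exists>w\<in>V. f \<doteq> c \<odot> v + (w - T w)"
  and surj: "\<And>z f. [|\<kappa> \<le> cmod z; z \<noteq> 1; f \<in> V|] ==> \<exists>w\<in>V. f \<doteq> z \<odot> w - T w"
  and inj: "\<And>z w. [|\<kappa> \<le> cmod z; z \<noteq> 1; w \<in> V; z \<odot> w - T w \<doteq> 0|] ==> N w = 0"
 obtains n where "n > 0" "\<And>f. [|f \<in> V; I f = 0|] ==> N ((T ^^ n) f) \<le> N f / 2"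
proof -
 note [simp] = linop_mem[OF T] v(1)
 obtain c0 w0 where w0: "w0 \<in> V" "e \<doteq> c0 \<odot> v + (w0 - T w0)" using dec[of e] by auto
 \<comment> \<open>The range of \<open>1 - T\<close> lies in the kernel of \<open>I\<close>, so the
   eigenvector has to carry the mean of \<open>e\<close>; this allows the normalisation
   \<open>I u = 1\<close>.\<close>
 have "1 = I (c0 \<odot> v + (w0 - T w0))" using I_cong[OF w0(2)] by simp
 then have "c0 * I v = 1" using w0 by (simp add: I_add I_scl I_diff IT)
 then have Iv: "I v \<noteq> 0" by auto
 define u where "u = inverse (I v) \<odot> v"
 have u: "u \<in> V" "I u = 1" using Iv by (simp_all add: u_def I_scl)
 have Tu: "T u \<doteq> u" unfolding u_def by (intro eqv_trans[OF linop_scl[OF T]] eqv_scl v)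
 define D where "D f = T f - I f \<odot> u" for f
 have Dlin: "linop D"
 proof -
  obtain K where K: "0 < K" "\<And>f. f \<in> V ==> cmod (I f) \<le> K * N f" using I_bound' by blast
  have "linop (\<lambda>f. I f \<odot> u)" unfolding linop_def
  proof (intro conjI ballI allI)
   show "I (f + g) \<odot> u \<doteq> I f \<odot> u + I g \<odot> u" if "f \<in> V" "g \<in> V" for f g
   proof -
    have "I (f + g) \<odot> u = I f \<odot> u + I g \<odot> u" using that by (auto simp: I_add fun_eq_iff algebra_simps)
    then show ?thesis using that u by simp
   qed
   show "I (c \<odot> f) \<odot> u \<doteq> c \<odot> I f \<odot> u" if "f \<in> V" for f c
   proof -
    have "I (c \<odot> f) \<odot> u = c \<odot> I f \<odot> u" using that by (auto simp: I_scl fun_eq_iff algebra_simps)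
    then show ?thesis using that u by simp
   qed
   have "N (I f \<odot> u) \<le> (K * N u) * N f" if "f \<in> V" for f
    using mult_right_mono[OF K(2)[OF that], of "N u"] u by (simp add: N_scl algebra_simps)
   then show "\<exists>K. \<forall>f\<in>V. N (I f \<odot> u) \<le> K * N f" by blast
  qed (use u in auto)
  then show ?thesis unfolding D_def by (intro linop_diff_op T)
 qed
 note [simp] = linop_mem[OF Dlin]
 have zD: "z \<odot> w - D w = (z \<odot> w - T w) + I w \<odot> u" for z w by (auto simp: D_def fun_eq_iff)
 have IzD: "I (z \<odot> w - D w) = z * I w" if "w \<in> V" for z w using that u by (simp add: zD I_add I_diff I_scl IT)
 have surjD: "\<exists>w\<in>V. f \<doteq> z \<odot> w - D w" if z: "\<kappa> \<le> cmod z" and f: "f \<in> V" for z f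
 proof (cases "z = 1")
  case False
  have z0: "z \<noteq> 0" using z \<kappa> by auto
  \<comment> \<open>Applying \<open>I\<close> to the deflated equation forces
    \<open>I w = I f / z\<close>. The rank one term is thus known beforehand and is subtracted from
    \<open>f\<close> before \<open>T\<close> is used.\<close>
  obtain w where w: "w \<in> V" "f - (I f / z) \<odot> u \<doteq> z \<odot> w - T w" using surj[OF z False, of "f - (I f / z) \<odot> u"] f u by auto
  have "I f - I f / z = z * I w - I w" using I_cong[OF w(2)] w f u by (simp add: I_diff I_scl IT)
  then have "(z - 1) * I w = (z - 1) * (I f / z)" using z0 by (simp add: field_simps)
  then have Iw: "I w = I f / z" using False by (subst (asm) mult_cancel_left) simp
  have "z \<odot> w - D w \<doteq> (f - (I f / z) \<odot> u) + I w \<odot> u" unfolding zD using w u by (intro eqv_add eqv_refl eqv_sym[OF w(2)]) auto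
  also have "... = f" by (simp add: Iw)
  finally show ?thesis using w(1) eqv_sym by blast
 next
  case True
  obtain c w where w: "w \<in> V" "f \<doteq> c \<odot> v + (w - T w)" using dec f by blast
  \<comment> \<open>Adding a multiple of the fixed vector \<open>u\<close> leaves
    \<open>w - T w\<close> unchanged, and its coefficient is chosen so that the rank one term
    becomes exactly \<open>c \<odot> v\<close>.\<close>
  define x where "x = w + (c * I v - I w) \<odot> u"
  have x: "x \<in> V" using w u by (simp add: x_def)
  have Ix: "I x = c * I v" using w u by (simp add: x_def I_add I_scl)
  have xD: "1 \<odot> x - D x = (x - T x) + (c * I v) \<odot> u" unfolding zD Ix by simp
  have "(x - T x) + (c * I v) \<odot> u \<doteq> (x - (T w + (c * I v - I w) \<odot> u)) + (c * I v) \<odot> u"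
  proof -
   have "T x \<doteq> T w + (c * I v - I w) \<odot> u" unfolding x_def using w u Tu
    by (intro eqv_trans[OF linop_add[OF T]] eqv_add eqv_trans[OF linop_scl[OF T]] eqv_scl eqv_refl) auto
   then show ?thesis using x u by (intro eqv_add eqv_diff eqv_refl) auto
  qed
  also have "... = c \<odot> v + (w - T w)"
  proof -
   have cu: "(c * I v) \<odot> u = c \<odot> v" unfolding u_def by (rule ext) (simp add: Iv)
   have "(w + a) - (t + a) + b = b + (w - t)" for a b t :: "'x \<Rightarrow> complex" by (simp add: algebra_simps)
   then show ?thesis unfolding x_def cu .
  qed
  also have "... \<doteq> f" by (rule eqv_sym[OF w(2)])
  finally have "f \<doteq> 1 \<odot> x - D x" unfolding xD by (rule eqv_sym)
  then show ?thesis using x True by blast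
 qed
 have injD: "N w = 0" if z: "\<kappa> \<le> cmod z" and w: "w \<in> V" "z \<odot> w - D w \<doteq> 0" for z w
 proof -
  have z0: "z \<noteq> 0" using z \<kappa> by auto
  have "z * I w = 0" using I_cong[OF w(2)] IzD[OF w(1)] by simp
  then have Iw: "I w = 0" using z0 by simp
  then have Tw: "z \<odot> w - T w \<doteq> 0" using w(2) unfolding zD by simp
  show ?thesis
  proof (cases "z = 1")
   case False then show ?thesis using inj z w Tw by blast
  next
   case True
   then have "w \<doteq> T w" using Tw w by (simp add: eqv_diff_zero_iff)
   then obtain c where c: "w \<doteq> c \<odot> v" using eig[OF w(1)] eqv_sym by blast
   then have "c * I v = 0" using I_cong[OF c] Iw by (simp add: I_scl)
   then have "c = 0" using Iv by simp
   then show ?thesis using eqv_N[OF c] by simp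
  qed
 qed
 have DT: "(D ^^ n) f = (T ^^ n) f" if "f \<in> V" "I f = 0" for f n
 proof (induction n)
  case (Suc n)
  have "I ((T ^^ n) f) = 0" using I_pow[OF T IT that(1)] that by simp
  then show ?case using Suc by (simp add: D_def)
 qed simp
 show ?thesis
 proof (rule small_power[OF Dlin \<kappa>])
  show "\<exists>w\<in>V. f \<doteq> z \<odot> w - D w" if "\<kappa> \<le> cmod z" "f \<in> V" for z f using that by (rule surjD)
  show "N w = 0" if "\<kappa> \<le> cmod z" "w \<in> V" "z \<odot> w - D w \<doteq> 0" for z w using that by (rule injD)
  fix n :: nat assume n: "n > 0" "\<And>f. f \<in> V ==> N ((D ^^ n) f) \<le> N f / 2"
  show ?thesis
  proof (rule that[OF n(1)])
   show "N ((T ^^ n) f) \<le> N f / 2" if "f \<in> V" "I f = 0" for f using n(2)[OF that(1)] DT[OF that] by simp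
  qed
 qed
qed

lemma eventual_contraction_power:
 assumes T: "linop T" and IT: "\<And>f. f \<in> V ==> I (T f) = I f"
  and n: "\<And>f. [|f \<in> V; I f = 0|] ==> N ((T ^^ n) f) \<le> N f / 2"
  and f: "f \<in> V" "I f = 0"
 shows "N ((T ^^ (n * j)) f) \<le> (1/2) ^ j * N f"
proof (induction j)
 case (Suc j)
 have "(T ^^ (n * Suc j)) f = (T ^^ n) ((T ^^ (n * j)) f)" by (simp add: funpow_add)
 then show ?case using n[of "(T ^^ (n * j)) f"] Suc f I_pow[OF T IT] by (simp add: linop_pow_mem[OF T])
qed simp

text \<open>Twisted operators do not preserve \<open>I\<close>, but the means of their iterates stay
  bounded. Removing the mean before every block of length \<open>l\<close> gives a recursion
  \<open>a' \<le> p + (a + p) / 2\<close> with \<open>p = K * B * N e * N f\<close>; its fixed point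
  \<open>3 * p\<close> explains the constant.\<close>

lemma geometric_bound:
 assumes Q: "linop Q" and B: "1 \<le> B" "\<And>r f. [|r \<le> l; f \<in> V|] ==> N ((Q ^^ r) f) \<le> B * N f"
  and l: "0 < l" "\<And>f. [|f \<in> V; I f = 0|] ==> N ((Q ^^ l) f) \<le> N f / 2"
  and K: "0 < K" "\<And>f n. f \<in> V ==> cmod (I ((Q ^^ n) f)) \<le> K * N f" and f: "f \<in> V"
 shows "N ((Q ^^ n) f) \<le> B * (1 + 3 * K * B * N e) * N f"
proof -
 have lin: "linop (Q ^^ k)" for k by (rule linop_pow[OF Q])
 note mem = linop_pow_mem[OF Q]
 have blocks: "N ((Q ^^ (l * j)) f) \<le> (1 + 3 * K * B * N e) * N f" for j
 proof (induction j)
  case 0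
  have "1 * N f \<le> (1 + 3 * K * B * N e) * N f" using f K B by (intro mult_right_mono) auto
  then show ?case by simp
 next
  case (Suc j)
  define x where "x = (Q ^^ (l * j)) f"
  have x: "x \<in> V" using f mem by (simp add: x_def)
  have Ix: "cmod (I x) \<le> K * N f" using K f by (simp add: x_def)
  have "(Q ^^ l) (I x \<odot> e + (x - I x \<odot> e)) \<doteq> I x \<odot> (Q ^^ l) e + (Q ^^ l) (x - I x \<odot> e)"
   using x mem by (intro eqv_trans[OF linop_add[OF lin]] eqv_add linop_scl[OF lin] eqv_refl) auto
  then have "N ((Q ^^ l) x) = N (I x \<odot> (Q ^^ l) e + (Q ^^ l) (x - I x \<odot> e))" using eqv_N by simp
  also have "... \<le> N (I x \<odot> (Q ^^ l) e) + N ((Q ^^ l) (x - I x \<odot> e))" using x mem by (intro N_add) auto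
  also have "N (I x \<odot> (Q ^^ l) e) \<le> (K * N f) * (B * N e)" using mem Ix B(2)[of l e] K(1) f by (simp add: N_scl mult_mono)
  also have "N ((Q ^^ l) (x - I x \<odot> e)) \<le> N (x - I x \<odot> e) / 2" using x by (intro l(2)) (auto simp: I_diff I_scl)
  also have "N (x - I x \<odot> e) \<le> N x + (K * N f) * N e" using N_diff[of x "I x \<odot> e"] mult_right_mono[OF Ix, of "N e"] x by (simp add: N_scl)
  also have "N x \<le> (1 + 3 * K * B * N e) * N f" using Suc by (simp add: x_def)
  also have "K * N f * N e \<le> K * N f * (B * N e)" using B K f by (intro mult_left_mono) (auto simp: mult_le_cancel_right1)
  finally have bd: "N ((Q ^^ l) x) \<le> K * N f * (B * N e) + ((1 + 3 * K * B * N e) * N f + K * N f * (B * N e)) / 2" by simp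
  have "N ((Q ^^ l) x) \<le> (1 + 3 * K * B * N e) * N f"
  proof -
   define p where "p = K * B * N e * N f"
   have eq: "K * N f * (B * N e) = p" "(1 + 3 * K * B * N e) * N f = N f + 3 * p" by (simp_all add: p_def algebra_simps)
   show ?thesis using bd N_nonneg[OF f] unfolding eq by (simp add: field_simps)
  qed
  then show ?case by (simp add: x_def funpow_add)
 qed
 have "(Q ^^ n) f = (Q ^^ (n mod l)) ((Q ^^ (l * (n div l))) f)" by (metis comp_apply funpow_add mod_mult_div_eq)
 then have "N ((Q ^^ n) f) \<le> B * N ((Q ^^ (l * (n div l))) f)"
  using B(2)[of "n mod l" "(Q ^^ (l * (n div l))) f"] l(1) mem f by (simp add: less_imp_le)
 also have "... \<le> B * ((1 + 3 * K * B * N e) * N f)" using B(1) blocks by (intro mult_left_mono) auto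
 finally show ?thesis by (simp add: mult.assoc)
qed

text \<open>The contraction applied to \<open>\<rho> - e\<close>, which has mean zero, gives
  \<open>N \<rho> \<le> B * N e + (N \<rho> + N e) / 2\<close> and so bounds the invariant vector by
  data that do not involve it. Decay is then the contraction applied to
  \<open>f - I f \<odot> \<rho>\<close>.\<close>

lemma geometric_mixing:
 assumes Q: "linop Q" and IQ: "\<And>f. f \<in> V ==> I (Q f) = I f"
  and B: "1 \<le> B" "\<And>r f. [|r \<le> l; f \<in> V|] ==> N ((Q ^^ r) f) \<le> B * N f"
  and l: "0 < l" "\<And>f. [|f \<in> V; I f = 0|] ==> N ((Q ^^ l) f) \<le> N f / 2"
  and K: "0 < K" "\<And>f. f \<in> V ==> cmod (I f) \<le> K * N f"
  and \<rho>: "\<rho> \<in> V" "Q \<rho> \<doteq> \<rho>" "I \<rho> = 1" and f: "f \<in> V"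
 shows "N \<rho> \<le> 3 * B * N e"
  and "N ((Q ^^ n) f - I f \<odot> \<rho>) \<le> B * (1 + 3 * K * B * N e) * (1/2) ^ (n div l) * N f"
proof -
 have lin: "linop (Q ^^ k)" for k by (rule linop_pow[OF Q])
 note mem = linop_pow_mem[OF Q]
 have Qk: "(Q ^^ k) \<rho> \<doteq> \<rho>" for k
 proof (induction k)
  case (Suc k) then show ?case using eqv_trans[OF linop_cong[OF Q Suc] \<rho>(2)] by simp
 qed (use \<rho> in simp)
 show N\<rho>: "N \<rho> \<le> 3 * B * N e"
 proof -
  have "(Q ^^ l) (\<rho> - e) \<doteq> \<rho> - (Q ^^ l) e" using \<rho> mem by (intro eqv_trans[OF linop_diff[OF lin]] eqv_diff Qk eqv_refl) auto
  then have "N (\<rho> - (Q ^^ l) e) \<le> N (\<rho> - e) / 2" using l(2)[of "\<rho> - e"] \<rho> eqv_N by (fastforce simp: I_diff)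
  moreover have "N (\<rho> - e) \<le> N \<rho> + N e" using \<rho> by (intro N_diff) auto
  moreover have "N \<rho> \<le> N ((Q ^^ l) e) + N (\<rho> - (Q ^^ l) e)" using \<rho> mem by (intro N_le_add_diff) auto
  moreover have "N ((Q ^^ l) e) \<le> B * N e" using B(2)[of l e] by simp
  moreover have "N e \<le> B * N e" using B(1) by (simp add: mult_le_cancel_right1)
  ultimately show ?thesis by linarith
 qed
 define g where "g = f - I f \<odot> \<rho>"
 have g: "g \<in> V" "I g = 0" using f \<rho> by (auto simp: g_def I_diff I_scl)
 have Ng: "N g \<le> (1 + 3 * K * B * N e) * N f"
 proof -
  have "N g \<le> N f + cmod (I f) * N \<rho>" using N_diff[of f "I f \<odot> \<rho>"] f \<rho> by (simp add: g_def N_scl)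
  also have "... \<le> N f + (K * N f) * (3 * B * N e)" using N\<rho> K f \<rho>(1) by (intro add_left_mono mult_mono) auto
  finally show ?thesis by (simp add: algebra_simps)
 qed
 have blocks: "N ((Q ^^ (l * j)) g) \<le> (1/2) ^ j * N g" for j by (rule eventual_contraction_power[OF Q IQ l(2) g])
 have "(Q ^^ n) f - I f \<odot> \<rho> \<doteq> (Q ^^ n) f - I f \<odot> (Q ^^ n) \<rho>" using f mem \<rho> by (intro eqv_diff eqv_scl eqv_sym[OF Qk] eqv_refl) auto
 also have "... \<doteq> (Q ^^ n) f - (Q ^^ n) (I f \<odot> \<rho>)" using f mem \<rho> by (intro eqv_diff eqv_sym[OF linop_scl[OF lin]] eqv_refl) auto
 also have "... \<doteq> (Q ^^ n) g" unfolding g_def using f \<rho> by (intro eqv_sym[OF linop_diff[OF lin]]) auto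
 finally have "N ((Q ^^ n) f - I f \<odot> \<rho>) = N ((Q ^^ n) g)" by (rule eqv_N)
 also have "(Q ^^ n) g = (Q ^^ (n mod l)) ((Q ^^ (l * (n div l))) g)" by (metis comp_apply funpow_add mod_mult_div_eq)
 also have "N ... \<le> B * N ((Q ^^ (l * (n div l))) g)"
  using B(2)[of "n mod l" "(Q ^^ (l * (n div l))) g"] l(1) mem g by (simp add: less_imp_le)
 also have "... \<le> B * ((1/2) ^ (n div l) * ((1 + 3 * K * B * N e) * N f))"
  using B(1) blocks[of "n div l"] Ng by (intro mult_left_mono order_trans[OF blocks]) auto
 also have "... = B * (1 + 3 * K * B * N e) * (1/2) ^ (n div l) * N f" by (simp add: algebra_simps)
 finally show "N ((Q ^^ n) f - I f \<odot> \<rho>) \<le> B * (1 + 3 * K * B * N e) * (1/2) ^ (n div l) * N f" .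
qed

section \<open>Stability of contraction when \<open>Q p\<close> approaches \<open>T\<close> only
  from the strong to the weak norm\<close>

context
 fixes T :: "('x \<Rightarrow> complex) \<Rightarrow> 'x \<Rightarrow> complex" and Q :: "'p \<Rightarrow> ('x \<Rightarrow> complex) \<Rightarrow> 'x \<Rightarrow> complex"
  and F :: "'p filter" and W :: "('x \<Rightarrow> complex) \<Rightarrow> real" and c C \<kappa> K\<^sub>W K\<^sub>T :: real
 assumes T: "linop T" and IT: "\<And>f. f \<in> V ==> I (T f) = I f"
  and W_add: "\<And>f g. [|f \<in> V; g \<in> V|] ==> W (f + g) \<le> W f + W g"
  and W_le: "\<And>f. f \<in> V ==> W f \<le> K\<^sub>W * N f"
  and W_T: "\<And>f. f \<in> V ==> W (T f) \<le> K\<^sub>T * W f" and K\<^sub>T: "0 \<le> K\<^sub>T" and K\<^sub>W: "0 \<le> K\<^sub>W"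
  and const: "0 < c" "0 < C" "0 < \<kappa>" "\<kappa> < 1"
  and Q: "\<forall>\<^sub>F p in F. linop (Q p)"
  and LY: "\<forall>\<^sub>F p in F. \<forall>f\<in>V. \<forall>n. N ((Q p ^^ n) f) \<le> c * \<kappa> ^ n * N f + C ^ n * W f"
  and close: "\<And>e. e > 0 ==> \<forall>\<^sub>F p in F. \<forall>f\<in>V. W (Q p f - T f) \<le> e * N f"
begin

lemma W_eqv: "f \<doteq> g ==> W f = W g"
proof -
 have *: "W f \<le> W g" if "f \<doteq> g" for f g using W_add[of g "f - g"] W_le[of "f - g"] that by (auto simp: eqv_def)
 show "f \<doteq> g ==> W f = W g" using * eqv_sym antisym by blast
qed

lemma Q_pow_bound: "\<forall>\<^sub>F p in F. \<forall>f\<in>V. \<forall>n. N ((Q p ^^ n) f) \<le> (c + C ^ n * K\<^sub>W) * N f" using LY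
proof eventually_elim
 case (elim p)
 have "N ((Q p ^^ n) f) \<le> (c + C ^ n * K\<^sub>W) * N f" if f: "f \<in> V" for f n
 proof -
  have "c * \<kappa> ^ n * N f \<le> c * N f" using const f by (intro mult_right_mono) (auto intro!: power_le_one)
  moreover have "C ^ n * W f \<le> C ^ n * (K\<^sub>W * N f)" using const W_le[OF f] by (intro mult_left_mono) auto
  moreover have "N ((Q p ^^ n) f) \<le> c * \<kappa> ^ n * N f + C ^ n * W f" using elim f by blast
  moreover have "(c + C ^ n * K\<^sub>W) * N f = c * N f + C ^ n * (K\<^sub>W * N f)" by (simp add: algebra_simps)
  ultimately show ?thesis by linarith
 qed
 then show ?case by blast
qed

text \<open>The splitting \<open>Q^(n+1) - T^(n+1) = (Q - T) Q^n + T (Q^n - T^n)\<close> needs the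
  strong bound on \<open>Q^n\<close> in the first term and the weak boundedness of \<open>T\<close>
  in the second.\<close>

lemma close_pow:
 assumes "\<epsilon> > 0"
 shows "\<forall>\<^sub>F p in F. \<forall>f\<in>V. W ((Q p ^^ n) f - (T ^^ n) f) \<le> \<epsilon> * N f" using assms
proof (induction n arbitrary: \<epsilon>)
 case 0
 have "W 0 \<le> 0" using W_le[of 0] by simp
 then have "W ((Q p ^^ 0) f - (T ^^ 0) f) \<le> \<epsilon> * N f" if "f \<in> V" for p f
  using 0 that order_trans[of "W 0" 0 "\<epsilon> * N f"] by (simp add: zero_fun_def)
 then show ?case by (intro always_eventually) blast
next
 case (Suc n)
 define B where "B = c + C ^ n * K\<^sub>W"
 have B: "B > 0" using const K\<^sub>W by (simp add: B_def add_pos_nonneg)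
 have e: "\<epsilon> / (2 * B) > 0" "\<epsilon> / (2 * (K\<^sub>T + 1)) > 0" using Suc.prems B K\<^sub>T by auto
 show ?case using Q close[OF e(1)] Suc.IH[OF e(2)] Q_pow_bound
 proof eventually_elim
  case (elim p)
  note [simp] = linop_mem[OF elim(1)] linop_pow_mem[OF elim(1)] linop_mem[OF T] linop_pow_mem[OF T]
  have "W ((Q p ^^ Suc n) f - (T ^^ Suc n) f) \<le> \<epsilon> * N f" if f: "f \<in> V" for f
  proof -
   define x y where "x = (Q p ^^ n) f" and "y = (T ^^ n) f"
   have mem: "x \<in> V" "y \<in> V" using f by (auto simp: x_def y_def)
   have "(Q p ^^ Suc n) f - (T ^^ Suc n) f = (Q p x - T x) + (T x - T y)" by (simp add: x_def y_def)
   then have "W ((Q p ^^ Suc n) f - (T ^^ Suc n) f) \<le> W (Q p x - T x) + W (T x - T y)"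
    using W_add[of "Q p x - T x" "T x - T y"] mem by simp
   moreover have "W (T x - T y) \<le> K\<^sub>T * W (x - y)" using W_eqv[OF linop_diff[OF T mem]] W_T[of "x - y"] mem by simp
   moreover have "K\<^sub>T * W (x - y) \<le> K\<^sub>T * (\<epsilon> / (2 * (K\<^sub>T + 1)) * N f)"
    using bspec[OF elim(3) f] K\<^sub>T unfolding x_def y_def by (rule mult_left_mono)
   moreover have "K\<^sub>T * (\<epsilon> / (2 * (K\<^sub>T + 1)) * N f) \<le> \<epsilon> / 2 * N f"
   proof -
    have "K\<^sub>T * (\<epsilon> / (2 * (K\<^sub>T + 1))) \<le> \<epsilon> / 2" using K\<^sub>T Suc.prems by (simp add: field_simps)
    then show ?thesis using mult_right_mono[of _ "\<epsilon> / 2" "N f"] f by (fastforce simp: mult.assoc)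
   qed
   moreover have "W (Q p x - T x) \<le> \<epsilon> / (2 * B) * N x" using bspec[OF elim(2) mem(1)] .
   moreover have "\<epsilon> / (2 * B) * N x \<le> \<epsilon> / (2 * B) * (B * N f)"
    using bspec[OF elim(4) f] e(1) unfolding x_def B_def by (intro mult_left_mono) auto
   moreover have "\<epsilon> / (2 * B) * (B * N f) = \<epsilon> / 2 * N f" using B by simp
   ultimately show ?thesis by linarith
  qed
  then show ?case by blast
 qed
qed

text \<open>The mechanism of Keller and Liverani. In the Lasota-Yorke inequality over
  \<open>k\<close> steps the strong part contracts by 1/4, while the weak part is compared with the
  orbit under \<open>T\<close>, where mean-zero vectors decay. The comparison is used from block
  \<open>i0\<close> on, when that orbit is already negligible; \<open>s\<close> further blocks then
  absorb the possibly large bound \<open>B0\<close> reached at block \<open>i0\<close>.\<close>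

lemma perturbed_contraction:
 assumes n: "n > 0" "\<And>f. [|f \<in> V; I f = 0|] ==> N ((T ^^ n) f) \<le> N f / 2"
 obtains l B where "l > 0" "1 \<le> B" "\<forall>\<^sub>F p in F. linop (Q p) \<and>
  (\<forall>r\<le>l. \<forall>f\<in>V. N ((Q p ^^ r) f) \<le> B * N f) \<and> (\<forall>f\<in>V. I f = 0 \<longrightarrow> N ((Q p ^^ l) f) \<le> N f / 2)"
proof -
 have "(\<lambda>j. c * \<kappa> ^ (n * j)) \<longlonglongrightarrow> 0"
  using const n(1) by (intro tendsto_mult_right_zero) (simp add: power_mult LIMSEQ_realpow_zero power_less_one_iff)
 then have "\<forall>\<^sub>F j in sequentially. c * \<kappa> ^ (n * j) < 1/4" by (intro order_tendstoD) auto
 then have "\<forall>\<^sub>F j in sequentially. c * \<kappa> ^ (n * j) < 1/4 \<and> j > 0" using eventually_gt_at_top[of 0] by eventually_elim auto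
 then obtain j where j: "c * \<kappa> ^ (n * j) < 1/4" "j > 0" by (auto simp: eventually_sequentially)
 define k where "k = n * j"
 have k: "k > 0" "c * \<kappa> ^ k \<le> 1/4" using j n(1) by (auto simp: k_def)
 have Tk: "N ((T ^^ (k * i)) f) \<le> (1/2) ^ (j * i) * N f" if "f \<in> V" "I f = 0" for f i
  unfolding k_def mult.assoc by (rule eventual_contraction_power[OF T IT n(2) that])
 define D where "D = C ^ k * K\<^sub>W"
 have D: "D \<ge> 0" using const K\<^sub>W by (simp add: D_def)
 have "(\<lambda>i. D * (1/2) ^ i) \<longlonglongrightarrow> 0" by (intro tendsto_mult_right_zero LIMSEQ_realpow_zero) auto
 then have "\<forall>\<^sub>F i in sequentially. D * (1/2) ^ i < 1/16" by (intro order_tendstoD) auto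
 then obtain i0 where i0: "\<And>i. i \<ge> i0 ==> D * (1/2) ^ i < 1/16" by (auto simp: eventually_sequentially)
 define B0 where "B0 = c + C ^ (k * i0) * K\<^sub>W"
 have "(\<lambda>i. (1/4) ^ i * B0) \<longlonglongrightarrow> 0" by (intro tendsto_mult_left_zero LIMSEQ_realpow_zero) auto
 then have "\<forall>\<^sub>F i in sequentially. (1/4) ^ i * B0 < 1/4" by (intro order_tendstoD) auto
 then obtain s where s: "(1/4) ^ s * B0 < 1/4" by (auto simp: eventually_sequentially)
 define l where "l = k * Suc (i0 + s)"
 define B where "B = Max (insert 1 ((\<lambda>r. c + C ^ r * K\<^sub>W) ` {..l}))"
 have B: "1 \<le> B" "\<And>r. r \<le> l ==> c + C ^ r * K\<^sub>W \<le> B" unfolding B_def by (rule Max_ge; auto)+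
 \<comment> \<open>Weak closeness is needed at finitely many times only, so a single eventuality in
   \<open>p\<close> covers all blocks up to \<open>i0 + s\<close>.\<close>
 have ev: "\<forall>\<^sub>F p in F. \<forall>i\<in>{..i0 + s}. \<forall>f\<in>V. W ((Q p ^^ (k * i)) f - (T ^^ (k * i)) f) \<le> 1 / (16 * C ^ k) * N f"
  using const by (intro eventually_ball_finite ballI close_pow) auto
 have "\<forall>\<^sub>F p in F. linop (Q p) \<and>
  (\<forall>r\<le>l. \<forall>f\<in>V. N ((Q p ^^ r) f) \<le> B * N f) \<and> (\<forall>f\<in>V. I f = 0 \<longrightarrow> N ((Q p ^^ l) f) \<le> N f / 2)" using ev Q LY Q_pow_bound
 proof eventually_elim
  case (elim p)
  note [simp] = linop_mem[OF elim(2)] linop_pow_mem[OF elim(2)] linop_mem[OF T] linop_pow_mem[OF T]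
  have 1: "N ((Q p ^^ r) f) \<le> B * N f" if "r \<le> l" "f \<in> V" for r f
  proof -
   have "N ((Q p ^^ r) f) \<le> (c + C ^ r * K\<^sub>W) * N f" using elim(4) that(2) by blast
   also have "... \<le> B * N f" using that by (intro mult_right_mono B) auto
   finally show ?thesis .
  qed
  have 2: "N ((Q p ^^ l) f) \<le> N f / 2" if f: "f \<in> V" "I f = 0" for f
  proof -
   have step: "N ((Q p ^^ (k * Suc i)) f) \<le> 1/4 * N ((Q p ^^ (k * i)) f) + 1/8 * N f"
    if i: "i0 \<le> i" "i \<le> i0 + s" for i
   proof -
    define x y where "x = (Q p ^^ (k * i)) f" and "y = (T ^^ (k * i)) f"
    have mem: "x \<in> V" "y \<in> V" using f by (auto simp: x_def y_def)
    have "(Q p ^^ (k * Suc i)) f = (Q p ^^ k) x" by (simp add: x_def funpow_add)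
    then have a: "N ((Q p ^^ (k * Suc i)) f) \<le> c * \<kappa> ^ k * N x + C ^ k * W x" using bspec[OF elim(3) mem(1)] by simp
    have b: "c * \<kappa> ^ k * N x \<le> 1/4 * N x" using k(2) mem by (intro mult_right_mono) auto
    have "W x \<le> W (x - y) + W y" using W_add[of "x - y" y] mem by simp
    also have "W (x - y) \<le> 1 / (16 * C ^ k) * N f" using bspec[OF bspec[OF elim(1), of i] f(1)] i(2) unfolding x_def y_def by simp
    also have "W y \<le> K\<^sub>W * ((1/2) ^ i * N f)"
    proof -
     have "N y \<le> (1/2) ^ (j * i) * N f" using Tk f by (simp add: y_def)
     also have "... \<le> (1/2) ^ i * N f" using f j(2) by (intro mult_right_mono power_decreasing) auto
     finally show ?thesis using order_trans[OF W_le[OF mem(2)] mult_left_mono[OF _ K\<^sub>W]] by blast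
    qed
    finally have "C ^ k * W x \<le> C ^ k * (1 / (16 * C ^ k) * N f + K\<^sub>W * ((1/2) ^ i * N f))" using const by (intro mult_left_mono) auto
    also have "... = 1/16 * N f + (D * (1/2) ^ i) * N f" using const by (simp add: D_def algebra_simps)
    also have "... \<le> 1/16 * N f + 1/16 * N f" using i0[OF i(1)] f by (intro add_left_mono mult_right_mono) auto
    finally show ?thesis using a b by (simp add: x_def)
   qed
   \<comment> \<open>The value 1/6 is the fixed point of \<open>a \<mapsto> a / 4 + 1 / 8\<close>;
     the initial excess \<open>B0\<close> shrinks by 1/4 per block.\<close>
   have "N ((Q p ^^ (k * (i0 + i))) f) \<le> ((1/4) ^ i * B0 + 1/6) * N f" if "i \<le> Suc s" for i using that
   proof (induction i)
    case 0
    have "N ((Q p ^^ (k * i0)) f) \<le> B0 * N f" using bspec[OF elim(4) f(1)] by (simp add: B0_def)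
    moreover have "B0 * N f \<le> (B0 + 1/6) * N f" using f by (intro mult_right_mono) auto
    ultimately show ?case by simp
   next
    case (Suc i)
    have "N ((Q p ^^ (k * (i0 + Suc i))) f) \<le> 1/4 * N ((Q p ^^ (k * (i0 + i))) f) + 1/8 * N f" using step[of "i0 + i"] Suc.prems by simp
    also have "... \<le> 1/4 * (((1/4) ^ i * B0 + 1/6) * N f) + 1/8 * N f" using Suc by simp
    also have "... = ((1/4) ^ Suc i * B0 + 1/6) * N f" by (simp add: algebra_simps)
    finally show ?case .
   qed
   from this[of "Suc s"] have "N ((Q p ^^ l) f) \<le> ((1/4) ^ Suc s * B0 + 1/6) * N f" by (simp add: l_def)
   also have "... \<le> 1/2 * N f"
   proof (rule mult_right_mono)
    have "(1/4) ^ Suc s * B0 = 1/4 * ((1/4) ^ s * B0)" by simp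
    then show "(1/4) ^ Suc s * B0 + 1/6 \<le> 1/2" using s by linarith
   qed (use f in simp)
   finally show ?thesis by simp
  qed
  show ?case using 1 2 elim(2) by blast
 qed
 moreover have "l > 0" using k by (simp add: l_def)
 ultimately show ?thesis using that B(1) by blast
qed

end

end

section \<open>Transfer operators\<close>

lemma LinfI: "[|f \<in> borel_measurable m; \<And>x. norm (f x) \<le> K|] ==> f \<in> Linf m" by (auto simp: Linf_def)

lemma nonsingular_measurable: "nonsingular m g ==> g \<in> measurable m m" by (simp add: nonsingular_def)

lemma nonsingular_AE:
 assumes g: "nonsingular m g" and P: "AE x in m. P x"
 shows "AE x in m. P (g x)"
proof -
 obtain U where U: "U \<in> sets m" "emeasure m U = 0" "{x\<in>space m. \<not> P x} \<subseteq> U" using AE_E[OF P] by metis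
 have "g -` U \<inter> space m \<in> null_sets m" using g U by (auto simp: nonsingular_def intro!: null_setsI)
 then show ?thesis by (rule AE_I') (use U g[THEN nonsingular_measurable, THEN measurable_space] in auto)
qed

lemma nonsingular_funpow: "nonsingular m g ==> nonsingular m (g ^^ n)"
proof (induction n)
 case (Suc n)
 have *: "(g ^^ Suc n) -` U \<inter> space m = (g ^^ n) -` (g -` U \<inter> space m) \<inter> space m" for U
  using Suc nonsingular_measurable[THEN measurable_space] by auto
 show ?case using Suc unfolding nonsingular_def * by (auto intro!: measurable_comp[of _ m] simp: comp_def)
qed (auto simp: nonsingular_def)

lemma Linf_comp: "[|nonsingular m g; \<psi> \<in> Linf m|] ==> (\<lambda>x. \<psi> (g x)) \<in> Linf m"
 using nonsingular_AE[of m g "\<lambda>x. norm (\<psi> x) \<le> _"] measurable_compose[OF nonsingular_measurable[of m g]] unfolding Linf_def by blast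

lemma Linf_mult: "[|\<psi> \<in> Linf m; \<omega> \<in> Linf m|] ==> (\<lambda>x. \<psi> x * \<omega> x) \<in> Linf m"
proof -
 assume *: "\<psi> \<in> Linf m" "\<omega> \<in> Linf m"
 then obtain K L where KL: "AE x in m. norm (\<psi> x) \<le> K" "AE x in m. norm (\<omega> x) \<le> L" by (auto simp: Linf_def)
 have "AE x in m. norm (\<psi> x * \<omega> x) \<le> K * L" using KL
  by eventually_elim (auto simp: norm_mult intro!: mult_mono intro: order_trans[OF norm_ge_zero])
 then show ?thesis using * by (auto simp: Linf_def)
qed

lemma integrable_Linf_mult:
 assumes f: "integrable m f" and \<psi>: "\<psi> \<in> Linf m"
 shows "integrable m (\<lambda>x. f x * \<psi> x)"
proof -
 obtain K where K: "AE x in m. norm (\<psi> x) \<le> K" using \<psi> by (auto simp: Linf_def)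
 have [measurable]: "f \<in> borel_measurable m" "\<psi> \<in> borel_measurable m" using f \<psi> by (auto simp: Linf_def)
 show ?thesis
 proof (rule dominated)
  show "integrable m (\<lambda>x. of_real K * f x)" using f by simp
  show "AE x in m. norm (f x * \<psi> x) \<le> norm (of_real K * f x)"
   using K by eventually_elim (auto simp: norm_mult mult.commute[of "norm (f _)"] intro!: mult_right_mono)
 qed measurable
qed

lemma cnj_sgn_Linf: "f \<in> borel_measurable m ==> (\<lambda>x. cnj (sgn (f x :: complex))) \<in> Linf m"
proof (rule LinfI[of _ _ 1])
 assume [measurable]: "f \<in> borel_measurable m"
 have "(\<lambda>x. cnj (sgn (f x))) = (\<lambda>x. Complex (Re (f x) / cmod (f x)) (- Im (f x) / cmod (f x)))"
  by (auto simp: fun_eq_iff complex_eq_iff sgn_div_norm inverse_eq_divide)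
 then show "(\<lambda>x. cnj (sgn (f x))) \<in> borel_measurable m" by (simp add: borel_measurable_complex_iff)
qed (simp add: norm_sgn)

lemma mult_cnj_sgn: "z * cnj (sgn z) = of_real (norm z)" for z :: complex
 by (auto simp: sgn_div_norm scaleR_conv_of_real complex_norm_square[symmetric] power2_eq_square field_simps)

text \<open>Testing against the conjugate sign of the difference turns the pairing into its L^1
  norm. This is how identities between arbitrarily chosen representatives of transfer operators are
  obtained.\<close>

lemma Linf_dual_unique:
 assumes f: "integrable m f" "integrable m f'"
  and eq: "\<And>\<psi>. \<psi> \<in> Linf m ==> (LINT x|m. f x * \<psi> x) = (LINT x|m. f' x * \<psi> x)"
 shows "AE x in m. f x = f' x"
proof -
 have [measurable]: "f \<in> borel_measurable m" "f' \<in> borel_measurable m" using f by auto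
 define \<psi> where "\<psi> x = cnj (sgn (f x - f' x))" for x
 have \<psi>: "\<psi> \<in> Linf m" unfolding \<psi>_def by (rule cnj_sgn_Linf) simp
 have "0 = (LINT x|m. f x * \<psi> x) - (LINT x|m. f' x * \<psi> x)" using eq[OF \<psi>] by simp
 also have "... = (LINT x|m. f x * \<psi> x - f' x * \<psi> x)" using f \<psi> by (intro Bochner_Integration.integral_diff[symmetric] integrable_Linf_mult)
 also have "... = (LINT x|m. complex_of_real (norm (f x - f' x)))"
  by (intro Bochner_Integration.integral_cong refl) (simp add: \<psi>_def mult_cnj_sgn[symmetric] algebra_simps)
 also have "... = of_real (LINT x|m. norm (f x - f' x))" by simp
 finally have "(LINT x|m. norm (f x - f' x)) = 0" by simp
 then have "AE x in m. norm (f x - f' x) = 0" using f by (subst (asm) integral_nonneg_eq_0_iff_AE) auto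
 then show ?thesis by eventually_elim simp
qed

text \<open>The iterate of the transfer operator is a complex function determined up to null sets.
  This representative is real and nonnegative at every point, hence usable as a density.\<close>

definition push_density :: "'x measure \<Rightarrow> ('x \<Rightarrow> 'x) \<Rightarrow> nat \<Rightarrow> ('x \<Rightarrow> real) \<Rightarrow> 'x \<Rightarrow> real" where
 "push_density m g n \<phi> x = max 0 (Re ((transfer_op m g ^^ n) (cr \<phi>) x))"

context prob_space
begin

text \<open>Non-singularity makes the push-forward absolutely continuous with respect to
  \<open>M\<close>; its Radon-Nikodym derivative is the image of \<open>\<phi>\<close> under the
  transfer operator.\<close>

lemma transfer_nonneg:
 assumes g: "nonsingular M g" and \<phi>: "integrable M \<phi>" "\<And>x. 0 \<le> (\<phi> x :: real)"
 obtains D where "D \<in> borel_measurable M" "\<And>x. 0 \<le> D x" "integrable M D"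
  "distr (density M \<phi>) M g = density M D"
proof -
 have [measurable]: "g \<in> measurable M M" "\<phi> \<in> borel_measurable M" using nonsingular_measurable[OF g] \<phi> by auto
 define \<nu> where "\<nu> = distr (density M \<phi>) M g"
 have fin: "finite_measure \<nu>"
 proof
  have "emeasure \<nu> (space \<nu>) = (\<integral>\<^sup>+x. \<phi> x \<partial>M)"
   by (auto simp: \<nu>_def emeasure_distr emeasure_density intro!: nn_integral_cong simp: measurable_space[of g M M])
  also have "... < \<infinity>" using \<phi> by (subst nn_integral_eq_integral) auto
  finally show "emeasure \<nu> (space \<nu>) \<noteq> \<infinity>" by simp
 qed
 have "absolutely_continuous M \<nu>" unfolding absolutely_continuous_def
 proof
  fix U assume U: "U \<in> null_sets M"
  then have "g -` U \<inter> space M \<in> null_sets M" using g by (auto simp: nonsingular_def intro!: null_setsI)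
  then have "AE x in M. x \<notin> g -` U \<inter> space M" by (rule AE_not_in)
  then have "(\<integral>\<^sup>+x. ennreal (\<phi> x) * indicator (g -` U \<inter> space M) x \<partial>M) = 0"
   using U by (subst nn_integral_0_iff_AE) (auto split: split_indicator)
  then show "U \<in> null_sets \<nu>" using U by (auto simp: \<nu>_def null_sets_def emeasure_distr emeasure_density)
 qed
 then obtain D where D: "D \<in> borel_measurable M" "AE x in M. RN_deriv M \<nu> x = ennreal (D x)" "\<And>x. 0 \<le> D x"
  using real_RN_deriv[of \<nu>] fin by (metis \<nu>_def sets_distr)
 have \<nu>D: "\<nu> = density M D" using density_RN_deriv[of \<nu>] \<open>absolutely_continuous M \<nu>\<close> density_cong[of "RN_deriv M \<nu>" M D] D
  by (simp add: \<nu>_def)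
 have "(\<integral>\<^sup>+x. ennreal (D x) \<partial>M) = emeasure \<nu> (space \<nu>)" unfolding \<nu>D using D by (auto simp: emeasure_density intro!: nn_integral_cong)
 also have "... < \<infinity>" using finite_measure.emeasure_finite[OF fin] by (simp add: top.not_eq_extremum)
 finally have "integrable M D" using D by (intro integrableI_nonneg) auto
 then show ?thesis using that[OF D(1,3)] \<nu>D unfolding \<nu>_def by blast
qed

lemma transfer_nonneg_integral:
 assumes D: "D \<in> borel_measurable M" "\<And>x. 0 \<le> D x" "distr (density M \<phi>) M g = density M D"
  and \<phi>: "\<phi> \<in> borel_measurable M" "\<And>x. 0 \<le> \<phi> x" and g: "g \<in> measurable M M" and F: "F \<in> borel_measurable M"
 shows "(LINT x|M. of_real (D x) * F x) = (LINT x|M. of_real (\<phi> x) * (F (g x) :: complex))"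
proof -
 have "(LINT x|M. of_real (D x) * F x) = (LINT x|density M D. F x)" using D F by (subst integral_density) (auto simp: scaleR_conv_of_real)
 also have "... = (LINT x|density M \<phi>. F (g x))" unfolding D(3)[symmetric] using g F by (intro integral_distr) auto
 also have "... = (LINT x|M. of_real (\<phi> x) * F (g x))" using \<phi> F g by (subst integral_density) (auto simp: scaleR_conv_of_real)
 finally show ?thesis .
qed

text \<open>Gives the choice in \<open>transfer_op\<close> its meaning for every integrable
  function: the positive and negative parts of the real and imaginary parts are treated by
  Radon-Nikodym and recombined.\<close>

lemma transfer_exists:
 assumes g: "nonsingular M g" and \<phi>: "integrable M (\<phi> :: _ \<Rightarrow> complex)"
 shows "\<exists>f. integrable M f \<and> (\<forall>\<psi>\<in>Linf M. (LINT x|M. f x * \<psi> x) = (LINT x|M. \<phi> x * \<psi> (g x)))"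
proof -
 define P where "P \<phi> f \<longleftrightarrow> integrable M f \<and> (\<forall>\<psi>\<in>Linf M. (LINT x|M. f x * \<psi> x) = (LINT x|M. \<phi> x * \<psi> (g x)))"
  for \<phi> f :: "_ \<Rightarrow> complex"
 have nonneg: "\<exists>f. P (\<lambda>x. of_real (max 0 (k x))) f" if k: "integrable M k" for k :: "_ \<Rightarrow> real"
 proof -
  have k': "integrable M (\<lambda>x. max 0 (k x))" using k by simp
  obtain D where D: "D \<in> borel_measurable M" "\<And>x. 0 \<le> D x" "integrable M D"
   "distr (density M (\<lambda>x. max 0 (k x))) M g = density M D" using transfer_nonneg[OF g k'] by auto
  have "P (\<lambda>x. of_real (max 0 (k x))) (cr D)"
   unfolding P_def using D(3) transfer_nonneg_integral[OF D(1,2,4)] k' nonsingular_measurable[OF g] by (auto simp: Linf_def)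
  then show ?thesis by blast
 qed
 have comb: "\<exists>f. P (\<lambda>x. \<phi>1 x + c * \<phi>2 x) f"
  if i: "integrable M \<phi>1" "integrable M \<phi>2" and P: "\<exists>f. P \<phi>1 f" "\<exists>f. P \<phi>2 f" for \<phi>1 \<phi>2 c
 proof -
  obtain f1 f2 where f: "P \<phi>1 f1" "P \<phi>2 f2" using P by blast
  have "P (\<lambda>x. \<phi>1 x + c * \<phi>2 x) (\<lambda>x. f1 x + c * f2 x)" unfolding P_def
  proof (intro conjI ballI)
   show "integrable M (\<lambda>x. f1 x + c * f2 x)" using f by (auto simp: P_def)
   fix \<psi> assume \<psi>: "\<psi> \<in> Linf M"
   note \<psi>g = Linf_comp[OF g \<psi>]
   show "(LINT x|M. (f1 x + c * f2 x) * \<psi> x) = (LINT x|M. (\<phi>1 x + c * \<phi>2 x) * \<psi> (g x))"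
    using f i \<psi> integrable_Linf_mult[OF _ \<psi>] integrable_Linf_mult[OF _ \<psi>g] by (auto simp: P_def distrib_right mult.assoc)
  qed
  then show ?thesis by blast
 qed
 define a where "a x = complex_of_real (max 0 (Re (\<phi> x)))" for x
 define b where "b x = complex_of_real (max 0 (- Re (\<phi> x)))" for x
 define c where "c x = complex_of_real (max 0 (Im (\<phi> x)))" for x
 define d where "d x = complex_of_real (max 0 (- Im (\<phi> x)))" for x
 have int: "integrable M (\<lambda>x. Re (\<phi> x))" "integrable M (\<lambda>x. Im (\<phi> x))" using \<phi> by auto
 have i: "integrable M a" "integrable M b" "integrable M c" "integrable M d" unfolding a_def b_def c_def d_def using int by auto
 have P: "\<exists>f. P a f" "\<exists>f. P b f" "\<exists>f. P c f" "\<exists>f. P d f" unfolding a_def b_def c_def d_def using int by (auto intro!: nonneg)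
 have "\<exists>f. P (\<lambda>x. ((a x + (-1) * b x) + \<i> * c x) + (- \<i>) * d x) f" using i P by (intro comb) auto
 also have "(\<lambda>x. ((a x + (-1) * b x) + \<i> * c x) + (- \<i>) * d x) = \<phi>" by (auto simp: fun_eq_iff complex_eq_iff a_def b_def c_def d_def)
 finally show ?thesis by (simp add: P_def)
qed

context
 fixes g assumes g: "nonsingular M g"
begin

lemma transfer_integrable [simp]: "integrable M \<phi> ==> integrable M (transfer_op M g \<phi>)"
 and transfer_dual: "[|integrable M \<phi>; \<psi> \<in> Linf M|] ==>
  (LINT x|M. transfer_op M g \<phi> x * \<psi> x) = (LINT x|M. \<phi> x * \<psi> (g x))"
 using someI_ex[OF transfer_exists[OF g], of \<phi>] by (auto simp: transfer_op_def)

lemma transfer_unique: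
 "[|integrable M \<phi>; integrable M f; \<And>\<psi>. \<psi> \<in> Linf M ==> (LINT x|M. f x * \<psi> x) = (LINT x|M. \<phi> x * \<psi> (g x))|]
  ==> AE x in M. transfer_op M g \<phi> x = f x" by (rule Linf_dual_unique) (auto simp: transfer_dual)

lemma transfer_mean: "integrable M \<phi> ==> (LINT x|M. transfer_op M g \<phi> x) = (LINT x|M. \<phi> x)"
 using transfer_dual[of \<phi> "\<lambda>_. 1"] LinfI[of "\<lambda>_. 1" M 1] by simp

text \<open>Dual to the fact that composition with \<open>g\<close> does not increase the supremum
  of the test function; the test function here is the conjugate sign of the image.\<close>

lemma transfer_norm:
 assumes \<phi>: "integrable M \<phi>"
 shows "(LINT x|M. norm (transfer_op M g \<phi> x)) \<le> (LINT x|M. norm (\<phi> x))"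
proof -
 let ?f = "transfer_op M g \<phi>"
 have [measurable]: "?f \<in> borel_measurable M" "\<phi> \<in> borel_measurable M" "g \<in> measurable M M"
  using transfer_integrable[OF \<phi>] \<phi> nonsingular_measurable[OF g] by (auto simp del: transfer_integrable)
 define \<psi> where "\<psi> x = cnj (sgn (?f x))" for x
 have b: "norm (\<psi> x) \<le> 1" for x by (simp add: \<psi>_def norm_sgn)
 have \<psi>: "\<psi> \<in> Linf M" unfolding \<psi>_def by (rule cnj_sgn_Linf) simp
 have "complex_of_real (LINT x|M. norm (?f x)) = (LINT x|M. ?f x * \<psi> x)" by (simp add: \<psi>_def mult_cnj_sgn)
 also have "... = (LINT x|M. \<phi> x * \<psi> (g x))" by (rule transfer_dual[OF \<phi> \<psi>])
 finally have *: "complex_of_real (LINT x|M. norm (?f x)) = (LINT x|M. \<phi> x * \<psi> (g x))" .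
 have "0 \<le> (LINT x|M. norm (?f x))" by simp
 then have "(LINT x|M. norm (?f x)) = norm (complex_of_real (LINT x|M. norm (?f x)))" by simp
 also have "... = norm (LINT x|M. \<phi> x * \<psi> (g x))" unfolding * ..
 also have "... \<le> (LINT x|M. norm (\<phi> x * \<psi> (g x)))" by (rule integral_norm_bound)
 also have "... \<le> (LINT x|M. norm (\<phi> x))"
  using \<phi> Linf_comp[OF g \<psi>] b by (intro integral_mono integrable_norm integrable_Linf_mult) (auto simp: norm_mult mult_left_le)
 finally show ?thesis .
qed

lemma transfer_of_nonneg:
 assumes \<phi>: "integrable M \<phi>" "\<And>x. 0 \<le> (\<phi> x :: real)"
 shows "AE x in M. transfer_op M g (cr \<phi>) x = of_real (max 0 (Re (transfer_op M g (cr \<phi>) x)))"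
  and "distr (density M \<phi>) M g = density M (\<lambda>x. max 0 (Re (transfer_op M g (cr \<phi>) x)))"
proof -
 obtain D where D: "D \<in> borel_measurable M" "\<And>x. 0 \<le> D x" "integrable M D"
  "distr (density M \<phi>) M g = density M D" using transfer_nonneg[OF g \<phi>] by auto
 have eq: "AE x in M. transfer_op M g (cr \<phi>) x = of_real (D x)"
  using \<phi> D nonsingular_measurable[OF g] transfer_nonneg_integral[OF D(1,2,4)] by (intro transfer_unique) (auto simp: Linf_def)
 then show "AE x in M. transfer_op M g (cr \<phi>) x = of_real (max 0 (Re (transfer_op M g (cr \<phi>) x)))" by eventually_elim (auto simp: D(2))
 have [measurable]: "transfer_op M g (cr \<phi>) \<in> borel_measurable M"
  using transfer_integrable[of "\<lambda>x. of_real (\<phi> x)"] \<phi> by (auto simp del: transfer_integrable)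
 show "distr (density M \<phi>) M g = density M (\<lambda>x. max 0 (Re (transfer_op M g (cr \<phi>) x)))"
  unfolding D(4) using eq D(1) by (intro density_cong) (auto elim!: eventually_mono simp: D(2))
qed

context
 fixes h :: "_ \<Rightarrow> real" assumes h [measurable]: "h \<in> borel_measurable M"
begin

lemma twist_integrable: "integrable M \<phi> ==> integrable M (\<lambda>x. ei s (h x) * \<phi> x)"
 by (rule dominated[of M \<phi>]) (auto simp: norm_mult)

lemma twisted_integrable: "integrable M \<phi> ==> integrable M (twisted_op M g h s \<phi>)"
 unfolding twisted_op_def by (intro transfer_integrable twist_integrable)

lemma twisted_pow_integrable: "integrable M \<phi> ==> integrable M ((twisted_op M g h s ^^ n) \<phi>)"
 by (induction n) (auto intro: twisted_integrable)

lemma twisted_norm: "integrable M \<phi> ==> (LINT x|M. norm (twisted_op M g h s \<phi> x)) \<le> (LINT x|M. norm (\<phi> x))"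
 unfolding twisted_op_def using transfer_norm[OF twist_integrable] by (simp add: norm_mult)

lemma twisted_pow_norm: "integrable M \<phi> ==> (LINT x|M. norm ((twisted_op M g h s ^^ n) \<phi> x)) \<le> (LINT x|M. norm (\<phi> x))"
proof (induction n)
 case (Suc n)
 then show ?case using order_trans[OF twisted_norm[OF twisted_pow_integrable[OF Suc.prems]]] by simp
qed simp

lemma birkhoff_measurable [measurable]: "birkhoff_sum g h n \<in> borel_measurable M" unfolding birkhoff_sum_def
 using nonsingular_measurable[OF nonsingular_funpow[OF g]] by measurable

text \<open>The identity behind the spectral method: every application of the twisted operator
  contributes one summand to the exponent, so \<open>\<psi> = 1\<close> yields characteristic
  functions of Birkhoff sums under the density \<open>\<phi>\<close>.\<close>

lemma twisted_pow_dual: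
 assumes \<phi>: "integrable M \<phi>" and \<psi>: "\<psi> \<in> Linf M"
 shows "(LINT x|M. (twisted_op M g h s ^^ n) \<phi> x * \<psi> x) =
  (LINT x|M. \<phi> x * (ei s (birkhoff_sum g h n x) * \<psi> ((g ^^ n) x)))" using \<psi>
proof (induction n arbitrary: \<psi>)
 case 0 then show ?case by (simp add: birkhoff_sum_def)
next
 case (Suc n)
 let ?f = "(twisted_op M g h s ^^ n) \<phi>"
 have e: "(\<lambda>x. ei s (h x)) \<in> Linf M" by (rule LinfI[of _ _ 1]) auto
 have "(LINT x|M. (twisted_op M g h s ^^ Suc n) \<phi> x * \<psi> x)
   = (LINT x|M. (ei s (h x) * ?f x) * \<psi> (g x))" unfolding funpow.simps comp_def twisted_op_def[of M g h s "(twisted_op M g h s ^^ n) \<phi>"]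
  by (intro transfer_dual twist_integrable twisted_pow_integrable \<phi> Suc)
 also have "... = (LINT x|M. ?f x * (ei s (h x) * \<psi> (g x)))" by (simp add: algebra_simps)
 also have "... = (LINT x|M. \<phi> x * (ei s (birkhoff_sum g h n x) *
   (ei s (h ((g ^^ n) x)) * \<psi> (g ((g ^^ n) x)))))" by (rule Suc.IH) (intro Linf_mult e Linf_comp[OF g Suc.prems])
 also have "... = (LINT x|M. \<phi> x * (ei s (birkhoff_sum g h (Suc n) x) * \<psi> ((g ^^ Suc n) x)))"
  by (simp add: birkhoff_sum_def exp_add[symmetric] distrib_left mult.assoc[symmetric])
 finally show ?case .
qed

end

lemma twisted_zero: "twisted_op M g h 0 = transfer_op M g" by (simp add: twisted_op_def fun_eq_iff)

lemma transfer_pow_integrable: "integrable M \<phi> ==> integrable M ((transfer_op M g ^^ n) \<phi>)" by (induction n) auto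

lemma transfer_pow_dual:
 "[|integrable M \<phi>; \<psi> \<in> Linf M|] ==> (LINT x|M. (transfer_op M g ^^ n) \<phi> x * \<psi> x) = (LINT x|M. \<phi> x * \<psi> ((g ^^ n) x))"
 using twisted_pow_dual[of "\<lambda>_. 0" \<phi> \<psi> n 0] by (simp add: twisted_zero)

lemma transfer_cong_AE:
 assumes "integrable M \<phi>" "integrable M \<phi>'" "AE x in M. \<phi> x = \<phi>' x"
 shows "AE x in M. transfer_op M g \<phi> x = transfer_op M g \<phi>' x"
proof (rule transfer_unique)
 fix \<psi> assume \<psi>: "\<psi> \<in> Linf M"
 have "(LINT x|M. transfer_op M g \<phi>' x * \<psi> x) = (LINT x|M. \<phi>' x * \<psi> (g x))" by (rule transfer_dual[OF assms(2) \<psi>])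
 also have "... = (LINT x|M. \<phi> x * \<psi> (g x))" using assms Linf_comp[OF g \<psi>] by (intro integral_cong_AE) (auto simp: Linf_def)
 finally show "(LINT x|M. transfer_op M g \<phi>' x * \<psi> x) = (LINT x|M. \<phi> x * \<psi> (g x))" .
qed (use assms in auto)

lemma push_density:
 assumes \<phi>: "integrable M \<phi>" "\<And>x. 0 \<le> (\<phi> x :: real)"
 shows "integrable M (push_density M g n \<phi>)" "0 \<le> push_density M g n \<phi> x"
  "AE x in M. (transfer_op M g ^^ n) (cr \<phi>) x = of_real (push_density M g n \<phi> x)"
  "distr (density M \<phi>) M (g ^^ n) = density M (push_density M g n \<phi>)"
proof -
 let ?c = "\<lambda>n. (transfer_op M g ^^ n) (cr \<phi>)"
 have c: "integrable M (?c n)" for n using \<phi> by (intro transfer_pow_integrable) auto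
 show int: "integrable M (push_density M g n \<phi>)" for n unfolding push_density_def using c[of n] by auto
 show nonneg: "0 \<le> push_density M g n \<phi> x" for n x by (simp add: push_density_def)
 have [measurable]: "(g ^^ n) \<in> measurable M M" for n using nonsingular_measurable[OF nonsingular_funpow[OF g]] .
 show eq: "AE x in M. ?c n x = of_real (push_density M g n \<phi> x)" for n
 proof (induction n)
  case 0 show ?case using \<phi> by (simp add: push_density_def)
 next
  case (Suc n)
  have "AE x in M. ?c (Suc n) x = transfer_op M g (cr (push_density M g n \<phi>)) x" using transfer_cong_AE[OF c _ Suc] int by simp
  then show ?case using transfer_of_nonneg(1)[OF int[of n] nonneg[of n]] by eventually_elim (auto simp: push_density_def)
 qed
 show "distr (density M \<phi>) M (g ^^ n) = density M (push_density M g n \<phi>)"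
 proof (induction n)
  case 0
  have "distr (density M \<phi>) M (\<lambda>x. x) = density M \<phi>" by (intro distr_id2) simp
  then show ?case using \<phi> by (simp add: push_density_def id_def)
 next
  case (Suc n)
  have "distr (density M \<phi>) M (g ^^ Suc n) = distr (distr (density M \<phi>) M (g ^^ n)) M g"
   using nonsingular_measurable[OF g] by (subst distr_distr) (auto simp: comp_def)
  also have "... = density M (\<lambda>x. max 0 (Re (transfer_op M g (cr (push_density M g n \<phi>)) x)))"
   unfolding Suc by (rule transfer_of_nonneg(2)[OF int nonneg])
  also have "... = density M (push_density M g (Suc n) \<phi>)"
  proof (intro density_cong)
   have "AE x in M. ?c (Suc n) x = transfer_op M g (cr (push_density M g n \<phi>)) x" using transfer_cong_AE[OF c _ eq] int by simp
   then show "AE x in M. ennreal (max 0 (Re (transfer_op M g (cr (push_density M g n \<phi>)) x))) = ennreal (push_density M g (Suc n) \<phi> x)"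
    by eventually_elim (simp add: push_density_def)
  qed (use int c[of "Suc n"] borel_measurable_integrable[OF transfer_integrable[of "\<lambda>x. of_real (push_density M g n \<phi> x)"]] in \<open>auto intro!: borel_measurable_integrable\<close>)
  finally show ?case .
 qed
qed

end

end

section \<open>Banach spaces of classes, their operators, and square integrability\<close>

lemma banach_spaceD:
 assumes "banach_space m B"
 shows "f \<in> elems B ==> f \<in> borel_measurable m"
  and "f \<in> elems B ==> 0 \<le> nrm B f"
  and "f \<in> elems B ==> nrm B f = 0 \<longleftrightarrow> (AE x in m. f x = 0)"
  and "[|f \<in> elems B; g \<in> borel_measurable m; AE x in m. f x = g x|] ==> g \<in> elems B"
  and "[|f \<in> elems B; g \<in> borel_measurable m; AE x in m. f x = g x|] ==> nrm B g = nrm B f"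
proof -
 have "elems B \<subseteq> borel_measurable m"
  "\<forall>f\<in>elems B. \<forall>g\<in>borel_measurable m. (AE x in m. f x = g x) \<longrightarrow> g \<in> elems B \<and> nrm B g = nrm B f"
  "\<forall>f\<in>elems B. 0 \<le> nrm B f \<and> (nrm B f = 0 \<longleftrightarrow> (AE x in m. f x = 0))" using assms unfolding banach_space_def by - (elim conjE, assumption)+
 then show "f \<in> elems B ==> f \<in> borel_measurable m" "f \<in> elems B ==> 0 \<le> nrm B f"
  "f \<in> elems B ==> nrm B f = 0 \<longleftrightarrow> (AE x in m. f x = 0)"
  "[|f \<in> elems B; g \<in> borel_measurable m; AE x in m. f x = g x|] ==> g \<in> elems B"
  "[|f \<in> elems B; g \<in> borel_measurable m; AE x in m. f x = g x|] ==> nrm B g = nrm B f" by blast+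
qed

lemma integral_Cauchy_Schwarz:
 fixes f g :: "'x \<Rightarrow> real"
 assumes [measurable]: "f \<in> borel_measurable m" "g \<in> borel_measurable m"
  and int: "integrable m (\<lambda>x. (f x)^2)" "integrable m (\<lambda>x. (g x)^2)"
 shows "integrable m (\<lambda>x. f x * g x)"
  and "(LINT x|m. abs (f x * g x)) \<le> sqrt (LINT x|m. (f x)^2) * sqrt (LINT x|m. (g x)^2)"
proof -
 show i: "integrable m (\<lambda>x. f x * g x)"
 proof (rule dominated)
  show "integrable m (\<lambda>x. (f x)^2 + (g x)^2)" using int by simp
  have "abs (a * b) \<le> a^2 + b^2" for a b :: real
  proof -
   have "2 * (abs a * abs b) \<le> a^2 + b^2" using sum_squares_bound[of "abs a" "abs b"] by (simp add: mult.assoc)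
   moreover have "0 \<le> abs a * abs b" by simp
   ultimately have "abs a * abs b \<le> a^2 + b^2" by linarith
   then show ?thesis by (simp add: abs_mult)
  qed
  then show "AE x in m. norm (f x * g x) \<le> norm ((f x)^2 + (g x)^2)" by simp
 qed simp
 have "(\<integral>\<^sup>+x. ennreal (abs (f x)) * ennreal (abs (g x)) \<partial>m) = (\<integral>\<^sup>+x. ennreal (abs (f x * g x)) \<partial>m)"
  by (intro nn_integral_cong) (simp add: ennreal_mult[symmetric] abs_mult)
 also have "... = ennreal (LINT x|m. abs (f x * g x))" using i by (intro nn_integral_eq_integral) auto
 finally have "ennreal ((LINT x|m. abs (f x * g x))^2) = (\<integral>\<^sup>+x. ennreal (abs (f x)) * ennreal (abs (g x)) \<partial>m)^2" by (simp add: ennreal_power)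
 also have "... \<le> (\<integral>\<^sup>+x. (ennreal (abs (f x)))^2 \<partial>m) * (\<integral>\<^sup>+x. (ennreal (abs (g x)))^2 \<partial>m)" by (intro Cauchy_Schwarz_nn_integral) auto
 also have "... = ennreal ((LINT x|m. (f x)^2) * (LINT x|m. (g x)^2))"
  using int by (simp add: ennreal_power nn_integral_eq_integral ennreal_mult[symmetric])
 finally have "(LINT x|m. abs (f x * g x))^2 \<le> (LINT x|m. (f x)^2) * (LINT x|m. (g x)^2)" by (simp add: ennreal_le_iff)
 then have "(LINT x|m. abs (f x * g x)) \<le> sqrt ((LINT x|m. (f x)^2) * (LINT x|m. (g x)^2))" by (rule real_le_rsqrt)
 then show "(LINT x|m. abs (f x * g x)) \<le> sqrt (LINT x|m. (f x)^2) * sqrt (LINT x|m. (g x)^2)" by (simp add: real_sqrt_mult)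
qed

definition norm2 :: "'x measure \<Rightarrow> ('x \<Rightarrow> complex) \<Rightarrow> real" where
 "norm2 m f = sqrt (LINT x|m. (norm (f x))^2)"

lemma norm2_nonneg [simp]: "0 \<le> norm2 m f" by (simp add: norm2_def)

context prob_space
begin

lemma integrable_of_square:
 assumes [measurable]: "f \<in> borel_measurable M" and "sqi M f"
 shows "integrable M (f :: _ \<Rightarrow> complex)" "(LINT x|M. norm (f x)) \<le> norm2 M f"
proof -
 have *: "integrable M (\<lambda>x. norm (f x) * 1)" "(LINT x|M. abs (norm (f x) * 1)) \<le> norm2 M f"
  using integral_Cauchy_Schwarz[of "\<lambda>x. norm (f x)" M "\<lambda>_. 1"] assms(2) by (auto simp: norm2_def prob_space)
 show "integrable M f" using *(1) by (subst integrable_norm_iff[symmetric]) auto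
 show "(LINT x|M. norm (f x)) \<le> norm2 M f" using *(2) by simp
qed

text \<open>On a probability space the elementary inequality \<open>t^2 \<le> 1 + t powr p\<close>
  suffices once \<open>f\<close> has been divided by \<open>a\<close>, a bound for its L^p norm.
  Elements of norm zero cannot be scaled and are treated apart.\<close>

lemma embeds_Lp_norm2:
 assumes B: "banach_space M B" and emb: "embeds B (Lp M p)" and p: "2 \<le> p"
 obtains K where "0 < K" "\<And>f. f \<in> elems B ==> f \<in> borel_measurable M \<and> sqi M f \<and> norm2 M f \<le> K * nrm B f"
proof -
 obtain K where K: "elems B \<subseteq> elems (Lp M p)" "\<And>f. f \<in> elems B ==> nrm (Lp M p) f \<le> K * nrm B f" using emb by (auto simp: embeds_def)
 define K' where "K' = 2 * max K 1"
 have K': "K' > 0" by (simp add: K'_def)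
 have "f \<in> borel_measurable M \<and> sqi M f \<and> norm2 M f \<le> K' * nrm B f" if f: "f \<in> elems B" for f
 proof -
  have fm [measurable]: "f \<in> borel_measurable M" and fp: "integrable M (\<lambda>x. norm (f x) powr p)" using f K(1) by (auto simp: Lp_def)
  have sq: "t^2 \<le> 1 + t powr p" if "0 \<le> t" for t :: real
  proof (cases "t \<le> 1")
   case True
   then show ?thesis using that power_le_one[of t 2] powr_ge_zero[of t p] by linarith
  next
   case False
   then have "t powr 2 \<le> t powr p" using p by (intro powr_mono) auto
   then show ?thesis using False by (simp add: powr_numeral)
  qed
  have int: "sqi M f"
   by (rule dominated[of M "\<lambda>x. 1 + norm (f x) powr p"]) (use fp sq in \<open>auto simp: abs_of_nonneg\<close>)
  have "norm2 M f \<le> K' * nrm B f"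
  proof (cases "nrm B f = 0")
   case True
   then have "AE x in M. f x = 0" using banach_spaceD(3)[OF B f] by simp
   then have "(LINT x|M. (norm (f x))^2) = (LINT x|M. 0)" by (intro integral_cong_AE) auto
   then show ?thesis using True by (simp add: norm2_def)
  next
   case False
   have nn: "0 \<le> nrm B f" by (rule banach_spaceD(2)[OF B f])
   define a where "a = max K 1 * nrm B f"
   have a: "a > 0" using nn False by (simp add: a_def)
   let ?I = "\<integral>x. norm (f x) powr p \<partial>M"
   have "?I powr (1 / p) \<le> a" using K(2)[OF f] mult_right_mono[OF max.cobounded1[of K 1] nn] by (auto simp: Lp_def a_def)
   then have "(?I powr (1 / p)) powr p \<le> a powr p" using p by (intro powr_mono2) auto
   then have Ip: "?I \<le> a powr p" using p by (simp add: powr_powr)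
   have "(norm (f x))^2 \<le> a^2 * (1 + norm (f x) powr p / a powr p)" for x
   proof -
    have "(norm (f x) / a)^2 \<le> 1 + (norm (f x) / a) powr p" using a by (intro sq) auto
    then have "a^2 * (norm (f x) / a)^2 \<le> a^2 * (1 + (norm (f x) / a) powr p)" by (intro mult_left_mono) auto
    then show ?thesis using a by (simp add: power_divide powr_divide)
   qed
   then have "(LINT x|M. (norm (f x))^2) \<le> (LINT x|M. a^2 * (1 + norm (f x) powr p / a powr p))"
    using int fp by (intro integral_mono) auto
   also have "... = a^2 * (1 + ?I / a powr p)" using fp by (simp add: prob_space)
   also have "... \<le> a^2 * (1 + 1)" using Ip a by (intro mult_left_mono add_left_mono) (auto simp: divide_le_eq)
   also have "... \<le> (2 * a)^2" by (simp add: power_mult_distrib)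
   finally have "norm2 M f \<le> 2 * a" unfolding norm2_def using a by (intro real_le_lsqrt) auto
   then show ?thesis by (simp add: a_def K'_def)
  qed
  then show ?thesis using int fm by simp
 qed
 then show ?thesis using that K' by blast
qed

end

lemma embeds_refl: "embeds B B" unfolding embeds_def by (auto intro!: exI[of _ 1])

lemma embedsE:
 assumes "embeds B1 B2" "banach_space m B1"
 obtains K where "0 < K" "elems B1 \<subseteq> elems B2" "\<And>f. f \<in> elems B1 ==> nrm B2 f \<le> K * nrm B1 f"
proof -
 obtain K where K: "elems B1 \<subseteq> elems B2" "\<And>f. f \<in> elems B1 ==> nrm B2 f \<le> K * nrm B1 f" using assms(1) by (auto simp: embeds_def)
 have "nrm B2 f \<le> max K 1 * nrm B1 f" if "f \<in> elems B1" for f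
 proof -
  have "0 \<le> nrm B1 f" by (rule banach_spaceD(2)[OF assms(2) that])
  then show ?thesis using K(2)[OF that] mult_right_mono[of K "max K 1" "nrm B1 f"] by simp
 qed
 then show ?thesis using that[of "max K 1"] K(1) by simp
qed

lemma embeds_trans:
 assumes "embeds B1 B2" "embeds B2 B3" "banach_space m B1" "banach_space m B2"
 shows "embeds B1 B3"
proof -
 obtain K where K: "0 < K" "elems B1 \<subseteq> elems B2" "\<And>f. f \<in> elems B1 ==> nrm B2 f \<le> K * nrm B1 f" using embedsE assms by metis
 obtain L where L: "0 < L" "elems B2 \<subseteq> elems B3" "\<And>f. f \<in> elems B2 ==> nrm B3 f \<le> L * nrm B2 f" using embedsE assms by metis
 have "nrm B3 f \<le> (L * K) * nrm B1 f" if "f \<in> elems B1" for f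
  using order_trans[OF L(3)[of f] mult_left_mono[OF K(3)[OF that], of L]] K(2) that L(1) by (auto simp: mult.assoc)
 then show ?thesis unfolding embeds_def using K(2) L(2) by blast
qed

lemma banach_space_seminormed:
 assumes "banach_space m B"
 shows "complete_seminormed (elems B) (nrm B)"
proof unfold_locales
 fix F :: "nat \<Rightarrow> 'a \<Rightarrow> complex"
 assume "\<And>k. F k \<in> elems B" "\<And>e. e > 0 ==> \<exists>K. \<forall>k\<ge>K. \<forall>l\<ge>K. nrm B (F k - F l) < e"
 then show "\<exists>f\<in>elems B. (\<lambda>k. nrm B (F k - f)) \<longlonglongrightarrow> 0" using assms unfolding banach_space_def fun_diff_def by blast
qed (use assms in \<open>auto simp: banach_space_def scl_def plus_fun_def zero_fun_def\<close>)

lemma bounded_op_linop: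
 assumes B: "banach_space m B" and T: "bounded_op m B B T"
 shows "seminormed.linop (elems B) (nrm B) T"
proof -
 interpret complete_seminormed "elems B" "nrm B" by (rule banach_space_seminormed[OF B])
 have AE0: "nrm B (f - g) = 0" if "f \<in> elems B" "g \<in> elems B" "AE x in m. f x = g x" for f g
  using banach_spaceD(3)[OF B diff_mem[OF that(1,2)]] that(3) by simp
 show ?thesis using T AE0 unfolding linop_def bounded_op_def eqv_def scl_def plus_fun_def
  by (auto simp: add_mem[unfolded plus_fun_def] scl_mem[unfolded scl_def])
qed

lemma banach_eqv_iff:
 assumes B: "banach_space m B" and f: "f \<in> elems B" "g \<in> elems B"
 shows "seminormed.eqv (elems B) (nrm B) f g \<longleftrightarrow> (AE x in m. f x = g x)"
proof -
 interpret complete_seminormed "elems B" "nrm B" by (rule banach_space_seminormed[OF B])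
 have "nrm B (f - g) = 0 \<longleftrightarrow> (AE x in m. (f - g) x = 0)" by (rule banach_spaceD(3)[OF B diff_mem[OF f]])
 then show ?thesis using f by (simp add: eqv_def)
qed

lemma bounded_op_combine:
 assumes F: "bounded_op m B1 B2 F" and G: "bounded_op m B1 B2 G" and B: "banach_space m B1" "banach_space m B2"
 shows "bounded_op m B1 B2 (\<lambda>f x. a * F f x + b * G f x)"
proof -
 interpret B2: complete_seminormed "elems B2" "nrm B2" by (rule banach_space_seminormed[OF B(2)])
 have mem: "F f \<in> elems B2" "G f \<in> elems B2" if "f \<in> elems B1" for f using F G that by (auto simp: bounded_op_def)
 have eq: "(\<lambda>x. a * F f x + b * G f x) = a \<odot> F f + b \<odot> G f" for f by (simp add: fun_eq_iff)
 obtain K where K: "\<And>f. f \<in> elems B1 ==> nrm B2 (F f) \<le> K * nrm B1 f" using F unfolding bounded_op_def by blast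
 obtain K' where K': "\<And>f. f \<in> elems B1 ==> nrm B2 (G f) \<le> K' * nrm B1 f" using G unfolding bounded_op_def by blast
 have "nrm B2 (\<lambda>x. a * F f x + b * G f x) \<le> (cmod a * K + cmod b * K') * nrm B1 f" if f: "f \<in> elems B1" for f
 proof -
  have "nrm B2 (\<lambda>x. a * F f x + b * G f x) \<le> cmod a * nrm B2 (F f) + cmod b * nrm B2 (G f)"
   unfolding eq using B2.N_add[of "a \<odot> F f" "b \<odot> G f"] mem[OF f] by (simp add: B2.N_scl)
  also have "... \<le> cmod a * (K * nrm B1 f) + cmod b * (K' * nrm B1 f)" by (intro add_mono mult_left_mono K K' f) auto
  finally show ?thesis by (simp add: algebra_simps)
 qed
 moreover have "(\<lambda>x. a * F f x + b * G f x) \<in> elems B2" if "f \<in> elems B1" for f unfolding eq using mem[OF that] by simp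
 moreover have "AE x in m. a * F (\<lambda>y. f y + g y) x + b * G (\<lambda>y. f y + g y) x = a * F f x + b * G f x + (a * F g x + b * G g x)"
  if "f \<in> elems B1" "g \<in> elems B1" for f g
 proof -
  have "AE x in m. F (\<lambda>y. f y + g y) x = F f x + F g x" "AE x in m. G (\<lambda>y. f y + g y) x = G f x + G g x"
   using F G that by (auto simp: bounded_op_def)
  then show ?thesis by eventually_elim (simp add: algebra_simps)
 qed
 moreover have "AE x in m. a * F (\<lambda>y. c * f y) x + b * G (\<lambda>y. c * f y) x = c * (a * F f x + b * G f x)" if "f \<in> elems B1" for f c
 proof -
  have "AE x in m. F (\<lambda>y. c * f y) x = c * F f x" "AE x in m. G (\<lambda>y. c * f y) x = c * G f x" using F G that by (auto simp: bounded_op_def)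
  then show ?thesis by eventually_elim (simp add: algebra_simps)
 qed
 ultimately show ?thesis unfolding bounded_op_def by blast
qed

lemma opnorm_bound:
 assumes T: "bounded_op m B1 B2 T" and B: "banach_space m B1" "banach_space m B2" and f: "f \<in> elems B1"
 shows "nrm B2 (T f) \<le> opnorm B1 B2 T * nrm B1 f"
proof -
 interpret B1: complete_seminormed "elems B1" "nrm B1" by (rule banach_space_seminormed[OF B(1)])
 interpret B2: complete_seminormed "elems B2" "nrm B2" by (rule banach_space_seminormed[OF B(2)])
 have mem: "T g \<in> elems B2" if "g \<in> elems B1" for g using T that by (auto simp: bounded_op_def)
 obtain K where K: "\<And>f. f \<in> elems B1 ==> nrm B2 (T f) \<le> K * nrm B1 f" using T unfolding bounded_op_def by blast
 have bdd: "bdd_above {nrm B2 (T g) |g. g \<in> elems B1 \<and> nrm B1 g \<le> 1}"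
 proof (rule bdd_aboveI)
  fix y assume "y \<in> {nrm B2 (T g) |g. g \<in> elems B1 \<and> nrm B1 g \<le> 1}"
  then obtain g where g: "g \<in> elems B1" "nrm B1 g \<le> 1" "y = nrm B2 (T g)" by auto
  have "K * nrm B1 g \<le> abs K * 1" using g by (intro mult_mono) auto
  then show "y \<le> abs K" using K[OF g(1)] g(3) by simp
 qed
 show ?thesis
 proof (cases "nrm B1 f = 0")
  case True
  then show ?thesis using K[OF f] by simp
 next
  case False
  then have pos: "nrm B1 f > 0" using B1.N_nonneg[OF f] by linarith
  define c where "c = complex_of_real (nrm B1 f)"
  define g where "g = inverse c \<odot> f"
  have g: "g \<in> elems B1" "nrm B1 g \<le> 1" using f pos by (auto simp: g_def B1.N_scl c_def norm_inverse)
  have fg: "f = (\<lambda>y. c * g y)" using pos by (auto simp: g_def c_def fun_eq_iff)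
  have "AE x in m. T f x = (c \<odot> T g) x" using T g(1) unfolding fg scl_def by (auto simp: bounded_op_def)
  then have "nrm B2 (T f) = nrm B2 (c \<odot> T g)"
   using banach_spaceD(1)[OF B(2) B2.scl_mem[OF mem[OF g(1)], of c]] by (intro banach_spaceD(5)[OF B(2) mem[OF f], symmetric])
  also have "... = nrm B1 f * nrm B2 (T g)" using B2.N_scl[OF mem[OF g(1)], of c] pos by (simp add: c_def)
  also have "... \<le> nrm B1 f * opnorm B1 B2 T" unfolding opnorm_def using g pos by (intro mult_left_mono cSup_upper bdd) auto
  finally show ?thesis by (simp add: mult.commute)
 qed
qed

text \<open>The filter includes the point \<open>p\<close> itself, where the difference vanishes; so
  the estimate can be composed with any map tending to \<open>p\<close>, even one that attains
  it.\<close>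

lemma op_continuous_close:
 assumes cont: "op_continuous_on m B1 B2 S F" and p: "p \<in> S" and e: "e > 0"
  and B: "banach_space m B1" "banach_space m B2"
 shows "\<forall>\<^sub>F q in inf (nhds p) (principal S). \<forall>f\<in>elems B1. nrm B2 (F q f - F p f) \<le> e * nrm B1 f"
proof -
 interpret B1: complete_seminormed "elems B1" "nrm B1" by (rule banach_space_seminormed[OF B(1)])
 interpret B2: complete_seminormed "elems B2" "nrm B2" by (rule banach_space_seminormed[OF B(2)])
 have bop: "bounded_op m B1 B2 (F q)" if "q \<in> S" for q using cont that by (auto simp: op_continuous_on_def)
 let ?D = "\<lambda>q. opnorm B1 B2 (\<lambda>f x. F q f x - F p f x)"
 have "(?D \<longlongrightarrow> 0) (at p within S)" using cont p by (auto simp: op_continuous_on_def)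
 then have "\<forall>\<^sub>F q in at p within S. ?D q < e" using e by (intro order_tendstoD)
 then have "\<forall>\<^sub>F q in inf (nhds p) (principal S). q \<noteq> p \<longrightarrow> ?D q < e"
  unfolding eventually_at_filter eventually_inf_principal by (auto elim!: eventually_mono)
 moreover have "\<forall>\<^sub>F q in inf (nhds p) (principal S). q \<in> S" unfolding eventually_inf_principal by simp
 ultimately show ?thesis
 proof eventually_elim
  case (elim q)
  show ?case
  proof
   fix f assume f: "f \<in> elems B1"
   show "nrm B2 (F q f - F p f) \<le> e * nrm B1 f"
   proof (cases "q = p")
    case True
    then have "F q f - F p f = 0" by simp
    then show ?thesis using e f by simp
   next
    case False
    have b: "bounded_op m B1 B2 (\<lambda>f x. F q f x - F p f x)" using bounded_op_combine[OF bop[OF elim(2)] bop[OF p] B, of 1 "-1"] by simp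
    have "nrm B2 (F q f - F p f) \<le> ?D q * nrm B1 f" using opnorm_bound[OF b B f] by (simp add: fun_diff_def)
    also have "... \<le> e * nrm B1 f" using elim(1) False f by (intro mult_right_mono) auto
    finally show ?thesis .
   qed
  qed
 qed
qed

text \<open>Translates the spectral formulation into the hypotheses of
  \<open>mean_zero_decay\<close>. Outside the spectrum there is a two-sided inverse: as a right
  inverse it gives solvability, as a left inverse injectivity.\<close>

lemma spectral_gap_decay:
 assumes prob: "prob_space m" and Y: "banach_space m Y" and one: "(\<lambda>_. 1) \<in> elems Y"
  and L2: "\<And>f. f \<in> elems Y ==> f \<in> borel_measurable m \<and> sqi m f \<and> norm2 m f \<le> K * nrm Y f"
  and g: "nonsingular m g" and T: "bounded_op m Y Y (transfer_op m g)"
  and gap: "spectral_gap m Y (transfer_op m g) \<kappa>" and \<kappa>: "0 < \<kappa>" "\<kappa> < 1"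
 shows "functional_space (elems Y) (nrm Y) (\<lambda>f. \<integral>x. f x \<partial>m) (\<lambda>_. 1)"
  and "\<exists>n>0. \<forall>f\<in>elems Y. (LINT x|m. f x) = 0 \<longrightarrow> nrm Y ((transfer_op m g ^^ n) f) \<le> nrm Y f / 2"
proof -
 interpret prob_space m by (rule prob)
 interpret complete_seminormed "elems Y" "nrm Y" by (rule banach_space_seminormed[OF Y])
 have int: "integrable m f" if "f \<in> elems Y" for f using integrable_of_square L2[OF that] by blast
 show "functional_space (elems Y) (nrm Y) (\<lambda>f. \<integral>x. f x \<partial>m) (\<lambda>_. 1)"
 proof unfold_locales
  have "norm (LINT x|m. f x) \<le> K * nrm Y f" if "f \<in> elems Y" for f
   using integral_norm_bound[of m f] integrable_of_square(2)[of f] L2[OF that] by linarith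
  then show "\<exists>K. \<forall>f\<in>elems Y. norm (LINT x|m. f x) \<le> K * nrm Y f" by blast
 qed (use int one in \<open>auto simp: prob_space\<close>)
 then interpret functional_space "elems Y" "nrm Y" "\<lambda>f. \<integral>x. f x \<partial>m" "\<lambda>_. 1" .
 let ?T = "transfer_op m g"
 have Tl: "linop ?T" by (rule bounded_op_linop[OF Y T])
 have eqvI: "eqv f k" if "f \<in> elems Y" "k \<in> elems Y" "AE x in m. f x = k x" for f k using banach_eqv_iff[OF Y] that by blast
 have eqvD: "AE x in m. f x = k x" if "eqv f k" for f k using banach_eqv_iff[OF Y] that eqv_mem by blast
 have "op_simple_eigenvalue m Y ?T 1" using gap by (simp only: spectral_gap_def)
 from this[unfolded op_simple_eigenvalue_def] obtain v where v: "v \<in> elems Y"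
   and eig0: "\<forall>f\<in>elems Y. (AE x in m. ?T f x = 1 * f x) \<longleftrightarrow> (\<exists>c. AE x in m. f x = c * v x)"
   and dec0: "\<forall>f\<in>elems Y. \<exists>!c. \<exists>w\<in>elems Y. AE x in m. f x = c * v x + (1 * w x - ?T w x)" by (elim bexE conjE)
 note eig = bspec[OF eig0] and dec = ex1_implies_ex[OF bspec[OF dec0]]
 have res: "\<exists>R. bounded_op m Y Y R \<and>
  (\<forall>f\<in>elems Y. AE x in m. R (\<lambda>y. z * f y - ?T f y) x = f x) \<and>
  (\<forall>f\<in>elems Y. AE x in m. z * R f x - ?T (R f) x = f x)" if "\<kappa> \<le> cmod z" "z \<noteq> 1" for z
 proof -
  have "z \<notin> op_spectrum m Y ?T" using gap that unfolding spectral_gap_def by force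
  then show ?thesis unfolding op_spectrum_def by blast
 qed
 show "\<exists>n>0. \<forall>f\<in>elems Y. (LINT x|m. f x) = 0 \<longrightarrow> nrm Y ((?T ^^ n) f) \<le> nrm Y f / 2"
 proof (rule mean_zero_decay[OF Tl _ \<kappa> v])
  show "(LINT x|m. ?T f x) = (LINT x|m. f x)" if "f \<in> elems Y" for f using transfer_mean[OF g int[OF that]] .
  have "\<exists>c. AE x in m. v x = c * v x" by (rule exI[of _ 1]) simp
  then have "AE x in m. ?T v x = v x" using eig[OF v] by simp
  then show "eqv (?T v) v" using v linop_mem[OF Tl] by (intro eqvI) auto
  show "\<exists>c. eqv f (c \<odot> v)" if f: "f \<in> elems Y" "eqv (?T f) f" for f
  proof -
   obtain c where "AE x in m. f x = c * v x" using eig[OF f(1)] eqvD[OF f(2)] by auto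
   then show ?thesis using f v by (intro exI[of _ c] eqvI) auto
  qed
  show "\<exists>c. \<exists>w\<in>elems Y. eqv f (c \<odot> v + (w - ?T w))" if f: "f \<in> elems Y" for f
  proof -
   obtain c w where w: "w \<in> elems Y" "AE x in m. f x = c * v x + (1 * w x - ?T w x)" using dec[OF f] by (elim exE bexE)
   have "eqv f (c \<odot> v + (w - ?T w))" using w f v linop_mem[OF Tl] by (intro eqvI) auto
   then show ?thesis using w by blast
  qed
  show "\<exists>w\<in>elems Y. eqv f (z \<odot> w - ?T w)" if z: "\<kappa> \<le> cmod z" "z \<noteq> 1" and f: "f \<in> elems Y" for z f
  proof -
   obtain R where R: "bounded_op m Y Y R" "\<And>f. f \<in> elems Y ==> AE x in m. z * R f x - ?T (R f) x = f x" using res[OF z] by blast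
   have Rf: "R f \<in> elems Y" using R(1) f by (auto simp: bounded_op_def)
   have "eqv f (z \<odot> R f - ?T (R f))"
   proof (rule eqvI)
    show "AE x in m. f x = (z \<odot> R f - ?T (R f)) x" using R(2)[OF f] by eventually_elim simp
   qed (use f Rf linop_mem[OF Tl] in auto)
   then show ?thesis using Rf by blast
  qed
  show "nrm Y w = 0" if z: "\<kappa> \<le> cmod z" "z \<noteq> 1" and w: "w \<in> elems Y" "eqv (z \<odot> w - ?T w) 0" for z w
  proof -
   obtain R where R: "bounded_op m Y Y R" "\<And>f. f \<in> elems Y ==> AE x in m. R (\<lambda>y. z * f y - ?T f y) x = f x" using res[OF z] by blast
   have Rl: "linop R" by (rule bounded_op_linop[OF Y R(1)])
   have zw: "(\<lambda>y. z * w y - ?T w y) = z \<odot> w - ?T w" by (auto simp: fun_eq_iff)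
   have "eqv (R (z \<odot> w - ?T w)) w" using R(2)[OF w(1)] w(1) linop_mem[OF Tl] linop_mem[OF Rl] unfolding zw by (intro eqvI) auto
   moreover have "eqv (R (z \<odot> w - ?T w)) 0" using eqv_trans[OF linop_cong[OF Rl w(2)] linop_zero[OF Rl]] .
   ultimately have "eqv w 0" using eqv_trans eqv_sym by blast
   then show ?thesis by (simp add: eqv_zero_iff)
  qed
  fix n :: nat assume n: "n > 0" "\<And>f. [|f \<in> elems Y; (LINT x|m. f x) = 0|] ==> nrm Y ((?T ^^ n) f) \<le> nrm Y f / 2"
  then show ?thesis by blast
 qed
qed

section \<open>Uniform spectral gaps of the family\<close>

locale twisted_family = prob_space m for m :: "'x measure" +
 fixes \<Theta> :: "real set" and G :: "real \<Rightarrow> 'x \<Rightarrow> 'x" and h :: "'x \<Rightarrow> real"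
 assumes zero_mem: "0 \<in> \<Theta>" and nonsing: "t \<in> \<Theta> ==> nonsingular m (G t)"
  and h_meas [measurable]: "h \<in> borel_measurable m"
begin

abbreviation "Q t s \<equiv> twisted_op m (G t) h s"
abbreviation "L t \<equiv> transfer_op m (G t)"
abbreviation "rem \<rho> t n f \<equiv> (\<lambda>x. (L t ^^ n) f x - (LINT x|m. f x) * of_real (\<rho> t x :: real))"

lemma Q_zero: "t \<in> \<Theta> ==> Q t 0 = L t" using twisted_zero[OF nonsing] .

definition near_zero :: "(real \<times> real) filter" where
 "near_zero = inf (nhds (0, 0)) (principal (\<Theta> \<times> UNIV))"

lemma near_zeroD:
 assumes "\<forall>\<^sub>F p in near_zero. P p"
 obtains \<delta> where "\<delta> > 0" "\<And>t s. [|t \<in> \<Theta>; abs t < \<delta>; abs s < \<delta>|] ==> P (t, s)"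
proof -
 obtain d where d: "d > 0" "\<And>p. dist p (0, 0) < d ==> p \<in> \<Theta> \<times> UNIV ==> P p"
  using assms unfolding near_zero_def eventually_inf_principal eventually_nhds_metric by blast
 have "P (t, s)" if "t \<in> \<Theta>" "abs t < d / 2" "abs s < d / 2" for t s
 proof -
  have "dist (t, s) (0, 0) \<le> abs t + abs s" using sqrt_sum_squares_le_sum_abs[of t s] by (simp add: dist_Pair_Pair)
  then show ?thesis using d(2)[of "(t, s)"] that by simp
 qed
 then show ?thesis using that[of "d / 2"] d(1) by auto
qed

lemma near_zeroI:
 assumes "\<delta> > 0" "\<And>t s. [|t \<in> \<Theta>; abs t < \<delta>; abs s < \<delta>|] ==> P (t, s)"
 shows "\<forall>\<^sub>F p in near_zero. P p" unfolding near_zero_def eventually_inf_principal eventually_nhds_metric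
proof (intro exI[of _ \<delta>] conjI allI impI assms(1))
 fix p :: "real \<times> real" assume p: "dist p (0, 0) < \<delta>" "p \<in> \<Theta> \<times> UNIV"
 have "abs (fst p) \<le> dist p (0, 0)" "abs (snd p) \<le> dist p (0, 0)"
  using norm_fst_le[of p] norm_snd_le[of p] dist_fst_le[of p "(0,0)"] dist_snd_le[of p "(0,0)"] by (auto simp: dist_norm)
 then show "P p" using assms(2)[of "fst p" "snd p"] p by auto
qed

lemma near_zero_continuity:
 assumes cont: "op_continuous_on m B1 B2 ((\<Theta> \<inter> {-\<delta><..<\<delta>}) \<times> UNIV) (\<lambda>(t, s). Q t s)" and \<delta>: "\<delta> > 0"
  and B: "banach_space m B1" "banach_space m B2" and e: "e > 0"
 shows "\<forall>\<^sub>F p in near_zero. \<forall>f\<in>elems B1. nrm B2 (Q (fst p) (snd p) f - L 0 f) \<le> e * nrm B1 f"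
proof -
 have "\<forall>\<^sub>F p in inf (nhds (0, 0)) (principal ((\<Theta> \<inter> {-\<delta><..<\<delta>}) \<times> UNIV)).
   \<forall>f\<in>elems B1. nrm B2 ((\<lambda>(t, s). Q t s) p f - (\<lambda>(t, s). Q t s) (0, 0) f) \<le> e * nrm B1 f"
  using zero_mem \<delta> by (intro op_continuous_close[OF cont _ e B]) auto
 then have 1: "\<forall>\<^sub>F p in nhds (0, 0). p \<in> (\<Theta> \<inter> {-\<delta><..<\<delta>}) \<times> UNIV \<longrightarrow>
   (\<forall>f\<in>elems B1. nrm B2 (Q (fst p) (snd p) f - L 0 f) \<le> e * nrm B1 f)"
  unfolding eventually_inf_principal by (rule eventually_mono) (auto simp: Q_zero zero_mem)
 have "\<forall>\<^sub>F p in near_zero. fst p \<in> \<Theta> \<inter> {-\<delta><..<\<delta>}" by (rule near_zeroI[OF \<delta>]) auto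
 moreover have "\<forall>\<^sub>F p in near_zero. p \<in> (\<Theta> \<inter> {-\<delta><..<\<delta>}) \<times> UNIV \<longrightarrow>
   (\<forall>f\<in>elems B1. nrm B2 (Q (fst p) (snd p) f - L 0 f) \<le> e * nrm B1 f)"
  unfolding near_zero_def eventually_inf_principal using 1 by (rule eventually_mono) blast
 ultimately show ?thesis by eventually_elim (auto simp: mem_Times_iff)
qed

end

text \<open>Collects the outcome of the perturbation argument so that it can be obtained twice, for
  \<open>Y = X 0\<close> and for \<open>Y = X 6\<close>, in both cases with \<open>X 8\<close> as
  the weak space \<open>W\<close>. The constants do not depend on the parameter.\<close>

locale uniformly_gapped = twisted_family m \<Theta> G h for m :: "'x measure" and \<Theta> G h +
 fixes Y W :: "'x fspace" and \<delta>0 M \<eta> :: real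
 assumes gap_const: "0 < \<delta>0" "0 < M" "0 < \<eta>" "\<eta> < 1"
  and gap_pow: "\<And>t s n f. [|t \<in> \<Theta>; abs t < \<delta>0; abs s < \<delta>0; f \<in> elems Y|] ==>
   (Q t s ^^ n) f \<in> elems Y \<and> nrm Y ((Q t s ^^ n) f) \<le> M * nrm Y f"
  and gap_mean_zero: "\<And>t f. [|t \<in> \<Theta>; abs t < \<delta>0; f \<in> elems Y; AE x in m. L t f x = f x; (LINT x|m. f x) = 0|] ==> nrm Y f = 0"
  and gap_invariant: "\<And>t \<rho>. [|t \<in> \<Theta>; abs t < \<delta>0; \<rho> \<in> elems Y; AE x in m. L t \<rho> x = \<rho> x; (LINT x|m. \<rho> x) = 1|] ==> nrm Y \<rho> \<le> M"
  and gap_decay: "\<And>t \<rho> n f. [|t \<in> \<Theta>; abs t < \<delta>0; \<rho> \<in> elems Y; AE x in m. L t \<rho> x = \<rho> x; (LINT x|m. \<rho> x) = 1; f \<in> elems Y|] ==>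
   (L t ^^ n) f - (LINT x|m. f x) \<odot> \<rho> \<in> elems Y \<and>
   nrm Y ((L t ^^ n) f - (LINT x|m. f x) \<odot> \<rho>) \<le> M * \<eta> ^ n * nrm Y f"
  and gap_close: "\<And>n e. e > 0 ==> \<forall>\<^sub>F p in near_zero. \<forall>f\<in>elems Y. nrm W ((Q (fst p) (snd p) ^^ n) f - (L 0 ^^ n) f) \<le> e * nrm Y f"

text \<open>The gap at parameter 0 gives a contraction on mean-zero functions;
  \<open>perturbed_contraction\<close> carries it to nearby parameters and frequencies at once.
  Bounds for twisted powers then follow from \<open>geometric_bound\<close>, statements about
  invariant densities from \<open>geometric_mixing\<close>.\<close>

lemma (in twisted_family) uniform_gap:
 assumes Y: "banach_space m Y" and W: "banach_space m W" and one: "(\<lambda>_. 1) \<in> elems Y"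
  and YW: "embeds Y W" and WL: "embeds W (Lp m p0)" and p0: "2 \<le> p0"
  and r: "r > 0" and Qr: "\<And>t s. [|t \<in> \<Theta>; abs t < r|] ==> bounded_op m Y Y (Q t s)" and LW: "bounded_op m W W (L 0)"
  and close: "\<And>e. e > 0 ==> \<forall>\<^sub>F p in near_zero. \<forall>f\<in>elems Y. nrm W (Q (fst p) (snd p) f - L 0 f) \<le> e * nrm Y f"
  and alt: "same_space Y W \<or> (\<exists>c C \<kappa>. 0 < c \<and> 0 < C \<and> 0 < \<kappa> \<and> \<kappa> < 1 \<and>
   (\<forall>\<psi>\<in>elems Y. \<forall>n. \<forall>t\<in>\<Theta>. \<forall>s. abs t \<le> r \<and> abs s \<le> r \<longrightarrow>
    (Q t s ^^ n) \<psi> \<in> elems Y \<and> nrm Y ((Q t s ^^ n) \<psi>) \<le> c * \<kappa> ^ n * nrm Y \<psi> + C ^ n * nrm W \<psi>))"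
  and gap: "spectral_gap m Y (L 0) \<kappa>'" and \<kappa>': "0 < \<kappa>'" "\<kappa>' < 1"
 shows "\<exists>\<delta>0 M \<eta>. \<delta>0 \<le> r \<and> uniformly_gapped m \<Theta> G h Y W \<delta>0 M \<eta>"
proof -
 interpret Y: complete_seminormed "elems Y" "nrm Y" by (rule banach_space_seminormed[OF Y])
 obtain \<delta> c C \<kappa> where \<delta>: "\<delta> > 0" "\<delta> \<le> r" and const: "0 < c" "0 < C" "0 < \<kappa>" "\<kappa> < 1"
  and LY: "\<And>t s f n. [|t \<in> \<Theta>; abs t < \<delta>; abs s < \<delta>; f \<in> elems Y|] ==>
   nrm Y ((Q t s ^^ n) f) \<le> c * \<kappa> ^ n * nrm Y f + C ^ n * nrm W f"
 \<comment> \<open>If the two norms agree, closeness to \<open>L 0\<close> is closeness in operator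
   norm, so all twisted operators are bounded by one \<open>C\<close>. The weak term
   \<open>C^n\<close> alone then gives a Lasota-Yorke inequality, whatever contraction factor is
   written in front.\<close>
 proof (cases "same_space Y W")
  case True
  obtain \<delta>1 where \<delta>1: "\<delta>1 > 0" "\<And>t s. [|t \<in> \<Theta>; abs t < \<delta>1; abs s < \<delta>1|] ==> \<forall>f\<in>elems Y. nrm W (Q t s f - L 0 f) \<le> 1 * nrm Y f"
   using near_zeroD[OF close[OF zero_less_one]] by (metis fst_conv snd_conv)
  define \<delta> where "\<delta> = min r \<delta>1"
  have \<delta>: "\<delta> > 0" "\<delta> \<le> r" "\<delta> \<le> \<delta>1" using r \<delta>1(1) by (auto simp: \<delta>_def)
  have L0: "bounded_op m Y Y (L 0)" using Qr[OF zero_mem, of 0] r by (simp add: Q_zero zero_mem)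
  obtain b where b: "\<And>f. f \<in> elems Y ==> nrm Y (L 0 f) \<le> b * nrm Y f" using L0 unfolding bounded_op_def by blast
  define C where "C = 1 + abs b"
  have step: "Q t s f \<in> elems Y \<and> nrm Y (Q t s f) \<le> C * nrm Y f"
   if "t \<in> \<Theta>" "abs t < \<delta>" "abs s < \<delta>" "f \<in> elems Y" for t s f
  proof -
   have m1: "Q t s f \<in> elems Y" using Qr[of t s] that \<delta> by (auto simp: bounded_op_def)
   have m2: "L 0 f \<in> elems Y" using L0 that by (auto simp: bounded_op_def)
   have "nrm Y (Q t s f) = nrm Y ((Q t s f - L 0 f) + L 0 f)" by simp
   also have "... \<le> nrm Y (Q t s f - L 0 f) + nrm Y (L 0 f)" by (intro Y.N_add Y.diff_mem m1 m2)
   also have "nrm Y (Q t s f - L 0 f) = nrm W (Q t s f - L 0 f)" using True Y.diff_mem[OF m1 m2] by (simp add: same_space_def)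
   also have "... \<le> 1 * nrm Y f" using \<delta>1(2)[of t s] that \<delta> by auto
   also have "nrm Y (L 0 f) \<le> abs b * nrm Y f"
    by (rule order_trans[OF b[OF that(4)] mult_right_mono[OF abs_ge_self Y.N_nonneg[OF that(4)]]])
   finally show ?thesis using m1 by (simp add: C_def algebra_simps)
  qed
  have C: "0 < C" by (simp add: C_def)
  have LY: "nrm Y ((Q t s ^^ n) f) \<le> 1 * (1 / 2) ^ n * nrm Y f + C ^ n * nrm W f"
   if *: "t \<in> \<Theta>" "abs t < \<delta>" "abs s < \<delta>" and f: "f \<in> elems Y" for t s f n
  proof -
   have "(Q t s ^^ n) f \<in> elems Y \<and> nrm Y ((Q t s ^^ n) f) \<le> C ^ n * nrm Y f"
   proof (induction n)
    case (Suc n)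
    then have "nrm Y (Q t s ((Q t s ^^ n) f)) \<le> C * (C ^ n * nrm Y f)"
     using step[OF *, of "(Q t s ^^ n) f"] C by (meson mult_left_mono less_imp_le order_trans)
    then show ?case using step[OF *, of "(Q t s ^^ n) f"] Suc by simp
   qed (use f in simp)
   moreover have "nrm W f = nrm Y f" using True f by (simp add: same_space_def)
   moreover have "0 \<le> 1 * (1 / 2) ^ n * nrm Y f" using Y.N_nonneg[OF f] by simp
   ultimately show ?thesis by auto
  qed
  show thesis by (rule that[OF \<delta>(1,2) zero_less_one C _ _ LY]) auto
 next
  case False
  then obtain c C \<kappa> where c: "0 < c" "0 < C" "0 < \<kappa>" "\<kappa> < 1"
   and LY: "\<forall>\<psi>\<in>elems Y. \<forall>n. \<forall>t\<in>\<Theta>. \<forall>s. abs t \<le> r \<and> abs s \<le> r \<longrightarrow>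
    (Q t s ^^ n) \<psi> \<in> elems Y \<and> nrm Y ((Q t s ^^ n) \<psi>) \<le> c * \<kappa> ^ n * nrm Y \<psi> + C ^ n * nrm W \<psi>" using alt by blast
  show thesis by (rule that[OF r order_refl c]) (use LY in \<open>meson less_imp_le\<close>)
 qed
 have Qb: "bounded_op m Y Y (Q t s)" if "t \<in> \<Theta>" "abs t < \<delta>" for t s using Qr[of t s] that \<delta> by simp
 obtain K1 where K1: "0 < K1" "elems Y \<subseteq> elems W" "\<And>f. f \<in> elems Y ==> nrm W f \<le> K1 * nrm Y f" using embedsE[OF YW Y] by metis
 obtain K where K: "0 < K" "\<And>f. f \<in> elems Y ==> f \<in> borel_measurable m \<and> sqi m f \<and> norm2 m f \<le> K * nrm Y f"
  using embeds_Lp_norm2[OF Y embeds_trans[OF YW WL Y W] p0] by metis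
 have L0b: "bounded_op m Y Y (L 0)" using Qb[OF zero_mem, of 0] \<delta> by (simp add: Q_zero zero_mem)
 interpret Y: functional_space "elems Y" "nrm Y" "\<lambda>f. \<integral>x. f x \<partial>m" "\<lambda>_. 1"
  by (rule spectral_gap_decay(1)[OF prob_space_axioms Y one K(2) nonsing[OF zero_mem] L0b gap \<kappa>'])
 interpret W: complete_seminormed "elems W" "nrm W" by (rule banach_space_seminormed[OF W])
 have int: "integrable m f" if "f \<in> elems Y" for f using integrable_of_square K(2)[OF that] by blast
 \<comment> \<open>Twisted operators contract L^1, so the means of all iterates stay bounded
   although they are not preserved.\<close>
 have IK: "norm (LINT x|m. (Q t s ^^ n) f x) \<le> K * nrm Y f" if "t \<in> \<Theta>" "f \<in> elems Y" for t s n f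
 proof -
  have "norm (LINT x|m. (Q t s ^^ n) f x) \<le> (LINT x|m. norm ((Q t s ^^ n) f x))" by (rule integral_norm_bound)
  also have "... \<le> (LINT x|m. norm (f x))" by (rule twisted_pow_norm[OF nonsing[OF that(1)] h_meas int[OF that(2)]])
  also have "... \<le> norm2 m f" using integrable_of_square(2) K(2)[OF that(2)] by blast
  also have "... \<le> K * nrm Y f" using K(2)[OF that(2)] by blast
  finally show ?thesis .
 qed
 have mean: "(LINT x|m. L t f x) = (LINT x|m. f x)" if "t \<in> \<Theta>" "f \<in> elems Y" for t f
  by (rule transfer_mean[OF nonsing[OF that(1)] int[OF that(2)]])
 have L0: "Y.linop (L 0)" by (rule bounded_op_linop[OF Y L0b])
 obtain n where n: "n > 0" "\<forall>f\<in>elems Y. (LINT x|m. f x) = 0 \<longrightarrow> nrm Y ((L 0 ^^ n) f) \<le> nrm Y f / 2"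
  using spectral_gap_decay(2)[OF prob_space_axioms Y one K(2) nonsing[OF zero_mem] L0b gap \<kappa>'] by blast
 obtain KT where KT: "\<forall>f\<in>elems W. nrm W (L 0 f) \<le> KT * nrm W f" using LW unfolding bounded_op_def by blast
 have Wadd: "nrm W (f + g) \<le> nrm W f + nrm W g" if "f \<in> elems Y" "g \<in> elems Y" for f g using K1(2) that by (intro W.N_add) auto
 have WT: "nrm W (L 0 f) \<le> max KT 0 * nrm W f" if "f \<in> elems Y" for f
 proof -
  have f: "f \<in> elems W" using K1(2) that by blast
  have "nrm W (L 0 f) \<le> KT * nrm W f" using KT f by blast
  also have "... \<le> max KT 0 * nrm W f" using f by (intro mult_right_mono) auto
  finally show ?thesis .
 qed
 have Qlin: "\<forall>\<^sub>F p in near_zero. Y.linop (Q (fst p) (snd p))" by (rule near_zeroI[OF \<delta>(1)]) (auto intro!: bounded_op_linop[OF Y] Qb)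
 have QLY: "\<forall>\<^sub>F p in near_zero. \<forall>f\<in>elems Y. \<forall>n. nrm Y ((Q (fst p) (snd p) ^^ n) f) \<le> c * \<kappa> ^ n * nrm Y f + C ^ n * nrm W f"
  by (rule near_zeroI[OF \<delta>(1)]) (simp add: LY)
 note pert = L0 mean[OF zero_mem] Wadd K1(3) WT max.cobounded2 less_imp_le[OF K1(1)] const Qlin QLY close
 have pow_close: "\<forall>\<^sub>F p in near_zero. \<forall>f\<in>elems Y. nrm W ((Q (fst p) (snd p) ^^ n) f - (L 0 ^^ n) f) \<le> e * nrm Y f" if "e > 0" for e n
  using Y.close_pow[where Q = "\<lambda>p. Q (fst p) (snd p)" and W = "nrm W", OF pert that] .
 obtain l B where l: "l > 0" "1 \<le> B" and ev: "\<forall>\<^sub>F p in near_zero. Y.linop (Q (fst p) (snd p)) \<and>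
  (\<forall>r\<le>l. \<forall>f\<in>elems Y. nrm Y ((Q (fst p) (snd p) ^^ r) f) \<le> B * nrm Y f) \<and>
  (\<forall>f\<in>elems Y. (LINT x|m. f x) = 0 \<longrightarrow> nrm Y ((Q (fst p) (snd p) ^^ l) f) \<le> nrm Y f / 2)"
  using Y.perturbed_contraction[where Q = "\<lambda>p. Q (fst p) (snd p)" and W = "nrm W" and n = n, OF pert n(1)] n(2) by blast
 obtain \<delta>1 where \<delta>1: "\<delta>1 > 0" "\<And>t s. [|t \<in> \<Theta>; abs t < \<delta>1; abs s < \<delta>1|] ==> Y.linop (Q t s) \<and>
  (\<forall>r\<le>l. \<forall>f\<in>elems Y. nrm Y ((Q t s ^^ r) f) \<le> B * nrm Y f) \<and>
  (\<forall>f\<in>elems Y. (LINT x|m. f x) = 0 \<longrightarrow> nrm Y ((Q t s ^^ l) f) \<le> nrm Y f / 2)" using near_zeroD[OF ev] by (metis fst_conv snd_conv)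
 define \<delta>0 where "\<delta>0 = min \<delta> \<delta>1"
 have \<delta>0: "0 < \<delta>0" "\<delta>0 \<le> \<delta>" "\<delta>0 \<le> \<delta>1" using \<delta>(1) \<delta>1(1) by (auto simp: \<delta>0_def)
 define N1 where "N1 = nrm Y (\<lambda>_. 1)"
 have N1: "0 \<le> N1" unfolding N1_def using one by simp
 define M0 where "M0 = B * (1 + 3 * K * B * N1)"
 have M0: "0 < M0" unfolding M0_def using l(2) K(1) N1 by (intro mult_pos_pos add_pos_nonneg) auto
 define M where "M = 2 * M0 + 3 * B * N1"
 have M: "0 < M" "M0 \<le> M" "3 * B * N1 \<le> M" "2 * M0 \<le> M" unfolding M_def using M0 l(2) N1 by (auto intro: add_pos_nonneg)
 \<comment> \<open>Halving every \<open>l\<close> steps is rewritten as a rate per step; the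
   incomplete last block costs the factor 2 in the estimate below.\<close>
 define \<eta> where "\<eta> = root l (1/2)"
 have \<eta>: "0 < \<eta>" "\<eta> < 1" "\<eta> ^ l = 1/2" unfolding \<eta>_def using l(1) by (auto simp: real_root_pow_pos)
 have \<eta>n: "(1/2) ^ (n div l) \<le> 2 * \<eta> ^ n" for n
 proof -
  have "n \<le> l * (n div l) + l" using l(1) mod_less_divisor[of l n] mult_div_mod_eq[of l n] by linarith
  then have "\<eta> ^ (l * (n div l) + l) \<le> \<eta> ^ n" using \<eta> by (intro power_decreasing) auto
  then show ?thesis by (simp add: power_add power_mult \<eta>(3))
 qed
 have lin: "Y.linop (Q t s)" and Bd: "\<And>r f. [|r \<le> l; f \<in> elems Y|] ==> nrm Y ((Q t s ^^ r) f) \<le> B * nrm Y f"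
  and con: "\<And>f. [|f \<in> elems Y; (LINT x|m. f x) = 0|] ==> nrm Y ((Q t s ^^ l) f) \<le> nrm Y f / 2"
  if "t \<in> \<Theta>" "abs t < \<delta>0" "abs s < \<delta>0" for t s using \<delta>1(2)[OF that(1)] that \<delta>0 by auto
 have Llin: "Y.linop (L t)" and LBd: "\<And>r f. [|r \<le> l; f \<in> elems Y|] ==> nrm Y ((L t ^^ r) f) \<le> B * nrm Y f"
  and Lcon: "\<And>f. [|f \<in> elems Y; (LINT x|m. f x) = 0|] ==> nrm Y ((L t ^^ l) f) \<le> nrm Y f / 2"
  if "t \<in> \<Theta>" "abs t < \<delta>0" for t using lin[OF that, of 0] Bd[OF that, of 0] con[OF that, of 0] \<delta>0(1) unfolding Q_zero[OF that(1)] by auto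
 have eqvI: "Y.eqv f k" if "f \<in> elems Y" "k \<in> elems Y" "AE x in m. f x = k x" for f k using banach_eqv_iff[OF Y] that by blast
 have ImK: "norm (LINT x|m. f x) \<le> K * nrm Y f" if "f \<in> elems Y" for f using IK[OF zero_mem that, of 0 0] by simp
 have "uniformly_gapped m \<Theta> G h Y W \<delta>0 M \<eta>"
 proof unfold_locales
  fix t assume t: "t \<in> \<Theta>" "abs t < \<delta>0"
  show "(Q t s ^^ n) f \<in> elems Y \<and> nrm Y ((Q t s ^^ n) f) \<le> M * nrm Y f" if s: "abs s < \<delta>0" and f: "f \<in> elems Y" for s n f
  proof
   show "(Q t s ^^ n) f \<in> elems Y" by (rule Y.linop_pow_mem[OF lin[OF t s] f])
   have "nrm Y ((Q t s ^^ n) f) \<le> M0 * nrm Y f" unfolding M0_def N1_def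
    by (rule Y.geometric_bound[OF lin[OF t s] l(2) Bd[OF t s] l(1) con[OF t s] K(1) IK[OF t(1)] f])
   also have "... \<le> M * nrm Y f" using M f by (intro mult_right_mono) auto
   finally show "nrm Y ((Q t s ^^ n) f) \<le> M * nrm Y f" .
  qed
  show "nrm Y f = 0" if f: "f \<in> elems Y" "AE x in m. L t f x = f x" "(LINT x|m. f x) = 0" for f
  proof -
   have "Y.eqv ((L t ^^ k) f) f" for k
   proof (induction k)
    case (Suc k)
    have "Y.eqv (L t ((L t ^^ k) f)) (L t f)" by (rule Y.linop_cong[OF Llin[OF t] Suc])
    then show ?case using Y.eqv_trans[OF _ eqvI[OF Y.linop_mem[OF Llin[OF t] f(1)] f(1,2)]] by simp
   qed (use f in simp)
   then have "nrm Y f \<le> nrm Y f / 2" using Lcon[OF t f(1,3)] Y.eqv_N by metis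
   then show ?thesis using Y.N_nonneg[OF f(1)] by simp
  qed
  fix \<rho> assume \<rho>: "\<rho> \<in> elems Y" "AE x in m. L t \<rho> x = \<rho> x" "(LINT x|m. \<rho> x) = 1"
  have \<rho>': "Y.eqv (L t \<rho>) \<rho>" by (rule eqvI[OF Y.linop_mem[OF Llin[OF t] \<rho>(1)] \<rho>(1,2)])
  have "nrm Y \<rho> \<le> 3 * B * nrm Y (\<lambda>_. 1)"
   by (rule Y.geometric_mixing(1)[OF Llin[OF t] mean[OF t(1)] l(2) LBd[OF t] l(1) Lcon[OF t] K(1) ImK \<rho>(1) \<rho>' \<rho>(3) one])
  then show "nrm Y \<rho> \<le> M" using M(3) by (simp add: N1_def)
  show "(L t ^^ n) f - (LINT x|m. f x) \<odot> \<rho> \<in> elems Y \<and> nrm Y ((L t ^^ n) f - (LINT x|m. f x) \<odot> \<rho>) \<le> M * \<eta> ^ n * nrm Y f"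
   if f: "f \<in> elems Y" for n f
  proof
   show "(L t ^^ n) f - (LINT x|m. f x) \<odot> \<rho> \<in> elems Y" using Y.linop_pow_mem[OF Llin[OF t] f] \<rho>(1) by (intro Y.diff_mem Y.scl_mem)
   have "nrm Y ((L t ^^ n) f - (LINT x|m. f x) \<odot> \<rho>) \<le> M0 * (1/2) ^ (n div l) * nrm Y f" unfolding M0_def N1_def 
    by (rule Y.geometric_mixing(2)[OF Llin[OF t] mean[OF t(1)] l(2) LBd[OF t] l(1) Lcon[OF t] K(1) ImK \<rho>(1) \<rho>' \<rho>(3) f])
   also have "... \<le> M0 * (2 * \<eta> ^ n) * nrm Y f" using \<eta>n M0 f by (intro mult_right_mono mult_left_mono) auto
   also have "... = (2 * M0) * (\<eta> ^ n * nrm Y f)" by simp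
   also have "... \<le> M * (\<eta> ^ n * nrm Y f)" using M(4) \<eta> f by (intro mult_right_mono) auto
   finally show "nrm Y ((L t ^^ n) f - (LINT x|m. f x) \<odot> \<rho>) \<le> M * \<eta> ^ n * nrm Y f" by simp
  qed
 qed (rule \<delta>0(1) M(1) \<eta>(1,2) pow_close; assumption?)+
 moreover have "\<delta>0 \<le> r" using \<delta>0(2) \<delta>(2) by simp
 ultimately show ?thesis by blast
qed

section \<open>The central limit theorem for arrays of mixing systems\<close>

text \<open>The moment function \<open>\<bar>x\<bar>\<^sup>5\<^sup>/\<^sup>2\<close>; any exponent strictly between 2 and the available moments would do.\<close>

definition mom :: "real \<Rightarrow> real" where
 "mom x = x^2 * sqrt (abs x)"

lemma mom_nonneg [simp]: "0 \<le> mom x" by (simp add: mom_def)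

lemma mom_measurable [measurable]: "mom \<in> borel_measurable borel" unfolding mom_def by measurable

lemma mom_mono: "abs x \<le> abs y ==> mom x \<le> mom y" unfolding mom_def by (intro mult_mono) (auto simp: abs_le_square_iff)

lemma mom_scale: "mom (c * x) = mom c * mom x" by (simp add: mom_def power_mult_distrib abs_mult real_sqrt_mult)

lemma square_le_mom: "x^2 \<le> 1 + mom x"
proof (cases "abs x \<le> 1")
 case True
 then have "x^2 \<le> 1" by (simp add: abs_square_le_1)
 then show ?thesis using mom_nonneg[of x] by linarith
next
 case False
 then have "x^2 * 1 \<le> mom x" unfolding mom_def by (intro mult_left_mono) auto
 then show ?thesis by simp
qed

lemma mom_nat_le: "mom (real n) \<le> real n ^ 3"
proof (cases "n = 0")
 case False
 have "sqrt (real n) \<le> sqrt (real n * real n)" using False by (intro real_sqrt_le_mono) (simp add: mult_le_cancel_right1)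
 then have "sqrt (real n) \<le> real n" by simp
 then show ?thesis unfolding mom_def by (simp add: power3_eq_cube power2_eq_square mult_mono)
qed (simp add: mom_def)

text \<open>Crude, by way of the largest summand. Any polynomial growth in \<open>n\<close> is
  acceptable, because it is applied to blocks whose length is a very small power of the total
  time.\<close>

lemma mom_sum: "mom (\<Sum>i<n. x i) \<le> real n ^ 3 * (\<Sum>i<n. mom (x i))"
proof (cases "n = 0")
 case True then show ?thesis by (simp add: mom_def)
next
 case False
 obtain j where j: "j < n" "\<And>i. i < n ==> abs (x i) \<le> abs (x j)"
 proof -
  have "Max ((\<lambda>i. abs (x i)) ` {..<n}) \<in> (\<lambda>i. abs (x i)) ` {..<n}" using False by (intro Max_in) auto
  then obtain j where "j < n" "Max ((\<lambda>i. abs (x i)) ` {..<n}) = abs (x j)" by auto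
  moreover have "abs (x i) \<le> Max ((\<lambda>i. abs (x i)) ` {..<n})" if "i < n" for i using that by (intro Max_ge) auto
  ultimately show ?thesis using that by metis
 qed
 have "abs (\<Sum>i<n. x i) \<le> (\<Sum>i<n. abs (x i))" by (rule sum_abs)
 also have "... \<le> real n * abs (x j)" using sum_bounded_above[of "{..<n}" "\<lambda>i. abs (x i)" "abs (x j)"] j by simp
 finally have "mom (\<Sum>i<n. x i) \<le> mom (real n * x j)" by (intro mom_mono) (simp add: abs_mult)
 also have "... \<le> real n ^ 3 * mom (x j)" unfolding mom_scale using mom_nat_le by (intro mult_right_mono) auto
 also have "... \<le> real n ^ 3 * (\<Sum>i<n. mom (x i))" using j by (intro mult_left_mono member_le_sum) auto
 finally show ?thesis .
qed

lemma mom_diff: "mom (x - a) \<le> 8 * (mom x + mom a)"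
proof -
 have *: "mom (x - a) \<le> 8 * mom y" if "abs x \<le> abs y" "abs a \<le> abs y" for y
 proof -
  have "mom (x - a) \<le> mom (2 * y)" using that by (intro mom_mono) (simp add: abs_mult)
  also have "... \<le> 8 * mom y" unfolding mom_scale using mom_nat_le[of 2] by (intro mult_right_mono) auto
  finally show ?thesis .
 qed
 show ?thesis 
 proof (cases "abs x \<le> abs a")
  case True then show ?thesis using *[of a, OF True order_refl] mom_nonneg[of x] by (simp add: distrib_left add_increasing)
 next
  case False then show ?thesis using *[of x, OF order_refl] mom_nonneg[of a] by (simp add: distrib_left add_increasing2)
 qed
qed

lemma abs_le_sqrt_abs: "abs x \<le> 1 ==> abs x \<le> sqrt (abs (x :: real))" by (rule real_le_rsqrt) (unfold power2_eq_square, rule mult_left_le, auto)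

text \<open>Interpolates between the cubic remainder, better for small arguments, and the quadratic
  one, better for large arguments; \<open>mom\<close> dominates the smaller of the two.\<close>

lemma iexp_taylor_mom: "cmod (exp (\<i> * of_real x) - (1 + \<i> * of_real x - of_real (x^2 / 2))) \<le> mom x"
proof -
 have sum: "(\<Sum>k\<le>2. (\<i> * complex_of_real x) ^ k / fact k) = 1 + \<i> * of_real x - of_real (x^2 / 2)"
  by (simp add: numeral_2_eq_2 power2_eq_square algebra_simps)
 have 1: "cmod (exp (\<i> * of_real x) - (1 + \<i> * of_real x - of_real (x^2 / 2))) \<le> abs x ^ 3 / 6"
  using iexp_approx1[of x 2] unfolding sum by (simp add: numeral_eq_Suc)
 have 2: "cmod (exp (\<i> * of_real x) - (1 + \<i> * of_real x - of_real (x^2 / 2))) \<le> x^2"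
  using iexp_approx2[of x 2] unfolding sum by (simp add: numeral_eq_Suc)
 show ?thesis
 proof (cases "abs x \<le> 1")
  case True
  have "abs x ^ 3 = x^2 * abs x" by (simp add: power3_eq_cube power2_eq_square)
  moreover have "0 \<le> x^2 * abs x" by simp
  ultimately have "abs x ^ 3 / 6 \<le> x^2 * abs x" by linarith
  also have "... \<le> mom x" unfolding mom_def using abs_le_sqrt_abs[OF True] by (intro mult_left_mono) auto
  finally show ?thesis using 1 by simp
 next
  case False
  then have "x^2 * 1 \<le> mom x" unfolding mom_def by (intro mult_left_mono) auto
  then show ?thesis using 2 by simp
 qed
qed

text \<open>Recovers a second moment from the real part of a characteristic function at a single
  small frequency, with an error governed by \<open>mom\<close>.\<close>

lemma cos_taylor_mom: "abs (x^2 - 2 * (1 - cos (u * x)) / u^2) \<le> 2 * sqrt u * mom x" if u: "0 < u"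
proof -
 have "abs (cos (u * x) - (1 - (u * x)^2 / 2)) \<le> mom (u * x)"
  using order_trans[OF abs_Re_le_cmod iexp_taylor_mom[of "u * x"]] by (simp add: Re_exp)
 then have "2 * abs (cos (u * x) - (1 - (u * x)^2 / 2)) / u^2 \<le> 2 * mom (u * x) / u^2" by (intro divide_right_mono mult_left_mono) auto
 then have "abs (2 * (cos (u * x) - (1 - (u * x)^2 / 2)) / u^2) \<le> 2 * mom (u * x) / u^2" unfolding abs_divide abs_mult by simp
 moreover have "2 * (cos (u * x) - (1 - (u * x)^2 / 2)) / u^2 = x^2 - 2 * (1 - cos (u * x)) / u^2"
  using u by (simp add: field_simps power_mult_distrib)
 moreover have "2 * mom (u * x) / u^2 = 2 * sqrt u * mom x" unfolding mom_scale using u by (simp add: mom_def)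
 ultimately show ?thesis by (simp only:)
qed

lemma sin_remainder_mom: "(x - sin (u * x) / u)^2 \<le> 4 * sqrt u * mom x" if u: "0 < u"
proof -
 have *: "abs (y - sin y) \<le> 2 * abs y" for y :: real using abs_sin_x_le_abs_x[of y] by linarith
 have **: "(y - sin y)^2 \<le> 4 * mom y" for y :: real
 proof (cases "abs y \<le> 1")
  case False
  have "(y - sin y)^2 \<le> (2 * y)^2" using *[of y] abs_le_square_iff[of "y - sin y" "2 * y"] by (simp add: abs_mult)
  also have "... = 4 * (y^2 * 1)" by (simp add: power_mult_distrib)
  also have "... \<le> 4 * mom y" unfolding mom_def using False by (intro mult_left_mono) auto
  finally show ?thesis .
 next
  case True
  have "abs (sin y - y) \<le> mom y" using order_trans[OF abs_Im_le_cmod iexp_taylor_mom[of y]] by (simp add: Im_exp)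
  then have "(y - sin y)^2 \<le> (mom y)^2" by (simp add: abs_le_square_iff[symmetric])
  also have "... \<le> mom y * 1"
  proof -
   have "mom y \<le> 1" unfolding mom_def using True by (intro mult_le_one) (auto simp: abs_square_le_1)
   then show ?thesis unfolding power2_eq_square by (intro mult_left_mono) auto
  qed
  finally show ?thesis using mom_nonneg[of y] by linarith
 qed
 have "x - sin (u * x) / u = (u * x - sin (u * x)) / u" using u by (simp add: diff_divide_distrib)
 then have "(x - sin (u * x) / u)^2 = (u * x - sin (u * x))^2 / u^2" by (simp only: power_divide)
 also have "... \<le> 4 * mom (u * x) / u^2" using **[of "u * x"] by (intro divide_right_mono) auto
 also have "... = 4 * sqrt u * mom x" unfolding mom_scale using u by (simp add: mom_def)
 finally show ?thesis .
qed

context prob_space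
begin

lemma mom_integrable_square:
 assumes [measurable]: "X \<in> borel_measurable M" and int: "integrable M (\<lambda>x. mom (X x))"
 shows "integrable M (\<lambda>x. (X x)^2)" "integrable M X" "(LINT x|M. (X x)^2) \<le> 1 + (LINT x|M. mom (X x))"
  "abs (\<integral>x. X x \<partial>M) \<le> 1 + (LINT x|M. mom (X x))"
proof -
 show sq: "integrable M (\<lambda>x. (X x)^2)"
  by (rule dominated[of M "\<lambda>x. 1 + mom (X x)"]) (use int square_le_mom in \<open>auto simp: abs_of_nonneg\<close>)
 show s: "integrable M X" by (rule square_integrable_imp_integrable[OF _ sq]) simp
 have "(LINT x|M. (X x)^2) \<le> (LINT x|M. 1 + mom (X x))" using sq int square_le_mom by (intro integral_mono) auto
 then show 1: "(LINT x|M. (X x)^2) \<le> 1 + (LINT x|M. mom (X x))" using int by (simp add: prob_space)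
 have "(LINT x|M. X x)^2 \<le> (LINT x|M. (X x)^2)" using variance_positive[of X] variance_eq[OF s sq] by simp
 then have 2: "(LINT x|M. X x)^2 \<le> 1 + (LINT x|M. mom (X x))" using 1 by simp
 have m0: "0 \<le> (LINT x|M. mom (X x))" by simp
 have "1 + (LINT x|M. mom (X x)) \<le> (1 + (LINT x|M. mom (X x)))^2" using m0 by (simp add: power2_eq_square algebra_simps)
 then have "(LINT x|M. X x)^2 \<le> (1 + (LINT x|M. mom (X x)))^2" using 2 by linarith
 then show "abs (\<integral>x. X x \<partial>M) \<le> 1 + (LINT x|M. mom (X x))" using m0 by (simp add: abs_le_square_iff[symmetric])
qed

text \<open>Low frequencies suffice: \<open>X\<close> differs from \<open>sin (u X) / u\<close> by a quantity that is small in \<open>L\<^sup>2\<close>.\<close>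

lemma low_frequency_split:
 assumes [measurable]: "X \<in> borel_measurable M" "Y \<in> borel_measurable M"
  and X: "integrable M (\<lambda>x. mom (X x))" and Y: "integrable M (\<lambda>x. (Y x)^2)" and u: "0 < u" and a: "0 < a"
 shows "abs ((LINT x|M. X x * Y x) - (LINT x|M. sin (u * X x) / u * Y x))
  \<le> 2 * sqrt u * (LINT x|M. mom (X x)) / a + a / 2 * (LINT x|M. (Y x)^2)"
  and "integrable M (\<lambda>x. X x * Y x)" "integrable M (\<lambda>x. sin (u * X x) / u * Y x)"
proof -
 have "integrable M (\<lambda>x. (X x)^2)" by (rule mom_integrable_square(1)[OF assms(1) X])
 then show i1: "integrable M (\<lambda>x. X x * Y x)" by (rule integral_Cauchy_Schwarz(1)[OF assms(1,2) _ Y])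
 have iY: "integrable M Y" by (rule square_integrable_imp_integrable[OF assms(2) Y])
 show i2: "integrable M (\<lambda>x. sin (u * X x) / u * Y x)"
 proof (rule dominated)
  show "integrable M (\<lambda>x. (1 / u) * Y x)" using iY by simp
  show "AE x in M. norm (sin (u * X x) / u * Y x) \<le> norm ((1 / u) * Y x)"
  proof (rule AE_I2)
   fix x
   have "abs (sin (u * X x)) * abs (Y x) \<le> 1 * abs (Y x)" by (intro mult_right_mono) auto
   then show "norm (sin (u * X x) / u * Y x) \<le> norm ((1 / u) * Y x)" using u by (simp add: abs_mult divide_right_mono)
  qed
 qed simp
 let ?r = "\<lambda>x. X x - sin (u * X x) / u"
 \<comment> \<open>Young's inequality with weight \<open>a\<close>, which the applications take to
   be \<open>\<eta>^k\<close>, much larger than \<open>sqrt u\<close>.\<close>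
 have b: "abs (?r x * Y x) \<le> 2 * sqrt u * mom (X x) / a + a / 2 * (Y x)^2" for x
 proof -
  have "2 * (abs (?r x) * (a * abs (Y x))) \<le> (?r x)^2 + (a * abs (Y x))^2" using sum_squares_bound[of "abs (?r x)" "a * abs (Y x)"] by (simp add: mult.assoc)
  also have "... \<le> 4 * sqrt u * mom (X x) + a * (a * (Y x)^2)"
  proof -
   have "(a * abs (Y x))^2 = a * (a * (Y x)^2)" by (simp add: power_mult_distrib) (simp add: power2_eq_square)
   then show ?thesis using sin_remainder_mom[OF u, of "X x"] by linarith
  qed
  also have "2 * (abs (?r x) * (a * abs (Y x))) = 2 * a * abs (?r x * Y x)" unfolding abs_mult by simp
  also have "4 * sqrt u * mom (X x) + a * (a * (Y x)^2) = 2 * a * (2 * sqrt u * mom (X x) / a + a / 2 * (Y x)^2)"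
   using a by (simp add: field_simps)
  finally show ?thesis using a by (subst (asm) mult_le_cancel_left_pos) auto
 qed
 have "(LINT x|M. X x * Y x) - (LINT x|M. sin (u * X x) / u * Y x) = (LINT x|M. ?r x * Y x)"
  using i1 i2 by (subst Bochner_Integration.integral_diff[symmetric]) (auto simp: algebra_simps)
 then have "abs ((LINT x|M. X x * Y x) - (LINT x|M. sin (u * X x) / u * Y x)) \<le> (LINT x|M. abs (?r x * Y x))" by (simp add: integral_abs_bound)
 also have "... \<le> (LINT x|M. 2 * sqrt u * mom (X x) / a + a / 2 * (Y x)^2)"
  using i1 i2 X Y b by (intro integral_mono) (auto simp: left_diff_distrib)
 also have "... = 2 * sqrt u * (LINT x|M. mom (X x)) / a + a / 2 * (LINT x|M. (Y x)^2)" using X Y by simp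
 finally show "abs ((LINT x|M. X x * Y x) - (LINT x|M. sin (u * X x) / u * Y x))
  \<le> 2 * sqrt u * (LINT x|M. mom (X x)) / a + a / 2 * (LINT x|M. (Y x)^2)" .
qed

end

section \<open>Covariances and variances of a stationary mixing system\<close>

lemma birkhoff_sum_Suc: "birkhoff_sum g h (Suc n) x = birkhoff_sum g h n x + h ((g ^^ n) x)" by (simp add: birkhoff_sum_def)

lemma birkhoff_sum_add: "birkhoff_sum g h (m + n) x = birkhoff_sum g h m x + birkhoff_sum g h n ((g ^^ m) x)"
proof (induction n)
 case (Suc n)
 have "(g ^^ (m + n)) x = (g ^^ n) ((g ^^ m) x)" by (metis add.commute comp_apply funpow_add)
 then show ?case using Suc by (simp add: birkhoff_sum_Suc)
qed (simp add: birkhoff_sum_def)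

text \<open>The exponent \<open>8 * q\<close> is a reserve: dividing by a frequency of size
  \<open>\<eta>^(4 k)\<close> must still leave exponential decay. In \<open>mix_h\<close> the time
  is \<open>Suc q\<close> because the first step belongs to the twisted operator and only the
  remaining \<open>q\<close> steps decorrelate.\<close>

locale mixing_system = prob_space \<nu> for \<nu> :: "'x measure" +
 fixes g :: "'x \<Rightarrow> 'x" and h :: "'x \<Rightarrow> real" and D \<eta> \<delta> :: real
 assumes g_meas [measurable]: "g \<in> measurable \<nu> \<nu>" and inv: "distr \<nu> \<nu> g = \<nu>"
  and h_meas [measurable]: "h \<in> borel_measurable \<nu>"
  and h_mom: "integrable \<nu> (\<lambda>x. mom (h x))" "(LINT x|\<nu>. mom (h x)) \<le> D"
  and const: "0 < \<eta>" "\<eta> < 1" "0 < \<delta>" "\<delta> \<le> 1"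
  and mix: "\<And>u p q \<psi>. [|abs u < \<delta>; \<psi> \<in> borel_measurable \<nu>; \<And>x. cmod (\<psi> x) \<le> 1|] ==>
   cmod ((LINT x|\<nu>. ei u (birkhoff_sum g h p x) * \<psi> ((g ^^ (p + q)) x))
    - (LINT x|\<nu>. ei u (birkhoff_sum g h p x)) * (LINT x|\<nu>. \<psi> x)) \<le> D * \<eta> ^ (8 * q)"
  and mix_h: "\<And>u q. abs u < \<delta> ==>
   cmod ((LINT x|\<nu>. ei u (h x) * of_real (h ((g ^^ Suc q) x)))
    - (LINT x|\<nu>. ei u (h x)) * of_real (LINT x|\<nu>. h x)) \<le> D * \<eta> ^ (8 * q)"
begin

definition A where "A = (LINT x|\<nu>. h x)"
definition ht where "ht x = h x - A"
abbreviation "S n x \<equiv> birkhoff_sum g ht n x"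
definition c where "c k = (LINT x|\<nu>. ht x * ht ((g ^^ k) x))"
definition V where "V n = (LINT x|\<nu>. (S n x)^2)"
text \<open>The Green-Kubo expression for the asymptotic variance of the centred sums divided by
  \<open>sqrt n\<close>.\<close>

definition s where "s = c 0 + 2 * (\<Sum>k. c (Suc k))"

text \<open>These constants, like \<open>D4\<close> and \<open>D5\<close> below, involve
  \<open>D\<close>, \<open>\<eta>\<close> and \<open>\<delta>\<close> alone; estimates in terms of
  them are therefore uniform over an array of systems sharing these parameters.\<close>

definition "D1 = 8 * (D + mom (1 + D))"
definition "D2 = 1 + D1"
definition "D3 = D2 + D / \<eta> ^ 8 * (2 / \<delta>) + 2 * D + D2 / 2"

lemma D_nonneg: "0 \<le> D" using h_mom(2) by (rule order_trans[rotated]) simp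

lemma D_consts: "0 \<le> D1" "0 < D2" "0 < D3" "D2 \<le> D3"
proof -
 show 1: "0 \<le> D1" using D_nonneg by (simp add: D1_def)
 show 2: "0 < D2" using 1 by (simp add: D2_def)
 have "0 \<le> D / \<eta> ^ 8 * (2 / \<delta>)" using D_nonneg const by simp
 then show "0 < D3" "D2 \<le> D3" using 2 D_nonneg by (auto simp: D3_def)
qed

lemma ht_meas [measurable]: "ht \<in> borel_measurable \<nu>" unfolding ht_def by measurable

lemma g_pow_meas [measurable]: "g ^^ k \<in> measurable \<nu> \<nu>" by (induction k) (auto intro: measurable_comp[OF _ g_meas] simp: id_def[symmetric])

lemma inv_pow: "distr \<nu> \<nu> (g ^^ k) = \<nu>"
proof (induction k)
 case 0 then show ?case by (simp add: id_def distr_id)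
next
 case (Suc k)
 have "distr \<nu> \<nu> (g ^^ Suc k) = distr (distr \<nu> \<nu> (g ^^ k)) \<nu> g" unfolding funpow.simps by (subst distr_distr) auto
 then show ?case by (simp only: Suc inv)
qed

lemma integral_pow: "f \<in> borel_measurable \<nu> ==> (LINT x|\<nu>. f ((g ^^ k) x)) = (LINT x|\<nu>. (f x :: 'b :: {banach, second_countable_topology}))"
 using integral_distr[of "g ^^ k" \<nu> \<nu> f] by (simp add: inv_pow)

lemma integrable_pow: "integrable \<nu> f ==> integrable \<nu> (\<lambda>x. f ((g ^^ k) x) :: 'b :: {banach, second_countable_topology})"
 using integrable_distr[of "g ^^ k" \<nu> \<nu> f] by (simp add: inv_pow)

lemma ht_mom: "integrable \<nu> (\<lambda>x. mom (ht x))" "(LINT x|\<nu>. mom (ht x)) \<le> D1"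
proof -
 have i: "integrable \<nu> (\<lambda>x. 8 * (mom (h x) + mom A))" using h_mom by simp
 show 1: "integrable \<nu> (\<lambda>x. mom (ht x))"
  by (rule dominated[OF i]) (use mom_diff in \<open>auto simp: ht_def add_nonneg_nonneg\<close>)
 have "abs A \<le> 1 + D" unfolding A_def using mom_integrable_square(4)[OF h_meas h_mom(1)] h_mom(2) by linarith
 then have mA: "mom A \<le> mom (1 + D)" by (intro mom_mono) linarith
 have "(LINT x|\<nu>. mom (ht x)) \<le> (LINT x|\<nu>. 8 * (mom (h x) + mom A))" using 1 i mom_diff by (intro integral_mono) (auto simp: ht_def)
 also have "... = 8 * ((LINT x|\<nu>. mom (h x)) + mom A)" using h_mom by (simp add: prob_space)
 also have "... \<le> D1" unfolding D1_def using mA h_mom(2) by (intro mult_left_mono add_mono) auto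
 finally show "(LINT x|\<nu>. mom (ht x)) \<le> D1" .
qed

lemma ht_square: "integrable \<nu> (\<lambda>x. (ht x)^2)" "integrable \<nu> ht" "(LINT x|\<nu>. (ht x)^2) \<le> D2" "integrable \<nu> h"
proof -
 note * = mom_integrable_square[OF ht_meas ht_mom(1)]
 show "integrable \<nu> (\<lambda>x. (ht x)^2)" "integrable \<nu> ht" by (rule *)+
 show "(LINT x|\<nu>. (ht x)^2) \<le> D2" unfolding D2_def using *(3) ht_mom(2) by linarith
 show "integrable \<nu> h" by (rule mom_integrable_square(2)[OF h_meas h_mom(1)])
qed

lemma ht_mean: "(LINT x|\<nu>. ht x) = 0" using ht_square(4) by (simp add: ht_def A_def prob_space)

lemma prod_integrable: "integrable \<nu> (\<lambda>x. ht ((g ^^ i) x) * ht ((g ^^ j) x))"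
proof -
 have "(\<lambda>x. ht ((g ^^ i) x)) \<in> borel_measurable \<nu>" for i by measurable
 moreover have "integrable \<nu> (\<lambda>x. (ht ((g ^^ i) x))^2)" for i by (rule integrable_pow[OF ht_square(1)])
 ultimately show ?thesis by (intro integral_Cauchy_Schwarz(1))
qed

lemma prod_integral: "(LINT x|\<nu>. ht ((g ^^ i) x) * ht ((g ^^ j) x)) = c (if i \<le> j then j - i else i - j)"
proof -
 have *: "(LINT x|\<nu>. ht ((g ^^ i) x) * ht ((g ^^ j) x)) = c (j - i)" if "i \<le> j" for i j
 proof -
  have "(g ^^ j) x = (g ^^ (j - i)) ((g ^^ i) x)" for x using that by (metis comp_apply funpow_add le_add_diff_inverse2)
  then show ?thesis unfolding c_def using integral_pow[of "\<lambda>x. ht x * ht ((g ^^ (j - i)) x)" i] by simp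
 qed
 show ?thesis using *[of i j] *[of j i] by (auto simp: mult.commute)
qed

text \<open>The mixing hypothesis pairs bounded exponentials with \<open>h\<close>, so the earlier
  factor is replaced by \<open>sin (u h) / u\<close>. With \<open>u\<close> of size
  \<open>\<eta>^(4 k)\<close> the mixing error, divided by \<open>u\<close>, is still of size
  \<open>\<eta>^(4 k)\<close>, while the replacement costs \<open>sqrt u / \<eta>^k\<close> and
  \<open>\<eta>^k\<close>, both of order \<open>\<eta>^k\<close>.\<close>

lemma c_bound: "abs (c k) \<le> D3 * \<eta> ^ k"
proof (cases k)
 case 0
 have "c 0 = (LINT x|\<nu>. (ht x)^2)" by (simp add: c_def power2_eq_square)
 then have "abs (c 0) \<le> D2" using ht_square(3) by simp
 then show ?thesis using 0 D_consts by simp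
next
 case (Suc q)
 define Y where "Y x = ht ((g ^^ k) x)" for x
 have Y [measurable]: "Y \<in> borel_measurable \<nu>" and Y2: "integrable \<nu> (\<lambda>x. (Y x)^2)" and Y1: "integrable \<nu> Y"
  unfolding Y_def using integrable_pow[OF ht_square(1)] integrable_pow[OF ht_square(2)] by auto
 have Y2': "(LINT x|\<nu>. (Y x)^2) \<le> D2" unfolding Y_def using integral_pow[of "\<lambda>x. (ht x)^2" k] ht_square(3) by simp
 have Y0: "(LINT x|\<nu>. Y x) = 0" unfolding Y_def using integral_pow[of ht k] ht_mean by simp
 define u where "u = \<delta> / 2 * \<eta> ^ (4 * k)"
 have u: "0 < u" "abs u < \<delta>" "sqrt u \<le> \<eta> ^ (2 * k)"
 proof -
  show "0 < u" using const by (simp add: u_def)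
  have "u \<le> \<delta> / 2 * 1" unfolding u_def using const by (intro mult_left_mono power_le_one) auto
  then show "abs u < \<delta>" using const \<open>0 < u\<close> by simp
  have "u \<le> 1 * \<eta> ^ (4 * k)" unfolding u_def using const by (intro mult_right_mono) auto
  then have "u \<le> (\<eta> ^ (2 * k))^2" by (simp add: power_mult[symmetric] mult.commute)
  then show "sqrt u \<le> \<eta> ^ (2 * k)" using const by (intro real_le_lsqrt) (auto simp: u_def)
 qed
 \<comment> \<open>The later factor has mean zero, so the centring of the earlier one may be dropped
   and the hypothesis on the uncentred \<open>h\<close> applies.\<close>
 have "c k = (LINT x|\<nu>. h x * Y x)"
 proof -
  have "integrable \<nu> (\<lambda>x. h x * Y x)" using mom_integrable_square(1)[OF h_meas h_mom(1)] Y2 by (intro integral_Cauchy_Schwarz(1)) auto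
  then have "(LINT x|\<nu>. h x * Y x - A * Y x) = (LINT x|\<nu>. h x * Y x) - A * (LINT x|\<nu>. Y x)" using Y1 by simp
  moreover have "c k = (LINT x|\<nu>. ht x * Y x)" by (simp add: c_def Y_def)
  moreover have "(LINT x|\<nu>. ht x * Y x) = (LINT x|\<nu>. h x * Y x - A * Y x)" by (simp add: ht_def left_diff_distrib)
  ultimately show ?thesis unfolding Y0 by (simp only: mult_zero_right diff_zero)
 qed
 have e_int: "integrable \<nu> (\<lambda>x. ei u (h x) * of_real (Y x))"
 proof (rule dominated)
  show "integrable \<nu> Y" by (rule Y1)
  show "AE x in \<nu>. cmod (ei u (h x) * of_real (Y x)) \<le> norm (Y x)" by (simp add: norm_mult)
 qed simp
 have "cmod (LINT x|\<nu>. ei u (h x) * of_real (Y x)) \<le> D * \<eta> ^ (8 * q)"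
 proof -
  have i1: "integrable \<nu> (\<lambda>x. ei u (h x) * of_real (h ((g ^^ Suc q) x)))"
  proof (rule dominated)
   show "integrable \<nu> (\<lambda>x. h ((g ^^ Suc q) x))" by (rule integrable_pow[OF ht_square(4)])
  qed (auto simp: norm_mult)
  have i2: "integrable \<nu> (\<lambda>x. ei u (h x))" by (rule integrable_const_bound[of _ 1]) auto
  have "(LINT x|\<nu>. ei u (h x) * of_real (Y x))
   = (LINT x|\<nu>. ei u (h x) * of_real (h ((g ^^ Suc q) x)) - ei u (h x) * of_real A)"
   by (intro Bochner_Integration.integral_cong refl) (simp add: Y_def Suc ht_def right_diff_distrib)
  also have "... = (LINT x|\<nu>. ei u (h x) * of_real (h ((g ^^ Suc q) x)))
    - (LINT x|\<nu>. ei u (h x)) * of_real A" using i1 i2 by (subst Bochner_Integration.integral_diff) auto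
  finally show ?thesis using mix_h[OF u(2), of q] by (simp add: A_def)
 qed
 moreover have "(LINT x|\<nu>. sin (u * h x) * Y x) = Im (LINT x|\<nu>. ei u (h x) * of_real (Y x))"
  unfolding integral_Im[OF e_int, symmetric] by (intro Bochner_Integration.integral_cong refl) (simp add: Im_exp)
 ultimately have "abs (\<integral>x. sin (u * h x) * Y x \<partial>\<nu>) \<le> D * \<eta> ^ (8 * q)" using order_trans[OF abs_Im_le_cmod] by presburger
 then have "abs (\<integral>x. sin (u * h x) * Y x \<partial>\<nu>) / u \<le> D * \<eta> ^ (8 * q) / u" using u by (intro divide_right_mono) auto
 moreover have "abs (\<integral>x. sin (u * h x) / u * Y x \<partial>\<nu>) = abs (\<integral>x. sin (u * h x) * Y x \<partial>\<nu>) / u" using u by simp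
 ultimately have "abs (\<integral>x. sin (u * h x) / u * Y x \<partial>\<nu>) \<le> D * \<eta> ^ (8 * q) / u" by (simp only:)
 also have "D * \<eta> ^ (8 * q) / u = D / \<eta> ^ 8 * (2 / \<delta>) * (\<eta> ^ (8 * k) / \<eta> ^ (4 * k))"
  using const by (simp add: u_def Suc power_add field_simps)
 also have "\<eta> ^ (8 * k) / \<eta> ^ (4 * k) = \<eta> ^ (4 * k)" using const by (simp add: power_diff[symmetric] flip: power_add)
 also have "D / \<eta> ^ 8 * (2 / \<delta>) * \<eta> ^ (4 * k) \<le> D / \<eta> ^ 8 * (2 / \<delta>) * \<eta> ^ k"
  using const D_nonneg by (intro mult_left_mono power_decreasing) auto
 finally have m1: "abs (\<integral>x. sin (u * h x) / u * Y x \<partial>\<nu>) \<le> D / \<eta> ^ 8 * (2 / \<delta>) * \<eta> ^ k" .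
 have "abs (c k - (LINT x|\<nu>. sin (u * h x) / u * Y x)) \<le> 2 * sqrt u * (LINT x|\<nu>. mom (h x)) / \<eta> ^ k + \<eta> ^ k / 2 * (LINT x|\<nu>. (Y x)^2)"
  unfolding \<open>c k = _\<close> using const by (intro low_frequency_split(1) h_mom Y2 u) auto
 also have "... \<le> 2 * \<eta> ^ (2 * k) * D / \<eta> ^ k + \<eta> ^ k / 2 * D2"
  using u h_mom(2) Y2' const D_nonneg by (intro add_mono divide_right_mono mult_mono mult_left_mono) auto
 also have "2 * \<eta> ^ (2 * k) * D / \<eta> ^ k = 2 * D * \<eta> ^ k"
 proof -
  have "\<eta> ^ (2 * k) = \<eta> ^ k * \<eta> ^ k" by (metis mult_2 power_add)
  then show ?thesis using const by simp
 qed
 finally have m2: "abs (c k - (LINT x|\<nu>. sin (u * h x) / u * Y x)) \<le> 2 * D * \<eta> ^ k + \<eta> ^ k / 2 * D2" .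
 have "abs (c k) \<le> D / \<eta> ^ 8 * (2 / \<delta>) * \<eta> ^ k + (2 * D * \<eta> ^ k + \<eta> ^ k / 2 * D2)" using m1 m2 by linarith
 also have "... = (D3 - D2) * \<eta> ^ k" by (simp add: D3_def algebra_simps)
 also have "... \<le> D3 * \<eta> ^ k" using D_consts const by (intro mult_right_mono) auto
 finally show ?thesis .
qed

text \<open>Arbitrary finite index sets are allowed because the times left out by the blocks do not
  form an interval. The growth is linear in the cardinality since each row of covariances is
  summable.\<close>

lemma sum_square_bound:
 assumes "finite I"
 shows "integrable \<nu> (\<lambda>x. (\<Sum>i\<in>I. ht ((g ^^ i) x))^2)"
  and "(LINT x|\<nu>. (\<Sum>i\<in>I. ht ((g ^^ i) x))^2) \<le> real (card I) * (2 * D3 / (1 - \<eta>))"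
proof -
 have eq: "(\<Sum>i\<in>I. ht ((g ^^ i) x))^2 = (\<Sum>i\<in>I. \<Sum>j\<in>I. ht ((g ^^ i) x) * ht ((g ^^ j) x))" for x by (simp add: power2_eq_square sum_product)
 show "integrable \<nu> (\<lambda>x. (\<Sum>i\<in>I. ht ((g ^^ i) x))^2)" unfolding eq using prod_integrable by simp
 have "(LINT x|\<nu>. (\<Sum>i\<in>I. ht ((g ^^ i) x))^2) = (\<Sum>i\<in>I. \<Sum>j\<in>I. c (if i \<le> j then j - i else i - j))"
  unfolding eq using prod_integrable by (simp add: prod_integral)
 also have "... \<le> (\<Sum>i\<in>I. 2 * D3 / (1 - \<eta>))"
 proof (rule sum_mono)
  fix i assume "i \<in> I"
  define d where "d j = (if i \<le> j then j - i else i - j)" for j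
  \<comment> \<open>On either side of \<open>i\<close> every distance occurs at most once, so each
    side is dominated by a geometric series.\<close>
  have half: "(\<Sum>j\<in>J. \<eta> ^ d j) \<le> 1 / (1 - \<eta>)" if "finite J" "inj_on d J" for J
  proof -
   have "(\<Sum>j\<in>J. \<eta> ^ d j) = (\<Sum>k\<in>d ` J. \<eta> ^ k)" using that by (simp add: sum.reindex)
   also have "... \<le> (\<Sum>k. \<eta> ^ k)" using const that by (intro sum_le_suminf) (auto simp: summable_geometric)
   also have "... = 1 / (1 - \<eta>)" using const by (intro suminf_geometric) auto
   finally show ?thesis .
  qed
  have "(\<Sum>j\<in>I. c (d j)) \<le> (\<Sum>j\<in>I. D3 * \<eta> ^ d j)" using c_bound abs_le_D1 by (intro sum_mono) blast
  also have "... = D3 * ((\<Sum>j\<in>{j\<in>I. i \<le> j}. \<eta> ^ d j) + (\<Sum>j\<in>{j\<in>I. \<not> i \<le> j}. \<eta> ^ d j))"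
   using assms sum.inter_filter[OF assms, of "\<lambda>j. \<eta> ^ d j" "\<lambda>j. i \<le> j"] sum.inter_filter[OF assms, of "\<lambda>j. \<eta> ^ d j" "\<lambda>j. \<not> i \<le> j"]
   by (simp add: sum_distrib_left[symmetric] sum.distrib[symmetric]) (intro disjI2 sum.cong, auto)
  also have "... \<le> D3 * (1 / (1 - \<eta>) + 1 / (1 - \<eta>))"
   using D_consts assms by (intro mult_left_mono add_mono half) (auto simp: inj_on_def d_def)
  finally show "(\<Sum>j\<in>I. c (if i \<le> j then j - i else i - j)) \<le> 2 * D3 / (1 - \<eta>)" by (simp add: d_def mult.commute)
 qed
 finally show "(LINT x|\<nu>. (\<Sum>i\<in>I. ht ((g ^^ i) x))^2) \<le> real (card I) * (2 * D3 / (1 - \<eta>))" by simp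
qed

lemma S_meas [measurable]: "S n \<in> borel_measurable \<nu>" unfolding birkhoff_sum_def by measurable

lemma V_bound: "integrable \<nu> (\<lambda>x. (S n x)^2)" "V n \<le> real n * (2 * D3 / (1 - \<eta>))" "0 \<le> V n"
 using sum_square_bound[of "{..<n}"] by (auto simp: birkhoff_sum_def V_def)

lemma c_summable: "summable (\<lambda>k. c (Suc k))"
proof (rule summable_comparison_test')
 show "summable (\<lambda>k. D3 * \<eta> ^ Suc k)" using const by (simp add: summable_geometric summable_mult)
 show "norm (c (Suc k)) \<le> D3 * \<eta> ^ Suc k" for k using c_bound[of "Suc k"] by simp
qed

lemma V_Suc: "V (Suc n) = V n + (c 0 + 2 * (\<Sum>k<n. c (Suc k)))"
proof -
 have "(S (Suc n) x)^2 = (S n x)^2 + (ht ((g ^^ n) x) * ht ((g ^^ n) x) + 2 * (\<Sum>i<n. ht ((g ^^ i) x) * ht ((g ^^ n) x)))" for x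
  by (simp add: birkhoff_sum_def power2_eq_square algebra_simps sum_distrib_left)
 then have "V (Suc n) = V n + (c 0 + 2 * (\<Sum>i<n. c (n - i)))" unfolding V_def using prod_integrable V_bound(1) by (simp add: prod_integral)
 also have "(\<Sum>i<n. c (n - i)) = (\<Sum>k<n. c (Suc k))" by (subst sum.nat_diff_reindex[symmetric]) (auto intro!: sum.cong simp: Suc_diff_Suc)
 finally show ?thesis .
qed

definition "D4 = 2 * D3 / (1 - \<eta>)^2"

text \<open>The increment \<open>V (Suc n) - V n\<close> is a partial sum of the series defining
  \<open>s\<close>, so its deviation from \<open>s\<close> is geometrically small and the deviations
  add up to a bound independent of \<open>n\<close>. In particular vanishing \<open>s\<close> means
  bounded variances.\<close>

lemma V_linear: "abs (V n - real n * s) \<le> D4"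
proof -
 have tail: "abs ((c 0 + 2 * (\<Sum>k<n. c (Suc k))) - s) \<le> 2 * D3 / (1 - \<eta>) * \<eta> ^ n" for n
 proof -
  have "s - (c 0 + 2 * (\<Sum>k<n. c (Suc k))) = 2 * (\<Sum>k. c (Suc (k + n)))"
   using suminf_minus_initial_segment[OF c_summable, of n] by (simp add: s_def)
  moreover have "abs (\<Sum>k. c (Suc (k + n))) \<le> D3 / (1 - \<eta>) * \<eta> ^ n"
  proof -
   have sg: "summable (\<lambda>k. D3 * \<eta> ^ n * \<eta> ^ k)" using const by (simp add: summable_geometric summable_mult)
   have le: "norm (c (Suc (k + n))) \<le> D3 * \<eta> ^ n * \<eta> ^ k" for k
   proof -
    have "abs (c (Suc (k + n))) \<le> D3 * \<eta> ^ Suc (k + n)" by (rule c_bound)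
    also have "... \<le> D3 * \<eta> ^ (k + n)" using D_consts const by (intro mult_left_mono power_decreasing) auto
    finally show ?thesis by (simp add: power_add mult_ac)
   qed
   have "norm (\<Sum>k. c (Suc (k + n))) \<le> (\<Sum>k. D3 * \<eta> ^ n * \<eta> ^ k)" using sg le by (intro norm_suminf_le)
   also have "... = D3 * \<eta> ^ n * (1 / (1 - \<eta>))" using const by (subst suminf_mult) (auto simp: summable_geometric suminf_geometric)
   finally show ?thesis by simp
  qed
  ultimately show ?thesis by (simp add: abs_minus_commute abs_mult)
 qed
 have "abs (V n - real n * s) \<le> (\<Sum>k<n. 2 * D3 / (1 - \<eta>) * \<eta> ^ k)"
 proof (induction n)
  case 0 then show ?case by (simp add: V_def birkhoff_sum_def)
 next
  case (Suc n)
  have "V (Suc n) - real (Suc n) * s = (V n - real n * s) + ((c 0 + 2 * (\<Sum>k<n. c (Suc k))) - s)" by (simp add: V_Suc algebra_simps)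
  then show ?case using Suc tail[of n] by simp
 qed
 also have "... = 2 * D3 / (1 - \<eta>) * (\<Sum>k<n. \<eta> ^ k)" by (simp add: sum_distrib_left)
 also have "... \<le> 2 * D3 / (1 - \<eta>) * (1 / (1 - \<eta>))"
 proof (rule mult_left_mono)
  have "(\<Sum>k<n. \<eta> ^ k) \<le> (\<Sum>k. \<eta> ^ k)" using const by (intro sum_le_suminf) (auto simp: summable_geometric)
  then show "(\<Sum>k<n. \<eta> ^ k) \<le> 1 / (1 - \<eta>)" using const by (simp add: suminf_geometric)
 qed (use D_consts const in auto)
 finally show ?thesis by (simp add: D4_def power2_eq_square)
qed

lemma S_mom: "integrable \<nu> (\<lambda>x. mom (S n x))" "(LINT x|\<nu>. mom (S n x)) \<le> real n ^ 4 * D1"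
proof -
 have i: "integrable \<nu> (\<lambda>x. real n ^ 3 * (\<Sum>i<n. mom (ht ((g ^^ i) x))))" using integrable_pow[OF ht_mom(1)] by simp
 show 1: "integrable \<nu> (\<lambda>x. mom (S n x))"
 proof (rule dominated[OF i])
  show "AE x in \<nu>. norm (mom (S n x)) \<le> norm (real n ^ 3 * (\<Sum>i<n. mom (ht ((g ^^ i) x))))"
  proof (rule AE_I2)
   fix x
   have "0 \<le> (\<Sum>i<n. mom (ht ((g ^^ i) x)))" by (intro sum_nonneg) simp
   then show "norm (mom (S n x)) \<le> norm (real n ^ 3 * (\<Sum>i<n. mom (ht ((g ^^ i) x))))"
    unfolding birkhoff_sum_def using mom_sum[of "\<lambda>i. ht ((g ^^ i) x)" n] by simp
  qed
 qed simp
 have "(LINT x|\<nu>. mom (S n x)) \<le> (LINT x|\<nu>. real n ^ 3 * (\<Sum>i<n. mom (ht ((g ^^ i) x))))"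
  using 1 i mom_sum by (intro integral_mono) (auto simp: birkhoff_sum_def)
 also have "... = real n ^ 3 * (\<Sum>i<n. (LINT x|\<nu>. mom (ht x)))" using integrable_pow[OF ht_mom(1)] integral_pow[of "\<lambda>x. mom (ht x)"] by simp
 also have "... \<le> real n ^ 3 * (real n * D1)"
  using ht_mom(2) sum_bounded_above[of "{..<n}" "\<lambda>i. \<integral>x. mom (ht x) \<partial>\<nu>" D1] by (intro mult_left_mono) auto
 finally show "(LINT x|\<nu>. mom (S n x)) \<le> real n ^ 4 * D1" by (simp add: numeral_eq_Suc)
qed

end

section \<open>Bernstein blocks and characteristic functions\<close>

lemma exp_minus_quadratic: "0 \<le> x ==> abs (exp (- x) - (1 - x)) \<le> x^2 / 2" for x :: real
proof -
 assume x: "0 \<le> x"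
 have 1: "1 - x \<le> exp (- x)" using exp_ge_add_one_self[of "- x"] by simp
 have 2: "1 + x + x^2 / 2 \<le> exp x" by (rule exp_lower_Taylor_quadratic[OF x])
 have pos: "0 < 1 + x + x^2 / 2" using x by (simp add: add_pos_nonneg)
 have "(1 - x + x^2 / 2) * (1 + x + x^2 / 2) = 1 + (x^2)^2 / 4" by (simp add: power2_eq_square algebra_simps)
 then have "1 \<le> (1 - x + x^2 / 2) * (1 + x + x^2 / 2)" by simp
 then have "1 / (1 + x + x^2 / 2) \<le> 1 - x + x^2 / 2" using pos by (simp add: pos_divide_le_eq)
 moreover have "exp (- x) \<le> 1 / (1 + x + x^2 / 2)" using 2 pos by (simp add: exp_minus inverse_eq_divide frac_le)
 ultimately show ?thesis using 1 by simp
qed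

lemma exp_minus_Lipschitz: "[|0 \<le> a; 0 \<le> b|] ==> abs (exp (- a) - exp (- b)) \<le> abs (a - b)" for a b :: real
proof -
 have *: "exp (- a) - exp (- b) \<le> b - a" if "0 \<le> a" "a \<le> b" for a b :: real
 proof -
  define E where "E = exp (- (b - a))"
  have 1: "1 - E \<le> b - a" unfolding E_def using exp_ge_add_one_self[of "- (b - a)"] by linarith
  have E: "E \<le> 1" using that by (simp add: E_def)
  have "exp (- b) = exp (- a) * E" by (simp add: E_def exp_add[symmetric])
  then have "exp (- a) - exp (- b) = exp (- a) * (1 - E)" by (simp add: right_diff_distrib)
  also have "... \<le> 1 * (1 - E)" using that E by (intro mult_right_mono) auto
  finally show ?thesis using 1 by simp
 qed
 assume "0 \<le> a" "0 \<le> b"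
 then show ?thesis using *[of a b] *[of b a] by (cases "a \<le> b") auto
qed

lemma norm_triangle4: "norm (a - e) \<le> norm (a - b) + norm (b - c) + norm (c - d) + norm (d - e)"
 for a b c d e :: complex
proof -
 have "norm (a - e) \<le> norm (a - d) + norm (d - e)" "norm (a - d) \<le> norm (a - c) + norm (c - d)"
  "norm (a - c) \<le> norm (a - b) + norm (b - c)"
  using norm_triangle_ineq[of "a - d" "d - e"] norm_triangle_ineq[of "a - c" "c - d"] norm_triangle_ineq[of "a - b" "b - c"] by simp_all
 then show ?thesis by linarith
qed

lemma iexp_Lipschitz: "cmod (exp (\<i> * of_real a) - exp (\<i> * of_real b)) \<le> abs (a - b)"
proof -
 have "exp (\<i> * of_real a) - exp (\<i> * of_real b) = exp (\<i> * of_real b) * (exp (\<i> * of_real (a - b)) - 1)"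
  by (simp add: right_diff_distrib exp_add[symmetric] algebra_simps)
 then have "cmod (exp (\<i> * of_real a) - exp (\<i> * of_real b)) = cmod (exp (\<i> * of_real (a - b)) - 1)" by (simp add: norm_mult)
 also have "... \<le> abs (a - b)" using iexp_approx1[of "a - b" 0] by simp
 finally show ?thesis .
qed

context mixing_system
begin

definition \<phi> where "\<phi> n u = (LINT x|\<nu>. ei u (S n x))"

definition "D5 = 2 * D3 / (1 - \<eta>)"

lemma D5: "0 \<le> D5" unfolding D5_def using D_consts const by simp

lemma D4: "0 \<le> D4" unfolding D4_def using D_consts const by simp

lemma S_eq: "S n x = birkhoff_sum g h n x - real n * A" by (simp add: birkhoff_sum_def ht_def sum_subtractf)

lemma iexp_integrable: "f \<in> borel_measurable \<nu> ==> integrable \<nu> (\<lambda>x. ei u (f x))" by (rule integrable_const_bound[of _ 1]) auto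

lemma \<phi>_le_1: "cmod (\<phi> n u) \<le> 1"
proof -
 have "cmod (\<phi> n u) \<le> (LINT x|\<nu>. cmod (ei u (S n x)))" unfolding \<phi>_def by (rule integral_norm_bound)
 also have "... = 1" by (simp add: prob_space)
 finally show ?thesis .
qed

lemma \<phi>_eq: "\<phi> n u = exp (- (\<i> * of_real u * of_real (real n * A))) * (LINT x|\<nu>. ei u (birkhoff_sum g h n x))"
 unfolding \<phi>_def by (subst integral_mult_right_zero[symmetric], intro Bochner_Integration.integral_cong refl)
  (simp add: S_eq exp_add[symmetric] algebra_simps)

lemma mix_S:
 assumes "abs u < \<delta>" "\<psi> \<in> borel_measurable \<nu>" "\<And>x. cmod (\<psi> x) \<le> 1"
 shows "cmod ((LINT x|\<nu>. ei u (S p x) * \<psi> ((g ^^ (p + q)) x)) - \<phi> p u * (LINT x|\<nu>. \<psi> x)) \<le> D * \<eta> ^ (8 * q)"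
proof -
 define w where "w = exp (- (\<i> * of_real u * of_real (real p * A)))"
 have w: "cmod w = 1" by (simp add: w_def)
 have "(LINT x|\<nu>. ei u (S p x) * \<psi> ((g ^^ (p + q)) x))
   = w * (LINT x|\<nu>. ei u (birkhoff_sum g h p x) * \<psi> ((g ^^ (p + q)) x))"
 proof -
  have "ei u (S p x) = w * ei u (birkhoff_sum g h p x)" for x by (simp add: S_eq w_def exp_add[symmetric] algebra_simps)
  then show ?thesis by (simp add: mult.assoc)
 qed
 then have "(LINT x|\<nu>. ei u (S p x) * \<psi> ((g ^^ (p + q)) x)) - \<phi> p u * (LINT x|\<nu>. \<psi> x)
  = w * ((LINT x|\<nu>. ei u (birkhoff_sum g h p x) * \<psi> ((g ^^ (p + q)) x))
    - (LINT x|\<nu>. ei u (birkhoff_sum g h p x)) * (LINT x|\<nu>. \<psi> x))"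
  unfolding \<phi>_eq w_def[symmetric] by (simp add: right_diff_distrib mult.assoc)
 then show ?thesis using mix[OF assms] by (simp add: norm_mult w)
qed

lemma S_square_integrable: "integrable \<nu> (S n)" "(LINT x|\<nu>. S n x) = 0"
proof -
 show "integrable \<nu> (S n)" by (rule square_integrable_imp_integrable[OF S_meas V_bound(1)])
 have "(LINT x|\<nu>. S n x) = (\<Sum>i<n. (LINT x|\<nu>. ht ((g ^^ i) x)))"
  unfolding birkhoff_sum_def using integrable_pow[OF ht_square(2)] by (intro Bochner_Integration.integral_sum)
 then show "(LINT x|\<nu>. S n x) = 0" using integral_pow[OF ht_meas] ht_mean by simp
qed

lemma \<phi>_taylor: "cmod (\<phi> n u - of_real (1 - u^2 * V n / 2)) \<le> mom u * (real n ^ 4 * D1)"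
proof -
 define e where "e x = exp (\<i> * of_real (u * S n x)) - (1 + \<i> * of_real (u * S n x) - of_real ((u * S n x)^2 / 2))" for x
 have i: "integrable \<nu> (\<lambda>x. ei u (S n x))" by (rule iexp_integrable) simp
 have i1: "integrable \<nu> (\<lambda>x. \<i> * of_real (u * S n x))" using S_square_integrable(1)[of n] by simp
 have i2: "integrable \<nu> (\<lambda>x. complex_of_real ((u * S n x)^2 / 2))"
 proof (rule integrable_of_real)
  show "integrable \<nu> (\<lambda>x. (u * S n x)^2 / 2)" using V_bound(1)[of n] by (simp add: power_mult_distrib)
 qed
 have "(LINT x|\<nu>. e x) = \<phi> n u - (LINT x|\<nu>. 1 + \<i> * of_real (u * S n x) - of_real ((u * S n x)^2 / 2))"
  unfolding e_def \<phi>_def using i i1 i2 by (subst Bochner_Integration.integral_diff) (auto simp: mult.assoc)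
 also have "(LINT x|\<nu>. 1 + \<i> * of_real (u * S n x) - of_real ((u * S n x)^2 / 2))
   = 1 + \<i> * of_real (LINT x|\<nu>. u * S n x) - of_real (LINT x|\<nu>. (u * S n x)^2 / 2)"
  using i1 i2 by (simp add: prob_space del: of_real_mult of_real_power of_real_divide)
 also have "(LINT x|\<nu>. u * S n x) = 0" using S_square_integrable by simp
 also have "(LINT x|\<nu>. (u * S n x)^2 / 2) = u^2 * V n / 2" by (simp add: V_def power_mult_distrib)
 finally have "\<phi> n u - of_real (1 - u^2 * V n / 2) = (LINT x|\<nu>. e x)" by simp
 then have "cmod (\<phi> n u - of_real (1 - u^2 * V n / 2)) \<le> (LINT x|\<nu>. cmod (e x))" by (simp add: integral_norm_bound)
 also have "... \<le> (LINT x|\<nu>. mom u * mom (S n x))"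
 proof (rule integral_mono)
  show "integrable \<nu> (\<lambda>x. cmod (e x))" unfolding e_def using i i1 i2 by (auto simp: mult.assoc)
  show "cmod (e x) \<le> mom u * mom (S n x)" for x unfolding e_def mom_scale[symmetric] by (rule iexp_taylor_mom)
 qed (use S_mom(1) in simp)
 also have "... \<le> mom u * (real n ^ 4 * D1)" using S_mom by (simp add: mult_left_mono)
 finally show ?thesis .
qed

text \<open>Expresses a variance by one characteristic function at one frequency, a quantity for
  which continuity in the parameter is available.\<close>

lemma V_low_frequency: "0 < u ==> abs (V n - 2 * (1 - Re (\<phi> n u)) / u^2) \<le> 2 * sqrt u * (real n ^ 4 * D1)"
proof -
 assume u: "0 < u"
 have i: "integrable \<nu> (\<lambda>x. ei u (S n x))" by (rule iexp_integrable) simp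
 have Re: "Re (\<phi> n u) = (LINT x|\<nu>. cos (u * S n x))" unfolding \<phi>_def integral_Re[OF i, symmetric] by (simp add: Re_exp)
 have ic: "integrable \<nu> (\<lambda>x. cos (u * S n x))" by (rule integrable_const_bound[of _ 1]) auto
 have "V n - 2 * (1 - Re (\<phi> n u)) / u^2 = (LINT x|\<nu>. (S n x)^2 - 2 * (1 - cos (u * S n x)) / u^2)"
  unfolding Re V_def using ic V_bound(1)[of n] by (simp add: prob_space)
 then have "abs (V n - 2 * (1 - Re (\<phi> n u)) / u^2) \<le> (LINT x|\<nu>. abs ((S n x)^2 - 2 * (1 - cos (u * S n x)) / u^2))"
  by (simp add: integral_abs_bound)
 also have "... \<le> (LINT x|\<nu>. 2 * sqrt u * mom (S n x))" using ic V_bound(1)[of n] S_mom(1) cos_taylor_mom[OF u] by (intro integral_mono) auto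
 also have "... \<le> 2 * sqrt u * (real n ^ 4 * D1)" using S_mom(2) u by (simp add: mult_left_mono)
 finally show ?thesis .
qed

text \<open>The first block is split off: all later blocks together form a function of modulus 1
  evaluated a gap \<open>q\<close> after its end, so every block costs one mixing error.\<close>

lemma blocks_char:
 assumes u: "abs u < \<delta>"
 shows "cmod ((LINT x|\<nu>. ei u (\<Sum>j<k. S p ((g ^^ (j * (p + q))) x))) - \<phi> p u ^ k)
  \<le> real k * (D * \<eta> ^ (8 * q))"
proof (induction k)
 case 0 then show ?case by (simp add: prob_space)
next
 case (Suc k)
 define \<psi> where "\<psi> x = ei u (\<Sum>j<k. S p ((g ^^ (j * (p + q))) x))" for x
 have \<psi>: "\<psi> \<in> borel_measurable \<nu>" "\<And>x. cmod (\<psi> x) \<le> 1" unfolding \<psi>_def by auto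
 have gp: "(g ^^ (j * (p + q))) ((g ^^ (p + q)) x) = (g ^^ (Suc j * (p + q))) x" for j x
  by (metis add.commute comp_apply funpow_add mult_Suc)
 have "ei u (\<Sum>j<Suc k. S p ((g ^^ (j * (p + q))) x))
   = ei u (S p x) * \<psi> ((g ^^ (p + q)) x)" for x unfolding sum.lessThan_Suc_shift \<psi>_def gp exp_add[symmetric] by (simp add: distrib_left)
 then have "(LINT x|\<nu>. ei u (\<Sum>j<Suc k. S p ((g ^^ (j * (p + q))) x)))
   = (LINT x|\<nu>. ei u (S p x) * \<psi> ((g ^^ (p + q)) x))" (is "?a = ?b") by simp
 moreover have "cmod (?b - \<phi> p u ^ Suc k) \<le> cmod (?b - \<phi> p u * (LINT x|\<nu>. \<psi> x)) + cmod (\<phi> p u * ((LINT x|\<nu>. \<psi> x) - \<phi> p u ^ k))"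
  using norm_triangle_ineq[of "?b - \<phi> p u * (LINT x|\<nu>. \<psi> x)" "\<phi> p u * ((LINT x|\<nu>. \<psi> x) - \<phi> p u ^ k)"] by (simp add: right_diff_distrib)
 moreover have "cmod (?b - \<phi> p u * (LINT x|\<nu>. \<psi> x)) \<le> D * \<eta> ^ (8 * q)" by (rule mix_S[OF u \<psi>])
 moreover have "cmod (\<phi> p u * ((LINT x|\<nu>. \<psi> x) - \<phi> p u ^ k)) \<le> 1 * (real k * (D * \<eta> ^ (8 * q)))" unfolding norm_mult
 proof (rule mult_mono)
  show "cmod ((LINT x|\<nu>. \<psi> x) - \<phi> p u ^ k) \<le> real k * (D * \<eta> ^ (8 * q))" unfolding \<psi>_def by (rule Suc)
 qed (use \<phi>_le_1 in auto)
 ultimately show ?case by (simp add: algebra_simps)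
qed

text \<open>The summands outside the blocks have \<open>n - k * p\<close> indices, and their L^2
  norm is of the order of the square root of that number by \<open>sum_square_bound\<close>.\<close>

lemma blocks_remainder:
 assumes n: "k * (p + q) \<le> n"
 shows "cmod (\<phi> n u - (LINT x|\<nu>. ei u (\<Sum>j<k. S p ((g ^^ (j * (p + q))) x))))
  \<le> abs u * sqrt (real (n - k * p) * D5)"
proof -
 define B where "B x = (\<Sum>j<k. S p ((g ^^ (j * (p + q))) x))" for x
 define J where "J = (\<Union>j<k. {j * (p + q)..<j * (p + q) + p})"
 define I where "I = {..<n} - J"
 have B [measurable]: "B \<in> borel_measurable \<nu>" unfolding B_def by measurable
 have disj: "{i * (p + q)..<i * (p + q) + p} \<inter> {j * (p + q)..<j * (p + q) + p} = {}" if "i < j" for i j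
 proof -
  have "Suc i * (p + q) \<le> j * (p + q)" using that by (intro mult_le_mono1) simp
  then show ?thesis by auto
 qed
 have disj': "\<forall>i\<in>{..<k}. \<forall>j\<in>{..<k}. i \<noteq> j \<longrightarrow> {i * (p + q)..<i * (p + q) + p} \<inter> {j * (p + q)..<j * (p + q) + p} = {}"
  using disj by (metis Int_commute linorder_neqE_nat)
 have cJ: "card J = k * p" unfolding J_def using disj' by (subst card_UN_disjoint) auto
 have Jn: "J \<subseteq> {..<n}"
 proof
  fix i assume "i \<in> J"
  then obtain j where j: "j < k" "i < j * (p + q) + p" by (auto simp: J_def)
  have "Suc j * (p + q) \<le> k * (p + q)" using j by (intro mult_le_mono1) simp
  then show "i \<in> {..<n}" using j n by simp
 qed
 have cI: "card I = n - k * p" unfolding I_def using Jn cJ by (subst card_Diff_subset) (auto intro: finite_subset)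
 have BJ: "B x = (\<Sum>i\<in>J. ht ((g ^^ i) x))" for x
 proof -
  have "(\<Sum>i\<in>J. ht ((g ^^ i) x)) = (\<Sum>j<k. \<Sum>i\<in>{j * (p + q)..<j * (p + q) + p}. ht ((g ^^ i) x))"
   unfolding J_def using disj' by (intro sum.UNION_disjoint) auto
  also have "... = (\<Sum>j<k. S p ((g ^^ (j * (p + q))) x))"
  proof (intro sum.cong refl)
   fix j
   have "(\<Sum>i\<in>{j * (p + q)..<j * (p + q) + p}. ht ((g ^^ i) x)) = (\<Sum>i\<in>{0..<p}. ht ((g ^^ (i + j * (p + q))) x))"
    using sum.shift_bounds_nat_ivl[of "\<lambda>i. ht ((g ^^ i) x)" 0 "j * (p + q)" p] by (simp add: add.commute)
   also have "... = S p ((g ^^ (j * (p + q))) x)" by (simp add: birkhoff_sum_def funpow_add atLeast0LessThan)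
   finally show "(\<Sum>i\<in>{j * (p + q)..<j * (p + q) + p}. ht ((g ^^ i) x)) = S p ((g ^^ (j * (p + q))) x)" .
  qed
  finally show ?thesis by (simp add: B_def)
 qed
 have SI: "S n x - B x = (\<Sum>i\<in>I. ht ((g ^^ i) x))" for x unfolding BJ birkhoff_sum_def I_def using Jn by (subst sum_diff) auto
 have I: "integrable \<nu> (\<lambda>x. (S n x - B x)^2)" "(LINT x|\<nu>. (S n x - B x)^2) \<le> real (n - k * p) * D5"
  unfolding SI cI[symmetric] D5_def by (rule sum_square_bound; simp add: I_def)+
 have L1: "integrable \<nu> (\<lambda>x. (S n x - B x) * 1)" "(LINT x|\<nu>. abs ((S n x - B x) * 1)) \<le> sqrt (LINT x|\<nu>. (S n x - B x)^2) * sqrt (LINT x|\<nu>. 1^2)"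
  by (rule integral_Cauchy_Schwarz; use I(1) in simp)+
 have i: "integrable \<nu> (\<lambda>x. ei u (S n x))" "integrable \<nu> (\<lambda>x. ei u (B x))" by (rule iexp_integrable; simp)+
 have "\<phi> n u - (LINT x|\<nu>. ei u (B x)) = (LINT x|\<nu>. ei u (S n x) - ei u (B x))" unfolding \<phi>_def using i by simp
 then have "cmod (\<phi> n u - (LINT x|\<nu>. ei u (B x))) \<le> (LINT x|\<nu>. cmod (ei u (S n x) - ei u (B x)))" by (simp add: integral_norm_bound)
 also have "... \<le> (LINT x|\<nu>. abs u * abs (S n x - B x))"
 proof (rule integral_mono)
  show "cmod (ei u (S n x) - ei u (B x)) \<le> abs u * abs (S n x - B x)" for x
   using iexp_Lipschitz[of "u * S n x" "u * B x"] by (simp add: right_diff_distrib[symmetric] abs_mult mult.assoc)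
 qed (use i L1(1) in auto)
 also have "... = abs u * (LINT x|\<nu>. abs (S n x - B x))" by simp
 also have "(LINT x|\<nu>. abs (S n x - B x)) \<le> sqrt (LINT x|\<nu>. (S n x - B x)^2)" using L1(2) by (simp add: prob_space)
 also have "... \<le> sqrt (real (n - k * p) * D5)" using I(2) by (rule real_sqrt_le_mono)
 finally show ?thesis by (simp add: B_def mult_left_mono)
qed

lemma s_bounds: "0 \<le> s" "s \<le> D5 + D4"
proof -
 show "0 \<le> s"
 proof (rule ccontr)
  assume "\<not> 0 \<le> s"
  then have neg: "0 < - s" by simp
  obtain n where n: "D4 < real n * (- s)" using reals_Archimedean3[OF neg] by blast
  then show False using V_linear[of n] V_bound(3)[of n] by (simp add: abs_le_iff)
 qed
 show "s \<le> D5 + D4" using V_linear[of 1] V_bound(2)[of 1] by (simp add: D5_def abs_le_iff)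
qed

text \<open>The four errors, in the order of the bound: discarding the times outside the blocks,
  decoupling the blocks, replacing the block characteristic function by a Gaussian factor, and
  replacing the block variance by \<open>s\<close>. The quantity \<open>\<epsilon>\<close> bounds
  the fraction of discarded times: the gaps contribute \<open>q / p\<close>, the incomplete last
  block \<open>(p + q) / n\<close>.\<close>

lemma char_estimate:
 fixes n p q :: nat and t :: real
 assumes n: "0 < n" and p: "0 < p" and t: "abs t / sqrt (real n) < \<delta>"
 defines "\<epsilon> \<equiv> real q / real p + real (p + q) / real n"
 shows "cmod (\<phi> n (t / sqrt (real n)) - of_real (exp (- (t^2 * s / 2)))) \<le>
  abs t * sqrt (\<epsilon> * D5) + real n * (D * \<eta> ^ (8 * q)) +
  real n * (mom (t / sqrt (real n)) * (real p ^ 4 * D1) + (t^2 / real n * (real p * D5))^2 / 8) +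
  t^2 / 2 * (D4 / real p + (D5 + D4) * \<epsilon>)"
proof -
 define k where "k = n div (p + q)"
 define u where "u = t / sqrt (real n)"
 have u2: "u^2 = t^2 / real n" using n by (simp add: u_def power_divide)
 have u: "abs u < \<delta>" using t by (simp add: u_def)
 have kn: "k * (p + q) \<le> n" by (simp add: k_def)
 have kp: "real k * real p \<le> real n"
 proof -
  have "k * p \<le> k * (p + q)" by simp
  then have "k * p \<le> n" using kn by linarith
  then show ?thesis by (metis of_nat_le_iff of_nat_mult)
 qed
 have k1: "real k \<le> real n"
 proof -
  have "real k * 1 \<le> real k * real p" using p by (intro mult_left_mono) auto
  then show ?thesis using kp by simp
 qed
 have kpn: "real k / real n \<le> 1 / real p" using kp n p by (simp add: field_simps)
 have rest: "real (n - k * p) \<le> real n * \<epsilon>" and rest': "1 - real k * real p / real n \<le> \<epsilon>"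
 proof -
  have "n = k * (p + q) + n mod (p + q)" unfolding k_def by (rule div_mult_mod_eq[symmetric])
  moreover have "n mod (p + q) < p + q" using p by simp
  ultimately have "n \<le> k * p + (k * q + (p + q))" by (simp add: algebra_simps)
  then have "real n \<le> real (k * p + (k * q + (p + q)))" by (simp only: of_nat_le_iff)
  then have 1: "real n - real k * real p \<le> real k * real q + real (p + q)" by simp
  have "real k * real q \<le> real n / real p * real q" using kp p by (intro mult_right_mono) (auto simp: field_simps)
  then have 2: "real n - real k * real p \<le> real n * \<epsilon>" 
  proof -
   have "real n * \<epsilon> = real n / real p * real q + real (p + q)" using n unfolding \<epsilon>_def distrib_left by simp
   then show ?thesis using 1 \<open>real k * real q \<le> _\<close> by linarith
  qed
  have "k * p \<le> n" using kp by (metis of_nat_le_iff of_nat_mult)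
  then show "real (n - k * p) \<le> real n * \<epsilon>" using 2 by (simp add: of_nat_diff)
  have "real n * (1 - real k * real p / real n) \<le> real n * \<epsilon>" using 2 n by (simp add: right_diff_distrib)
  then show "1 - real k * real p / real n \<le> \<epsilon>" using n by simp
 qed
 have \<epsilon>: "0 \<le> \<epsilon>" by (simp add: \<epsilon>_def)
 have V: "0 \<le> V p" "V p \<le> real p * D5" using V_bound(2,3) by (auto simp: D5_def)
 let ?B = "\<integral>x. ei u (\<Sum>j<k. S p ((g ^^ (j * (p + q))) x)) \<partial>\<nu>"
 have 1: "cmod (\<phi> n u - ?B) \<le> abs t * sqrt (\<epsilon> * D5)"
 proof -
  have "cmod (\<phi> n u - ?B) \<le> abs u * sqrt (real (n - k * p) * D5)" by (rule blocks_remainder[OF kn])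
  also have "... \<le> abs u * sqrt (real n * \<epsilon> * D5)" using rest D5 by (intro mult_left_mono real_sqrt_le_mono mult_right_mono) auto
  also have "... = abs t * sqrt (\<epsilon> * D5)" using n by (simp add: u_def real_sqrt_mult mult.assoc)
  finally show ?thesis .
 qed
 have 2: "cmod (?B - \<phi> p u ^ k) \<le> real n * (D * \<eta> ^ (8 * q))"
  using order_trans[OF blocks_char[OF u] mult_right_mono[OF k1]] D_nonneg const by simp
 have 3: "cmod (\<phi> p u ^ k - of_real (exp (- (u^2 * V p / 2))) ^ k) \<le>
   real n * (mom u * (real p ^ 4 * D1) + (u^2 * (real p * D5))^2 / 8)"
 proof -
  have x: "0 \<le> u^2 * V p / 2" using V by simp
  have "cmod (\<phi> p u ^ k - of_real (exp (- (u^2 * V p / 2))) ^ k) \<le> real k * cmod (\<phi> p u - of_real (exp (- (u^2 * V p / 2))))"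
   using \<phi>_le_1 x by (intro norm_power_diff) auto
  also have "cmod (\<phi> p u - of_real (exp (- (u^2 * V p / 2)))) \<le>
   cmod (\<phi> p u - of_real (1 - u^2 * V p / 2)) + cmod (of_real (1 - u^2 * V p / 2) - complex_of_real (exp (- (u^2 * V p / 2))))"
   using norm_triangle_ineq[of "\<phi> p u - of_real (1 - u^2 * V p / 2)" "of_real (1 - u^2 * V p / 2) - complex_of_real (exp (- (u^2 * V p / 2)))"]
   by (simp only: diff_add_cancel add_diff_eq)
  also have "cmod (of_real (1 - u^2 * V p / 2) - complex_of_real (exp (- (u^2 * V p / 2)))) = abs (exp (- (u^2 * V p / 2)) - (1 - u^2 * V p / 2))"
   unfolding of_real_diff[symmetric] norm_of_real by (rule abs_minus_commute)
  also have "... \<le> (u^2 * V p / 2)^2 / 2" by (rule exp_minus_quadratic[OF x])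
  also have "... \<le> (u^2 * (real p * D5) / 2)^2 / 2" using V x by (intro divide_right_mono power_mono mult_left_mono) auto
  also have "cmod (\<phi> p u - of_real (1 - u^2 * V p / 2)) \<le> mom u * (real p ^ 4 * D1)" by (rule \<phi>_taylor)
  also have "(u^2 * (real p * D5) / 2)^2 / 2 = (u^2 * (real p * D5))^2 / 8" by (simp add: power_divide)
  finally have "cmod (\<phi> p u ^ k - of_real (exp (- (u^2 * V p / 2))) ^ k) \<le> real k * (mom u * (real p ^ 4 * D1) + (u^2 * (real p * D5))^2 / 8)"
   by (simp add: mult_left_mono)
  also have "... \<le> real n * (mom u * (real p ^ 4 * D1) + (u^2 * (real p * D5))^2 / 8)" using k1 D_consts by (intro mult_right_mono) auto
  finally show ?thesis .
 qed
 have 4: "cmod (of_real (exp (- (u^2 * V p / 2))) ^ k - complex_of_real (exp (- (t^2 * s / 2)))) \<le> t^2 / 2 * (D4 / real p + (D5 + D4) * \<epsilon>)"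
 proof -
  have "exp (- (u^2 * V p / 2)) ^ k = exp (- (real k * (u^2 * V p / 2)))" by (simp add: exp_of_nat_mult[symmetric])
  then have "cmod (of_real (exp (- (u^2 * V p / 2))) ^ k - complex_of_real (exp (- (t^2 * s / 2))))
   = abs (exp (- (real k * (u^2 * V p / 2))) - exp (- (t^2 * s / 2)))"
   unfolding of_real_power[symmetric] of_real_diff[symmetric] norm_of_real by simp
  also have "... \<le> abs (real k * (u^2 * V p / 2) - t^2 * s / 2)" using V s_bounds by (intro exp_minus_Lipschitz) auto
  also have "real k * (u^2 * V p / 2) - t^2 * s / 2 = t^2 / 2 * (real k / real n * (V p - real p * s) - (1 - real k * real p / real n) * s)"
   unfolding u2 using n by (simp add: field_simps)
  also have "abs (t^2 / 2 * (real k / real n * (V p - real p * s) - (1 - real k * real p / real n) * s))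
   = t^2 / 2 * abs (real k / real n * (V p - real p * s) - (1 - real k * real p / real n) * s)" by (simp add: abs_mult)
  also have "... \<le> t^2 / 2 * (D4 / real p + (D5 + D4) * \<epsilon>)"
  proof (rule mult_left_mono)
   have "abs (real k / real n * (V p - real p * s) - (1 - real k * real p / real n) * s)
    \<le> abs (real k / real n * (V p - real p * s)) + abs ((1 - real k * real p / real n) * s)" by (rule abs_triangle_ineq4)
   moreover have "abs (real k / real n * (V p - real p * s)) \<le> 1 / real p * D4"
    unfolding abs_mult using V_linear[of p] kpn by (intro mult_mono) auto
   moreover have "abs ((1 - real k * real p / real n) * s) \<le> \<epsilon> * (D5 + D4)"
   proof -
    have "0 \<le> 1 - real k * real p / real n" using kp n by simp
    then show ?thesis unfolding abs_mult using rest' s_bounds \<epsilon> by (intro mult_mono) auto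
   qed
   ultimately show "abs (real k / real n * (V p - real p * s) - (1 - real k * real p / real n) * s) \<le> D4 / real p + (D5 + D4) * \<epsilon>"
    by (simp add: mult.commute)
  qed simp
  finally show ?thesis .
 qed
 have "cmod (\<phi> n u - of_real (exp (- (t^2 * s / 2)))) \<le> cmod (\<phi> n u - ?B) + cmod (?B - \<phi> p u ^ k) +
  cmod (\<phi> p u ^ k - of_real (exp (- (u^2 * V p / 2))) ^ k) +
  cmod (of_real (exp (- (u^2 * V p / 2))) ^ k - complex_of_real (exp (- (t^2 * s / 2))))" by (rule norm_triangle4)
 then show ?thesis using 1 2 3 4 unfolding u2[symmetric] u_def[symmetric] by linarith
qed

end

lemma mom_inverse_sqrt: "n > 0 ==> mom (t / sqrt n) = mom t * (1 / n * sqrt (1 / sqrt n))" for t n :: real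
 using mom_scale[of t "1 / sqrt n"] by (simp add: mom_def power_divide)

text \<open>Block length about \<open>n^(1/32)\<close> and gap about \<open>n^(1/64)\<close>: the
  gaps are negligible relative to the blocks, the decoupling error \<open>n * \<eta>^(8 q)\<close>
  still vanishes, and the Taylor error is of order \<open>n^(-1/4)\<close> times the fourth power of
  the block length, that is \<open>n^(-1/8)\<close>.\<close>

lemma mixing_array_clt:
 assumes sys: "\<forall>\<^sub>F n in sequentially. mixing_system (\<nu> n) (g n) h D \<eta> \<delta>"
  and s: "(\<lambda>n. mixing_system.s (\<nu> n) (g n) h) \<longlonglongrightarrow> v"
 shows "(\<lambda>n. mixing_system.\<phi> (\<nu> n) (g n) h n (t / sqrt (real n))) \<longlonglongrightarrow> of_real (exp (- (t^2 * v / 2)))"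
proof -
 obtain n0 where n0: "mixing_system (\<nu> n0) (g n0) h D \<eta> \<delta>" using sys by (auto simp: eventually_sequentially)
 interpret n0: mixing_system "\<nu> n0" "g n0" h D \<eta> \<delta> by (rule n0)
 define a where "a = - 8 * ln \<eta>"
 have a: "a > 0" using n0.const by (simp add: a_def)
 define e :: "nat \<Rightarrow> real" where
  "e n = (real n powr (1/64) + 1) / real n powr (1/32) + (real n powr (1/32) + real n powr (1/64) + 2) / real n" for n
 define E where "E n = abs t * sqrt (e n * n0.D5) + D * (real n * exp (- a * real n powr (1/64))) +
  (mom t * n0.D1 * (sqrt (1 / sqrt (real n)) * (real n powr (1/32) + 1) ^ 4) +
  (t^2 * n0.D5)^2 / 8 * ((real n powr (1/32) + 1)^2 / real n)) +
  t^2 / 2 * (n0.D4 / real n powr (1/32) + (n0.D5 + n0.D4) * e n)" for n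
 have e0: "e \<longlonglongrightarrow> 0" unfolding e_def by real_asymp
 have lim1: "(\<lambda>n. real n * exp (- a * real n powr (1/64))) \<longlonglongrightarrow> 0" using a by real_asymp
 have lim2: "(\<lambda>n. sqrt (1 / sqrt (real n)) * (real n powr (1/32) + 1) ^ 4) \<longlonglongrightarrow> 0" by real_asymp
 have lim3: "(\<lambda>n. (real n powr (1/32) + 1)^2 / real n) \<longlonglongrightarrow> 0" by real_asymp
 have lim4: "(\<lambda>n. n0.D4 / real n powr (1/32)) \<longlonglongrightarrow> 0" by real_asymp
 have "E \<longlonglongrightarrow> abs t * sqrt (0 * n0.D5) + D * 0 + (mom t * n0.D1 * 0 + (t^2 * n0.D5)^2 / 8 * 0) + t^2 / 2 * (0 + (n0.D5 + n0.D4) * 0)"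
  unfolding E_def by (intro tendsto_intros e0 lim1 lim2 lim3 lim4)
 then have E0: "E \<longlonglongrightarrow> 0" by simp
 have bound: "\<forall>\<^sub>F n in sequentially. cmod (mixing_system.\<phi> (\<nu> n) (g n) h n (t / sqrt (real n)) -
   of_real (exp (- (t^2 * mixing_system.s (\<nu> n) (g n) h / 2)))) \<le> E n"
 proof -
  have "(\<lambda>n. abs t / sqrt (real n)) \<longlonglongrightarrow> 0" by real_asymp
  then have "\<forall>\<^sub>F n in sequentially. abs t / sqrt (real n) < \<delta>" using n0.const by (intro order_tendstoD) auto
  then show ?thesis using sys eventually_gt_at_top[of 0]
  proof eventually_elim
   case (elim n)
   interpret mixing_system "\<nu> n" "g n" h D \<eta> \<delta> by (rule elim)
   define p where "p = nat \<lceil>real n powr (1/32)\<rceil>"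
   define q where "q = nat \<lceil>real n powr (1/64)\<rceil>"
   have np: "real n powr (1/32) > 0" using elim by simp
   have p: "real n powr (1/32) \<le> real p" "real p \<le> real n powr (1/32) + 1" "0 < p" unfolding p_def using np by (linarith, linarith, simp)
   have q: "real n powr (1/64) \<le> real q" "real q \<le> real n powr (1/64) + 1"
   proof -
    have "real n powr (1/64) > 0" using elim by simp
    then show "real n powr (1/64) \<le> real q" "real q \<le> real n powr (1/64) + 1" unfolding q_def by linarith+
   qed
   have \<epsilon>: "real q / real p + real (p + q) / real n \<le> e n"
    unfolding e_def using p q np by (intro add_mono frac_le divide_right_mono) auto
   have "\<eta> ^ (8 * q) = exp (real (8 * q) * ln \<eta>)" using const exp_of_nat_mult[of "8 * q" "ln \<eta>"] by simp
   also have "... \<le> exp (- a * real n powr (1/64))" unfolding a_def using q(1) const by (simp add: mult_left_mono_neg)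
   finally have \<eta>q: "\<eta> ^ (8 * q) \<le> exp (- a * real n powr (1/64))" .
   have nn: "real n > 0" using elim by simp
   have mm: "real n * (mom (t / sqrt (real n)) * (real p ^ 4 * D1)) \<le> mom t * D1 * (sqrt (1 / sqrt (real n)) * (real n powr (1/32) + 1) ^ 4)"
   proof -
    have "real n * (mom (t / sqrt (real n)) * (real p ^ 4 * D1)) = mom t * D1 * (sqrt (1 / sqrt (real n)) * real p ^ 4)"
     unfolding mom_inverse_sqrt[OF nn] using nn by simp
    also have "... \<le> mom t * D1 * (sqrt (1 / sqrt (real n)) * (real n powr (1/32) + 1) ^ 4)"
     using p D_consts by (intro mult_left_mono power_mono) auto
    finally show ?thesis .
   qed
   have pp: "real n * ((t^2 / real n * (real p * D5))^2 / 8) \<le> (t^2 * D5)^2 / 8 * ((real n powr (1/32) + 1)^2 / real n)"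
   proof -
    have "real n * ((t^2 / real n * (real p * D5))^2 / 8) = (t^2 * D5)^2 / 8 * ((real p)^2 / real n)"
     using nn by (simp add: power2_eq_square field_simps)
    also have "... \<le> (t^2 * D5)^2 / 8 * ((real n powr (1/32) + 1)^2 / real n)"
     using p by (intro mult_left_mono divide_right_mono power_mono) auto
    finally show ?thesis .
   qed
   let ?\<epsilon> = "real q / real p + real (p + q) / real n"
   have "cmod (\<phi> n (t / sqrt (real n)) - of_real (exp (- (t^2 * s / 2)))) \<le>
    abs t * sqrt (?\<epsilon> * D5) + real n * (D * \<eta> ^ (8 * q)) +
    real n * (mom (t / sqrt (real n)) * (real p ^ 4 * D1) + (t^2 / real n * (real p * D5))^2 / 8) +
    t^2 / 2 * (D4 / real p + (D5 + D4) * ?\<epsilon>)" using elim p by (intro char_estimate) auto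
   also have "... = abs t * sqrt (?\<epsilon> * D5) + D * (real n * \<eta> ^ (8 * q)) +
    (real n * (mom (t / sqrt (real n)) * (real p ^ 4 * D1)) + real n * ((t^2 / real n * (real p * D5))^2 / 8)) +
    t^2 / 2 * (D4 / real p + (D5 + D4) * ?\<epsilon>)" by (simp only: distrib_left mult.left_commute)
   also have "... \<le> E n" unfolding E_def using \<epsilon> \<eta>q mm pp D5 D4 D_nonneg p(1) np mult_pos_pos[OF _ np, of "real p"] p(3)
    by (intro add_mono mult_left_mono real_sqrt_le_mono mult_right_mono divide_left_mono) auto
   finally show ?case .
  qed
 qed
 have "(\<lambda>n. mixing_system.\<phi> (\<nu> n) (g n) h n (t / sqrt (real n)) - of_real (exp (- (t^2 * mixing_system.s (\<nu> n) (g n) h / 2)))) \<longlonglongrightarrow> 0"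
  by (rule Lim_null_comparison[OF bound E0])
 moreover have "(\<lambda>n. complex_of_real (exp (- (t^2 * mixing_system.s (\<nu> n) (g n) h / 2)))) \<longlonglongrightarrow> of_real (exp (- (t^2 * v / 2)))"
  by (intro tendsto_intros s) simp
 ultimately show ?thesis using tendsto_add by fastforce
qed

text \<open>Three approximations, fixed in this order: \<open>s\<close> by the variance at time
  \<open>p\<close> divided by \<open>p\<close>, uniformly over the systems; that variance by a
  characteristic function at a small \<open>u\<close>; and that characteristic function by its limit
  along the array.\<close>

lemma mixing_variance_limit:
 assumes sys: "\<forall>\<^sub>F n in sequentially. mixing_system (\<nu> n) (g n) h D \<eta> \<delta>" and sys0: "mixing_system \<nu>0 g0 h D \<eta> \<delta>"
  and A: "(\<lambda>n. \<integral>x. h x \<partial>\<nu> n) \<longlonglongrightarrow> (LINT x|\<nu>0. h x)"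
  and conv: "\<And>p u. abs u < \<delta> ==> (\<lambda>n. \<integral>x. ei u (birkhoff_sum (g n) h p x) \<partial>\<nu> n) \<longlonglongrightarrow>
   (LINT x|\<nu>0. ei u (birkhoff_sum g0 h p x))"
 shows "(\<lambda>n. mixing_system.s (\<nu> n) (g n) h) \<longlonglongrightarrow> mixing_system.s \<nu>0 g0 h"
proof (rule tendstoI)
 interpret n0: mixing_system \<nu>0 g0 h D \<eta> \<delta> by (rule sys0)
 fix e :: real assume e: "e > 0"
 obtain p where p: "p > 0" "2 * n0.D4 / real p < e / 3"
 proof -
  have "(\<lambda>p. 2 * n0.D4 / real p) \<longlonglongrightarrow> 0" by real_asymp
  then have "\<forall>\<^sub>F p in sequentially. 2 * n0.D4 / real p < e / 3" using e by (intro order_tendstoD) auto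
  then have "\<forall>\<^sub>F p in sequentially. 2 * n0.D4 / real p < e / 3 \<and> p > 0" using eventually_gt_at_top by (rule eventually_conj)
  then show ?thesis using that by (auto simp: eventually_sequentially)
 qed
 define W where "W = real p ^ 4 * n0.D1"
 have W: "W \<ge> 0" using n0.D_consts by (simp add: W_def)
 obtain u where u: "0 < u" "abs u < \<delta>" "4 * sqrt u * W < e / 3"
 proof -
  have "((\<lambda>u. 4 * sqrt u * W) \<longlongrightarrow> 4 * sqrt 0 * W) (at_right 0)" by (intro tendsto_intros)
  then have "\<forall>\<^sub>F u in at_right 0. 4 * sqrt u * W < e / 3" using e by (intro order_tendstoD(2)) auto
  moreover have "\<forall>\<^sub>F u in at_right 0. u < \<delta> \<and> 0 < u" using n0.const by (auto simp: eventually_at_right[of 0 \<delta>] intro: exI[of _ \<delta>])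
  ultimately have "\<forall>\<^sub>F u in at_right (0::real). 4 * sqrt u * W < e / 3 \<and> u < \<delta> \<and> 0 < u" by (rule eventually_conj)
  then have "\<exists>u::real. 4 * sqrt u * W < e / 3 \<and> u < \<delta> \<and> 0 < u" by (rule eventually_happens'[rotated]) simp
  then show ?thesis using that by auto
 qed
 have A': "(\<lambda>n. mixing_system.A (\<nu> n) h) \<longlonglongrightarrow> n0.A"
 proof -
  have "\<forall>\<^sub>F n in sequentially. (LINT x|\<nu> n. h x) = mixing_system.A (\<nu> n) h" using sys by eventually_elim (simp add: mixing_system.A_def)
  then show ?thesis using A unfolding n0.A_def by (rule Lim_transform_eventually[rotated])
 qed
 have \<phi>: "(\<lambda>n. mixing_system.\<phi> (\<nu> n) (g n) h p u) \<longlonglongrightarrow> n0.\<phi> p u"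
 proof -
  have "(\<lambda>n. exp (- (\<i> * of_real u * of_real (real p * mixing_system.A (\<nu> n) h))) * (LINT x|\<nu> n. ei u (birkhoff_sum (g n) h p x)))
   \<longlonglongrightarrow> n0.\<phi> p u" unfolding n0.\<phi>_eq by (intro tendsto_intros A' conv u)
  moreover have "\<forall>\<^sub>F n in sequentially. exp (- (\<i> * of_real u * of_real (real p * mixing_system.A (\<nu> n) h))) * (LINT x|\<nu> n. ei u (birkhoff_sum (g n) h p x))
   = mixing_system.\<phi> (\<nu> n) (g n) h p u" using sys by eventually_elim (simp add: mixing_system.\<phi>_eq)
  ultimately show ?thesis by (rule Lim_transform_eventually)
 qed
 have "(\<lambda>n. 2 * abs (Re (mixing_system.\<phi> (\<nu> n) (g n) h p u) - Re (n0.\<phi> p u)) / u^2) \<longlonglongrightarrow> 2 * abs (Re (n0.\<phi> p u) - Re (n0.\<phi> p u)) / u^2"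
  using u by (intro tendsto_intros \<phi>) auto
 then have "\<forall>\<^sub>F n in sequentially. 2 * abs (Re (mixing_system.\<phi> (\<nu> n) (g n) h p u) - Re (n0.\<phi> p u)) / u^2 < e / 3"
  using e by (intro order_tendstoD) auto
 then show "\<forall>\<^sub>F n in sequentially. dist (mixing_system.s (\<nu> n) (g n) h) n0.s < e" using sys
 proof eventually_elim
  case (elim n)
  interpret mixing_system "\<nu> n" "g n" h D \<eta> \<delta> by (rule elim)
  define x x0 where "x = 2 * (1 - Re (\<phi> p u)) / u^2" and "x0 = 2 * (1 - Re (n0.\<phi> p u)) / u^2"
  have 1: "abs (V p - x) \<le> 2 * sqrt u * W" "abs (n0.V p - x0) \<le> 2 * sqrt u * W"
   using V_low_frequency[OF u(1), of p] n0.V_low_frequency[OF u(1), of p] by (simp_all add: W_def x_def x0_def)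
  have "x - x0 = 2 * (Re (n0.\<phi> p u) - Re (\<phi> p u)) / u^2" by (simp add: x_def x0_def diff_divide_distrib[symmetric] right_diff_distrib)
  then have "abs (x - x0) = abs (2 * (Re (n0.\<phi> p u) - Re (\<phi> p u)) / u^2)" by (simp only:)
  also have "... = 2 * abs (Re (\<phi> p u) - Re (n0.\<phi> p u)) / u^2" unfolding abs_divide abs_mult abs_minus_commute[of "Re (n0.\<phi> p u)"] by simp
  finally have 2: "abs (x - x0) < e / 3" using elim(1) by simp
  have 3: "abs (V p - real p * s) \<le> n0.D4" "abs (n0.V p - real p * n0.s) \<le> n0.D4" using V_linear[of p] n0.V_linear[of p] by simp_all
  have "real p * abs (s - n0.s) = abs (real p * s - real p * n0.s)" by (simp add: abs_mult right_diff_distrib[symmetric])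
  also have "... \<le> 2 * n0.D4 + (4 * sqrt u * W + e / 3)" using 1 2 3 by linarith
  also have "... \<le> 2 * n0.D4 + (e / 3 + e / 3)" using u(3) by simp
  finally have "abs (s - n0.s) \<le> (2 * n0.D4 + (e / 3 + e / 3)) / real p" using p(1) by (simp add: field_simps)
  also have "... = 2 * n0.D4 / real p + (e / 3 + e / 3) / real p" by (rule add_divide_distrib)
  also have "(e / 3 + e / 3) / real p \<le> e / 3 + e / 3" using e p(1) by (simp add: divide_le_eq mult_le_cancel_left1)
  finally show ?case using p(2) by (simp add: dist_real_def)
 qed
qed


text \<open>Polya's theorem. By continuity the limit attains all levels \<open>k / m\<close>;
  monotonicity controls every other point by the two neighbouring level points, and the extreme
  levels are controlled by the range from 0 to 1.\<close>

lemma uniform_cdf_convergence: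
 fixes F :: "nat \<Rightarrow> real \<Rightarrow> real" and M :: "real measure"
 assumes M: "real_distribution M" and cont: "\<And>x. isCont (cdf M) x"
  and mono: "\<And>n x y. x \<le> y ==> F n x \<le> F n y" and bd: "\<And>n x. 0 \<le> F n x" "\<And>n x. F n x \<le> 1"
  and conv: "\<And>x. (\<lambda>n. F n x) \<longlonglongrightarrow> cdf M x" and e: "e > 0"
 shows "\<forall>\<^sub>F n in sequentially. \<forall>z. abs (F n z - cdf M z) \<le> e"
proof -
 interpret real_distribution M by (rule M)
 obtain m :: nat where m: "m > 0" "2 / real m < e / 2"
 proof -
  have "(\<lambda>m. 2 / real m) \<longlonglongrightarrow> 0" by real_asymp
  then have "\<forall>\<^sub>F m in sequentially. 2 / real m < e / 2" using e by (intro order_tendstoD) auto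
  then have "\<forall>\<^sub>F m in sequentially. 2 / real m < e / 2 \<and> m > 0" using eventually_gt_at_top by (rule eventually_conj)
  then show ?thesis using that by (auto simp: eventually_sequentially)
 qed
 have "\<exists>x. cdf M x = real k / real m" if k: "0 < k" "k < m" for k
 proof -
  have "\<forall>\<^sub>F x in at_bot. cdf M x < real k / real m" using k m by (intro order_tendstoD(2)[OF cdf_lim_at_bot]) auto
  then obtain a where a: "\<And>x. x \<le> a ==> cdf M x < real k / real m" by (auto simp: eventually_at_bot_linorder)
  have "\<forall>\<^sub>F x in at_top. cdf M x > real k / real m" using k m by (intro order_tendstoD(1)[OF cdf_lim_at_top_prob]) auto
  then obtain b where b: "\<And>x. x \<ge> b ==> cdf M x > real k / real m" by (auto simp: eventually_at_top_linorder)
  have "\<exists>x. min a b \<le> x \<and> x \<le> b \<and> cdf M x = real k / real m" using a[of "min a b"] b[of b] cont by (intro IVT) auto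
  then show ?thesis by blast
 qed
 then obtain X where X: "\<And>k. 0 < k ==> k < m ==> cdf M (X k) = real k / real m" by metis
 have "\<forall>\<^sub>F n in sequentially. \<forall>k\<in>{..<m}. abs (F n (X k) - cdf M (X k)) < e / 2"
  using tendstoD[OF conv, of "e / 2"] e by (intro eventually_ball_finite) (auto simp: dist_real_def)
 then show ?thesis
 proof eventually_elim
  case (elim n)
  show ?case
  proof
   fix z
   define k where "k = nat \<lfloor>real m * cdf M z\<rfloor>"
   have c: "0 \<le> cdf M z" "cdf M z \<le> 1" using cdf_nonneg cdf_bounded_prob by auto
   have k: "real k \<le> real m * cdf M z" "real m * cdf M z < real k + 1" using c m by (simp_all add: k_def)
   have k': "real k / real m \<le> cdf M z" "cdf M z < (real k + 1) / real m" using k m by (auto simp: field_simps)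
   have up: "F n z \<le> cdf M z + e"
   proof (cases "k + 1 < m")
    case True
    have "cdf M (X (k + 1)) = (real k + 1) / real m" using X[of "k + 1"] True by (simp add: add.commute)
    then have "cdf M z < cdf M (X (k + 1))" using k' by simp
    then have "z \<le> X (k + 1)" using cdf_nondecreasing[of "X (k + 1)" z] by linarith
    then have "F n z \<le> F n (X (k + 1))" by (rule mono)
    also have "... \<le> cdf M (X (k + 1)) + e / 2"
    proof -
     have "abs (F n (X (k + 1)) - cdf M (X (k + 1))) < e / 2" using bspec[OF elim, of "k + 1"] True by simp
     then show ?thesis by linarith
    qed
    also have "... = real k / real m + 1 / real m + e / 2" using X[of "k + 1"] True by (simp add: add_divide_distrib)
    finally show ?thesis using k' m(2) e by (simp add: field_simps)
   next
    case False
    then have "1 \<le> (real k + 1) / real m" using m by (simp add: field_simps)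
    also have "... = real k / real m + 1 / real m" by (rule add_divide_distrib)
    finally have "F n z \<le> real k / real m + 1 / real m" using bd(2) order_trans by blast
    moreover have "1 / real m \<le> e" using m(2) e by simp
    ultimately show ?thesis using k' by linarith
   qed
   have low: "cdf M z - e \<le> F n z"
   proof (cases "1 < k")
    case True
    have "real k \<le> real m * 1" using k(1) c m by (meson mult_left_mono of_nat_0_le_iff order_trans)
    then have km: "k - 1 < m" using True by simp
    have "cdf M (X (k - 1)) = real k / real m - 1 / real m" using X[of "k - 1"] km True by (simp add: of_nat_diff diff_divide_distrib)
    moreover have "1 / real m > 0" using m by simp
    ultimately have "cdf M (X (k - 1)) < cdf M z" using k' by linarith
    then have "X (k - 1) \<le> z" using cdf_nondecreasing[of z "X (k - 1)"] by linarith
    then have "F n (X (k - 1)) \<le> F n z" by (rule mono)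
    moreover have "cdf M (X (k - 1)) - e / 2 \<le> F n (X (k - 1))"
    proof -
     have "abs (F n (X (k - 1)) - cdf M (X (k - 1))) < e / 2" using bspec[OF elim, of "k - 1"] km by simp
     then show ?thesis by linarith
    qed
    moreover have "cdf M z < real k / real m + 1 / real m" using k' by (simp add: add_divide_distrib)
    moreover have "2 / real m = 1 / real m + 1 / real m" by (simp add: add_divide_distrib[symmetric])
    ultimately show ?thesis using \<open>cdf M (X (k - 1)) = _\<close> m(2) by linarith
   next
    case False
    then have "(real k + 1) / real m \<le> 2 / real m" by (intro divide_right_mono) auto
    then have "cdf M z \<le> e" using k' m(2) e by linarith
    then show ?thesis using bd(1)[of n z] by linarith
   qed
   show "abs (F n z - cdf M z) \<le> e" using up low by linarith
  qed
 qed
qed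

lemma cdf_std_normal_continuous: "isCont (cdf std_normal_distribution) x"
proof -
 interpret real_distribution std_normal_distribution by (rule real_dist_normal_dist)
 have "emeasure std_normal_distribution {x} = 0"
  by (subst emeasure_density) (auto intro!: nn_integral_null_set[THEN trans] simp: nn_integral_0_iff_AE AE_lborel_singleton
    split: split_indicator elim!: eventually_mono[OF AE_lborel_singleton[of x]])
 then show ?thesis by (simp add: isCont_cdf measure_def)
qed

text \<open>Dividing by \<open>sqrt v\<close> reduces the claim to the standard normal law, whose
  distribution function is continuous; positivity of \<open>v\<close> enters here.\<close>

lemma normal_limit_uniform:
 assumes P: "\<And>n. prob_space (P n)" and T: "\<And>n. T n \<in> borel_measurable (P n)" and v: "0 < v"
  and conv: "\<And>t. (\<lambda>n. \<integral>x. ei t (T n x) \<partial>P n) \<longlonglongrightarrow> of_real (exp (- (t^2 * v / 2)))"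
  and e: "e > 0"
 shows "\<forall>\<^sub>F n in sequentially. \<forall>z. abs (measure (P n) {x \<in> space (P n). T n x \<le> z} - cdf std_normal_distribution (z / sqrt v)) \<le> e"
proof -
 define R where "R n x = T n x / sqrt v" for n x
 define M where "M n = distr (P n) borel (R n)" for n
 have R [measurable]: "R n \<in> borel_measurable (P n)" for n unfolding R_def using T[of n] by measurable
 have rd: "real_distribution (M n)" for n unfolding M_def using P R by (intro prob_space.real_distribution_distr)
 have cdfM: "cdf (M n) z = measure (P n) {x \<in> space (P n). R n x \<le> z}" for n z
  unfolding cdf_def M_def using R by (subst measure_distr) (auto intro!: arg_cong[where f = "measure (P n)"])
 have "(\<lambda>n. char (M n) t) \<longlonglongrightarrow> char std_normal_distribution t" for t
 proof -
  have "char (M n) t = (LINT x|P n. ei (t / sqrt v) (T n x))" for n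
   unfolding char_def M_def using R by (subst integral_distr) (auto simp: R_def mult_ac)
  moreover have "(t / sqrt v)^2 * v / 2 = t^2 / 2" using v by (simp add: power_divide)
  ultimately show ?thesis using conv[of "t / sqrt v"] by (simp add: char_std_normal_distribution)
 qed
 then have "weak_conv_m M std_normal_distribution" using rd real_dist_normal_dist by (intro levy_continuity) auto
 then have pw: "(\<lambda>n. cdf (M n) x) \<longlonglongrightarrow> cdf std_normal_distribution x" for x
  unfolding weak_conv_m_def weak_conv_def using cdf_std_normal_continuous by blast
 have "\<forall>\<^sub>F n in sequentially. \<forall>z. abs (cdf (M n) z - cdf std_normal_distribution z) \<le> e"
 proof (rule uniform_cdf_convergence[OF real_dist_normal_dist cdf_std_normal_continuous _ _ _ pw e])
  fix n x y
  interpret real_distribution "M n" by (rule rd)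
  show "0 \<le> cdf (M n) x" "cdf (M n) x \<le> 1" by (rule cdf_nonneg cdf_bounded_prob)+
  show "cdf (M n) x \<le> cdf (M n) y" if "x \<le> y" using that by (rule cdf_nondecreasing)
 qed
 then show ?thesis
 proof eventually_elim
  case (elim n)
  show ?case
  proof
   fix z
   have "{x \<in> space (P n). T n x \<le> z} = {x \<in> space (P n). R n x \<le> z / sqrt v}" using v by (auto simp: R_def divide_le_cancel)
   then show "abs (measure (P n) {x \<in> space (P n). T n x \<le> z} - cdf std_normal_distribution (z / sqrt v)) \<le> e"
    using elim[rule_format, of "z / sqrt v"] by (simp add: cdfM)
  qed
 qed
qed

section \<open>Coboundaries\<close>

text \<open>Bounded Birkhoff sums in \<open>L\<^sup>2\<close> make \<open>u\<close> a coboundary. The Cesaro means of \<open>-S\<^sub>n\<close> solve the cohomological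
  equation approximately; minimal norm elements of the decreasing convex sets of approximate solutions form a
  Cauchy sequence by the parallelogram law, so no weak compactness is needed.\<close>

lemma (in prob_space) coboundary_of_bounded_sums:
 fixes u :: "'a \<Rightarrow> real"
 assumes g: "nonsingular M g" and u [measurable]: "u \<in> borel_measurable M"
  and S: "\<And>n. integrable M (\<lambda>x. (birkhoff_sum g u n x)^2)" "\<And>n. (LINT x|M. (birkhoff_sum g u n x)^2) \<le> C"
 obtains l where "l \<in> borel_measurable M" "integrable M (\<lambda>x. (l x)^2)" "AE x in M. u x = l (g x) - l x"
proof -
 note [measurable] = nonsingular_measurable[OF g]
 let ?S = "birkhoff_sum g u"
 have Sm [measurable]: "?S n \<in> borel_measurable M" for n
  using nonsingular_measurable[OF nonsingular_funpow[OF g]] unfolding birkhoff_sum_def by measurable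
 have C: "0 \<le> C" using order_trans[OF _ S(2)[of 0]] by simp
 have sq2: "(a + b)^2 \<le> 2 * a^2 + 2 * b^2" for a b :: real using zero_le_power2[of "a - b"] by (simp add: power2_eq_square algebra_simps)
 \<comment> \<open>Approximate solutions with a prescribed residual: these sets decrease in
   \<open>N\<close> and are closed under midpoints, which is all the convexity that is
   needed.\<close>
 define K where "K N = {f \<in> borel_measurable M. integrable M (\<lambda>x. (f x)^2) \<and>
   integrable M (\<lambda>x. (f (g x) - f x - u x)^2) \<and> (LINT x|M. (f (g x) - f x - u x)^2) \<le> 4 * C / (real (Suc N))^2}" for N
 have K_mono: "K N \<subseteq> K M" if "M \<le> N" for M N
 proof -
  have "4 * C / (real (Suc N))^2 \<le> 4 * C / (real (Suc M))^2"
   using that C by (intro divide_left_mono power_mono mult_pos_pos zero_less_power) auto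
  then show ?thesis unfolding K_def by auto
 qed
 have half: "((a + b) / 2)^2 \<le> (a^2 + b^2) / 2" for a b :: real using sq2[of a b] by (simp add: power_divide)
 have K_half: "(\<lambda>x. (f x + f' x) / 2) \<in> K N" if "f \<in> K N" "f' \<in> K N" for f f' N
 proof -
  have [measurable]: "f \<in> borel_measurable M" "f' \<in> borel_measurable M" using that by (auto simp: K_def)
  have i: "integrable M (\<lambda>x. (f x)^2)" "integrable M (\<lambda>x. (f' x)^2)" using that by (auto simp: K_def)
  define r r' where "r x = f (g x) - f x - u x" and "r' x = f' (g x) - f' x - u x" for x
  have [measurable]: "r \<in> borel_measurable M" "r' \<in> borel_measurable M" unfolding r_def r'_def by measurable
  have ir: "integrable M (\<lambda>x. (r x)^2)" "integrable M (\<lambda>x. (r' x)^2)"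
   "(LINT x|M. (r x)^2) \<le> 4 * C / (real (Suc N))^2" "(LINT x|M. (r' x)^2) \<le> 4 * C / (real (Suc N))^2"
   using that by (auto simp: K_def r_def r'_def)
  have eq: "(f (g x) + f' (g x)) / 2 - (f x + f' x) / 2 - u x = (r x + r' x) / 2" for x by (simp add: r_def r'_def field_simps)
  have i3: "integrable M (\<lambda>x. ((f x + f' x) / 2)^2)"
   by (rule dominated[of M "\<lambda>x. ((f x)^2 + (f' x)^2) / 2"]) (use i half in auto)
  have i4: "integrable M (\<lambda>x. ((r x + r' x) / 2)^2)"
   by (rule dominated[of M "\<lambda>x. ((r x)^2 + (r' x)^2) / 2"]) (use ir half in auto)
  have "(LINT x|M. ((r x + r' x) / 2)^2) \<le> (LINT x|M. ((r x)^2 + (r' x)^2) / 2)" using i4 ir half by (intro integral_mono) auto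
  also have "... = ((LINT x|M. (r x)^2) + (LINT x|M. (r' x)^2)) / 2" using ir by simp
  also have "... \<le> 4 * C / (real (Suc N))^2" using ir by simp
  finally have "(LINT x|M. ((r x + r' x) / 2)^2) \<le> 4 * C / (real (Suc N))^2" .
  then show ?thesis using i3 i4 unfolding K_def mem_Collect_eq eq by simp
 qed
 have K_ne: "\<exists>f\<in>K N. (LINT x|M. (f x)^2) \<le> C" for N
 proof -
  define n where "n = Suc N"
  have n: "real n > 0" by (simp add: n_def)
  \<comment> \<open>For this mean the residual telescopes to \<open>(S_1 - S_(n+1)) / n\<close>. The
    bound on the two sums and \<open>(a + b)^2 \<le> 2 a^2 + 2 b^2\<close> produce the constant
    \<open>4 * C\<close>.\<close>
  define f where "f x = - (\<Sum>j<n. ?S (Suc j) x) / real n" for x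
  have [measurable]: "f \<in> borel_measurable M" unfolding f_def by measurable
  have shift: "?S j (g x) = ?S (Suc j) x - u x" for j x using birkhoff_sum_add[of g u 1 j x] by (simp add: birkhoff_sum_def)
  have r: "f (g x) - f x - u x = - (?S (Suc n) x + (- ?S 1 x)) / real n" for x
  proof -
   have "(\<Sum>j<n. ?S (Suc j) (g x)) = (\<Sum>j<n. ?S (Suc (Suc j)) x) - real n * u x" by (simp add: shift sum_subtractf)
   moreover have "(\<Sum>j<n. ?S (Suc (Suc j)) x) - (\<Sum>j<n. ?S (Suc j) x) = ?S (Suc n) x - ?S 1 x"
    using sum_lessThan_telescope[of "\<lambda>j. ?S (Suc j) x" n] by (simp add: sum_subtractf)
   moreover have "real n * f y = - (\<Sum>j<n. ?S (Suc j) y)" for y using n by (simp add: f_def)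
   ultimately have "real n * (f (g x) - f x - u x) = - (?S (Suc n) x + (- ?S 1 x))" by (simp add: right_diff_distrib)
   then show ?thesis using n by (simp add: eq_divide_eq mult.commute)
  qed
  have cs: "(f x)^2 \<le> (\<Sum>j<n. (?S (Suc j) x)^2) / real n" for x
  proof -
   have "(\<Sum>j<n. ?S (Suc j) x * 1)^2 \<le> (\<Sum>j<n. (?S (Suc j) x)^2) * (\<Sum>j<n. 1^2)" by (rule Cauchy_Schwarz_ineq_sum)
   then have "(\<Sum>j<n. ?S (Suc j) x)^2 / (real n)^2 \<le> (\<Sum>j<n. (?S (Suc j) x)^2) * real n / (real n)^2" by (intro divide_right_mono) auto
   moreover have "(\<Sum>j<n. (?S (Suc j) x)^2) * real n / (real n)^2 = (\<Sum>j<n. (?S (Suc j) x)^2) / real n"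
    using n by (simp add: power2_eq_square)
   ultimately show ?thesis by (simp only: f_def power_divide power2_minus)
  qed
  have if2: "integrable M (\<lambda>x. (f x)^2)" by (rule dominated[of M "\<lambda>x. (\<Sum>j<n. (?S (Suc j) x)^2) / real n"])
    (use S cs in \<open>auto simp: sum_nonneg\<close>)
  have "(LINT x|M. (f x)^2) \<le> (LINT x|M. (\<Sum>j<n. (?S (Suc j) x)^2) / real n)" using if2 S cs by (intro integral_mono) auto
  also have "... = (\<Sum>j<n. (LINT x|M. (?S (Suc j) x)^2)) / real n" using S by simp
  also have "... \<le> (real n * C) / real n"
   using sum_bounded_above[of "{..<n}" "\<lambda>j. \<integral>x. (?S (Suc j) x)^2 \<partial>M" C] S by (intro divide_right_mono) auto
  also have "... = C" by (simp add: n_def del: of_nat_Suc)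
  finally have f2: "(LINT x|M. (f x)^2) \<le> C" .
  have rb: "(- (?S (Suc n) x + (- ?S 1 x)) / real n)^2 \<le> (2 * (?S (Suc n) x)^2 + 2 * (?S 1 x)^2) / (real n)^2" for x
   unfolding power_divide power2_minus using sq2[of "?S (Suc n) x" "- ?S 1 x"] by (intro divide_right_mono) auto
  have ir: "integrable M (\<lambda>x. (- (?S (Suc n) x + (- ?S 1 x)) / real n)^2)"
   by (rule dominated[of M "\<lambda>x. (2 * (?S (Suc n) x)^2 + 2 * (?S 1 x)^2) / (real n)^2"])
    (use S(1)[of "Suc n"] S(1)[of 1] rb in auto)
  have "(LINT x|M. (- (?S (Suc n) x + (- ?S 1 x)) / real n)^2) \<le> (LINT x|M. (2 * (?S (Suc n) x)^2 + 2 * (?S 1 x)^2) / (real n)^2)"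
   using ir S(1)[of "Suc n"] S(1)[of 1] rb by (intro integral_mono) auto
  also have "... = (2 * (LINT x|M. (?S (Suc n) x)^2) + 2 * (LINT x|M. (?S 1 x)^2)) / (real n)^2" using S(1)[of "Suc n"] S(1)[of 1] by simp
  also have "... \<le> (2 * C + 2 * C) / (real n)^2" using S(2)[of "Suc n"] S(2)[of 1] by (intro divide_right_mono add_mono mult_left_mono) auto
  finally have "(LINT x|M. (- (?S (Suc n) x + (- ?S 1 x)) / real n)^2) \<le> 4 * C / (real (Suc N))^2" by (simp add: n_def)
  then have "f \<in> K N" unfolding K_def mem_Collect_eq r using if2 ir by simp
  then show ?thesis using f2 by blast
 qed
 define E where "E f = (LINT x|M. (f x)^2)" for f :: "'a \<Rightarrow> real"
 define d where "d N = Inf (E ` K N)" for N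
 have E0: "0 \<le> E f" for f by (simp add: E_def)
 have bdd: "bdd_below (E ` K N)" for N using E0 by (intro bdd_belowI[of _ 0]) auto
 have d_le: "d N \<le> E f" if "f \<in> K N" for f N unfolding d_def using that bdd by (intro cInf_lower) auto
 have d_mono: "d M \<le> d N" if "M \<le> N" for M N unfolding d_def using K_ne[of N] K_mono[OF that] bdd by (intro cInf_superset_mono) auto
 have d_C: "d N \<le> C" for N using K_ne[of N] d_le[of _ N] unfolding E_def by (meson order_trans)
 have "\<exists>f\<in>K N. E f < d N + 1 / real (Suc N)" for N
 proof -
  have "Inf (E ` K N) < d N + 1 / real (Suc N)" by (simp add: d_def)
  then show ?thesis using K_ne[of N] cInf_lessD[of "E ` K N"] by blast
 qed
 then obtain z where z: "\<And>N. z N \<in> K N" "\<And>N. E (z N) < d N + 1 / real (Suc N)" by metis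
 have zm [measurable]: "z N \<in> borel_measurable M" and zi: "integrable M (\<lambda>x. (z N x)^2)" for N using z(1)[of N] by (auto simp: K_def)
 \<comment> \<open>The midpoint of \<open>z m\<close> and \<open>z n\<close> lies in
   \<open>K m\<close>, so its energy is at least \<open>d m\<close>; the parallelogram law turns
   this into smallness of the difference, because \<open>d\<close> is bounded and
   increasing.\<close>
 have para: "(LINT x|M. (z m x - z n x)^2) \<le> 2 * (d n - d m) + 4 / real (Suc m)" if "m \<le> n" for m n
 proof -
  have km: "(\<lambda>x. (z m x + z n x) / 2) \<in> K m" using z(1)[of m] z(1)[of n] K_mono[OF that] by (intro K_half) auto
  then have i: "integrable M (\<lambda>x. ((z m x + z n x) / 2)^2)" by (auto simp: K_def)
  have "(z m x - z n x)^2 = 2 * (z m x)^2 + 2 * (z n x)^2 - 4 * ((z m x + z n x) / 2)^2" for x by (simp add: power2_eq_square field_simps)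
  then have "(LINT x|M. (z m x - z n x)^2) = 2 * E (z m) + 2 * E (z n) - 4 * E (\<lambda>x. (z m x + z n x) / 2)" using zi i by (simp add: E_def)
  moreover have "1 / real (Suc n) \<le> 1 / real (Suc m)" using that by (intro divide_left_mono) auto
  ultimately show ?thesis using z(2)[of m] z(2)[of n] d_le[OF km] by (simp add: E_def)
 qed
 have "Bseq d"
 proof (rule BseqI')
  show "norm (d n) \<le> C" for n
  proof -
   have "0 \<le> d n" unfolding d_def using K_ne[of n] E0 by (intro cInf_greatest) auto
   then show ?thesis using d_C by simp
  qed
 qed
 then have "convergent d" using d_mono by (intro Bseq_mono_convergent) auto
 then obtain dl where dl: "d \<longlonglongrightarrow> dl" by (auto simp: convergent_def)
 have d_dl: "d n \<le> dl" for n
 proof (rule LIMSEQ_le_const[OF dl])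
  show "\<exists>N. \<forall>k\<ge>N. d n \<le> d k" using d_mono by blast
 qed
 have L1: "(LINT x|M. abs (z m x - z n x)) \<le> sqrt (2 * (dl - d m) + 4 / real (Suc m))" if "m \<le> n" for m n
 proof -
  have i: "integrable M (\<lambda>x. (z m x - z n x)^2)"
  proof (rule dominated[of M "\<lambda>x. 2 * (z m x)^2 + 2 * (z n x)^2"])
   show "AE x in M. norm ((z m x - z n x)^2) \<le> norm (2 * (z m x)^2 + 2 * (z n x)^2)"
    using sq2[of "z m _" "- z n _"] by (intro AE_I2) simp
  qed (use zi in auto)
  have "(LINT x|M. abs ((z m x - z n x) * 1)) \<le> sqrt (LINT x|M. (z m x - z n x)^2) * sqrt (LINT x|M. 1^2)"
   using i by (intro integral_Cauchy_Schwarz(2)) auto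
  also have "... \<le> sqrt (2 * (dl - d m) + 4 / real (Suc m))" using para[OF that] d_dl[of n] by (simp add: prob_space)
  finally show ?thesis by simp
 qed
 have zint: "integrable M (z n)" for n by (rule square_integrable_imp_integrable[OF zm zi])
 have "(\<lambda>m. sqrt (2 * (dl - d m) + 4 / real (Suc m))) \<longlonglongrightarrow> sqrt (2 * (dl - dl) + 0)"
  by (intro tendsto_intros dl LIMSEQ_Suc[OF lim_const_over_n])
 then have lim0: "(\<lambda>m. sqrt (2 * (dl - d m) + 4 / real (Suc m))) \<longlonglongrightarrow> 0" by simp
 have cau: "\<exists>N. \<forall>i\<ge>N. \<forall>j\<ge>N. (LINT x|M. norm (z i x - z j x)) < e" if "e > 0" for e
 proof -
  have "\<forall>\<^sub>F m in sequentially. sqrt (2 * (dl - d m) + 4 / real (Suc m)) < e" using lim0 that by (intro order_tendstoD)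
  then obtain N where N: "\<And>m. m \<ge> N ==> sqrt (2 * (dl - d m) + 4 / real (Suc m)) < e" by (auto simp: eventually_sequentially)
  have "(LINT x|M. norm (z i x - z j x)) < e" if "i \<ge> N" "j \<ge> N" for i j
  proof (cases "i \<le> j")
   case True then show ?thesis using L1[OF True] N[OF that(1)] by simp
  next
   case False
   then have "(LINT x|M. abs (z j x - z i x)) < e" using L1[of j i] N[OF that(2)] by simp
   then show ?thesis by (simp add: abs_minus_commute)
  qed
  then show ?thesis by blast
 qed
 obtain r where r: "strict_mono r" "AE x in M. Cauchy (\<lambda>i. z (r i) x)" using cauchy_L1_AE_cauchy_subseq[OF zint cau] by blast
 define R where "R N x = z N (g x) - z N x - u x" for N x
 have Rm [measurable]: "R N \<in> borel_measurable M" for N unfolding R_def by measurable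
 have Ri: "integrable M (\<lambda>x. (R N x)^2)" "(LINT x|M. (R N x)^2) \<le> 4 * C / (real (Suc N))^2" for N
  using z(1)[of N] by (auto simp: K_def R_def)
 have R1: "integrable M (R N)" for N by (rule square_integrable_imp_integrable[OF Rm Ri(1)])
 have R1b: "(LINT x|M. norm (R N x)) \<le> sqrt (4 * C) / real (Suc N)" for N
 proof -
  have "(LINT x|M. abs (R N x * 1)) \<le> sqrt (LINT x|M. (R N x)^2) * sqrt (LINT x|M. 1^2)" using Ri by (intro integral_Cauchy_Schwarz(2)) auto
  also have "... \<le> sqrt (4 * C / (real (Suc N))^2)" using Ri(2)[of N] by (simp add: prob_space)
  also have "... = sqrt (4 * C) / real (Suc N)" by (simp add: real_sqrt_divide)
  finally show ?thesis by simp
 qed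
 have "(\<lambda>N. \<integral>x. norm (R (r N) x) \<partial>M) \<longlonglongrightarrow> 0"
 proof (rule tendsto_sandwich[OF _ _ tendsto_const])
  show "(\<lambda>N. sqrt (4 * C) / real (Suc (r N))) \<longlonglongrightarrow> 0"
   using LIMSEQ_subseq_LIMSEQ[OF LIMSEQ_Suc[OF lim_const_over_n] r(1)] by (simp add: comp_def)
 qed (use R1b in auto)
 then obtain q where q: "strict_mono q" "AE x in M. (\<lambda>i. R (r (q i)) x) \<longlonglongrightarrow> 0" using tendsto_L1_AE_subseq[of M "\<lambda>N. R (r N)"] R1 by blast
 define l where "l x = lim (\<lambda>i. z (r (q i)) x)" for x
 have l [measurable]: "l \<in> borel_measurable M" unfolding l_def by measurable
 have conv: "AE x in M. (\<lambda>i. z (r (q i)) x) \<longlonglongrightarrow> l x" using r(2)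
 proof eventually_elim
  case (elim x)
  have "convergent (\<lambda>i. z (r i) x)" using elim by (simp add: Cauchy_convergent_iff)
  then have "convergent (\<lambda>i. z (r (q i)) x)" using convergent_subseq_convergent[OF _ q(1)] by (simp add: comp_def)
  then show ?case by (simp add: l_def convergent_LIMSEQ_iff)
 qed
 \<comment> \<open>Non-singularity transports almost everywhere convergence from \<open>x\<close> to
   \<open>g x\<close>, so the approximate equation passes to the limit along the
   subsequence.\<close>
 have "AE x in M. u x = l (g x) - l x" using conv nonsingular_AE[OF g conv] q(2)
 proof eventually_elim
  case (elim x)
  have "(\<lambda>i. R (r (q i)) x) \<longlonglongrightarrow> l (g x) - l x - u x" unfolding R_def by (intro tendsto_intros elim)
  then have "l (g x) - l x - u x = 0" using elim(3) LIMSEQ_unique by blast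
  then show ?case by simp
 qed
 moreover have "integrable M (\<lambda>x. (l x)^2)"
 \<comment> \<open>The subsequence is extracted from convergence in L^1; square integrability of the
   limit comes from Fatou and the bound \<open>C + 1\<close> on the energies.\<close>
 proof (rule integrableI_bounded)
  have "(\<integral>\<^sup>+x. ennreal (norm ((l x)^2)) \<partial>M) = (\<integral>\<^sup>+x. liminf (\<lambda>i. ennreal ((z (r (q i)) x)^2)) \<partial>M)"
  proof (intro nn_integral_cong_AE)
   show "AE x in M. ennreal (norm ((l x)^2)) = liminf (\<lambda>i. ennreal ((z (r (q i)) x)^2))" using conv
   proof eventually_elim
    case (elim x)
    have "(\<lambda>i. ennreal ((z (r (q i)) x)^2)) \<longlonglongrightarrow> ennreal ((l x)^2)" by (intro tendsto_ennrealI tendsto_intros elim)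
    then have "liminf (\<lambda>i. ennreal ((z (r (q i)) x)^2)) = ennreal ((l x)^2)" by (rule lim_imp_Liminf[OF trivial_limit_sequentially])
    then show ?case by simp
   qed
  qed
  also have "... \<le> liminf (\<lambda>i. \<integral>\<^sup>+x. ennreal ((z (r (q i)) x)^2) \<partial>M)" by (intro nn_integral_liminf) measurable
  also have "... \<le> liminf (\<lambda>i. ennreal (C + 1))"
  proof (intro Liminf_mono always_eventually allI)
   fix i
   have "E (z (r (q i))) \<le> C + 1"
   proof -
    have "1 / real (Suc (r (q i))) \<le> 1" by simp
    then show ?thesis using z(2)[of "r (q i)"] d_C[of "r (q i)"] by linarith
   qed
   then show "(\<integral>\<^sup>+x. ennreal ((z (r (q i)) x)^2) \<partial>M) \<le> ennreal (C + 1)"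
    using zi by (subst nn_integral_eq_integral) (auto simp: E_def intro: ennreal_leI)
  qed
  also have "... = ennreal (C + 1)" by (simp add: Liminf_const)
  finally show "(\<integral>\<^sup>+x. ennreal (norm ((l x)^2)) \<partial>M) < \<infinity>" by (simp add: order_le_less_trans)
 qed measurable
 ultimately show ?thesis using that l by blast
qed

text \<open>Zero asymptotic variance bounds the Birkhoff sums in L^2 of the invariant law, whereas
  the coboundary is wanted in L^2 of \<open>m\<close>. The hypothesis \<open>close\<close> compares
  covariances under the two laws, by the same low-frequency device as in \<open>c_bound\<close>; the
  differences decay exponentially in the later time and are therefore summable over all
  pairs.\<close>

lemma (in mixing_system) coboundary_of_zero_variance:
 assumes m: "prob_space m" and sets: "sets \<nu> = sets m" and g: "nonsingular m g" and s0: "s = 0"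
  and D': "\<And>k. integrable m (\<lambda>x. mom (h ((g ^^ k) x)))" "\<And>k. (LINT x|m. mom (h ((g ^^ k) x))) \<le> D'"
  and close: "\<And>u j k. [|abs u < \<delta>; j \<le> k|] ==>
   cmod ((LINT x|m. ei u (h ((g ^^ j) x)) * of_real (ht ((g ^^ k) x)))
     - (LINT x|\<nu>. ei u (h ((g ^^ j) x)) * of_real (ht ((g ^^ k) x)))) \<le> B * \<eta> ^ (8 * k)"
 shows "cohomologous_to_constant_L2 m g h"
proof -
 interpret m: prob_space m by (rule m)
 have meas: "f \<in> borel_measurable m" if "f \<in> borel_measurable \<nu>" for f :: "_ \<Rightarrow> real" using that measurable_cong_sets[OF sets refl] by blast
 have hk [measurable]: "(\<lambda>x. h ((g ^^ k) x)) \<in> borel_measurable \<nu>" "(\<lambda>x. ht ((g ^^ k) x)) \<in> borel_measurable \<nu>" for k by measurable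
 note hkm [measurable] = meas[OF hk(1)] meas[OF hk(2)]
 define E where "E = 8 * (max D D' + mom A) + 1"
 have momt: "integrable P (\<lambda>x. mom (ht ((g ^^ k) x)))" "(LINT x|P. mom (ht ((g ^^ k) x))) \<le> E - 1"
  if P: "prob_space P" "(\<lambda>x. h ((g ^^ k) x)) \<in> borel_measurable P" and i: "integrable P (\<lambda>x. mom (h ((g ^^ k) x)))"
   and b: "(LINT x|P. mom (h ((g ^^ k) x))) \<le> max D D'" for P k
 proof -
  interpret P: prob_space P by (rule P)
  note [measurable] = P(2)
  have i8: "integrable P (\<lambda>x. 8 * (mom (h ((g ^^ k) x)) + mom A))" using i by simp
  have [measurable]: "(\<lambda>x. ht ((g ^^ k) x)) \<in> borel_measurable P" unfolding ht_def by measurable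
  show 1: "integrable P (\<lambda>x. mom (ht ((g ^^ k) x)))"
   by (rule dominated[OF i8]) (use mom_diff in \<open>auto simp: ht_def add_nonneg_nonneg\<close>)
  have "(LINT x|P. mom (ht ((g ^^ k) x))) \<le> (LINT x|P. 8 * (mom (h ((g ^^ k) x)) + mom A))"
   using 1 i8 mom_diff by (intro integral_mono) (auto simp: ht_def)
  also have "... = 8 * ((LINT x|P. mom (h ((g ^^ k) x))) + mom A)" using i by (simp add: P.prob_space)
  also have "... \<le> E - 1" using b by (simp add: E_def)
  finally show "(LINT x|P. mom (ht ((g ^^ k) x))) \<le> E - 1" .
 qed
 have hmom: "integrable \<nu> (\<lambda>x. mom (h ((g ^^ k) x)))" "(LINT x|\<nu>. mom (h ((g ^^ k) x))) \<le> max D D'" for k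
  using integrable_pow[OF h_mom(1), of k] integral_pow[of "\<lambda>x. mom (h x)" k] h_mom(2) by auto
 have D'': "(LINT x|m. mom (h ((g ^^ k) x))) \<le> max D D'" for k using D'(2)[of k] by simp
 note mt = momt[OF m hkm(1) D'(1) D''] and mt\<nu> = momt[OF prob_space_axioms hk(1) hmom]
 have sqm: "integrable m (\<lambda>x. (ht ((g ^^ k) x))^2)" "(LINT x|m. (ht ((g ^^ k) x))^2) \<le> E"
  and sq\<nu>: "integrable \<nu> (\<lambda>x. (ht ((g ^^ k) x))^2)" "(LINT x|\<nu>. (ht ((g ^^ k) x))^2) \<le> E" for k
  using m.mom_integrable_square(1)[OF hkm(2) mt(1), of k] mom_integrable_square(1)[OF hk(2) mt\<nu>(1), of k]
   m.mom_integrable_square(3)[OF hkm(2) mt(1), of k] mom_integrable_square(3)[OF hk(2) mt\<nu>(1), of k] mt(2)[of k] mt\<nu>(2)[of k]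
  by - (assumption, linarith, assumption, linarith)
 have E: "0 \<le> E" using order_trans[OF _ sqm(2)[of 0]] by simp
 have B: "0 \<le> B" using order_trans[OF norm_ge_zero close[of 0 0 0]] const by simp
 define Z where "Z P j k = (LINT x|P. ht ((g ^^ j) x) * ht ((g ^^ k) x))" for P j k
 define C where "C = B * (2 / \<delta>) + 5 * (max D D' + E) + abs A * B"
 have max0: "0 \<le> max D D'" using D_nonneg by simp
 have C0: "0 \<le> C" using B E const max0 by (simp add: C_def add_nonneg_nonneg)
 have Z: "abs (Z m j k - Z \<nu> j k) \<le> C * \<eta> ^ k" if jk: "j \<le> k" for j k
 proof -
  define X Y where "X x = h ((g ^^ j) x)" and "Y x = ht ((g ^^ k) x)" for x
  have XY [measurable]: "X \<in> borel_measurable \<nu>" "Y \<in> borel_measurable \<nu>" "X \<in> borel_measurable m" "Y \<in> borel_measurable m"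
   unfolding X_def Y_def by measurable
  define u where "u = \<delta> / 2 * \<eta> ^ (4 * k)"
  have u: "0 < u" "abs u < \<delta>" "sqrt u \<le> \<eta> ^ (2 * k)"
  proof -
   show "0 < u" using const by (simp add: u_def)
   have "u \<le> \<delta> / 2 * 1" unfolding u_def using const by (intro mult_left_mono power_le_one) auto
   then show "abs u < \<delta>" using const \<open>0 < u\<close> by simp
   have "u \<le> 1 * \<eta> ^ (4 * k)" unfolding u_def using const by (intro mult_right_mono) auto
   then have "u \<le> (\<eta> ^ (2 * k))^2" by (simp add: power_mult[symmetric] mult.commute)
   then show "sqrt u \<le> \<eta> ^ (2 * k)" using const by (intro real_le_lsqrt) (auto simp: u_def)
  qed
  have split: "abs ((LINT x|P. X x * Y x) - (LINT x|P. sin (u * X x) / u * Y x)) \<le> (5/2) * (max D D' + E) * \<eta> ^ k"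
   and int: "integrable P (\<lambda>x. X x * Y x)" "integrable P (\<lambda>x. sin (u * X x) / u * Y x)" "integrable P Y"
   if P: "prob_space P" "X \<in> borel_measurable P" "Y \<in> borel_measurable P" "integrable P (\<lambda>x. mom (X x))" "(LINT x|P. mom (X x)) \<le> max D D'"
    "integrable P (\<lambda>x. (Y x)^2)" "(LINT x|P. (Y x)^2) \<le> E" for P
  proof -
   interpret P: prob_space P by (rule P)
   have a: "0 < \<eta> ^ k" using const by simp
   note sp = P.low_frequency_split[OF P(2,3,4,6) u(1) a]
   show "integrable P (\<lambda>x. X x * Y x)" "integrable P (\<lambda>x. sin (u * X x) / u * Y x)" by (rule sp)+
   show "integrable P Y" by (rule P.square_integrable_imp_integrable[OF P(3,6)])
   have "2 * sqrt u * (LINT x|P. mom (X x)) / \<eta> ^ k + \<eta> ^ k / 2 * (LINT x|P. (Y x)^2) \<le>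
    2 * \<eta> ^ (2 * k) * max D D' / \<eta> ^ k + \<eta> ^ k / 2 * E"
    using u(3) P(5,7) const max0 by (intro add_mono divide_right_mono mult_mono mult_left_mono) auto
   also have "\<eta> ^ (2 * k) = \<eta> ^ k * \<eta> ^ k" by (metis mult_2 power_add)
   also have "2 * (\<eta> ^ k * \<eta> ^ k) * max D D' / \<eta> ^ k + \<eta> ^ k / 2 * E = (2 * max D D' + E / 2) * \<eta> ^ k" using a by (simp add: field_simps)
   also have "... \<le> (5/2) * (max D D' + E) * \<eta> ^ k" using a max0 E by (intro mult_right_mono) auto
   finally show "abs ((LINT x|P. X x * Y x) - (LINT x|P. sin (u * X x) / u * Y x)) \<le> (5/2) * (max D D' + E) * \<eta> ^ k" using sp(1) by linarith
  qed
  note sm = split[OF m XY(3,4) D'(1)[of j, folded X_def] D''[of j, folded X_def] sqm[of k, folded Y_def]]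
   and im = int[OF m XY(3,4) D'(1)[of j, folded X_def] D''[of j, folded X_def] sqm[of k, folded Y_def]]
   and s\<nu> = split[OF prob_space_axioms XY(1,2) hmom[of j, folded X_def] sq\<nu>[of k, folded Y_def]]
   and i\<nu> = int[OF prob_space_axioms XY(1,2) hmom[of j, folded X_def] sq\<nu>[of k, folded Y_def]]
  have ei: "integrable P (\<lambda>x. ei u (X x) * of_real (Y x))"
   if "X \<in> borel_measurable P" "integrable P Y" for P
  proof (rule dominated[OF that(2)])
   note [measurable] = that(1) borel_measurable_integrable[OF that(2)]
   show "(\<lambda>x. ei u (X x) * of_real (Y x)) \<in> borel_measurable P" by measurable
  qed (simp add: norm_mult)
  have sinI: "(LINT x|P. sin (u * X x) / u * Y x) = Im (LINT x|P. ei u (X x) * of_real (Y x)) / u"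
   if "X \<in> borel_measurable P" "integrable P Y" for P unfolding integral_Im[OF ei[OF that], symmetric] by (simp add: Im_exp)
  have sin_close: "abs ((LINT x|m. sin (u * X x) / u * Y x) - (LINT x|\<nu>. sin (u * X x) / u * Y x)) \<le> B * (2 / \<delta>) * \<eta> ^ k"
  proof -
   have "abs (Im (LINT x|m. ei u (X x) * of_real (Y x)) - Im (LINT x|\<nu>. ei u (X x) * of_real (Y x))) \<le> B * \<eta> ^ (8 * k)"
    using order_trans[OF abs_Im_le_cmod close[OF u(2) jk]] by (simp add: X_def Y_def)
   then have "abs (Im (LINT x|m. ei u (X x) * of_real (Y x)) - Im (LINT x|\<nu>. ei u (X x) * of_real (Y x))) / u \<le> B * \<eta> ^ (8 * k) / u"
    using u by (intro divide_right_mono) auto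
   also have "B * \<eta> ^ (8 * k) / u = B * (2 / \<delta>) * (\<eta> ^ (8 * k) / \<eta> ^ (4 * k))" using const by (simp add: u_def)
   also have "\<eta> ^ (8 * k) / \<eta> ^ (4 * k) = \<eta> ^ (4 * k)" using const by (simp add: power_diff[symmetric])
   also have "B * (2 / \<delta>) * \<eta> ^ (4 * k) \<le> B * (2 / \<delta>) * \<eta> ^ k" using const B by (intro mult_left_mono power_decreasing) auto
   finally show ?thesis unfolding sinI[OF XY(3) im(3)] sinI[OF XY(1) i\<nu>(3)] diff_divide_distrib[symmetric] abs_divide using u(1) by simp
  qed
  have Y_close: "abs ((LINT x|m. Y x) - (LINT x|\<nu>. Y x)) \<le> B * \<eta> ^ k"
  proof -
   \<comment> \<open>The case of frequency 0 in \<open>close\<close> compares the means of the later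
     factor.\<close>
   have "cmod (of_real (LINT x|m. Y x) - of_real (LINT x|\<nu>. Y x)) \<le> B * \<eta> ^ (8 * k)" using close[of 0 k k] const unfolding Y_def by simp
   also have "... \<le> B * \<eta> ^ k" using B const by (intro mult_left_mono power_decreasing) auto
   finally show ?thesis by (simp add: of_real_diff[symmetric] del: of_real_diff)
  qed
  have ZX: "Z P j k = (LINT x|P. X x * Y x) - A * (LINT x|P. Y x)"
   if "integrable P (\<lambda>x. X x * Y x)" "integrable P Y" for P
  proof -
   have "Z P j k = (LINT x|P. X x * Y x - A * Y x)" unfolding Z_def Y_def[symmetric] by (simp add: X_def ht_def left_diff_distrib)
   then show ?thesis using that by simp
  qed
  have "abs (Z m j k - Z \<nu> j k) \<le> (5/2) * (max D D' + E) * \<eta> ^ k + B * (2 / \<delta>) * \<eta> ^ k + (5/2) * (max D D' + E) * \<eta> ^ k + abs A * (B * \<eta> ^ k)"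
  proof -
   have "abs (A * (LINT x|m. Y x) - A * (LINT x|\<nu>. Y x)) \<le> abs A * (B * \<eta> ^ k)"
    unfolding right_diff_distrib[symmetric] abs_mult using Y_close by (intro mult_left_mono) auto
   then show ?thesis unfolding ZX[OF im(1,3)] ZX[OF i\<nu>(1,3)] using sm s\<nu> sin_close by linarith
  qed
  also have "... = C * \<eta> ^ k" by (simp add: C_def algebra_simps)
  finally show ?thesis .
 qed
 have Zsym: "Z P j k = Z P k j" for P j k by (simp add: Z_def mult.commute)
 \<comment> \<open>Decay in the larger of two times becomes a product bound,
   \<open>\<eta>^k \<le> \<xi>^j * \<xi>^k\<close> for \<open>j \<le> k\<close>, so the double sum
   factors into two geometric sums.\<close>
 define \<xi> where "\<xi> = sqrt \<eta>"
 have \<xi>: "0 < \<xi>" "\<xi> < 1" "\<xi> * \<xi> = \<eta>" using const by (auto simp: \<xi>_def)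
 have Z': "abs (Z m j k - Z \<nu> j k) \<le> C * (\<xi> ^ j * \<xi> ^ k)" for j k
 proof -
  have *: "abs (Z m j k - Z \<nu> j k) \<le> C * (\<xi> ^ j * \<xi> ^ k)" if "j \<le> k" for j k
  proof -
   have "\<eta> ^ k = \<xi> ^ k * \<xi> ^ k" by (simp add: \<xi>(3)[symmetric] power_mult_distrib)
   also have "... \<le> \<xi> ^ j * \<xi> ^ k" using that \<xi> by (intro mult_right_mono power_decreasing) auto
   finally show ?thesis using Z[OF that] C0 by (meson mult_left_mono order_trans)
  qed
  show ?thesis using *[of j k] *[of k j] Zsym[of m j k] Zsym[of \<nu> j k] by (cases "j \<le> k") (auto simp: mult.commute)
 qed
 have prodm: "integrable m (\<lambda>x. ht ((g ^^ i) x) * ht ((g ^^ j) x))" for i j using sqm by (intro integral_Cauchy_Schwarz(1)) auto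
 have eq: "(S n x)^2 = (\<Sum>i<n. \<Sum>j<n. ht ((g ^^ i) x) * ht ((g ^^ j) x))" for n x
  by (simp add: power2_eq_square sum_product birkhoff_sum_def)
 have Sm: "integrable m (\<lambda>x. (S n x)^2)" for n unfolding eq using prodm by simp
 have "(LINT x|m. (S n x)^2) \<le> D4 + C * (1 / (1 - \<xi>) * (1 / (1 - \<xi>)))" for n
 proof -
  have "(LINT x|m. (S n x)^2) = (\<Sum>i<n. \<Sum>j<n. Z m i j)" unfolding eq Z_def using prodm by simp
  also have "... \<le> (\<Sum>i<n. \<Sum>j<n. Z \<nu> i j + C * (\<xi> ^ i * \<xi> ^ j))" using Z' by (intro sum_mono) (simp add: abs_le_iff algebra_simps)
  also have "... = V n + C * ((\<Sum>i<n. \<xi> ^ i) * (\<Sum>j<n. \<xi> ^ j))"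
  proof -
   have "C * ((\<Sum>i<n. \<xi> ^ i) * (\<Sum>j<n. \<xi> ^ j)) = (\<Sum>i<n. \<Sum>j<n. C * (\<xi> ^ i * \<xi> ^ j))"
    unfolding sum_product unfolding sum_distrib_left by (rule refl)
   moreover have "V n = (\<Sum>i<n. \<Sum>j<n. Z \<nu> i j)" unfolding V_def eq Z_def using prod_integrable by simp
   ultimately show ?thesis by (simp only: sum.distrib)
  qed
  also have "... \<le> D4 + C * (1 / (1 - \<xi>) * (1 / (1 - \<xi>)))"
  proof (intro add_mono mult_left_mono mult_mono C0)
   show "V n \<le> D4" using V_linear[of n] s0 by simp
   have "(\<Sum>k<n. \<xi> ^ k) \<le> (\<Sum>k. \<xi> ^ k)" using \<xi> by (intro sum_le_suminf) (auto simp: summable_geometric)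
   then show "(\<Sum>k<n. \<xi> ^ k) \<le> 1 / (1 - \<xi>)" "(\<Sum>k<n. \<xi> ^ k) \<le> 1 / (1 - \<xi>)" using \<xi> by (simp_all add: suminf_geometric)
  qed (use \<xi> in \<open>auto intro: sum_nonneg\<close>)
  finally show ?thesis .
 qed
 then obtain l where "l \<in> borel_measurable m" "integrable m (\<lambda>x. (l x)^2)" "AE x in m. ht x = l (g x) - l x"
  using m.coboundary_of_bounded_sums[OF g meas[OF ht_meas] Sm] by metis
 then show ?thesis unfolding cohomologous_to_constant_L2_def by (intro exI[of _ l] exI[of _ A]) (auto simp: ht_def algebra_simps)
qed

section \<open>Pairings in L^2 and densities\<close>

lemma (in prob_space) norm2_mult:
 assumes [measurable]: "f \<in> borel_measurable M" "k \<in> borel_measurable M"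
  and int: "sqi M f" "integrable M (\<lambda>x. (k x)^2)"
 shows "integrable M (\<lambda>x. f x * of_real (k x))"
  and "(LINT x|M. norm (f x * of_real (k x))) \<le> norm2 M f * sqrt (LINT x|M. (k x)^2)"
proof -
 have i: "integrable M (\<lambda>x. norm (f x) * k x)" using int by (intro integral_Cauchy_Schwarz(1)) auto
 show "integrable M (\<lambda>x. f x * of_real (k x))" by (rule dominated[OF i]) (auto simp: norm_mult abs_mult)
 have "(LINT x|M. abs (norm (f x) * k x)) \<le> sqrt (LINT x|M. (norm (f x))^2) * sqrt (LINT x|M. (k x)^2)"
  using int by (intro integral_Cauchy_Schwarz(2)) auto
 then show "(LINT x|M. norm (f x * of_real (k x))) \<le> norm2 M f * sqrt (LINT x|M. (k x)^2)" by (simp add: norm_mult abs_mult norm2_def)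
qed

lemma (in prob_space) norm2_triangle:
 assumes [measurable]: "f \<in> borel_measurable M" "k \<in> borel_measurable M"
  and int: "sqi M f" "sqi M k"
 shows "sqi M (\<lambda>x. f x - k x)" "norm2 M (\<lambda>x. f x - k x) \<le> norm2 M f + norm2 M k"
  and "sqi M (\<lambda>x. f x + k x)" "norm2 M (\<lambda>x. f x + k x) \<le> norm2 M f + norm2 M k"
proof -
 have *: "sqi M (\<lambda>x. f x + k' x)" "norm2 M (\<lambda>x. f x + k' x) \<le> norm2 M f + norm2 M k"
  if [measurable]: "k' \<in> borel_measurable M" and eq: "\<And>x. norm (k' x) = norm (k x)" for k'
 proof -
  have i: "integrable M (\<lambda>x. norm (f x) * norm (k x))" using int by (intro integral_Cauchy_Schwarz(1)) auto
  have le: "(norm (f x + k' x))^2 \<le> (norm (f x))^2 + (2 * (norm (f x) * norm (k x)) + (norm (k x))^2)" for x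
  proof -
   have "(norm (f x + k' x))^2 \<le> (norm (f x) + norm (k x))^2"
    using norm_triangle_ineq[of "f x" "k' x"] by (intro power_mono) (auto simp: eq)
   then show ?thesis by (simp add: power2_eq_square algebra_simps)
  qed
  have ii: "integrable M (\<lambda>x. (norm (f x))^2 + (2 * (norm (f x) * norm (k x)) + (norm (k x))^2))" using i int by simp
  show 1: "sqi M (\<lambda>x. f x + k' x)"
   by (rule dominated[OF ii]) (use le in \<open>auto simp: abs_of_nonneg\<close>)
  have "(LINT x|M. abs (norm (f x) * norm (k x))) \<le> norm2 M f * norm2 M k"
   unfolding norm2_def using int by (intro integral_Cauchy_Schwarz(2)) auto
  moreover have "(LINT x|M. (norm (f x + k' x))^2) \<le> (LINT x|M. (norm (f x))^2 + (2 * (norm (f x) * norm (k x)) + (norm (k x))^2))"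
   using 1 ii le by (intro integral_mono) auto
  moreover have "... = (norm2 M f)^2 + 2 * (LINT x|M. norm (f x) * norm (k x)) + (norm2 M k)^2" using i int by (simp add: norm2_def)
  ultimately have "(LINT x|M. (norm (f x + k' x))^2) \<le> (norm2 M f + norm2 M k)^2" by (simp add: power2_eq_square algebra_simps)
  then show "norm2 M (\<lambda>x. f x + k' x) \<le> norm2 M f + norm2 M k" unfolding norm2_def[of M "\<lambda>x. f x + k' x"] by (intro real_le_lsqrt) auto
 qed
 show "sqi M (\<lambda>x. f x - k x)" "norm2 M (\<lambda>x. f x - k x) \<le> norm2 M f + norm2 M k" using *[of "\<lambda>x. - k x"] by auto
 show "sqi M (\<lambda>x. f x + k x)" "norm2 M (\<lambda>x. f x + k x) \<le> norm2 M f + norm2 M k" using *[of k] by auto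
qed

text \<open>Truncating \<open>\<psi>\<close> and dominated convergence extend duality from bounded
  test functions to \<open>h\<close> and its centred version.\<close>

lemma (in prob_space) dual_unbounded:
 fixes a b :: "'a \<Rightarrow> complex" and \<psi> :: "'a \<Rightarrow> real"
 assumes [measurable]: "a \<in> borel_measurable M" "b \<in> borel_measurable M" "\<psi> \<in> borel_measurable M" "T \<in> measurable M M"
  and int: "integrable M (\<lambda>x. a x * of_real (\<psi> (T x)))" "integrable M (\<lambda>x. b x * of_real (\<psi> x))"
  and dual: "\<And>\<omega>. \<omega> \<in> Linf M ==> (LINT x|M. a x * \<omega> (T x)) = (LINT x|M. b x * \<omega> x)"
 shows "(LINT x|M. a x * of_real (\<psi> (T x))) = (LINT x|M. b x * of_real (\<psi> x))"
proof -
 define \<omega> where "\<omega> n x = (if abs (\<psi> x) \<le> real n then complex_of_real (\<psi> x) else 0)" for n x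
 have [measurable]: "\<omega> n \<in> borel_measurable M" for n unfolding \<omega>_def by measurable
 have \<omega>: "\<omega> n \<in> Linf M" for n by (rule LinfI[where K = "real n"]) (auto simp: \<omega>_def)
 have lim: "(\<lambda>n. \<omega> n x) \<longlonglongrightarrow> of_real (\<psi> x)" for x
 proof (rule tendsto_eventually)
  obtain N where "abs (\<psi> x) \<le> real N" using real_arch_simple by blast
  then show "\<forall>\<^sub>F n in sequentially. \<omega> n x = of_real (\<psi> x)" unfolding eventually_sequentially \<omega>_def by (intro exI[of _ N]) auto
 qed
 have le: "norm (\<omega> n x) \<le> norm (complex_of_real (\<psi> x))" for n x by (simp add: \<omega>_def)
 have "(\<lambda>n. \<integral>x. a x * \<omega> n (T x) \<partial>M) \<longlonglongrightarrow> (LINT x|M. a x * of_real (\<psi> (T x)))"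
  by (rule integral_dominated_convergence[where w = "\<lambda>x. norm (a x * of_real (\<psi> (T x)))"])
   (use lim le integrable_norm[OF int(1)] in \<open>auto intro!: tendsto_intros mult_left_mono simp: norm_mult simp del: norm_of_real\<close>)
 moreover have "(\<lambda>n. \<integral>x. b x * \<omega> n x \<partial>M) \<longlonglongrightarrow> (LINT x|M. b x * of_real (\<psi> x))"
  by (rule integral_dominated_convergence[where w = "\<lambda>x. norm (b x * of_real (\<psi> x))"])
   (use lim le integrable_norm[OF int(2)] in \<open>auto intro!: tendsto_intros mult_left_mono simp: norm_mult simp del: norm_of_real\<close>)
 ultimately show ?thesis unfolding dual[OF \<omega>] by (rule LIMSEQ_unique)
qed

lemma prob_space_density:
 fixes f :: "'x \<Rightarrow> real"
 assumes f: "integrable M f" "\<And>x. 0 \<le> f x" "(LINT x|M. f x) = 1"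
 shows "prob_space (density M f)"
proof (rule prob_spaceI)
 note [measurable] = borel_measurable_integrable[OF f(1)]
 have "emeasure (density M f) (space (density M f)) = (\<integral>\<^sup>+x. ennreal (f x) \<partial>M)" by (simp add: emeasure_density cong: nn_integral_cong)
 also have "... = ennreal (LINT x|M. f x)" using f(1,2) by (intro nn_integral_eq_integral) auto
 finally show "emeasure (density M f) (space (density M f)) = 1" using f(3) by simp
qed

section \<open>Mixing, variances and initial densities\<close>

text \<open>Later instantiated with \<open>Y = X 0\<close> and \<open>Z = X 6\<close>. Invariant
  densities live in \<open>Y\<close>, initial densities in \<open>Z\<close>; decay of the latter is
  required only in L^2, in the form \<open>\<eta>^(8 n)\<close> expected by
  \<open>mixing_system\<close>. Decay in the norm of \<open>Y\<close> itself,
  \<open>gap_strong\<close>, serves when a twisted operator acts on the remainder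
  afterwards.\<close>

locale gapped_family = twisted_family m \<Theta> G h for m :: "'x measure" and \<Theta> G h +
 fixes Y Z :: "'x fspace" and \<rho> :: "real \<Rightarrow> 'x \<Rightarrow> real" and \<delta> K C \<eta> :: real
 assumes const: "0 < \<delta>" "\<delta> \<le> 1" "0 < \<eta>" "\<eta> < 1" "0 < C" "0 < K"
  and h2: "integrable m (\<lambda>x. (h x)^2)" and one: "(\<lambda>_. 1) \<in> elems Y" and Y_banach: "banach_space m Y"
  and Y_L2: "f \<in> elems Y ==> f \<in> borel_measurable m \<and> sqi m f \<and> norm2 m f \<le> K * nrm Y f"
  and Z_L2: "f \<in> elems Z ==> f \<in> borel_measurable m \<and> sqi m f \<and> norm2 m f \<le> K * nrm Z f"
  and pow: "[|t \<in> \<Theta>; abs t < \<delta>; abs s < \<delta>; f \<in> elems Y|] ==>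
    (Q t s ^^ n) f \<in> elems Y \<and> nrm Y ((Q t s ^^ n) f) \<le> C * nrm Y f"
  and pow_Z: "[|t \<in> \<Theta>; abs t < \<delta>; f \<in> elems Z|] ==> (L t ^^ n) f \<in> elems Z"
  and \<rho>_nonneg: "0 \<le> \<rho> t x"
  and \<rho>_elem: "[|t \<in> \<Theta>; abs t < \<delta>|] ==> (cr (\<rho> t)) \<in> elems Y"
  and \<rho>_nrm: "[|t \<in> \<Theta>; abs t < \<delta>|] ==> nrm Y (cr (\<rho> t)) \<le> C"
  and \<rho>_int: "[|t \<in> \<Theta>; abs t < \<delta>|] ==> (LINT x|m. \<rho> t x) = 1"
  and \<rho>_inv: "[|t \<in> \<Theta>; abs t < \<delta>|] ==> AE x in m. L t (cr (\<rho> t)) x = of_real (\<rho> t x)"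
  and gap_Y: "[|t \<in> \<Theta>; abs t < \<delta>; f \<in> elems Y|] ==>
    norm2 m (rem \<rho> t n f) \<le> C * \<eta> ^ (8 * n) * nrm Y f"
  and gap_strong: "[|t \<in> \<Theta>; abs t < \<delta>; f \<in> elems Y|] ==>
    rem \<rho> t n f \<in> elems Y \<and>
    nrm Y (rem \<rho> t n f) \<le> C * \<eta> ^ (8 * n) * nrm Y f"
  and gap_Z: "[|t \<in> \<Theta>; abs t < \<delta>; f \<in> elems Z|] ==>
    norm2 m (rem \<rho> t n f) \<le> C * \<eta> ^ (8 * n) * nrm Z f"
  and pow_close: "e > 0 ==> \<forall>\<^sub>F t in inf (nhds 0) (principal \<Theta>). \<forall>f\<in>elems Y.
    norm2 m (\<lambda>x. (L t ^^ n) f x - (L 0 ^^ n) f x) \<le> e * nrm Y f"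
  and close: "[|abs u < \<delta>; e > 0|] ==> \<forall>\<^sub>F t in inf (nhds 0) (principal \<Theta>). \<forall>f\<in>elems Y.
    norm2 m (\<lambda>x. Q t u f x - Q 0 u f x) \<le> e * nrm Y f"
  and moment: "\<exists>D. \<forall>f. (\<forall>x. 0 \<le> f x) \<and> cr f \<in> elems Y \<and> nrm Y (cr f) \<le> R \<longrightarrow>
    integrable m (\<lambda>x. f x * mom (h x)) \<and> (LINT x|m. f x * mom (h x)) \<le> D"
begin

definition \<nu> where "\<nu> t = density m (\<lambda>x. ennreal (\<rho> t x))"

lemma Y_integrable: "f \<in> elems Y ==> integrable m f" "f \<in> elems Y ==> (LINT x|m. norm (f x)) \<le> norm2 m f"
 using Y_L2 integrable_of_square by blast+

lemma Z_integrable: "f \<in> elems Z ==> integrable m f" "f \<in> elems Z ==> (LINT x|m. norm (f x)) \<le> norm2 m f"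
 using Z_L2 integrable_of_square by blast+

context
 fixes t :: real assumes t: "t \<in> \<Theta>" "abs t < \<delta>"
begin

lemma \<rho>_integrable: "integrable m (\<rho> t)" using Y_integrable(1)[OF \<rho>_elem[OF t]] integrable_Re by fastforce

lemma \<rho>_measurable [measurable]: "\<rho> t \<in> borel_measurable m" using \<rho>_integrable by (rule borel_measurable_integrable)

lemma prob_\<nu>: "prob_space (\<nu> t)"
 unfolding \<nu>_def using \<rho>_integrable \<rho>_nonneg \<rho>_int[OF t] by (rule prob_space_density)

lemma sets_\<nu>: "sets (\<nu> t) = sets m" by (simp add: \<nu>_def)

lemma inv_\<nu>: "distr (\<nu> t) (\<nu> t) (G t) = \<nu> t"
proof -
 have [measurable]: "L t (cr (\<rho> t)) \<in> borel_measurable m"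
  using transfer_integrable[OF nonsing[OF t(1)] Y_integrable(1)[OF \<rho>_elem[OF t]]] by (rule borel_measurable_integrable)
 have "distr (\<nu> t) (\<nu> t) (G t) = distr (\<nu> t) m (G t)" by (rule distr_cong) (auto simp: sets_\<nu>)
 also have "... = density m (\<lambda>x. max 0 (Re (L t (cr (\<rho> t)) x)))"
  unfolding \<nu>_def by (rule transfer_of_nonneg(2)[OF nonsing[OF t(1)] \<rho>_integrable \<rho>_nonneg])
 also have "... = \<nu> t" unfolding \<nu>_def using \<rho>_inv[OF t] by (intro density_cong) (auto simp: \<rho>_nonneg)
 finally show ?thesis .
qed

lemma integral_\<nu>: "f \<in> borel_measurable m ==> (LINT x|\<nu> t. f x) = (LINT x|m. of_real (\<rho> t x) * (f x :: complex))"
 unfolding \<nu>_def using \<rho>_nonneg by (subst integral_density) (auto simp: scaleR_conv_of_real)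

lemma integral_\<nu>_real: "f \<in> borel_measurable m ==> (LINT x|\<nu> t. f x) = (LINT x|m. \<rho> t x * (f x :: real))"
 unfolding \<nu>_def using \<rho>_nonneg by (subst integral_density) auto

lemma integrable_\<nu>_real: "f \<in> borel_measurable m ==> integrable (\<nu> t) f \<longleftrightarrow> integrable m (\<lambda>x. \<rho> t x * (f x :: real))"
 unfolding \<nu>_def using \<rho>_nonneg by (subst integrable_density) auto

lemma Y_pow: "f \<in> elems Y ==> (L t ^^ n) f \<in> elems Y" using pow[OF t, of 0 f n] const by (simp add: Q_zero[OF t(1)])

lemma \<rho>_L2: "cr (\<rho> t) \<in> borel_measurable m" "sqi m (cr (\<rho> t))"
  "norm2 m (cr (\<rho> t)) \<le> K * C"
proof -
 have "K * nrm Y (cr (\<rho> t)) \<le> K * C" using \<rho>_nrm[OF t] const by (intro mult_left_mono) auto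
 then show "cr (\<rho> t) \<in> borel_measurable m" "sqi m (cr (\<rho> t))"
  "norm2 m (cr (\<rho> t)) \<le> K * C" using Y_L2[OF \<rho>_elem[OF t]] by auto
qed

lemma remainder_L2:
 assumes "b \<in> borel_measurable m" "sqi m b"
 shows "(\<lambda>x. b x - c * of_real (\<rho> t x)) \<in> borel_measurable m" "sqi m (\<lambda>x. b x - c * of_real (\<rho> t x))"
 using assms \<rho>_L2 by (measurable, intro norm2_triangle(1)) (auto simp: norm_mult power_mult_distrib simp del: norm_of_real)

lemma decay:
 assumes b: "b \<in> borel_measurable m" "sqi m b" and E: "norm2 m (\<lambda>x. b x - c * of_real (\<rho> t x)) \<le> E"
  and k [measurable]: "k \<in> borel_measurable m" and k2: "integrable m (\<lambda>x. (k x)^2)"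
 shows "cmod ((LINT x|m. b x * of_real (k x)) - c * of_real (LINT x|\<nu> t. k x)) \<le> E * sqrt (LINT x|m. (k x)^2)"
proof -
 have i: "integrable m (\<lambda>x. b x * of_real (k x))" "integrable m (\<lambda>x. of_real (\<rho> t x) * complex_of_real (k x))"
  using b \<rho>_L2 k k2 by (auto intro!: norm2_mult(1))
 have k\<nu>: "of_real (LINT x|\<nu> t. k x) = (LINT x|m. of_real (\<rho> t x) * complex_of_real (k x))"
  unfolding integral_\<nu>_real[OF k] of_real_mult[symmetric] by (rule integral_complex_of_real[symmetric])
 have "(LINT x|m. b x * of_real (k x)) - c * of_real (LINT x|\<nu> t. k x) = (LINT x|m. (b x - c * of_real (\<rho> t x)) * of_real (k x))"
  unfolding k\<nu> using i by (simp add: left_diff_distrib mult.assoc)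
 also have "cmod ... \<le> norm2 m (\<lambda>x. b x - c * of_real (\<rho> t x)) * sqrt (LINT x|m. (k x)^2)"
  using remainder_L2[OF b, of c] by (intro order_trans[OF integral_norm_bound] norm2_mult(2) k k2)
 also have "... \<le> E * sqrt (LINT x|m. (k x)^2)" by (intro mult_right_mono E) simp
 finally show ?thesis .
qed

text \<open>The twisted past is absorbed into \<open>k = Q^p f\<close>, bounded in \<open>Y\<close>
  uniformly in \<open>p\<close>; after \<open>q\<close> untwisted steps it is close to its integral
  times the invariant density.\<close>

lemma mixing_bounded:
 assumes u: "abs u < \<delta>" and f: "f \<in> elems Y" and \<psi> [measurable]: "\<psi> \<in> borel_measurable m" and b: "\<And>x. cmod (\<psi> x) \<le> 1"
 shows "cmod ((LINT x|m. f x * (ei u (birkhoff_sum (G t) h p x) * \<psi> ((G t ^^ (p + q)) x)))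
  - (LINT x|m. f x * ei u (birkhoff_sum (G t) h p x)) * (LINT x|\<nu> t. \<psi> x)) \<le> C * \<eta> ^ (8 * q) * (C * nrm Y f)"
proof -
 note ns = nonsing[OF t(1)]
 define k where "k = (Q t u ^^ p) f"
 have k: "k \<in> elems Y" "nrm Y k \<le> C * nrm Y f" using pow[OF t u f] by (auto simp: k_def)
 have \<psi>L: "\<psi> \<in> Linf m" by (rule LinfI[OF \<psi> b])
 have \<psi>q: "(\<lambda>x. \<psi> ((G t ^^ q) x)) \<in> Linf m" by (rule Linf_comp[OF nonsingular_funpow[OF ns] \<psi>L])
 have one: "(\<lambda>_. 1) \<in> Linf m" by (rule LinfI[where K = 1]) auto
 have 1: "(LINT x|m. f x * (ei u (birkhoff_sum (G t) h p x) * \<psi> ((G t ^^ (p + q)) x)))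
   = (LINT x|m. (L t ^^ q) k x * \<psi> x)" unfolding transfer_pow_dual[OF ns Y_integrable(1)[OF k(1)] \<psi>L]
  unfolding k_def twisted_pow_dual[OF ns h_meas Y_integrable(1)[OF f] \<psi>q] by (simp add: add.commute[of p q] funpow_add)
 have 2: "(LINT x|m. f x * ei u (birkhoff_sum (G t) h p x)) = (LINT x|m. k x)"
  using twisted_pow_dual[OF ns h_meas Y_integrable(1)[OF f] one, where s = u and n = p] by (simp add: k_def)
 define r where "r x = (L t ^^ q) k x - (LINT x|m. k x) * of_real (\<rho> t x)" for x
 have r: "r \<in> borel_measurable m" "sqi m r" using Y_L2[OF Y_pow[OF k(1)]] by (auto simp: r_def[abs_def] intro!: remainder_L2)
 have i: "integrable m (\<lambda>x. (L t ^^ q) k x * \<psi> x)" "integrable m (\<lambda>x. of_real (\<rho> t x) * \<psi> x)"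
  using integrable_Linf_mult[OF Y_integrable(1)[OF Y_pow[OF k(1)]] \<psi>L] integrable_Linf_mult[OF Y_integrable(1)[OF \<rho>_elem[OF t]] \<psi>L] by auto
 have "(LINT x|m. (L t ^^ q) k x * \<psi> x) - (LINT x|m. k x) * (LINT x|m. of_real (\<rho> t x) * \<psi> x) = (LINT x|m. r x * \<psi> x)"
  using i by (simp add: r_def left_diff_distrib mult.assoc)
 also have "cmod (LINT x|m. r x * \<psi> x) \<le> (LINT x|m. norm (r x))"
  using integrable_of_square(1)[OF r] b integrable_norm[OF integrable_Linf_mult[OF integrable_of_square(1)[OF r] \<psi>L]]
  by (intro order_trans[OF integral_norm_bound] integral_mono) (auto simp: norm_mult intro: mult_left_le)
 also have "... \<le> norm2 m r" by (rule integrable_of_square(2)[OF r])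
 also have "... \<le> C * \<eta> ^ (8 * q) * nrm Y k" unfolding r_def[abs_def] by (rule gap_Y[OF t k(1)])
 also have "... \<le> C * \<eta> ^ (8 * q) * (C * nrm Y f)" using k(2) const by (intro mult_left_mono) auto
 finally show ?thesis unfolding 1 2 integral_\<nu>[OF \<psi>] .
qed

lemma comp_push:
 assumes \<phi>: "integrable m \<phi>" "\<And>x. 0 \<le> (\<phi> x :: real)" and k [measurable]: "k \<in> borel_measurable m"
  and int: "integrable m (\<lambda>x. push_density m (G t) n \<phi> x * (k x :: real))"
 shows "integrable m (\<lambda>x. \<phi> x * k ((G t ^^ n) x))"
  and "(LINT x|m. \<phi> x * k ((G t ^^ n) x)) = (LINT x|m. push_density m (G t) n \<phi> x * k x)"
proof -
 note ns = nonsing[OF t(1)]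
 note pd = push_density[OF ns \<phi>, of n]
 note [measurable] = nonsingular_measurable[OF nonsingular_funpow[OF ns]] borel_measurable_integrable[OF \<phi>(1)] borel_measurable_integrable[OF pd(1)]
 have "integrable (density m \<phi>) (\<lambda>x. k ((G t ^^ n) x)) \<longleftrightarrow> integrable (distr (density m \<phi>) m (G t ^^ n)) k"
  by (rule integrable_distr_eq[symmetric]) measurable
 also have "..." unfolding pd(4) using int pd(2) by (subst integrable_density) auto
 finally show "integrable m (\<lambda>x. \<phi> x * k ((G t ^^ n) x))" using \<phi>(2) by (subst (asm) integrable_density) auto
 have "(LINT x|m. \<phi> x * k ((G t ^^ n) x)) = (LINT x|density m \<phi>. k ((G t ^^ n) x))" using \<phi>(2) by (subst integral_density) auto
 also have "... = (LINT x|distr (density m \<phi>) m (G t ^^ n). k x)" by (rule integral_distr[symmetric]) measurable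
 also have "... = (LINT x|m. push_density m (G t) n \<phi> x * k x)" unfolding pd(4) using pd(2) by (subst integral_density) auto
 finally show "(LINT x|m. \<phi> x * k ((G t ^^ n) x)) = (LINT x|m. push_density m (G t) n \<phi> x * k x)" .
qed

lemma comp_L2:
 assumes \<phi>: "integrable m \<phi>" "\<And>x. 0 \<le> (\<phi> x :: real)" and k [measurable]: "k \<in> borel_measurable m"
  and k2: "integrable m (\<lambda>x. (k x)^2)"
  and L2: "sqi m ((L t ^^ n) (cr \<phi>))"
 shows "integrable m (\<lambda>x. \<phi> x * k ((G t ^^ n) x))"
  and "of_real (LINT x|m. \<phi> x * k ((G t ^^ n) x)) = (LINT x|m. (L t ^^ n) (cr \<phi>) x * of_real (k x))"
proof -
 note ns = nonsing[OF t(1)]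
 note pd = push_density[OF ns \<phi>, of n]
 have [measurable]: "(L t ^^ n) (cr \<phi>) \<in> borel_measurable m"
  using transfer_pow_integrable[OF ns] \<phi>(1) by (intro borel_measurable_integrable) auto
 note [measurable] = borel_measurable_integrable[OF pd(1)]
 have i: "integrable m (\<lambda>x. (L t ^^ n) (cr \<phi>) x * of_real (k x))" by (rule norm2_mult(1)) (use L2 k2 in auto)
 have ae: "AE x in m. (L t ^^ n) (cr \<phi>) x * of_real (k x) = of_real (push_density m (G t) n \<phi> x * k x)" using pd(3) by eventually_elim simp
 have i2: "integrable m (\<lambda>x. complex_of_real (push_density m (G t) n \<phi> x * k x))"
  using i by (rule Bochner_Integration.integrable_cong_AE_imp) (use ae in auto)
 then have i3: "integrable m (\<lambda>x. push_density m (G t) n \<phi> x * k x)" using integrable_Re[OF i2] by simp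
 show "integrable m (\<lambda>x. \<phi> x * k ((G t ^^ n) x))" by (rule comp_push(1)[OF \<phi> k i3])
 have "(LINT x|m. (L t ^^ n) (cr \<phi>) x * of_real (k x)) = (LINT x|m. complex_of_real (push_density m (G t) n \<phi> x * k x))"
  using ae by (intro integral_cong_AE) auto
 then show "of_real (LINT x|m. \<phi> x * k ((G t ^^ n) x)) = (LINT x|m. (L t ^^ n) (cr \<phi>) x * of_real (k x))"
  unfolding comp_push(2)[OF \<phi> k i3] by (simp only: integral_complex_of_real)
qed

text \<open>One step is twisted and the other \<open>q\<close> are not. Duality is known for bounded
  test functions; integrability of both sides lets \<open>dual_unbounded\<close> extend it to
  \<open>k\<close>.\<close>

lemma comp_twisted_L2:
 assumes u: "abs u < \<delta>" and \<phi>: "\<And>x. 0 \<le> (\<phi> x :: real)" "cr \<phi> \<in> elems Y"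
  and k [measurable]: "k \<in> borel_measurable m" and k2: "integrable m (\<lambda>x. (k x)^2)"
 shows "(LINT x|m. of_real (\<phi> x) * (ei u (h x) * of_real (k ((G t ^^ Suc q) x)))) =
  (LINT x|m. (L t ^^ q) (Q t u (cr \<phi>)) x * of_real (k x))"
proof -
 note ns = nonsing[OF t(1)]
 let ?f = "\<lambda>x. complex_of_real (\<phi> x)"
 let ?a = "\<lambda>x. ?f x * ei u (h x)"
 have fi: "integrable m ?f" "integrable m \<phi>" using Y_integrable(1)[OF \<phi>(2)] integrable_Re by fastforce+
 note [measurable] = borel_measurable_integrable[OF fi(2)] nonsingular_measurable[OF nonsingular_funpow[OF ns]] nonsingular_measurable[OF ns]
 define w where "w = Q t u ?f"
 have w: "w \<in> elems Y" using pow[OF t u \<phi>(2), of 1] by (auto simp: w_def)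
 define b where "b = (L t ^^ q) w"
 have b: "b \<in> elems Y" unfolding b_def by (rule Y_pow[OF w])
 note bL = Y_L2[OF b]
 have dual: "(LINT x|m. ?a x * \<omega> ((G t ^^ Suc q) x)) = (LINT x|m. b x * \<omega> x)" if "\<omega> \<in> Linf m" for \<omega>
 proof -
  have \<omega>q: "(\<lambda>x. \<omega> ((G t ^^ q) x)) \<in> Linf m" by (rule Linf_comp[OF nonsingular_funpow[OF ns] that])
  show ?thesis unfolding b_def transfer_pow_dual[OF ns Y_integrable(1)[OF w] that]
   using twisted_pow_dual[OF ns h_meas fi(1) \<omega>q, where s = u and n = 1] by (simp add: w_def birkhoff_sum_def mult.assoc funpow_swap1)
 qed
 have ia: "integrable m (\<lambda>x. ?a x * of_real (k ((G t ^^ Suc q) x)))"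
 proof (rule dominated)
  show "integrable m (\<lambda>x. \<phi> x * k ((G t ^^ Suc q) x))"
   by (intro comp_L2(1)[OF fi(2) \<phi>(1) k k2] conjunct1[OF conjunct2[OF Y_L2[OF Y_pow[OF \<phi>(2)]]]])
 qed (auto simp: norm_mult abs_mult)
 have ib: "integrable m (\<lambda>x. b x * of_real (k x))" by (rule norm2_mult(1)) (use bL k2 in auto)
 have "(LINT x|m. ?a x * of_real (k ((G t ^^ Suc q) x))) = (LINT x|m. b x * of_real (k x))"
  by (rule dual_unbounded) (use bL ia ib dual in auto)
 then show ?thesis unfolding b_def w_def by (simp only: mult.assoc)
qed

lemma decay_L2:
 assumes w: "w \<in> elems Y" and k [measurable]: "k \<in> borel_measurable m" and k2: "integrable m (\<lambda>x. (k x)^2)"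
 shows "cmod ((LINT x|m. (L t ^^ q) w x * of_real (k x)) - (LINT x|m. w x) * of_real (LINT x|\<nu> t. k x))
   \<le> C * \<eta> ^ (8 * q) * nrm Y w * sqrt (LINT x|m. (k x)^2)"
 using Y_L2[OF Y_pow[OF w]] by (intro decay gap_Y[OF t w] k k2) auto

lemma mixing_L2:
 assumes u: "abs u < \<delta>" and \<phi>: "\<And>x. 0 \<le> (\<phi> x :: real)" "cr \<phi> \<in> elems Y"
  and k [measurable]: "k \<in> borel_measurable m" and k2: "integrable m (\<lambda>x. (k x)^2)"
 shows "cmod ((LINT x|m. of_real (\<phi> x) * (ei u (h x) * of_real (k ((G t ^^ Suc q) x))))
  - (LINT x|m. of_real (\<phi> x) * ei u (h x)) * of_real (LINT x|\<nu> t. k x))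
   \<le> C * \<eta> ^ (8 * q) * (C * nrm Y (cr \<phi>)) * sqrt (LINT x|m. (k x)^2)"
proof -
 note ns = nonsing[OF t(1)]
 let ?f = "\<lambda>x. complex_of_real (\<phi> x)"
 define w where "w = Q t u ?f"
 have w: "w \<in> elems Y" "nrm Y w \<le> C * nrm Y ?f" using pow[OF t u \<phi>(2), of 1] by (auto simp: w_def)
 have one: "(\<lambda>_. 1) \<in> Linf m" by (rule LinfI[where K = 1]) auto
 have 2: "(LINT x|m. ?f x * ei u (h x)) = (LINT x|m. w x)"
  using twisted_pow_dual[OF ns h_meas Y_integrable(1)[OF \<phi>(2)] one, where s = u and n = 1] by (simp add: w_def birkhoff_sum_def)
 have "C * \<eta> ^ (8 * q) * nrm Y w * sqrt (LINT x|m. (k x)^2) \<le> C * \<eta> ^ (8 * q) * (C * nrm Y ?f) * sqrt (LINT x|m. (k x)^2)"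
  using w(2) const by (intro mult_right_mono mult_left_mono) auto
 then show ?thesis unfolding 2 comp_twisted_L2[OF u \<phi> k k2] w_def[symmetric] by (rule order_trans[OF decay_L2[OF w(1) k k2]])
qed

end

text \<open>The density of the law after \<open>n\<close> steps stays in a ball of \<open>Y\<close>
  whose radius does not depend on \<open>n\<close>, so a single moment bound on that ball serves all
  times.\<close>

lemma moment_push:
 obtains D where "\<And>t \<phi> n. [|t \<in> \<Theta>; abs t < \<delta>; \<And>x. 0 \<le> (\<phi> x :: real); (cr \<phi>) \<in> elems Y; nrm Y (cr \<phi>) \<le> R|] ==>
  integrable m (\<lambda>x. \<phi> x * mom (h ((G t ^^ n) x))) \<and> (LINT x|m. \<phi> x * mom (h ((G t ^^ n) x))) \<le> D"
proof -
 obtain D where D: "\<And>f. [|\<And>x. 0 \<le> f x; (cr f) \<in> elems Y; nrm Y (cr f) \<le> C * R|] ==>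
   integrable m (\<lambda>x. f x * mom (h x)) \<and> (LINT x|m. f x * mom (h x)) \<le> D" using moment[of "C * R"] by blast
 show thesis
 proof (rule that[of D])
  fix t \<phi> n assume t: "t \<in> \<Theta>" "abs t < \<delta>" and \<phi>: "\<And>x. 0 \<le> (\<phi> x :: real)" "cr \<phi> \<in> elems Y" "nrm Y (cr \<phi>) \<le> R"
  have fi: "integrable m \<phi>" using Y_integrable(1)[OF \<phi>(2)] integrable_Re by fastforce
  note pd = push_density[OF nonsing[OF t(1)] fi \<phi>(1), of n]
  note [measurable] = borel_measurable_integrable[OF pd(1)]
  have L: "(L t ^^ n) (cr \<phi>) \<in> elems Y" "nrm Y ((L t ^^ n) (cr \<phi>)) \<le> C * nrm Y (cr \<phi>)"
   using pow[OF t _ \<phi>(2), of 0 n] const by (auto simp: Q_zero[OF t(1)])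
  have pm: "(cr (push_density m (G t) n \<phi>)) \<in> borel_measurable m" by measurable
  note e = banach_spaceD(4,5)[OF Y_banach L(1) pm pd(3)]
  have "C * nrm Y (cr \<phi>) \<le> C * R" using \<phi>(3) const by (intro mult_left_mono) auto
  then have "nrm Y (cr (push_density m (G t) n \<phi>)) \<le> C * R" using e(2) L(2) by simp
  note d = D[OF pd(2) e(1) this]
  note mm = measurable_compose[OF h_meas mom_measurable]
  show "integrable m (\<lambda>x. \<phi> x * mom (h ((G t ^^ n) x))) \<and> (LINT x|m. \<phi> x * mom (h ((G t ^^ n) x))) \<le> D"
   using d comp_push[OF t fi \<phi>(1) mm] by auto
 qed
qed

lemma mixing_system_\<nu>:
 obtains D where "\<And>t. [|t \<in> \<Theta>; abs t < \<delta>|] ==> mixing_system (\<nu> t) (G t) h D \<eta> \<delta>"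
proof -
 obtain D0 where D0: "\<And>f. [|\<And>x. 0 \<le> f x; (cr f) \<in> elems Y; nrm Y (cr f) \<le> C|] ==>
   integrable m (\<lambda>x. f x * mom (h x)) \<and> (LINT x|m. f x * mom (h x)) \<le> D0" using moment[of C] by blast
 define H where "H = sqrt (LINT x|m. (h x)^2)"
 have H: "0 \<le> H" by (simp add: H_def)
 define D where "D = max 0 D0 + C * (C * C) * (1 + H)"
 have cb: "C * \<eta> ^ (8 * q) * (C * nrm Y (cr (\<rho> t))) * a \<le> D * \<eta> ^ (8 * q)"
  if t: "t \<in> \<Theta>" "abs t < \<delta>" and a: "0 \<le> a" "a \<le> 1 + H" for t q a
 proof -
  have "C * \<eta> ^ (8 * q) * (C * nrm Y (cr (\<rho> t))) * a \<le> C * \<eta> ^ (8 * q) * (C * C) * (1 + H)"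
   using \<rho>_nrm[OF t] const a H by (intro mult_mono mult_left_mono) auto
  also have "... = C * (C * C) * (1 + H) * \<eta> ^ (8 * q)" by simp
  also have "... \<le> D * \<eta> ^ (8 * q)" unfolding D_def using const by (intro mult_right_mono) auto
  finally show ?thesis .
 qed
 show thesis
 proof (rule that[of D])
  fix t assume t: "t \<in> \<Theta>" "abs t < \<delta>"
  interpret P: prob_space "\<nu> t" by (rule prob_\<nu>[OF t])
  note ns = nonsing[OF t(1)]
  have meas: "f \<in> borel_measurable (\<nu> t) \<longleftrightarrow> f \<in> borel_measurable m" for f :: "'x \<Rightarrow> 'y::topological_space"
   using measurable_cong_sets[OF sets_\<nu>[OF t] refl] by blast
  note [measurable] = nonsingular_measurable[OF nonsingular_funpow[OF ns]] birkhoff_measurable[OF ns h_meas]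
  have mm: "(\<lambda>x. mom (h x)) \<in> borel_measurable m" by (rule measurable_compose[OF h_meas mom_measurable])
  note d0 = D0[OF \<rho>_nonneg \<rho>_elem[OF t] \<rho>_nrm[OF t]]
  show "mixing_system (\<nu> t) (G t) h D \<eta> \<delta>"
  proof unfold_locales
   show "G t \<in> measurable (\<nu> t) (\<nu> t)" using nonsingular_measurable[OF ns] measurable_cong_sets[OF sets_\<nu>[OF t] sets_\<nu>[OF t]] by blast
   show "distr (\<nu> t) (\<nu> t) (G t) = \<nu> t" by (rule inv_\<nu>[OF t])
   show "h \<in> borel_measurable (\<nu> t)" using h_meas meas by blast
   show "integrable (\<nu> t) (\<lambda>x. mom (h x))" using d0 integrable_\<nu>_real[OF t mm] by blast
   have "(LINT x|\<nu> t. mom (h x)) \<le> D0" using d0 integral_\<nu>_real[OF t mm] by simp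
   then show "(LINT x|\<nu> t. mom (h x)) \<le> D" using const H unfolding D_def by (smt (verit) mult_nonneg_nonneg)
  next
   fix u p q and \<psi> :: "'x \<Rightarrow> complex"
   assume u: "abs u < \<delta>" and "\<psi> \<in> borel_measurable (\<nu> t)" and b: "\<And>x. cmod (\<psi> x) \<le> 1"
   then have \<psi> [measurable]: "\<psi> \<in> borel_measurable m" using meas by blast
   show "cmod ((LINT x|\<nu> t. ei u (birkhoff_sum (G t) h p x) * \<psi> ((G t ^^ (p + q)) x))
    - (LINT x|\<nu> t. ei u (birkhoff_sum (G t) h p x)) * (LINT x|\<nu> t. \<psi> x)) \<le> D * \<eta> ^ (8 * q)"
    using mixing_bounded[OF t u \<rho>_elem[OF t] \<psi> b, of p q] cb[OF t, of 1 q] H by (subst (1 2) integral_\<nu>[OF t]) auto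
  next
   fix u q assume u: "abs u < \<delta>"
   show "cmod ((LINT x|\<nu> t. ei u (h x) * of_real (h ((G t ^^ Suc q) x)))
    - (LINT x|\<nu> t. ei u (h x)) * of_real (LINT x|\<nu> t. h x)) \<le> D * \<eta> ^ (8 * q)"
    using mixing_L2[OF t u \<rho>_nonneg \<rho>_elem[OF t] h_meas h2, of q, folded H_def] cb[OF t H, of q]
    by (subst (1 2) integral_\<nu>[OF t]) (auto simp del: funpow.simps)
  qed (use const in auto)
 qed
qed

end

context prob_space
begin

text \<open>The representatives are arbitrary choices, so linearity is recovered almost everywhere
  from the duality identity; this also covers functions outside the Banach spaces.\<close>

lemma twisted_pow_diff:
 assumes g: "nonsingular M g" and h: "h \<in> borel_measurable M" and a: "integrable M a" "integrable M b"
 shows "AE x in M. (twisted_op M g h s ^^ n) (\<lambda>x. a x - b x) x = (twisted_op M g h s ^^ n) a x - (twisted_op M g h s ^^ n) b x"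
proof (rule Linf_dual_unique)
 note i = twisted_pow_integrable[OF g h a(1), of n s] twisted_pow_integrable[OF g h a(2), of n s]
 have ab: "integrable M (\<lambda>x. a x - b x)" using a by simp
 show "integrable M ((twisted_op M g h s ^^ n) (\<lambda>x. a x - b x))" by (rule twisted_pow_integrable[OF g h ab])
 show "integrable M (\<lambda>x. (twisted_op M g h s ^^ n) a x - (twisted_op M g h s ^^ n) b x)" using i by simp
 fix \<psi> assume \<psi>: "\<psi> \<in> Linf M"
 let ?e = "\<lambda>x. ei s (birkhoff_sum g h n x) * \<psi> ((g ^^ n) x)"
 have "(\<lambda>x. ei s (birkhoff_sum g h n x)) \<in> Linf M" using birkhoff_measurable[OF g h] by (intro LinfI[where K = 1]) auto
 then have e: "?e \<in> Linf M" by (intro Linf_mult Linf_comp[OF nonsingular_funpow[OF g] \<psi>])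
 have "(LINT x|M. (a x - b x) * ?e x) = (LINT x|M. a x * ?e x) - (LINT x|M. b x * ?e x)"
  using integrable_Linf_mult[OF a(1) e] integrable_Linf_mult[OF a(2) e] by (simp add: left_diff_distrib)
 moreover have "(LINT x|M. ((twisted_op M g h s ^^ n) a x - (twisted_op M g h s ^^ n) b x) * \<psi> x) =
   (LINT x|M. (twisted_op M g h s ^^ n) a x * \<psi> x) - (LINT x|M. (twisted_op M g h s ^^ n) b x * \<psi> x)"
  using integrable_Linf_mult[OF i(1) \<psi>] integrable_Linf_mult[OF i(2) \<psi>] by (simp add: left_diff_distrib)
 ultimately show "(LINT x|M. (twisted_op M g h s ^^ n) (\<lambda>x. a x - b x) x * \<psi> x) =
   (LINT x|M. ((twisted_op M g h s ^^ n) a x - (twisted_op M g h s ^^ n) b x) * \<psi> x)"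
  unfolding twisted_pow_dual[OF g h ab \<psi>] twisted_pow_dual[OF g h a(1) \<psi>] twisted_pow_dual[OF g h a(2) \<psi>] by simp
qed

lemma transfer_pow_cong_AE:
 assumes g: "nonsingular M g" and "integrable M \<phi>" "integrable M \<phi>'" "AE x in M. \<phi> x = \<phi>' x"
 shows "AE x in M. (transfer_op M g ^^ n) \<phi> x = (transfer_op M g ^^ n) \<phi>' x"
proof (induction n)
 case (Suc n)
 show ?case using transfer_cong_AE[OF g transfer_pow_integrable[OF g assms(2)] transfer_pow_integrable[OF g assms(3)] Suc] by simp
qed (use assms in simp)

lemma twisted_diff_norm:
 assumes g: "nonsingular M g" and h: "h \<in> borel_measurable M" and a: "integrable M a" "integrable M b"
 shows "(LINT x|M. norm (twisted_op M g h s a x - twisted_op M g h s b x)) \<le> (LINT x|M. norm (a x - b x))"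
proof -
 have ab: "integrable M (\<lambda>x. a x - b x)" using a by simp
 have "(LINT x|M. norm (twisted_op M g h s a x - twisted_op M g h s b x)) = (LINT x|M. norm (twisted_op M g h s (\<lambda>x. a x - b x) x))"
  using twisted_pow_diff[OF g h a, where s = s and n = 1] twisted_integrable[OF g h ab, of s] twisted_integrable[OF g h a(1), of s] twisted_integrable[OF g h a(2), of s]
  by (intro integral_cong_AE) auto
 also have "... \<le> (LINT x|M. norm (a x - b x))" by (rule twisted_norm[OF g h ab])
 finally show ?thesis .
qed

end

section \<open>Continuity of invariant laws and variances in the parameter\<close>

context gapped_family
begin

definition "H = sqrt (LINT x|m. (h x)^2)"

abbreviation "param \<equiv> inf (nhds 0) (principal \<Theta>)"

lemma H_nonneg: "0 \<le> H" by (simp add: H_def)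

lemma zero: "0 \<in> \<Theta>" "abs (0 :: real) < \<delta>" using zero_mem const by auto

lemma param_small: "\<forall>\<^sub>F t in param. t \<in> \<Theta> \<and> abs t < \<delta>"
proof -
 have "\<forall>\<^sub>F t in nhds (0::real). abs t < \<delta>" using const eventually_nhds_metric[of "\<lambda>t. abs t < \<delta>" 0] by (auto simp: dist_real_def)
 then show ?thesis unfolding eventually_inf_principal by eventually_elim simp
qed

text \<open>By invariance \<open>\<rho> t\<close> equals its own image under
  \<open>L t ^^ n\<close>. For a fixed large \<open>n\<close> the gap at parameter 0 brings
  \<open>L 0 ^^ n\<close> of it close to \<open>\<rho> 0\<close>, and for that \<open>n\<close> the
  two iterates are close when \<open>t\<close> is near 0.\<close>

lemma \<rho>_close:
 assumes e: "e > 0"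
 shows "\<forall>\<^sub>F t in param. norm2 m (\<lambda>x. complex_of_real (\<rho> t x) - of_real (\<rho> 0 x)) \<le> e"
proof -
 have "(\<lambda>n. C * \<eta> ^ (8 * n) * C) \<longlonglongrightarrow> C * 0 * C"
  unfolding power_mult using const by (intro tendsto_intros LIMSEQ_power_zero) (simp add: power_less_one_iff)
 then have "\<forall>\<^sub>F n in sequentially. C * \<eta> ^ (8 * n) * C < e / 2" using e by (intro order_tendstoD) auto
 then obtain n where n: "C * \<eta> ^ (8 * n) * C < e / 2" by (auto simp: eventually_sequentially)
 have "e / (2 * C) > 0" using e const by simp
 from pow_close[OF this, of n] param_small show ?thesis
 proof eventually_elim
  case (elim t)
  then have t: "t \<in> \<Theta>" "abs t < \<delta>" by auto
  let ?r = "\<lambda>x. complex_of_real (\<rho> t x)"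
  note re = \<rho>_elem[OF t]
  have inv: "AE x in m. (L t ^^ n) ?r x = ?r x"
  proof (induction n)
   case (Suc n)
   from transfer_cong_AE[OF nonsing[OF t(1)] transfer_pow_integrable[OF nonsing[OF t(1)] Y_integrable(1)[OF re]] Y_integrable(1)[OF re] Suc] \<rho>_inv[OF t]
   show ?case by eventually_elim simp
  qed simp
  note L = Y_L2[OF Y_pow[OF t re, of n]] and L0 = Y_L2[OF Y_pow[OF zero re, of n]] and r0 = \<rho>_L2[OF zero] and r = \<rho>_L2[OF t]
  have [measurable]: "?r \<in> borel_measurable m" "(L t ^^ n) ?r \<in> borel_measurable m" "(L 0 ^^ n) ?r \<in> borel_measurable m"
   "cr (\<rho> 0) \<in> borel_measurable m" using L L0 r0 r by auto
  have eq: "norm2 m (\<lambda>x. ?r x - of_real (\<rho> 0 x)) = norm2 m (\<lambda>x. ((L t ^^ n) ?r x - (L 0 ^^ n) ?r x) + ((L 0 ^^ n) ?r x - of_real (\<rho> 0 x)))"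
   unfolding norm2_def using inv by (intro arg_cong[where f = sqrt] integral_cong_AE) (auto elim!: eventually_mono)
  have m1: "(\<lambda>x. (L t ^^ n) ?r x - (L 0 ^^ n) ?r x) \<in> borel_measurable m" "(\<lambda>x. (L 0 ^^ n) ?r x - of_real (\<rho> 0 x)) \<in> borel_measurable m"
   by measurable
  have i1: "sqi m (\<lambda>x. (L t ^^ n) ?r x - (L 0 ^^ n) ?r x)" by (rule norm2_triangle(1)) (use L L0 in auto)
  have i2: "sqi m (\<lambda>x. (L 0 ^^ n) ?r x - of_real (\<rho> 0 x))" by (rule norm2_triangle(1)) (use r0 L0 in auto)
  have "norm2 m (\<lambda>x. (L t ^^ n) ?r x - (L 0 ^^ n) ?r x) \<le> e / (2 * C) * nrm Y ?r" by (rule bspec[OF elim(1) re])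
  also have "... \<le> e / (2 * C) * C" using \<rho>_nrm[OF t] e const by (intro mult_left_mono) auto
  finally have 1: "norm2 m (\<lambda>x. (L t ^^ n) ?r x - (L 0 ^^ n) ?r x) \<le> e / 2" using const by simp
  have "(LINT x|m. ?r x) = 1" using \<rho>_int[OF t] by simp
  then have "norm2 m (\<lambda>x. (L 0 ^^ n) ?r x - of_real (\<rho> 0 x)) \<le> C * \<eta> ^ (8 * n) * nrm Y ?r" using gap_Y[OF zero re, of n] by simp
  also have "... \<le> C * \<eta> ^ (8 * n) * C" using \<rho>_nrm[OF t] const by (intro mult_left_mono) auto
  finally show ?case unfolding eq using norm2_triangle(4)[OF m1 i1 i2] 1 n by linarith
 qed
qed

lemma mean_close:
 assumes e: "e > 0"
 shows "\<forall>\<^sub>F t in param. abs ((LINT x|\<nu> t. h x) - (LINT x|\<nu> 0. h x)) \<le> e"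
proof -
 have "e / (1 + H) > 0" using e H_nonneg by simp
 from \<rho>_close[OF this] param_small show ?thesis
 proof eventually_elim
  case (elim t)
  then have t: "t \<in> \<Theta>" "abs t < \<delta>" by auto
  note r0 = \<rho>_L2[OF zero] and r = \<rho>_L2[OF t]
  have d: "(\<lambda>x. complex_of_real (\<rho> t x) - of_real (\<rho> 0 x)) \<in> borel_measurable m"
   "sqi m (\<lambda>x. complex_of_real (\<rho> t x) - of_real (\<rho> 0 x))"
   using norm2_triangle(1)[OF r(1) r0(1) r(2) r0(2)] r(1) r0(1) by auto
  have i: "integrable m (\<lambda>x. \<rho> t x * h x)" if "t \<in> \<Theta>" "abs t < \<delta>" for t
  proof -
   have "integrable m (\<lambda>x. complex_of_real (\<rho> t x) * of_real (h x))" using \<rho>_L2[OF that] h2 by (intro norm2_mult(1)) auto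
   then show ?thesis using integrable_Re by fastforce
  qed
  have "of_real ((LINT x|\<nu> t. h x) - (LINT x|\<nu> 0. h x)) = (LINT x|m. (complex_of_real (\<rho> t x) - of_real (\<rho> 0 x)) * of_real (h x))"
   unfolding integral_\<nu>_real[OF t h_meas] integral_\<nu>_real[OF zero h_meas] Bochner_Integration.integral_diff[OF i[OF t] i[OF zero], symmetric]
    integral_complex_of_real[symmetric] by (simp add: left_diff_distrib)
  then have "abs ((LINT x|\<nu> t. h x) - (LINT x|\<nu> 0. h x)) = cmod (LINT x|m. (complex_of_real (\<rho> t x) - of_real (\<rho> 0 x)) * of_real (h x))"
   by (metis norm_of_real)
  also have "... \<le> norm2 m (\<lambda>x. complex_of_real (\<rho> t x) - of_real (\<rho> 0 x)) * H"
   unfolding H_def by (rule order_trans[OF integral_norm_bound norm2_mult(2)[OF d(1) h_meas d(2) h2]])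
  also have "... \<le> e / (1 + H) * H" using elim H_nonneg by (intro mult_right_mono) auto
  also have "... \<le> e" using e H_nonneg by (simp add: field_simps)
  finally show ?case .
 qed
qed

text \<open>Compares \<open>Q t u\<close> with \<open>Q 0 u\<close> at a fixed frequency instead of
  letting \<open>u\<close> tend to 0. The telescoping is done in L^1, which twisted operators
  contract, while each one-step error is measured on \<open>Q 0 u ^^ p\<close> of \<open>f\<close>,
  bounded in \<open>Y\<close>.\<close>

lemma twisted_pow_close:
 assumes u: "abs u < \<delta>" and e: "e > 0"
 shows "\<forall>\<^sub>F t in param. \<forall>f\<in>elems Y. (LINT x|m. norm ((Q t u ^^ p) f x - (Q 0 u ^^ p) f x)) \<le> e * nrm Y f" using e
proof (induction p arbitrary: e)
 case 0
 have "0 \<le> nrm Y f" if "f \<in> elems Y" for f by (rule banach_spaceD(2)[OF Y_banach that])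
 then show ?case using 0 by simp
next
 case (Suc p)
 have e: "e / 2 > 0" "e / (2 * C) > 0" using Suc.prems const by auto
 from Suc.IH[OF e(1)] close[OF u e(2)] param_small show ?case
 proof (eventually_elim, intro ballI)
  case (elim t)
  fix f assume f: "f \<in> elems Y"
  from elim have t: "t \<in> \<Theta>" "abs t < \<delta>" by auto
  define a b where "a = (Q t u ^^ p) f" and "b = (Q 0 u ^^ p) f"
  have a: "a \<in> elems Y" and b: "b \<in> elems Y" "nrm Y b \<le> C * nrm Y f" using pow[OF t u f] pow[OF zero u f] by (auto simp: a_def b_def)
  have el: "Q t u a \<in> elems Y" "Q t u b \<in> elems Y" "Q 0 u b \<in> elems Y"
   using pow[OF t u a, of 1] pow[OF t u b(1), of 1] pow[OF zero u b(1), of 1] by auto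
  note i = Y_integrable(1)[OF el(1)] Y_integrable(1)[OF el(2)] Y_integrable(1)[OF el(3)]
  have L2: "(\<lambda>x. Q t u b x - Q 0 u b x) \<in> borel_measurable m" "sqi m (\<lambda>x. Q t u b x - Q 0 u b x)"
   using Y_L2[OF el(2)] Y_L2[OF el(3)] norm2_triangle(1)[of "Q t u b" "Q 0 u b"] by auto
  have tri: "cmod (x - z) \<le> cmod (x - y) + cmod (y - z)" for x y z using norm_triangle_ineq[of "x - y" "y - z"] by simp
  have "(LINT x|m. norm (Q t u a x - Q 0 u b x)) \<le> (LINT x|m. norm (Q t u a x - Q t u b x) + norm (Q t u b x - Q 0 u b x))"
   using i tri by (intro integral_mono) auto
  also have "... = (LINT x|m. norm (Q t u a x - Q t u b x)) + (LINT x|m. norm (Q t u b x - Q 0 u b x))" using i by simp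
  also have "(LINT x|m. norm (Q t u a x - Q t u b x)) \<le> (LINT x|m. norm (a x - b x))"
   by (rule twisted_diff_norm[OF nonsing[OF t(1)] h_meas Y_integrable(1)[OF a] Y_integrable(1)[OF b(1)]])
  also have "(LINT x|m. norm (a x - b x)) \<le> e / 2 * nrm Y f" unfolding a_def b_def by (rule bspec[OF elim(1) f])
  also have "(LINT x|m. norm (Q t u b x - Q 0 u b x)) \<le> e / (2 * C) * nrm Y b"
   by (rule order_trans[OF integrable_of_square(2)[OF L2] bspec[OF elim(2) b(1)]])
  also have "e / (2 * C) * nrm Y b \<le> e / (2 * C) * (C * nrm Y f)" using e b(2) by (intro mult_left_mono) auto
  also have "e / 2 * nrm Y f + e / (2 * C) * (C * nrm Y f) = e * nrm Y f" using const by simp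
  finally show "(LINT x|m. norm ((Q t u ^^ Suc p) f x - (Q 0 u ^^ Suc p) f x)) \<le> e * nrm Y f" by (simp add: a_def b_def)
 qed
qed

lemma char_close:
 assumes u: "abs u < \<delta>" and e: "e > 0"
 shows "\<forall>\<^sub>F t in param. cmod ((LINT x|\<nu> t. ei u (birkhoff_sum (G t) h p x))
  - (LINT x|\<nu> 0. ei u (birkhoff_sum (G 0) h p x))) \<le> e"
proof -
 have e': "e / 2 > 0" "e / (2 * C) > 0" using e const by auto
 have one: "(\<lambda>_. 1) \<in> Linf m" by (rule LinfI[where K = 1]) auto
 from \<rho>_close[OF e'(1)] twisted_pow_close[OF u e'(2), of p] param_small show ?thesis
 proof eventually_elim
  case (elim t)
  then have t: "t \<in> \<Theta>" "abs t < \<delta>" by auto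
  let ?r = "\<lambda>x. complex_of_real (\<rho> t x)" and ?z = "\<lambda>x. complex_of_real (\<rho> 0 x)"
  let ?E = "\<lambda>t x. ei u (birkhoff_sum (G t) h p x)"
  have EL: "?E t \<in> Linf m" if "t \<in> \<Theta>" for t using birkhoff_measurable[OF nonsing[OF that] h_meas] by (intro LinfI[where K = 1]) auto
  have int: "(LINT x|m. (Q t u ^^ p) f x) = (LINT x|m. f x * ?E t x)" if "f \<in> elems Y" "t \<in> \<Theta>" for f t
   using twisted_pow_dual[OF nonsing[OF that(2)] h_meas Y_integrable(1)[OF that(1)] one, where s = u and n = p] by simp
  note re = \<rho>_elem[OF t] and r0e = \<rho>_elem[OF zero]
  have \<nu>: "(LINT x|\<nu> t. ?E t x) = (LINT x|m. complex_of_real (\<rho> t x) * ?E t x)" if "t \<in> \<Theta>" "abs t < \<delta>" for t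
   using EL[OF that(1)] by (intro integral_\<nu>[OF that]) (auto simp: Linf_def)
  have i: "integrable m ((Q t u ^^ p) ?r)" "integrable m ((Q 0 u ^^ p) ?r)"
   by (rule Y_integrable(1)[OF conjunct1[OF pow[OF t u re, of p]]] Y_integrable(1)[OF conjunct1[OF pow[OF zero u re, of p]]])+
  have ir: "integrable m (\<lambda>x. ?r x * ?E 0 x)" "integrable m (\<lambda>x. ?z x * ?E 0 x)"
   using integrable_Linf_mult[OF Y_integrable(1)[OF re] EL[OF zero(1)]] integrable_Linf_mult[OF Y_integrable(1)[OF r0e] EL[OF zero(1)]] by auto
  have "(LINT x|\<nu> t. ?E t x) - (LINT x|\<nu> 0. ?E 0 x) =
    ((LINT x|m. (Q t u ^^ p) ?r x) - (LINT x|m. (Q 0 u ^^ p) ?r x)) + ((LINT x|m. ?r x * ?E 0 x) - (LINT x|m. ?z x * ?E 0 x))"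
   unfolding \<nu>[OF t] \<nu>[OF zero] int[OF re t(1)] int[OF re zero(1)] by simp
  also have "... = (LINT x|m. (Q t u ^^ p) ?r x - (Q 0 u ^^ p) ?r x) + (LINT x|m. (?r x - ?z x) * ?E 0 x)"
   using i ir by (simp add: left_diff_distrib)
  finally have *: "(LINT x|\<nu> t. ?E t x) - (LINT x|\<nu> 0. ?E 0 x) =
   (LINT x|m. (Q t u ^^ p) ?r x - (Q 0 u ^^ p) ?r x) + (LINT x|m. (?r x - ?z x) * ?E 0 x)" .
  have "cmod (LINT x|m. (Q t u ^^ p) ?r x - (Q 0 u ^^ p) ?r x) \<le> e / (2 * C) * nrm Y ?r"
   by (rule order_trans[OF integral_norm_bound bspec[OF elim(2) re]])
  also have "... \<le> e / (2 * C) * C" using \<rho>_nrm[OF t] e' by (intro mult_left_mono) auto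
  finally have 1: "cmod (LINT x|m. (Q t u ^^ p) ?r x - (Q 0 u ^^ p) ?r x) \<le> e / 2" using const by simp
  have "cmod (LINT x|m. (?r x - ?z x) * ?E 0 x) \<le> (LINT x|m. norm (?r x - ?z x))"
   using integral_norm_bound[of m "\<lambda>x. (?r x - ?z x) * ?E 0 x"] by (simp add: norm_mult)
  also have "... \<le> norm2 m (\<lambda>x. ?r x - ?z x)"
   using norm2_triangle(1)[OF \<rho>_L2(1)[OF t] \<rho>_L2(1)[OF zero] \<rho>_L2(2)[OF t] \<rho>_L2(2)[OF zero]] \<rho>_L2(1)[OF t] \<rho>_L2(1)[OF zero]
   by (intro integrable_of_square(2)) auto
  also have "... \<le> e / 2" by (rule elim(1))
  finally have "cmod (LINT x|m. (?r x - ?z x) * ?E 0 x) \<le> e / 2" .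
  then show ?case unfolding * using 1 norm_triangle_ineq[of "\<integral>x. (Q t u ^^ p) ?r x - (Q 0 u ^^ p) ?r x \<partial>m" "\<integral>x. (?r x - ?z x) * ?E 0 x \<partial>m"]
   by linarith
 qed
qed

lemma variance_convergence:
 fixes ts :: "nat \<Rightarrow> real"
 assumes ts: "filterlim ts param sequentially"
  and sys: "\<And>t. [|t \<in> \<Theta>; abs t < \<delta>|] ==> mixing_system (\<nu> t) (G t) h D \<eta> \<delta>"
 shows "(\<lambda>n. mixing_system.s (\<nu> (ts n)) (G (ts n)) h) \<longlonglongrightarrow> mixing_system.s (\<nu> 0) (G 0) h"
proof (rule mixing_variance_limit)
 have "\<forall>\<^sub>F n in sequentially. ts n \<in> \<Theta> \<and> abs (ts n) < \<delta>" using ts param_small unfolding filterlim_iff by blast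
 then show "\<forall>\<^sub>F n in sequentially. mixing_system (\<nu> (ts n)) (G (ts n)) h D \<eta> \<delta>" by eventually_elim (use sys in auto)
 show "mixing_system (\<nu> 0) (G 0) h D \<eta> \<delta>" by (rule sys[OF zero])
 show "(\<lambda>n. \<integral>x. h x \<partial>\<nu> (ts n)) \<longlonglongrightarrow> (LINT x|\<nu> 0. h x)"
 proof (rule tendstoI)
  fix e :: real assume "e > 0"
  then have "\<forall>\<^sub>F t in param. abs ((LINT x|\<nu> t. h x) - (LINT x|\<nu> 0. h x)) \<le> e / 2" by (intro mean_close) simp
  with ts have "\<forall>\<^sub>F n in sequentially. abs ((LINT x|\<nu> (ts n). h x) - (LINT x|\<nu> 0. h x)) \<le> e / 2" unfolding filterlim_iff by blast
  then show "\<forall>\<^sub>F n in sequentially. dist (LINT x|\<nu> (ts n). h x) (LINT x|\<nu> 0. h x) < e"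
   by eventually_elim (use \<open>e > 0\<close> in \<open>auto simp: dist_real_def\<close>)
 qed
 show "(\<lambda>n. \<integral>x. ei u (birkhoff_sum (G (ts n)) h p x) \<partial>\<nu> (ts n)) \<longlonglongrightarrow>
   (LINT x|\<nu> 0. ei u (birkhoff_sum (G 0) h p x))" if u: "abs u < \<delta>" for p u
 proof (rule tendstoI)
  fix e :: real assume e: "e > 0"
  then have "\<forall>\<^sub>F t in param. cmod ((LINT x|\<nu> t. ei u (birkhoff_sum (G t) h p x))
   - (LINT x|\<nu> 0. ei u (birkhoff_sum (G 0) h p x))) \<le> e / 2" by (intro char_close u) simp
  with ts have "\<forall>\<^sub>F n in sequentially. cmod ((LINT x|\<nu> (ts n). ei u (birkhoff_sum (G (ts n)) h p x))
   - (LINT x|\<nu> 0. ei u (birkhoff_sum (G 0) h p x))) \<le> e / 2" unfolding filterlim_iff by blast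
  then show "\<forall>\<^sub>F n in sequentially. dist (LINT x|\<nu> (ts n). ei u (birkhoff_sum (G (ts n)) h p x))
   (LINT x|\<nu> 0. ei u (birkhoff_sum (G 0) h p x)) < e" by eventually_elim (use e in \<open>auto simp: dist_norm\<close>)
 qed
qed

end

section \<open>Asymptotic means and initial densities\<close>

lemma Cesaro_geometric:
 fixes a :: "nat \<Rightarrow> real"
 assumes a: "\<And>j. abs (a j - l) \<le> B * r ^ j" and r: "0 < r" "r < 1" and B: "0 \<le> B"
 shows "(\<lambda>n. (\<Sum>j<n. a j) / real n) \<longlonglongrightarrow> l"
proof -
 have b: "abs ((\<Sum>j<n. a j) / real n - l) \<le> B / (1 - r) / real n" if n: "0 < n" for n
 proof -
  have "abs ((\<Sum>j<n. a j) - real n * l) = abs (\<Sum>j<n. (a j - l))" by (simp add: sum_subtractf)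
  also have "... \<le> (\<Sum>j<n. B * r ^ j)" by (rule order_trans[OF sum_abs sum_mono]) (rule a)
  also have "... = B * (\<Sum>j<n. r ^ j)" by (rule sum_distrib_left[symmetric])
  also have "... \<le> B * (\<Sum>j. r ^ j)" using r B by (intro mult_left_mono sum_le_suminf summable_geometric) auto
  also have "... = B / (1 - r)" using r by (simp add: suminf_geometric)
  finally have "abs ((\<Sum>j<n. a j) - real n * l) / real n \<le> B / (1 - r) / real n" by (intro divide_right_mono) auto
  moreover have "(\<Sum>j<n. a j) / real n - l = ((\<Sum>j<n. a j) - real n * l) / real n" using n by (simp add: field_simps)
  ultimately show ?thesis by (simp add: abs_divide)
 qed
 have "(\<lambda>n. (\<Sum>j<n. a j) / real n - l) \<longlonglongrightarrow> 0"
 proof (rule tendsto_rabs_zero_cancel, rule tendsto_sandwich[of "\<lambda>_. 0"])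
  show "\<forall>\<^sub>F n in sequentially. abs ((\<Sum>j<n. a j) / real n - l) \<le> B / (1 - r) / real n"
   using eventually_gt_at_top[of 0] by eventually_elim (rule b)
  show "(\<lambda>n. B / (1 - r) / real n) \<longlonglongrightarrow> 0" by (rule lim_const_over_n)
 qed auto
 then show ?thesis by (simp add: LIM_zero_iff)
qed

context gapped_family
begin

lemma mean_bound:
 assumes t: "t \<in> \<Theta>" "abs t < \<delta>"
 shows "abs (\<integral>x. h x \<partial>\<nu> t) \<le> K * C * H"
proof -
 note r = \<rho>_L2[OF t]
 have "abs (\<integral>x. h x \<partial>\<nu> t) = cmod (of_real (LINT x|m. \<rho> t x * h x))" unfolding integral_\<nu>_real[OF t h_meas] by simp
 also have "... = cmod (LINT x|m. of_real (\<rho> t x) * of_real (h x))" unfolding integral_complex_of_real[symmetric] by simp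
 also have "... \<le> norm2 m (cr (\<rho> t)) * H" unfolding H_def by (rule order_trans[OF integral_norm_bound norm2_mult(2)[OF r(1) h_meas r(2) h2]])
 also have "... \<le> K * C * H" by (rule mult_right_mono[OF r(3) H_nonneg])
 finally show ?thesis .
qed

lemma centered_L2:
 assumes t: "t \<in> \<Theta>" "abs t < \<delta>"
 shows "integrable m (\<lambda>x. (h x - (LINT x|\<nu> t. h x))^2)" "sqrt (LINT x|m. (h x - (LINT x|\<nu> t. h x))^2) \<le> (1 + K * C) * H"
proof -
 define A where "A = (LINT x|\<nu> t. h x)"
 have h: "norm2 m (cr h) = H" by (simp add: norm2_def H_def)
 have A: "norm2 m (\<lambda>x. complex_of_real A) = abs A" by (simp add: norm2_def prob_space)
 have 1: "sqi m (\<lambda>x. complex_of_real (h x) - complex_of_real A)"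
  "norm2 m (\<lambda>x. complex_of_real (h x) - complex_of_real A) \<le> H + abs A"
  using norm2_triangle(1,2)[of "\<lambda>x. complex_of_real (h x)" "\<lambda>x. complex_of_real A"] h2 by (auto simp: h A)
 have eq: "(norm (complex_of_real (h x) - complex_of_real A))^2 = (h x - A)^2" for x
  by (simp only: of_real_diff[symmetric] norm_of_real power2_abs)
 show "integrable m (\<lambda>x. (h x - (LINT x|\<nu> t. h x))^2)" using 1(1) unfolding eq A_def[symmetric] .
 show "sqrt (LINT x|m. (h x - (LINT x|\<nu> t. h x))^2) \<le> (1 + K * C) * H"
  using 1(2) mean_bound[OF t] unfolding norm2_def eq A_def[symmetric] by (simp add: algebra_simps)
qed

context
 fixes t R :: real and \<phi> :: "'x \<Rightarrow> real"
 assumes t: "t \<in> \<Theta>" "abs t < \<delta>" and \<phi>: "\<And>x. 0 \<le> \<phi> x" "cr \<phi> \<in> elems Z" "nrm Z (cr \<phi>) \<le> R"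
  "(LINT x|m. \<phi> x) = 1"
begin

lemma initial_integrable: "integrable m \<phi>" using Z_integrable(1)[OF \<phi>(2)] integrable_Re by fastforce

lemma prob_initial: "prob_space (density m \<phi>)" using initial_integrable \<phi>(1,4) by (rule prob_space_density)

lemma initial_gap:
 defines "f \<equiv> \<lambda>x. complex_of_real (\<phi> x)"
 shows "norm2 m (\<lambda>x. (L t ^^ n) f x - of_real (\<rho> t x)) \<le> C * \<eta> ^ (8 * n) * R"
  "(L t ^^ n) f \<in> borel_measurable m" "sqi m ((L t ^^ n) f)"
  "norm2 m ((L t ^^ n) f) \<le> C * R + K * C"
proof -
 have I: "(LINT x|m. f x) = 1" using \<phi>(4) by (simp add: f_def)
 have fZ: "f \<in> elems Z" using \<phi>(2) by (simp add: f_def)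
 have R: "C * \<eta> ^ (8 * n) * nrm Z f \<le> C * \<eta> ^ (8 * n) * R" using \<phi>(3) const by (intro mult_left_mono) (auto simp: f_def)
 show 1: "norm2 m (\<lambda>x. (L t ^^ n) f x - of_real (\<rho> t x)) \<le> C * \<eta> ^ (8 * n) * R" using gap_Z[OF t fZ, of n] R unfolding I by simp
 show b: "(L t ^^ n) f \<in> borel_measurable m" "sqi m ((L t ^^ n) f)" using Z_L2[OF pow_Z[OF t fZ, of n]] by auto
 note r = remainder_L2[OF t b, of 1, simplified]
 have R0: "0 \<le> R" using order_trans[OF norm2_nonneg gap_Z[OF t fZ, of 0]] const \<phi>(3) by (simp add: f_def zero_le_mult_iff)
 have "norm2 m (\<lambda>x. ((L t ^^ n) f x - of_real (\<rho> t x)) + of_real (\<rho> t x)) \<le> C * \<eta> ^ (8 * n) * R + K * C"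
  using norm2_triangle(4)[OF r(1) \<rho>_L2(1)[OF t] r(2) \<rho>_L2(2)[OF t]] 1 \<rho>_L2(3)[OF t] by linarith
 moreover have "C * \<eta> ^ (8 * n) * R \<le> C * 1 * R" using const R0 by (intro mult_right_mono mult_left_mono power_le_one) auto
 ultimately show "norm2 m ((L t ^^ n) f) \<le> C * R + K * C" by simp
qed

lemma initial_decay:
 assumes k: "k \<in> borel_measurable m" and k2: "integrable m (\<lambda>x. (k x)^2)"
 shows "integrable (density m \<phi>) (\<lambda>x. k ((G t ^^ j) x))"
  and "abs ((LINT x|density m \<phi>. k ((G t ^^ j) x)) - (LINT x|\<nu> t. k x)) \<le> C * \<eta> ^ (8 * j) * R * sqrt (LINT x|m. (k x)^2)"
  and "(LINT x|density m \<phi>. abs (k ((G t ^^ j) x))) \<le> (C * R + K * C) * sqrt (LINT x|m. (k x)^2)"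
proof -
 note ns = nonsing[OF t(1)]
 note [measurable] = k borel_measurable_integrable[OF initial_integrable] nonsingular_measurable[OF nonsingular_funpow[OF ns]]
 let ?b = "(L t ^^ j) (cr \<phi>)"
 note g = initial_gap[of j]
 have dens: "(LINT x|density m \<phi>. F x) = (LINT x|m. \<phi> x * F x)" if "F \<in> borel_measurable m" for F :: "'x \<Rightarrow> real"
  using that \<phi>(1) by (subst integral_density) auto
 note c = comp_L2[OF t initial_integrable \<phi>(1) k k2 g(3)]
 show "integrable (density m \<phi>) (\<lambda>x. k ((G t ^^ j) x))" using c(1) \<phi>(1) by (subst integrable_density) auto
 have d: "cmod ((LINT x|m. ?b x * of_real (k x)) - 1 * of_real (LINT x|\<nu> t. k x)) \<le> C * \<eta> ^ (8 * j) * R * sqrt (LINT x|m. (k x)^2)"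
  using g(1) by (intro decay t g(2,3) k k2) simp
 have "complex_of_real ((LINT x|density m \<phi>. k ((G t ^^ j) x)) - (LINT x|\<nu> t. k x)) = (LINT x|m. ?b x * of_real (k x)) - 1 * of_real (LINT x|\<nu> t. k x)"
  using c(2) by (subst dens) auto
 with d show "abs ((LINT x|density m \<phi>. k ((G t ^^ j) x)) - (LINT x|\<nu> t. k x)) \<le> C * \<eta> ^ (8 * j) * R * sqrt (LINT x|m. (k x)^2)"
  by (metis norm_of_real)
 have ka: "(\<lambda>x. abs (k x)) \<in> borel_measurable m" "integrable m (\<lambda>x. abs (k x)^2)" using k2 by auto
 have "(LINT x|density m \<phi>. abs (k ((G t ^^ j) x))) = cmod (of_real (LINT x|m. \<phi> x * abs (k ((G t ^^ j) x))))" using \<phi>(1) by (subst dens) auto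
 also have "... = cmod (LINT x|m. ?b x * of_real (abs (k x)))" unfolding comp_L2(2)[OF t initial_integrable \<phi>(1) ka g(3)] ..
 also have "... \<le> norm2 m ?b * sqrt (LINT x|m. abs (k x)^2)"
  by (rule order_trans[OF integral_norm_bound norm2_mult(2)[OF g(2) ka(1) g(3) ka(2)]])
 also have "... \<le> (C * R + K * C) * sqrt (LINT x|m. (k x)^2)" unfolding power2_abs by (intro mult_right_mono g(4)) simp
 finally show "(LINT x|density m \<phi>. abs (k ((G t ^^ j) x))) \<le> (C * R + K * C) * sqrt (LINT x|m. (k x)^2)" .
qed

lemma initial_R: "0 \<le> R" using order_trans[OF norm2_nonneg initial_gap(1)[of 0]] const by (simp add: zero_le_mult_iff)

text \<open>The expectations of \<open>h\<close> at time \<open>j\<close> converge exponentially to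
  the stationary mean, so the centring in \<open>T_stat\<close> is the same for every admissible
  initial law.\<close>

lemma asymptotic_mean_initial: "asymptotic_mean (density m \<phi>) (G t) h = (LINT x|\<nu> t. h x)"
proof -
 have \<eta>8: "0 < \<eta> ^ 8" "\<eta> ^ 8 < 1" using const by (auto simp: power_less_one_iff)
 have "abs ((LINT x|density m \<phi>. h ((G t ^^ j) x)) - (LINT x|\<nu> t. h x)) \<le> C * R * H * (\<eta> ^ 8) ^ j" for j
  using initial_decay(2)[OF h_meas h2, of j] unfolding H_def power_mult by (simp add: mult_ac)
 then have "(\<lambda>n. (\<Sum>j<n. \<integral>x. h ((G t ^^ j) x) \<partial>density m \<phi>) / real n) \<longlonglongrightarrow> (LINT x|\<nu> t. h x)"
  using \<eta>8 const initial_R H_nonneg by (intro Cesaro_geometric[where B = "C * R * H" and r = "\<eta> ^ 8"]) auto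
 moreover have "(LINT x|density m \<phi>. birkhoff_sum (G t) h n x / real n) = (\<Sum>j<n. \<integral>x. h ((G t ^^ j) x) \<partial>density m \<phi>) / real n" for n
  using initial_decay(1)[OF h_meas h2] by (simp add: birkhoff_sum_def)
 ultimately show ?thesis unfolding asymptotic_mean_def by (simp only: limI)
qed

text \<open>Waiting \<open>q\<close> steps: dropping the first \<open>q\<close> summands costs
  \<open>abs u\<close> times \<open>q\<close> times an L^1 bound, under the initial and under the
  stationary law alike; after the wait the two laws differ by a term of order
  \<open>\<eta>^(8 q)\<close>.\<close>

lemma initial_char:
 assumes n: "q \<le> n"
 defines "k \<equiv> \<lambda>x. h x - (LINT x|\<nu> t. h x)"
 shows "cmod ((LINT x|density m \<phi>. ei u (birkhoff_sum (G t) k n x))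
   - (LINT x|\<nu> t. ei u (birkhoff_sum (G t) k n x)))
  \<le> abs u * (real q * ((C * R + 2 * (K * C)) * ((1 + K * C) * H))) + C * \<eta> ^ (8 * q) * R"
proof -
 note ns = nonsing[OF t(1)]
 have km [measurable]: "k \<in> borel_measurable m" unfolding k_def by simp
 have k2: "integrable m (\<lambda>x. (k x)^2)" "sqrt (LINT x|m. (k x)^2) \<le> (1 + K * C) * H" using centered_L2[OF t] by (simp_all add: k_def)
 have [measurable]: "birkhoff_sum (G t) k n \<in> borel_measurable m" for n by (rule birkhoff_measurable[OF ns km])
 note [measurable] = borel_measurable_integrable[OF initial_integrable] nonsingular_measurable[OF nonsingular_funpow[OF ns]]
 let ?S = "birkhoff_sum (G t) k"
 define \<psi> where "\<psi> x = ei u (?S (n - q) x)" for x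
 have \<psi> [measurable]: "\<psi> \<in> borel_measurable m" unfolding \<psi>_def by measurable
 have \<psi>L: "\<psi> \<in> Linf m" by (rule LinfI[OF \<psi>, of 1]) (simp add: \<psi>_def)
 have step: "cmod (ei u (?S n x) - \<psi> ((G t ^^ q) x)) \<le> abs u * abs (?S q x)" for x
 proof -
  have "?S n x = ?S q x + ?S (n - q) ((G t ^^ q) x)" using birkhoff_sum_add[of "G t" k q "n - q" x] n by simp
  then have "ei u (?S n x) - \<psi> ((G t ^^ q) x) = (exp (\<i> * of_real (u * ?S q x)) - exp (\<i> * of_real 0)) * \<psi> ((G t ^^ q) x)"
   by (simp add: \<psi>_def exp_add algebra_simps)
  also have "cmod ... = cmod (exp (\<i> * of_real (u * ?S q x)) - exp (\<i> * of_real 0))" by (simp add: norm_mult \<psi>_def)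
  also have "... \<le> abs (u * ?S q x - 0)" by (rule iexp_Lipschitz)
  finally show ?thesis by (simp add: abs_mult)
 qed
 \<comment> \<open>Formulated for a general law because it is applied to the initial and to the
   stationary one; their constants add up to the factor \<open>C * R + 2 * (K * C)\<close>.\<close>
 have wait: "cmod ((LINT x|P. ei u (?S n x)) - (LINT x|P. \<psi> ((G t ^^ q) x))) \<le> abs u * (real q * (b * ((1 + K * C) * H)))"
  if P: "prob_space P" "sets P = sets m" and i: "\<And>j. integrable P (\<lambda>x. k ((G t ^^ j) x))" and b: "0 \<le> b" "\<And>j. (LINT x|P. abs (k ((G t ^^ j) x))) \<le> b * sqrt (LINT x|m. (k x)^2)" for P b
 proof -
  interpret P: prob_space P by (rule P)
  have mP: "f \<in> borel_measurable P" if "f \<in> borel_measurable m" for f :: "'x \<Rightarrow> 'y::topological_space"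
   using that measurable_cong_sets[OF P(2) refl] by blast
  have e: "integrable P (\<lambda>x. ei u (?S n x))" "integrable P (\<lambda>x. \<psi> ((G t ^^ q) x))"
   by (intro P.integrable_const_bound[where B = 1] mP; simp add: \<psi>_def)+
  have iS: "integrable P (?S q)" unfolding birkhoff_sum_def[abs_def] using i by simp
  have "cmod ((LINT x|P. ei u (?S n x)) - (LINT x|P. \<psi> ((G t ^^ q) x)))
    = cmod (LINT x|P. ei u (?S n x) - \<psi> ((G t ^^ q) x))" using e by simp
  also have "... \<le> (LINT x|P. abs u * abs (?S q x))" using e iS step by (intro order_trans[OF integral_norm_bound] integral_mono) auto
  also have "... = abs u * (LINT x|P. abs (?S q x))" by simp
  also have "... \<le> abs u * (real q * (b * ((1 + K * C) * H)))"
  proof (intro mult_left_mono)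
   have "(LINT x|P. abs (?S q x)) \<le> (LINT x|P. (\<Sum>j<q. abs (k ((G t ^^ j) x))))" using iS i by (intro integral_mono) (auto simp: birkhoff_sum_def)
   also have "... = (\<Sum>j<q. \<integral>x. abs (k ((G t ^^ j) x)) \<partial>P)" using i by simp
   also have "... \<le> real (card {..<q}) * (b * ((1 + K * C) * H))"
    using order_trans[OF b(2) mult_left_mono[OF k2(2) b(1)]] by (intro sum_bounded_above) auto
   finally show "(LINT x|P. abs (?S q x)) \<le> real q * (b * ((1 + K * C) * H))" by simp
  qed simp
  finally show ?thesis .
 qed
 have w1: "cmod ((LINT x|density m \<phi>. ei u (?S n x)) - (LINT x|density m \<phi>. \<psi> ((G t ^^ q) x)))
   \<le> abs u * (real q * ((C * R + K * C) * ((1 + K * C) * H)))"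
  using initial_decay(1,3)[OF km k2(1)] const initial_R by (intro wait prob_initial) auto
 have inv: "distr (\<nu> t) m (G t ^^ j) = \<nu> t" for j
 proof (induction j)
  case 0
  show ?case by (simp add: distr_id2 sets_\<nu>[OF t])
 next
  case (Suc j)
  have [measurable]: "G t ^^ j \<in> measurable (\<nu> t) m" using nonsingular_measurable[OF nonsingular_funpow[OF ns]] measurable_cong_sets[OF sets_\<nu>[OF t] refl] by blast
  have "distr (\<nu> t) m (G t ^^ Suc j) = distr (distr (\<nu> t) m (G t ^^ j)) m (G t)"
   using nonsingular_measurable[OF ns] by (subst distr_distr) (auto simp: funpow.simps)
  also have "... = distr (\<nu> t) (\<nu> t) (G t)" unfolding Suc by (rule distr_cong) (auto simp: sets_\<nu>[OF t])
  finally show ?case unfolding inv_\<nu>[OF t] .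
 qed
 have gj [measurable]: "G t ^^ j \<in> measurable (\<nu> t) m" for j using nonsingular_measurable[OF nonsingular_funpow[OF ns]] measurable_cong_sets[OF sets_\<nu>[OF t] refl] by blast
 have ik: "integrable (\<nu> t) k" "(LINT x|\<nu> t. abs (k x)) \<le> K * C * sqrt (LINT x|m. (k x)^2)"
 proof -
  note r = \<rho>_L2[OF t]
  have *: "integrable m (\<lambda>x. complex_of_real (\<rho> t x) * of_real (k x))" by (rule norm2_mult(1)[OF r(1) km r(2) k2(1)])
  have "integrable m (\<lambda>x. \<rho> t x * k x)" using integrable_Re[OF *] by simp
  then show "integrable (\<nu> t) k" using integrable_\<nu>_real[OF t km] by simp
  have "(LINT x|\<nu> t. abs (k x)) = (LINT x|m. norm (complex_of_real (\<rho> t x) * of_real (k x)))"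
   by (subst integral_\<nu>_real[OF t]) (auto simp: norm_mult \<rho>_nonneg)
  also have "... \<le> norm2 m (cr (\<rho> t)) * sqrt (LINT x|m. (k x)^2)" by (rule norm2_mult(2)[OF r(1) km r(2) k2(1)])
  also have "... \<le> K * C * sqrt (LINT x|m. (k x)^2)" by (intro mult_right_mono r(3)) simp
  finally show "(LINT x|\<nu> t. abs (k x)) \<le> K * C * sqrt (LINT x|m. (k x)^2)" .
 qed
 have w2: "cmod ((LINT x|\<nu> t. ei u (?S n x)) - (LINT x|\<nu> t. \<psi> ((G t ^^ q) x)))
   \<le> abs u * (real q * ((K * C) * ((1 + K * C) * H)))"
 proof (rule wait[OF prob_\<nu>[OF t] sets_\<nu>[OF t]])
  show "integrable (\<nu> t) (\<lambda>x. k ((G t ^^ j) x))" for j by (rule integrable_distr[OF gj[of j], where f = k]) (use ik(1) in \<open>simp add: inv\<close>)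
  have "(LINT x|\<nu> t. abs (k ((G t ^^ j) x))) = (LINT x|\<nu> t. abs (k x))" for j
   using integral_distr[OF gj[of j], where f = "\<lambda>x. abs (k x)"] by (simp add: inv)
  then show "(LINT x|\<nu> t. abs (k ((G t ^^ j) x))) \<le> K * C * sqrt (LINT x|m. (k x)^2)" for j using ik(2) by simp
 qed (use const in auto)
 let ?b = "(L t ^^ q) (cr \<phi>)"
 note g = initial_gap[of q]
 note r = remainder_L2[OF t g(2,3), of 1, simplified]
 have "(LINT x|\<nu> t. \<psi> ((G t ^^ q) x)) = (LINT x|m. of_real (\<rho> t x) * \<psi> x)"
  using integral_distr[OF gj[of q] \<psi>] integral_\<nu>[OF t \<psi>] by (simp add: inv)
 moreover have "(LINT x|density m \<phi>. \<psi> ((G t ^^ q) x)) = (LINT x|m. ?b x * \<psi> x)"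
  unfolding transfer_pow_dual[OF ns Z_integrable(1)[OF \<phi>(2)] \<psi>L] using \<phi>(1) by (subst integral_density) (auto simp: scaleR_conv_of_real)
 ultimately have "(LINT x|density m \<phi>. \<psi> ((G t ^^ q) x)) - (LINT x|\<nu> t. \<psi> ((G t ^^ q) x)) = (LINT x|m. (?b x - of_real (\<rho> t x)) * \<psi> x)"
  using integrable_Linf_mult[OF integrable_of_square(1)[OF g(2,3)] \<psi>L] integrable_Linf_mult[OF Y_integrable(1)[OF \<rho>_elem[OF t]] \<psi>L]
  by (simp add: left_diff_distrib)
 also have "cmod ... \<le> (LINT x|m. norm (?b x - of_real (\<rho> t x)))"
  using integral_norm_bound[of m "\<lambda>x. (?b x - of_real (\<rho> t x)) * \<psi> x"] by (simp add: norm_mult \<psi>_def)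
 also have "... \<le> C * \<eta> ^ (8 * q) * R" by (rule order_trans[OF integrable_of_square(2)[OF r] g(1)])
 finally have w3: "cmod ((LINT x|density m \<phi>. \<psi> ((G t ^^ q) x)) - (LINT x|\<nu> t. \<psi> ((G t ^^ q) x))) \<le> C * \<eta> ^ (8 * q) * R" .
 have tri: "cmod (a - d) \<le> cmod (a - b) + cmod (d - c) + cmod (b - c)" for a b c d :: complex
  using norm_triangle_ineq[of "a - b" "b - d"] norm_triangle_ineq[of "b - c" "c - d"] norm_minus_commute[of c d] by simp
 have "abs u * (real q * ((C * R + 2 * (K * C)) * ((1 + K * C) * H))) =
   abs u * (real q * ((C * R + K * C) * ((1 + K * C) * H))) + abs u * (real q * ((K * C) * ((1 + K * C) * H)))"
  by (simp only: distrib_left[symmetric] distrib_right[symmetric] mult_2 add.assoc)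
 then show ?thesis using tri[of "\<integral>x. ei u (?S n x) \<partial>density m \<phi>" "\<integral>x. ei u (?S n x) \<partial>\<nu> t"
   "\<integral>x. \<psi> ((G t ^^ q) x) \<partial>density m \<phi>" "\<integral>x. \<psi> ((G t ^^ q) x) \<partial>\<nu> t"] w1 w2 w3 by linarith
qed

end

text \<open>For each error the waiting time \<open>q\<close> is fixed first and \<open>n\<close> is
  sent to infinity afterwards: the cost of the dropped summands carries the frequency
  \<open>\<tau> / sqrt n\<close> and vanishes.\<close>

lemma initial_clt:
 fixes ts :: "nat \<Rightarrow> real" and \<phi> :: "nat \<Rightarrow> 'x \<Rightarrow> real"
 assumes sys: "\<And>t. [|t \<in> \<Theta>; abs t < \<delta>|] ==> mixing_system (\<nu> t) (G t) h D \<eta> \<delta>"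
  and ts: "filterlim ts param sequentially"
  and \<phi>: "\<forall>\<^sub>F n in sequentially. (\<forall>x. 0 \<le> \<phi> n x) \<and> cr (\<phi> n) \<in> elems Z \<and> nrm Z (cr (\<phi> n)) \<le> R \<and> (LINT x|m. \<phi> n x) = 1"
  and v: "mixing_system.s (\<nu> 0) (G 0) h \<noteq> 0" and e: "e > 0"
 shows "\<forall>\<^sub>F n in sequentially. \<forall>z. \<bar>measure (density m (\<phi> n)) {x \<in> space (density m (\<phi> n)). T_stat (density m (\<phi> n)) (G (ts n)) h n x \<le> z}
   - cdf std_normal_distribution (z / sqrt (mixing_system.s (\<nu> 0) (G 0) h))\<bar> \<le> e"
proof -
 define v where "v = mixing_system.s (\<nu> 0) (G 0) h"
 interpret n0: mixing_system "\<nu> 0" "G 0" h D \<eta> \<delta> by (rule sys[OF zero])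
 have v0: "v > 0" using n0.s_bounds assms(4) by (simp add: v_def)
 have tp: "\<forall>\<^sub>F n in sequentially. ts n \<in> \<Theta> \<and> abs (ts n) < \<delta>" using ts param_small unfolding filterlim_iff by blast
 define good where "good n \<longleftrightarrow> (ts n \<in> \<Theta> \<and> abs (ts n) < \<delta>) \<and> (\<forall>x. 0 \<le> \<phi> n x) \<and> cr (\<phi> n) \<in> elems Z \<and> nrm Z (cr (\<phi> n)) \<le> R \<and> (LINT x|m. \<phi> n x) = 1" for n
 obtain N where N: "\<And>n. n \<ge> N ==> good n" "N > 0"
 proof -
  have "\<forall>\<^sub>F n in sequentially. good n" unfolding good_def using tp \<phi> by (rule eventually_conj)
  then obtain N where "\<And>n. n \<ge> N ==> good n" by (auto simp: eventually_sequentially)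
  then show thesis using that[of "Suc N"] by auto
 qed
 have good: "ts n \<in> \<Theta>" "abs (ts n) < \<delta>" "\<And>x. 0 \<le> \<phi> n x" "cr (\<phi> n) \<in> elems Z" "nrm Z (cr (\<phi> n)) \<le> R" "(LINT x|m. \<phi> n x) = 1" if "n \<ge> N" for n
  using N(1)[OF that] by (auto simp: good_def)
 define P where "P n = density m (\<lambda>x. ennreal (\<phi> n x))" for n
 define T where "T n = T_stat (P n) (G (ts n)) h n" for n
 define k where "k n x = h x - (LINT x|\<nu> (ts n). h x)" for n x
 have am: "asymptotic_mean (P n) (G (ts n)) h = (LINT x|\<nu> (ts n). h x)" if "n \<ge> N" for n
  unfolding P_def by (rule asymptotic_mean_initial[OF good[OF that]])
 have T_eq: "T n x = birkhoff_sum (G (ts n)) (k n) n x / sqrt (real n)" if "n \<ge> N" for n x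
  unfolding T_def T_stat_def am[OF that] by (simp add: birkhoff_sum_def k_def sum_subtractf)
 define F where "F n \<tau> = (LINT x|P n. ei \<tau> (T n x))" for n \<tau>
 have F: "(\<lambda>n. F n \<tau>) \<longlonglongrightarrow> of_real (exp (- (\<tau>^2 * v / 2)))" for \<tau>
 proof -
  define ch where "ch n = (LINT x|\<nu> (ts n). ei (\<tau> / sqrt (real n)) (birkhoff_sum (G (ts n)) (k n) n x))" for n
  have ch: "ch \<longlonglongrightarrow> of_real (exp (- (\<tau>^2 * v / 2)))"
  proof -
   have s: "\<forall>\<^sub>F n in sequentially. mixing_system (\<nu> (ts n)) (G (ts n)) h D \<eta> \<delta>" using tp by eventually_elim (use sys in auto)
   have "(\<lambda>n. mixing_system.\<phi> (\<nu> (ts n)) (G (ts n)) h n (\<tau> / sqrt (real n))) \<longlonglongrightarrow> of_real (exp (- (\<tau>^2 * v / 2)))"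
    unfolding v_def by (rule mixing_array_clt[OF s variance_convergence[OF ts sys]])
   then show ?thesis
   proof (rule Lim_transform_eventually)
    from s show "\<forall>\<^sub>F n in sequentially. mixing_system.\<phi> (\<nu> (ts n)) (G (ts n)) h n (\<tau> / sqrt (real n)) = ch n"
    proof eventually_elim
     case (elim n)
     interpret n: mixing_system "\<nu> (ts n)" "G (ts n)" h D \<eta> \<delta> by (rule elim)
     have "n.ht = k n" by (rule ext) (simp add: n.ht_def k_def n.A_def)
     then show ?case unfolding n.\<phi>_def ch_def by simp
    qed
   qed
  qed
  define B where "B = (C * R + 2 * (K * C)) * ((1 + K * C) * H)"
  have diff: "cmod (F n \<tau> - ch n) \<le> abs (\<tau> / sqrt (real n)) * (real q * B) + C * \<eta> ^ (8 * q) * R" if n: "n \<ge> N" "q \<le> n" for n q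
  proof -
   have "F n \<tau> = (LINT x|P n. ei (\<tau> / sqrt (real n)) (birkhoff_sum (G (ts n)) (k n) n x))"
    unfolding F_def T_eq[OF n(1)] by (simp add: mult.assoc)
   then show ?thesis
    using initial_char[OF good[OF n(1)] n(2), of "\<tau> / sqrt (real n)"] unfolding ch_def P_def B_def k_def[abs_def] by simp
  qed
  have "(\<lambda>n. F n \<tau> - ch n) \<longlonglongrightarrow> 0"
  proof (rule tendstoI)
   fix e :: real assume e: "e > 0"
   have "(\<lambda>q. C * \<eta> ^ (8 * q) * R) \<longlonglongrightarrow> C * 0 * R"
    unfolding power_mult using const by (intro tendsto_intros LIMSEQ_power_zero) (simp add: power_less_one_iff)
   then have "\<forall>\<^sub>F q in sequentially. C * \<eta> ^ (8 * q) * R < e / 2" using e by (intro order_tendstoD) auto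
   then obtain q where q: "C * \<eta> ^ (8 * q) * R < e / 2" by (auto simp: eventually_sequentially)
   have "(\<lambda>n. 1 / sqrt (real n)) \<longlonglongrightarrow> 0" by real_asymp
   then have "(\<lambda>n. abs \<tau> * (real q * B) * (1 / sqrt (real n))) \<longlonglongrightarrow> 0" by (rule tendsto_mult_right_zero)
   then have "(\<lambda>n. abs (\<tau> / sqrt (real n)) * (real q * B)) \<longlonglongrightarrow> 0" by (simp add: abs_divide mult_ac)
   then have "\<forall>\<^sub>F n in sequentially. abs (\<tau> / sqrt (real n)) * (real q * B) < e / 2" using e by (intro order_tendstoD) auto
   then show "\<forall>\<^sub>F n in sequentially. dist (F n \<tau> - ch n) 0 < e" using eventually_ge_at_top[of "max N q"]
   proof eventually_elim
    case (elim n)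
    then have "cmod (F n \<tau> - ch n) < e" using diff[of n q] q by linarith
    then show ?case by (simp only: dist_norm diff_0_right)
   qed
  qed
  from tendsto_add[OF this ch] show ?thesis by simp
 qed
 have "\<forall>\<^sub>F n in sequentially. \<forall>z. abs (measure (P (n + N)) {x \<in> space (P (n + N)). T (n + N) x \<le> z} - cdf std_normal_distribution (z / sqrt v)) \<le> e"
 \<comment> \<open>The shift by \<open>N\<close> discards the indices at which the initial density
   or the parameter is not yet admissible, since the rule asks for probability laws at every
   index.\<close>
 proof (rule normal_limit_uniform[OF _ _ v0 _ e])
  show "prob_space (P (n + N))" for n unfolding P_def by (rule prob_initial[OF good[of "n + N"]]) simp_all
  show "T (n + N) \<in> borel_measurable (P (n + N))" for n
  proof -
   have "birkhoff_sum (G (ts (n + N))) h (n + N) \<in> borel_measurable m" by (rule birkhoff_measurable[OF nonsing h_meas]) (simp add: good)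
   then show ?thesis unfolding T_def T_stat_def[abs_def] P_def by simp
  qed
  show "(\<lambda>n. \<integral>x. ei \<tau> (T (n + N) x) \<partial>P (n + N)) \<longlonglongrightarrow> of_real (exp (- (\<tau>^2 * v / 2)))" for \<tau>
   using LIMSEQ_ignore_initial_segment[OF F[of \<tau>], of N] unfolding F_def .
 qed
 then have "\<forall>\<^sub>F n in sequentially. \<forall>z. abs (measure (P n) {x \<in> space (P n). T n x \<le> z} - cdf std_normal_distribution (z / sqrt v)) \<le> e"
  by (rule iffD1[OF eventually_sequentially_seg])
 then show ?thesis unfolding P_def T_def v_def .
qed

text \<open>Supplies the comparison needed by \<open>coboundary_of_zero_variance\<close>. After
  \<open>j\<close> steps the law \<open>m\<close> has density \<open>pj j\<close>, whose distance to
  the invariant density decays in \<open>Y\<close>; the twisted step and the remaining untwisted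
  steps then act on that difference, so the decays up to \<open>j\<close> and from \<open>j\<close>
  to \<open>k\<close> multiply.\<close>

lemma variance_pos_of_not_cohomologous:
 assumes sys: "mixing_system (\<nu> 0) (G 0) h D \<eta> \<delta>" and nc: "\<not> cohomologous_to_constant_L2 m (G 0) h"
 shows "mixing_system.s (\<nu> 0) (G 0) h \<noteq> 0"
proof
 interpret n0: mixing_system "\<nu> 0" "G 0" h D \<eta> \<delta> by (rule sys)
 assume s0: "n0.s = 0"
 note ns = nonsing[OF zero(1)]
 let ?g = "G 0"
 obtain D' where D': "\<And>t \<phi> n. [|t \<in> \<Theta>; abs t < \<delta>; \<And>x. 0 \<le> (\<phi> x :: real); (cr \<phi>) \<in> elems Y; nrm Y (cr \<phi>) \<le> nrm Y (\<lambda>_. 1)|] ==>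
  integrable m (\<lambda>x. \<phi> x * mom (h ((G t ^^ n) x))) \<and> (LINT x|m. \<phi> x * mom (h ((G t ^^ n) x))) \<le> D'"
  using moment_push[of "nrm Y (\<lambda>_. 1)"] by blast
 have D1: "integrable m (\<lambda>x. mom (h ((?g ^^ n) x)))" "(LINT x|m. mom (h ((?g ^^ n) x))) \<le> D'" for n
  using D'[OF zero, of "\<lambda>_. 1" n] one by auto
 have ht: "n0.ht = (\<lambda>x. h x - (LINT x|\<nu> 0. h x))" by (rule ext) (simp add: n0.ht_def n0.A_def)
 have htm [measurable]: "n0.ht \<in> borel_measurable m" unfolding ht by simp
 have ht2: "integrable m (\<lambda>x. (n0.ht x)^2)" "sqrt (LINT x|m. (n0.ht x)^2) \<le> (1 + K * C) * H" using centered_L2[OF zero] unfolding ht by auto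
 note [measurable] = nonsingular_measurable[OF nonsingular_funpow[OF ns]] \<rho>_measurable[OF zero]
 define pj where "pj j = push_density m ?g j (\<lambda>_. 1)" for j
 have i1: "integrable m (\<lambda>_. 1 :: real)" by simp
 note pd = push_density[OF ns i1, of, simplified, folded pj_def]
 let ?r = "\<lambda>x. complex_of_real (\<rho> 0 x)"
 note r = \<rho>_elem[OF zero]
 have pjm [measurable]: "pj j \<in> borel_measurable m" for j by (rule borel_measurable_integrable[OF pd(1)])
 have pY: "cr (pj j) \<in> elems Y"
  and dY: "(\<lambda>x. complex_of_real (pj j x) - ?r x) \<in> elems Y" "nrm Y (\<lambda>x. complex_of_real (pj j x) - ?r x) \<le> C * \<eta> ^ (8 * j) * nrm Y (\<lambda>_. 1)" for j
 proof -
  have m1: "cr (pj j) \<in> borel_measurable m" and m2: "(\<lambda>x. complex_of_real (pj j x) - ?r x) \<in> borel_measurable m"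
   using \<rho>_L2(1)[OF zero] by measurable
  show "cr (pj j) \<in> elems Y" by (rule banach_spaceD(4)[OF Y_banach Y_pow[OF zero one] m1 pd(3)])
  have gs: "(\<lambda>x. (L 0 ^^ j) (\<lambda>_. 1) x - ?r x) \<in> elems Y" "nrm Y (\<lambda>x. (L 0 ^^ j) (\<lambda>_. 1) x - ?r x) \<le> C * \<eta> ^ (8 * j) * nrm Y (\<lambda>_. 1)"
   using gap_strong[OF zero one, of j] by (simp_all add: prob_space)
  have ae: "AE x in m. (L 0 ^^ j) (\<lambda>_. 1) x - ?r x = complex_of_real (pj j x) - ?r x" using pd(3)[of j] by eventually_elim simp
  show "(\<lambda>x. complex_of_real (pj j x) - ?r x) \<in> elems Y" by (rule banach_spaceD(4)[OF Y_banach gs(1) m2 ae])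
  show "nrm Y (\<lambda>x. complex_of_real (pj j x) - ?r x) \<le> C * \<eta> ^ (8 * j) * nrm Y (\<lambda>_. 1)"
   using gs(2) banach_spaceD(5)[OF Y_banach gs(1) m2 ae] by simp
 qed
 \<comment> \<open>The two summands belong to the two cases below. For \<open>k > j\<close> one step
   is twisted and yields no decay, hence the division by \<open>\<eta> ^ 8\<close>; for
   \<open>k = j\<close> no operator intervenes.\<close>
 define B where "B = C * (C * (C * nrm Y (\<lambda>_. 1))) * ((1 + K * C) * H) / \<eta> ^ 8 + K * (C * nrm Y (\<lambda>_. 1)) * ((1 + K * C) * H)"
 have n1: "0 \<le> nrm Y (\<lambda>_. 1)" by (rule banach_spaceD(2)[OF Y_banach one])
 have B2: "0 \<le> C * (C * (C * nrm Y (\<lambda>_. 1))) * ((1 + K * C) * H)" "0 \<le> K * (C * nrm Y (\<lambda>_. 1)) * ((1 + K * C) * H)"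
  using const n1 H_nonneg by (auto intro!: mult_nonneg_nonneg add_nonneg_nonneg)
 have "cohomologous_to_constant_L2 m ?g h"
 proof (rule n0.coboundary_of_zero_variance[OF prob_space_axioms sets_\<nu>[OF zero] ns s0 D1])
  fix u :: real and j k :: nat assume u: "abs u < \<delta>" and jk: "j \<le> k"
  define i where "i = k - j"
  have k: "k = j + i" using jk by (simp add: i_def)
  define \<psi> where "\<psi> x = ei u (h x) * complex_of_real (n0.ht ((?g ^^ i) x))" for x
  have \<psi>m [measurable]: "\<psi> \<in> borel_measurable m" unfolding \<psi>_def by measurable
  have \<psi>\<nu>: "\<psi> \<in> borel_measurable (\<nu> 0)" using measurable_cong_sets[OF sets_\<nu>[OF zero] refl] \<psi>m by blast
  have eq: "ei u (h ((?g ^^ j) x)) * complex_of_real (n0.ht ((?g ^^ k) x)) = \<psi> ((?g ^^ j) x)" for x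
   unfolding \<psi>_def k by (simp add: add.commute[of j i] funpow_add)
  have "(LINT x|m. \<psi> ((?g ^^ j) x)) = (\<integral>x. \<psi> x \<partial>distr m m (?g ^^ j))" by (rule integral_distr[symmetric]) measurable
  also have "distr m m (?g ^^ j) = density m (pj j)" using pd(4)[of j] by (simp add: density_1)
  also have "(LINT x|density m (pj j). \<psi> x) = (LINT x|m. complex_of_real (pj j x) * \<psi> x)"
   using pd(2) by (subst integral_density) (auto simp: scaleR_conv_of_real)
  finally have em: "(LINT x|m. \<psi> ((?g ^^ j) x)) = (LINT x|m. complex_of_real (pj j x) * \<psi> x)" .
  have en: "(LINT x|\<nu> 0. \<psi> ((?g ^^ j) x)) = (LINT x|m. ?r x * \<psi> x)" unfolding n0.integral_pow[OF \<psi>\<nu>] by (rule integral_\<nu>[OF zero \<psi>m])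
  have "cmod ((LINT x|m. complex_of_real (pj j x) * \<psi> x) - (LINT x|m. ?r x * \<psi> x)) \<le> B * \<eta> ^ (8 * k)"
  proof (cases i)
   case 0
   define w where "w x = (complex_of_real (pj j x) - ?r x) * ei u (h x)" for x
   note d2 = Y_L2[OF dY(1), of j]
   have wm [measurable]: "w \<in> borel_measurable m" unfolding w_def using d2 by measurable
   have w: "norm (w x) = norm (complex_of_real (pj j x) - ?r x)" for x by (simp add: w_def norm_mult)
   have w2: "sqi m w" "norm2 m w \<le> K * nrm Y (\<lambda>x. complex_of_real (pj j x) - ?r x)"
    unfolding norm2_def w using d2 unfolding norm2_def by blast+
   have ii: "integrable m (\<lambda>x. complex_of_real (f x) * \<psi> x)" if f: "cr f \<in> elems Y" for f
   proof (rule dominated)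
    show "integrable m (\<lambda>x. complex_of_real (f x) * of_real (n0.ht x))" using Y_L2[OF f] ht2 by (intro norm2_mult(1)) auto
    show "(\<lambda>x. complex_of_real (f x) * \<psi> x) \<in> borel_measurable m" by (rule borel_measurable_times[OF conjunct1[OF Y_L2[OF f]] \<psi>m])
   qed (simp add: \<psi>_def norm_mult 0)
   have "(LINT x|m. complex_of_real (pj j x) * \<psi> x) - (LINT x|m. ?r x * \<psi> x) = (LINT x|m. w x * of_real (n0.ht x))"
    using ii[OF pY] ii[OF r] by (simp add: w_def \<psi>_def 0 left_diff_distrib mult.assoc)
   also have "cmod ... \<le> norm2 m w * sqrt (LINT x|m. (n0.ht x)^2)"
    by (rule order_trans[OF integral_norm_bound norm2_mult(2)[OF wm htm w2(1) ht2(1)]])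
   also have "... \<le> (K * (C * \<eta> ^ (8 * j) * nrm Y (\<lambda>_. 1))) * ((1 + K * C) * H)"
    using order_trans[OF w2(2) mult_left_mono[OF dY(2)[of j]]] ht2(2) const n1 by (intro mult_mono) auto
   also have "... = K * (C * nrm Y (\<lambda>_. 1)) * ((1 + K * C) * H) * \<eta> ^ (8 * k)" by (simp add: k 0)
   also have "... \<le> B * \<eta> ^ (8 * k)" unfolding B_def using B2(1) const by (intro mult_right_mono) (auto simp: divide_nonneg_pos)
   finally show ?thesis .
  next
   case (Suc q)
   let ?p = "\<lambda>x. complex_of_real (pj j x)"
   let ?d = "\<lambda>x. ?p x - ?r x"
   define w where "w = Q 0 u ?d"
   have w: "w \<in> elems Y" "nrm Y w \<le> C * nrm Y ?d" using pow[OF zero u dY(1)[of j], of 1] by (auto simp: w_def)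
   have wp: "Q 0 u ?p \<in> elems Y" "Q 0 u ?r \<in> elems Y" using pow[OF zero u pY, of 1] pow[OF zero u r, of 1] by auto
   have e: "(L 0 ^^ q) (Q 0 u ?p) \<in> elems Y" "(L 0 ^^ q) (Q 0 u ?r) \<in> elems Y" "(L 0 ^^ q) w \<in> elems Y"
    by (rule Y_pow[OF zero wp(1)] Y_pow[OF zero wp(2)] Y_pow[OF zero w(1)])+
   have wi: "integrable m (Q 0 u ?p)" "integrable m (Q 0 u ?r)" "integrable m w" by (rule Y_integrable(1) wp w)+
   have "AE x in m. w x = Q 0 u ?p x - Q 0 u ?r x"
    using twisted_pow_diff[OF ns h_meas Y_integrable(1)[OF pY] Y_integrable(1)[OF r], where s = u and n = 1] by (simp add: w_def)
   then have "AE x in m. (L 0 ^^ q) w x = (L 0 ^^ q) (\<lambda>x. Q 0 u ?p x - Q 0 u ?r x) x"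
    using wi by (intro transfer_pow_cong_AE[OF ns]) auto
   moreover have "AE x in m. (L 0 ^^ q) (\<lambda>x. Q 0 u ?p x - Q 0 u ?r x) x = (L 0 ^^ q) (Q 0 u ?p) x - (L 0 ^^ q) (Q 0 u ?r) x"
    using twisted_pow_diff[OF ns h_meas wi(1,2), where s = 0 and n = q] by (simp only: Q_zero[OF zero(1)])
   ultimately have ae: "AE x in m. (L 0 ^^ q) w x = (L 0 ^^ q) (Q 0 u ?p) x - (L 0 ^^ q) (Q 0 u ?r) x" by eventually_elim simp
   have ie: "integrable m (\<lambda>x. f x * of_real (n0.ht x))" "f \<in> borel_measurable m" if "f \<in> elems Y" for f
    using Y_L2[OF that] ht2 by (auto intro: norm2_mult(1))
   have "(LINT x|m. ?p x * \<psi> x) - (LINT x|m. ?r x * \<psi> x) = (LINT x|m. (L 0 ^^ q) (Q 0 u ?p) x * of_real (n0.ht x)) - (LINT x|m. (L 0 ^^ q) (Q 0 u ?r) x * of_real (n0.ht x))"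
    unfolding \<psi>_def Suc comp_twisted_L2[OF zero u pd(2) pY htm ht2(1)] comp_twisted_L2[OF zero u \<rho>_nonneg r htm ht2(1)] ..
   also have "... = (LINT x|m. (L 0 ^^ q) (Q 0 u ?p) x * of_real (n0.ht x) - (L 0 ^^ q) (Q 0 u ?r) x * of_real (n0.ht x))"
    by (rule Bochner_Integration.integral_diff[symmetric, OF ie(1)[OF e(1)] ie(1)[OF e(2)]])
   also have "... = (LINT x|m. (L 0 ^^ q) w x * of_real (n0.ht x))"
    using ae ie(2)[OF e(1)] ie(2)[OF e(2)] ie(2)[OF e(3)] by (intro integral_cong_AE) (auto elim!: eventually_mono simp: left_diff_distrib)
   finally have eq: "(LINT x|m. ?p x * \<psi> x) - (LINT x|m. ?r x * \<psi> x) = (LINT x|m. (L 0 ^^ q) w x * of_real (n0.ht x))" .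
   have "cmod (LINT x|m. (L 0 ^^ q) w x * of_real (n0.ht x)) \<le> C * \<eta> ^ (8 * q) * nrm Y w * sqrt (LINT x|m. (n0.ht x)^2)"
    using decay_L2[OF zero w(1) htm ht2(1), of q] n0.ht_mean by simp
   also have "... \<le> C * \<eta> ^ (8 * q) * (C * (C * \<eta> ^ (8 * j) * nrm Y (\<lambda>_. 1))) * ((1 + K * C) * H)"
    using order_trans[OF w(2) mult_left_mono[OF dY(2)[of j]]] ht2(2) const n1 banach_spaceD(2)[OF Y_banach w(1)]
    by (intro mult_mono mult_left_mono) auto
   also have "... = C * (C * (C * nrm Y (\<lambda>_. 1))) * ((1 + K * C) * H) * (\<eta> ^ (8 * q) * \<eta> ^ (8 * j))" by (simp add: mult_ac)
   also have "\<eta> ^ (8 * q) * \<eta> ^ (8 * j) = \<eta> ^ (8 * k) / \<eta> ^ 8" using const by (simp add: k Suc power_add field_simps)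
   also have "C * (C * (C * nrm Y (\<lambda>_. 1))) * ((1 + K * C) * H) * (\<eta> ^ (8 * k) / \<eta> ^ 8) =
     C * (C * (C * nrm Y (\<lambda>_. 1))) * ((1 + K * C) * H) / \<eta> ^ 8 * \<eta> ^ (8 * k)" by simp
   also have "... \<le> B * \<eta> ^ (8 * k)" unfolding B_def using B2(2) const by (intro mult_right_mono) auto
   finally show ?thesis unfolding eq .
  qed
  then show "cmod ((LINT x|m. ei u (h ((?g ^^ j) x)) * of_real (n0.ht ((?g ^^ k) x)))
    - (LINT x|\<nu> 0. ei u (h ((?g ^^ j) x)) * of_real (n0.ht ((?g ^^ k) x)))) \<le> B * \<eta> ^ (8 * k)" unfolding eq em en .
 qed
 then show False using nc by simp
qed

end

section \<open>Moments of the observable and invariant densities\<close>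

lemma bounded_op_quotient:
 assumes "bounded_op m B1 B2 F" "bounded_op m B1 B2 G" "bounded_op m B1 B2 F'" "banach_space m B1" "banach_space m B2"
 shows "bounded_op m B1 B2 (\<lambda>f x. (F f x - G f x) / c - F' f x)"
proof -
 have "bounded_op m B1 B2 (\<lambda>f x. 1 * (\<lambda>f x. inverse c * F f x + - inverse c * G f x) f x + - 1 * F' f x)"
  by (intro bounded_op_combine assms)
 moreover have "(\<lambda>f x. 1 * (\<lambda>f x. inverse c * F f x + - inverse c * G f x) f x + - 1 * F' f x) = (\<lambda>f x. (F f x - G f x) / c - F' f x)"
  by (intro ext) (simp add: divide_inverse algebra_simps)
 ultimately show ?thesis by simp
qed

text \<open>Integration is a continuous functional on the target space, so differentiability in
  operator norm passes to the scalar function, uniformly over balls of \<open>B1\<close>.\<close>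

lemma op_derivative_integral:
 assumes B: "banach_space m B1" "banach_space m B2"
  and int: "\<And>f. f \<in> elems B2 ==> integrable m f \<and> (LINT x|m. norm (f x)) \<le> K * nrm B2 f" and K: "0 \<le> K"
  and F: "\<And>t. t \<in> {-\<delta><..<\<delta>} ==> bounded_op m B1 B2 (F t)" "bounded_op m B1 B2 F'"
  and s: "s \<in> {-\<delta><..<\<delta>}" and deriv: "op_has_derivative B1 B2 F F' s" and f: "f \<in> elems B1"
 shows "((\<lambda>t. Re (LINT x|m. F t f x)) has_real_derivative Re (LINT x|m. F' f x)) (at s)"
proof -
 define T where "T t = (\<lambda>f x. (F t f x - F s f x) / of_real (t - s) - F' f x)" for t
 have opT: "bounded_op m B1 B2 (T t)" if t: "t \<in> {-\<delta><..<\<delta>}" for t unfolding T_def by (intro bounded_op_quotient F t s B)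
 have op0: "(\<lambda>t. opnorm B1 B2 (T t)) \<midarrow>s\<rightarrow> 0" using deriv unfolding op_has_derivative_def T_def .
 have mem: "integrable m (T f)" if "bounded_op m B1 B2 T" for T using int that f by (auto simp: bounded_op_def)
 have "(\<lambda>t. (Re (LINT x|m. F t f x) - Re (LINT x|m. F s f x)) / (t - s) - Re (LINT x|m. F' f x)) \<midarrow>s\<rightarrow> 0"
 proof (rule Lim_null_comparison)
  have "(\<lambda>t. K * (opnorm B1 B2 (T t) * nrm B1 f)) \<midarrow>s\<rightarrow> K * (0 * nrm B1 f)" by (intro tendsto_intros op0)
  then show "(\<lambda>t. K * (opnorm B1 B2 (T t) * nrm B1 f)) \<midarrow>s\<rightarrow> 0" by simp
  have "\<forall>\<^sub>F t in at s. t \<in> {-\<delta><..<\<delta>}" using s by (intro eventually_at_in_open') auto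
  then show "\<forall>\<^sub>F t in at s. norm ((Re (LINT x|m. F t f x) - Re (LINT x|m. F s f x)) / (t - s) - Re (LINT x|m. F' f x)) \<le> K * (opnorm B1 B2 (T t) * nrm B1 f)"
  proof eventually_elim
   case (elim t)
   have "(LINT x|m. T t f x) = ((LINT x|m. F t f x) - (LINT x|m. F s f x)) / of_real (t - s) - (LINT x|m. F' f x)"
    unfolding T_def using mem[OF F(1)[OF elim]] mem[OF F(1)[OF s]] mem[OF F(2)] by simp
   then have "(Re (LINT x|m. F t f x) - Re (LINT x|m. F s f x)) / (t - s) - Re (LINT x|m. F' f x) = Re (LINT x|m. T t f x)"
    by (simp only: minus_complex.simps Re_divide_of_real)
   also have "norm ... \<le> (LINT x|m. norm (T t f x))" using order_trans[OF abs_Re_le_cmod integral_norm_bound] by simp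
   also have "... \<le> K * nrm B2 (T t f)" using int opT[OF elim] f by (auto simp: bounded_op_def)
   also have "... \<le> K * (opnorm B1 B2 (T t) * nrm B1 f)" by (intro mult_left_mono opnorm_bound[OF opT[OF elim] B f] K)
   finally show ?case .
  qed
 qed
 then show ?thesis unfolding has_field_derivative_iff LIM_zero_iff .
qed

text \<open>The even function \<open>\<phi>\<close> stands for \<open>s \<mapsto> \<integral> f cos (s h)\<close>; the combination below is \<open>\<integral> f (1 - cos (s h))\<^sup>2\<close>.\<close>

lemma even_C3_combination:
 fixes \<phi> :: "real \<Rightarrow> real"
 assumes d: "\<And>t. abs t < r ==> (\<phi> has_real_derivative \<phi>1 t) (at t)" "\<And>t. abs t < r ==> (\<phi>1 has_real_derivative \<phi>2 t) (at t)"
  and even: "\<And>t. \<phi> (- t) = \<phi> t" and lip: "\<And>t. abs t < r ==> abs (\<phi>2 t - \<phi>2 0) \<le> B * abs t" and s: "0 < s" "2 * s < r" and B: "0 \<le> B"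
 shows "3 / 2 * \<phi> 0 - 2 * \<phi> s + \<phi> (2 * s) / 2 \<le> 6 * B * s ^ 3"
proof -
 have r: "0 < r" using s by simp
 \<comment> \<open>Evenness forces the first derivative at 0 to vanish, so no linear term appears in
   the expansion.\<close>
 have "((\<lambda>t. \<phi> (- t)) has_real_derivative - \<phi>1 0) (at 0)" using DERIV_mirror[of \<phi> "\<phi>1 0" 0] d(1)[of 0] r by simp
 then have "(\<phi> has_real_derivative - \<phi>1 0) (at 0)" unfolding even .
 from DERIV_unique[OF d(1)[of 0] this] r have z: "\<phi>1 0 = 0" by simp
 define \<psi> where "\<psi> t = \<phi> t - \<phi> 0 - \<phi>2 0 * t^2 / 2" for t
 define \<psi>1 where "\<psi>1 t = \<phi>1 t - \<phi>2 0 * t" for t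
 have dd: "(\<psi> has_real_derivative \<psi>1 t) (at t)" "(\<psi>1 has_real_derivative \<phi>2 t - \<phi>2 0) (at t)" if "abs t < r" for t
  unfolding \<psi>_def \<psi>1_def using d[OF that] by (auto intro!: derivative_eq_intros)
 have b1: "abs (\<psi>1 t) \<le> B * t^2" if t: "0 < t" "t < r" for t
 proof -
  obtain z where z': "0 < z" "z < t" "\<psi>1 t - \<psi>1 0 = (t - 0) * (\<phi>2 z - \<phi>2 0)" using MVT2[of 0 t \<psi>1 "\<lambda>z. \<phi>2 z - \<phi>2 0"] dd(2) t by auto
  have "\<psi>1 t = t * (\<phi>2 z - \<phi>2 0)" using z'(3) by (simp add: \<psi>1_def z)
  then have "abs (\<psi>1 t) = t * abs (\<phi>2 z - \<phi>2 0)" using t by (simp add: abs_mult)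
  also have "... \<le> t * (B * t)" using lip[of z] z' t B by (intro mult_left_mono order_trans[OF lip] mult_left_mono) auto
  finally show ?thesis by (simp add: power2_eq_square mult_ac)
 qed
 have b0: "abs (\<psi> t) \<le> B * t ^ 3" if t: "0 < t" "t < r" for t
 proof -
  obtain z where z': "0 < z" "z < t" "\<psi> t - \<psi> 0 = (t - 0) * \<psi>1 z" using MVT2[of 0 t \<psi> \<psi>1] dd(1) t by auto
  have "abs (\<psi> t) = t * abs (\<psi>1 z)" using z'(3) t by (simp add: \<psi>_def abs_mult)
  also have "... \<le> t * (B * t^2)" using z' t B by (intro mult_left_mono order_trans[OF b1] mult_left_mono power_mono) auto
  finally show ?thesis by (simp add: power2_eq_square power3_eq_cube mult_ac)
 qed
 \<comment> \<open>The combination annihilates constants and \<open>t^2\<close>, as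
   \<open>3/2 - 2 + 1/2 = 0\<close> and \<open>-2 + 4/2 = 0\<close>; only the cubic remainder is
   left.\<close>
 have "3 / 2 * \<phi> 0 - 2 * \<phi> s + \<phi> (2 * s) / 2 = - 2 * \<psi> s + \<psi> (2 * s) / 2"
  by (simp add: \<psi>_def power2_eq_square add_divide_distrib diff_divide_distrib algebra_simps)
 also have "... \<le> 2 * (B * s ^ 3) + (B * (2 * s) ^ 3) / 2" using b0[of s] b0[of "2 * s"] s by linarith
 also have "... = 6 * B * s ^ 3" by (simp add: power_mult_distrib)
 finally show ?thesis .
qed

text \<open>The bound 4 is the ratio of consecutive scales below. It stays under
  \<open>2 * pi - 1\<close>, where the cosine would climb back to \<open>cos 1\<close>.\<close>

lemma cos_le_cos_one:
 assumes "1 \<le> y" "y < 4"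
 shows "cos y \<le> cos (1 :: real)"
proof (cases "y \<le> pi")
 case True
 then show ?thesis using assms by (intro cos_monotone_0_pi_le) auto
next
 case False
 have "cos y = - cos (y - pi)" by (simp add: cos_diff)
 also have "... \<le> 0" using False assms pi_gt3 cos_ge_zero[of "y - pi"] by simp
 also have "0 \<le> cos (1 :: real)" using pi_gt3 by (intro cos_ge_zero) auto
 finally show ?thesis .
qed

text \<open>For \<open>\<bar>x\<bar> \<ge> 1\<close> the scale \<open>4\<^sup>j \<le> \<bar>x\<bar> < 4\<^sup>j\<^sup>+\<^sup>1\<close> contributes a term of the size of \<open>mom x\<close>.\<close>

lemma mom_dyadic:
 "mom x \<le> 1 \<or> (\<exists>j. mom x \<le> 32 ^ Suc j / (1 - cos 1)^2 * (1 - cos (x / 4 ^ j))^2)"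
proof (cases "abs x < 1")
 case True
 then have "mom x \<le> mom 1" by (intro mom_mono) auto
 then show ?thesis by (simp add: mom_def)
next
 case False
 have "\<exists>j. abs x < 4 ^ Suc j"
 proof -
  obtain n where "abs x < 4 ^ n" using real_arch_pow[of 4 "abs x"] by auto
  then have "abs x < 4 ^ Suc n" by (rule order_less_le_trans) simp
  then show ?thesis by blast
 qed
 define j where "j = (LEAST j. abs x < 4 ^ Suc j)"
 have up: "abs x < 4 ^ Suc j" unfolding j_def using \<open>\<exists>j. abs x < 4 ^ Suc j\<close> by (rule LeastI_ex)
 have lo: "4 ^ j \<le> abs x"
 proof (cases j)
  case 0 then show ?thesis using False by simp
 next
  case (Suc i)
  then have "\<not> abs x < 4 ^ Suc i" using not_less_Least[of i "\<lambda>j. abs x < 4 ^ Suc j"] unfolding j_def by simp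
  then show ?thesis using Suc by simp
 qed
 have "mom x \<le> mom (4 ^ Suc j)" using up by (intro mom_mono) simp
 also have "mom (4 ^ n) = 32 ^ n" for n
 proof -
  have "sqrt (4 ^ n) = (2 :: real) ^ n" by (simp add: real_sqrt_power)
  then have "mom (4 ^ n) = (4 * 4 * 2) ^ n" by (simp add: mom_def power2_eq_square power_mult_distrib[symmetric])
  then show ?thesis by simp
 qed
 finally have 1: "mom x \<le> 32 ^ Suc j" .
 define y where "y = abs x / 4 ^ j"
 have y: "1 \<le> y" "y < 4" using up lo by (simp_all add: y_def field_simps)
 have "cos (x / 4 ^ j) = cos y" by (cases "x \<ge> 0") (auto simp: y_def)
 then have c: "1 - cos 1 \<le> 1 - cos (x / 4 ^ j)" using cos_le_cos_one[OF y] by simp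
 have c1: "0 < 1 - cos (1 :: real)" using cos_monotone_0_pi[of 0 "1 :: real"] pi_gt3 by simp
 have "1 \<le> (1 - cos (x / 4 ^ j))^2 / (1 - cos 1)^2" using c c1 by (simp add: power_mono)
 then have "32 ^ Suc j * 1 \<le> 32 ^ Suc j * ((1 - cos (x / 4 ^ j))^2 / (1 - cos (1 :: real))^2)" by (intro mult_left_mono) auto
 then have "mom x \<le> 32 ^ Suc j / (1 - cos 1)^2 * (1 - cos (x / 4 ^ j))^2" using 1 by simp
 then show ?thesis by blast
qed

text \<open>At scale \<open>s0 / 2 / 4^j\<close> the moment weight \<open>32^(j+1)\<close> meets a
  bound proportional to \<open>64^(-j)\<close>, so the sum over scales is geometric with ratio 1/2.
  This is where the exponent 5/2 has to be less than 3: 32 is the power \<open>4^(5/2)\<close>, 64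
  is \<open>4^3\<close>.\<close>

lemma (in prob_space) mom_bound_of_cos:
 assumes f: "integrable M f" "\<And>x. 0 \<le> (f x :: real)" and h [measurable]: "h \<in> borel_measurable M" and s0: "0 < s0"
  and b: "\<And>s. [|0 < s; s < s0|] ==> (LINT x|M. f x * (1 - cos (s * h x))^2) \<le> B * s ^ 3"
 shows "integrable M (\<lambda>x. f x * mom (h x))"
  and "(LINT x|M. f x * mom (h x)) \<le> ((LINT x|M. f x) + 64 / (1 - cos 1)^2 * (B * (s0 / 2) ^ 3)) / mom (s0 / 2)"
proof -
 note [measurable] = borel_measurable_integrable[OF f(1)]
 define s1 where "s1 = s0 / 2"
 have s1: "0 < s1" "s1 < s0" using s0 by (auto simp: s1_def)
 define c where "c = 1 / (1 - cos (1 :: real))^2"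
 have c: "0 \<le> c" by (simp add: c_def)
 have ms: "mom s1 > 0" using s1 by (simp add: mom_def)
 have B0: "0 \<le> B * s1 ^ 3" using order_trans[OF _ b[OF s1]] f(2) by simp
 define t where "t j x = c * 32 ^ Suc j * (f x * (1 - cos (s1 / 4 ^ j * h x))^2)" for j x
 have tm [measurable]: "t j \<in> borel_measurable M" for j unfolding t_def by measurable
 have t0: "0 \<le> t j x" for j x using c f(2) by (simp add: t_def)
 have le4: "f x * (1 - cos a)^2 \<le> 4 * f x" for x a
 proof -
  have "abs (1 - cos a) \<le> 2" using cos_le_one[of a] cos_ge_minus_one[of a] by simp
  then have "(1 - cos a)^2 \<le> 4" using power_mono[of "abs (1 - cos a)" 2 2] by simp
  from mult_left_mono[OF this f(2)[of x]] show ?thesis by (simp add: mult.commute)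
 qed
 have it: "integrable M (t j)" for j unfolding t_def
 proof (rule integrable_mult_right, rule dominated[of M "\<lambda>x. 4 * f x"])
  show "AE x in M. norm (f x * (1 - cos (s1 / 4 ^ j * h x))^2) \<le> norm (4 * f x)" using le4 f(2) by (auto simp: abs_mult)
 qed (use f in auto)
 have bt: "(LINT x|M. t j x) \<le> c * 32 * (B * s1 ^ 3) * (1 / 2) ^ j" for j
 proof -
  have "s1 / 4 ^ j \<le> s1 / 1" using s1 by (intro divide_left_mono) auto
  then have "(LINT x|M. f x * (1 - cos (s1 / 4 ^ j * h x))^2) \<le> B * (s1 / 4 ^ j) ^ 3" using s1 by (intro b) auto
  then have "(LINT x|M. t j x) \<le> c * 32 ^ Suc j * (B * (s1 / 4 ^ j) ^ 3)" unfolding t_def using c by (simp add: mult_left_mono)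
  also have "(s1 / 4 ^ j) ^ 3 = s1 ^ 3 / 64 ^ j"
  proof -
   have "((4 :: real) ^ j) ^ 3 = (4 ^ 3) ^ j" by (simp only: power_mult[symmetric] mult.commute)
   then show ?thesis by (simp add: power_divide)
  qed
  also have "c * 32 ^ Suc j * (B * (s1 ^ 3 / 64 ^ j)) = c * 32 * (B * s1 ^ 3) * (32 ^ j / 64 ^ j)" by simp
  also have "(32 :: real) ^ j / 64 ^ j = (1 / 2) ^ j" by (simp add: power_divide[symmetric])
  finally show ?thesis .
 qed
 have pt: "ennreal (f x * mom (s1 * h x)) \<le> ennreal (f x) + (\<Sum>j. ennreal (t j x))" for x
 proof -
  consider "mom (s1 * h x) \<le> 1" | j where "mom (s1 * h x) \<le> 32 ^ Suc j / (1 - cos 1)^2 * (1 - cos (s1 * h x / 4 ^ j))^2"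
   using mom_dyadic[of "s1 * h x"] by blast
  then show ?thesis
  proof cases
   case 1
   then have "f x * mom (s1 * h x) \<le> f x" using f(2)[of x] by (simp add: mult_left_le)
   then have "ennreal (f x * mom (s1 * h x)) \<le> ennreal (f x)" by (rule ennreal_leI)
   also have "... \<le> ennreal (f x) + (\<Sum>j. ennreal (t j x))" by simp
   finally show ?thesis .
  next
   case (2 j)
   have "f x * mom (s1 * h x) \<le> f x * (32 ^ Suc j / (1 - cos 1)^2 * (1 - cos (s1 * h x / 4 ^ j))^2)" by (rule mult_left_mono[OF 2 f(2)])
   also have "... = t j x" by (simp add: t_def c_def)
   finally have "ennreal (f x * mom (s1 * h x)) \<le> ennreal (t j x)" by (rule ennreal_leI)
   also have "... \<le> (\<Sum>j. ennreal (t j x))" using sum_le_suminf[of "\<lambda>j. ennreal (t j x)" "{j}"] by simp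
   also have "... \<le> ennreal (f x) + (\<Sum>j. ennreal (t j x))" by simp
   finally show ?thesis .
  qed
 qed
 have "(\<integral>\<^sup>+x. ennreal (f x * mom (s1 * h x)) \<partial>M) \<le> (\<integral>\<^sup>+x. ennreal (f x) + (\<Sum>j. ennreal (t j x)) \<partial>M)" by (intro nn_integral_mono pt)
 also have "... = (\<integral>\<^sup>+x. ennreal (f x) \<partial>M) + (\<Sum>j. \<integral>\<^sup>+x. ennreal (t j x) \<partial>M)" by (subst nn_integral_add) (auto simp: nn_integral_suminf)
 also have "(\<integral>\<^sup>+x. ennreal (f x) \<partial>M) = ennreal (LINT x|M. f x)" using f by (intro nn_integral_eq_integral) auto
 also have "(\<Sum>j. \<integral>\<^sup>+x. ennreal (t j x) \<partial>M) \<le> (\<Sum>j. ennreal (c * 32 * (B * s1 ^ 3) * (1 / 2) ^ j))"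
 proof (intro suminf_le)
  show "(\<integral>\<^sup>+x. ennreal (t j x) \<partial>M) \<le> ennreal (c * 32 * (B * s1 ^ 3) * (1 / 2) ^ j)" for j
   using bt[of j] t0 by (subst nn_integral_eq_integral[OF it]) (auto intro: ennreal_leI)
 qed auto
 also have "(\<Sum>j. ennreal (c * 32 * (B * s1 ^ 3) * (1 / 2) ^ j)) = ennreal (c * 32 * (B * s1 ^ 3) * 2)"
 proof (rule suminf_ennreal_eq)
  show "(\<lambda>j. c * 32 * (B * s1 ^ 3) * (1 / 2) ^ j) sums (c * 32 * (B * s1 ^ 3) * 2)"
   using sums_mult[OF geometric_sums[of "1 / 2 :: real"], of "c * 32 * (B * s1 ^ 3)"] by simp
 qed (use c B0 in simp)
 also have "ennreal (LINT x|M. f x) + ennreal (c * 32 * (B * s1 ^ 3) * 2) = ennreal ((LINT x|M. f x) + c * 64 * (B * s1 ^ 3))"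
 proof -
  have "0 \<le> c * 32 * (B * s1 ^ 3) * 2" using c B0 by simp
  then have "ennreal (LINT x|M. f x) + ennreal (c * 32 * (B * s1 ^ 3) * 2) = ennreal ((LINT x|M. f x) + c * 32 * (B * s1 ^ 3) * 2)"
   using f(2) by (intro ennreal_plus[symmetric]) simp_all
  moreover have "c * 64 * (B * s1 ^ 3) = c * 32 * (B * s1 ^ 3) * 2" by simp
  ultimately show ?thesis by (simp only:)
 qed
 finally have nn: "(\<integral>\<^sup>+x. ennreal (f x * mom (s1 * h x)) \<partial>M) \<le> ennreal ((LINT x|M. f x) + c * 64 * (B * s1 ^ 3))" by simp
 have i: "integrable M (\<lambda>x. f x * mom (s1 * h x))"
 proof (rule integrableI_nonneg)
  show "(\<integral>\<^sup>+x. ennreal (f x * mom (s1 * h x)) \<partial>M) < \<infinity>" using nn by (simp add: order_le_less_trans)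
 qed (use f(2) in auto)
 have le: "(LINT x|M. f x * mom (s1 * h x)) \<le> (LINT x|M. f x) + c * 64 * (B * s1 ^ 3)"
 proof -
  have "0 \<le> c * 64 * (B * s1 ^ 3)" using c B0 by simp
  then have "0 \<le> (LINT x|M. f x) + c * 64 * (B * s1 ^ 3)" using f(2) by (intro add_nonneg_nonneg) simp_all
  moreover have "(\<integral>\<^sup>+x. ennreal (f x * mom (s1 * h x)) \<partial>M) = ennreal (LINT x|M. f x * mom (s1 * h x))"
   using f(2) by (intro nn_integral_eq_integral[OF i]) simp
  ultimately show ?thesis using nn by (simp only: ennreal_le_iff)
 qed
 have eq: "f x * mom (h x) = inverse (mom s1) * (f x * mom (s1 * h x))" for x using ms by (simp add: mom_scale)
 show "integrable M (\<lambda>x. f x * mom (h x))" unfolding eq using i by simp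
 have "(LINT x|M. f x * mom (h x)) = inverse (mom s1) * (LINT x|M. f x * mom (s1 * h x))" unfolding eq by simp
 also have "... \<le> inverse (mom s1) * ((LINT x|M. f x) + c * 64 * (B * s1 ^ 3))" using le ms by (intro mult_left_mono) auto
 finally have "(LINT x|M. f x * mom (h x)) \<le> ((LINT x|M. f x) + c * 64 * (B * s1 ^ 3)) / mom s1" by (simp only: divide_inverse_commute)
 then show "(LINT x|M. f x * mom (h x)) \<le> ((LINT x|M. f x) + 64 / (1 - cos 1)^2 * (B * (s0 / 2) ^ 3)) / mom (s0 / 2)"
  unfolding s1_def c_def by (simp only: times_divide_eq_left mult_1)
qed

context twisted_family
begin

text \<open>The integral of \<open>f * cos (t * h)\<close> is the real part of the integral of
  \<open>Q 0 t f\<close>, hence it inherits three derivatives at 0.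
  \<open>even_C3_combination\<close> turns them into a cubic bound, \<open>mom_bound_of_cos\<close>
  into a moment; all constants are linear in the norm of \<open>f\<close>, which makes the result
  uniform on balls.\<close>

lemma moment_of_C3:
 assumes B: "banach_space m B1" "banach_space m B2"
  and int1: "\<And>f. f \<in> elems B1 ==> integrable m f \<and> (LINT x|m. norm (f x)) \<le> K * nrm B1 f"
  and int: "\<And>f. f \<in> elems B2 ==> integrable m f \<and> (LINT x|m. norm (f x)) \<le> K * nrm B2 f" and K: "0 \<le> K"
  and deriv: "op_higher_derivative m B1 B2 3 {-\<delta><..<\<delta>} (\<lambda>s. Q 0 s ^^ 1) F'" and \<delta>: "0 < \<delta>"
 shows "\<exists>D. \<forall>f. (\<forall>x. 0 \<le> f x) \<and> cr f \<in> elems B1 \<and> nrm B1 (cr f) \<le> R \<longrightarrow>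
    integrable m (\<lambda>x. f x * mom (h x)) \<and> (LINT x|m. f x * mom (h x)) \<le> D"
proof -
 obtain D where D0: "D 0 = (\<lambda>s. Q 0 s ^^ 1)"
  and Db: "\<And>i s. [|i \<le> 3; s \<in> {-\<delta><..<\<delta>}|] ==> bounded_op m B1 B2 (D i s)"
  and Dd: "\<And>i s. [|i < 3; s \<in> {-\<delta><..<\<delta>}|] ==> op_has_derivative B1 B2 (D i) (D (Suc i) s) s"
  using deriv unfolding op_higher_derivative_def by blast
 have z: "0 \<in> {-\<delta><..<\<delta>}" using \<delta> by simp
 obtain K3 where K3: "\<And>f. f \<in> elems B1 ==> nrm B2 (D 3 0 f) \<le> K3 * nrm B1 f" using Db[OF order_refl z] unfolding bounded_op_def by blast
 \<comment> \<open>The difference quotient of the second derivative minus the third derivative at 0.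
   Its operator norm is below 1 near 0, which gives a Lipschitz bound with constant
   \<open>K * (1 + abs K3)\<close> per unit of norm.\<close>
 define T where "T t = (\<lambda>f x. (D 2 t f x - D 2 0 f x) / of_real (t - 0) - D 3 0 f x)" for t
 have "(\<lambda>t. opnorm B1 B2 (T t)) \<midarrow>0\<rightarrow> 0"
  using Dd[of 2 0] z unfolding op_has_derivative_def T_def by (simp add: numeral_3_eq_3 numeral_2_eq_2)
 then have "\<forall>\<^sub>F t in at 0. opnorm B1 B2 (T t) < 1" by (intro order_tendstoD) auto
 then obtain r0 where r0: "r0 > 0" "\<And>t. [|t \<noteq> 0; abs t < r0|] ==> opnorm B1 B2 (T t) < 1" unfolding eventually_at by (auto simp: dist_real_def)
 define r where "r = min r0 \<delta>"
 have r: "r > 0" "r \<le> \<delta>" "r \<le> r0" using r0 \<delta> by (auto simp: r_def)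
 define B' where "B' = K * (1 + abs K3)"
 have B': "0 \<le> B'" using K by (simp add: B'_def)
 have cosb: "(LINT x|m. f x * (1 - cos (s * h x))^2) \<le> 6 * (B' * nrm B1 (cr f)) * s ^ 3"
  if f: "\<And>x. 0 \<le> (f x :: real)" "cr f \<in> elems B1" and s: "0 < s" "2 * s < r" for f s
 proof -
  let ?f = "\<lambda>x. complex_of_real (f x)"
  have fi: "integrable m ?f" "integrable m f" using int1[OF f(2)] integrable_Re by fastforce+
  note [measurable] = borel_measurable_integrable[OF fi(2)]
  have f0: "0 \<le> nrm B1 ?f" by (rule banach_spaceD(2)[OF B(1) f(2)])
  define \<phi> where "\<phi> t = (LINT x|m. f x * cos (t * h x))" for t
  have ic: "integrable m (\<lambda>x. f x * cos (t * h x))" for t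
   by (rule dominated[OF fi(2)]) (auto simp: abs_mult intro!: AE_I2 mult_left_le)
  have one: "(\<lambda>_. 1) \<in> Linf m" by (rule LinfI[where K = 1]) auto
  have \<phi>: "\<phi> t = Re (LINT x|m. D 0 t ?f x)" for t
  proof -
   have i: "integrable m (\<lambda>x. ?f x * ei t (h x))" by (rule dominated[OF fi(1)]) (auto simp: norm_mult)
   have "(LINT x|m. D 0 t ?f x) = (LINT x|m. ?f x * ei t (h x))"
    using twisted_pow_dual[OF nonsing[OF zero_mem] h_meas fi(1) one, where s = t and n = 1] by (simp add: D0 birkhoff_sum_def)
   then show ?thesis unfolding \<phi>_def by (simp add: integral_Re[OF i, symmetric] Re_exp)
  qed
  have dd: "((\<lambda>t. Re (LINT x|m. D i t ?f x)) has_real_derivative Re (LINT x|m. D (Suc i) t ?f x)) (at t)" if "i < 3" "abs t < r" for i t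
   using that r by (intro op_derivative_integral[OF B int K Db Db _ Dd f(2), where \<delta> = \<delta>]) auto
  have lip: "abs (Re (LINT x|m. D 2 t ?f x) - Re (LINT x|m. D 2 0 ?f x)) \<le> B' * nrm B1 ?f * abs t" if t: "abs t < r" for t
  proof (cases "t = 0")
   case False
   have tI: "t \<in> {-\<delta><..<\<delta>}" using t r by auto
   have mem: "integrable m (D i t ?f)" if "i \<le> 3" "t \<in> {-\<delta><..<\<delta>}" for i t using Db[OF that] f(2) int by (auto simp: bounded_op_def)
   have Tb: "bounded_op m B1 B2 (T t)" unfolding T_def by (intro bounded_op_quotient Db B tI z) auto
   have "(LINT x|m. T t ?f x) = ((LINT x|m. D 2 t ?f x) - (LINT x|m. D 2 0 ?f x)) / of_real (t - 0) - (LINT x|m. D 3 0 ?f x)"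
    unfolding T_def using mem[of 2 t] mem[of 2 0] mem[of 3 0] tI z by simp
   then have eq: "(LINT x|m. D 2 t ?f x) - (LINT x|m. D 2 0 ?f x) = of_real t * ((LINT x|m. T t ?f x) + (LINT x|m. D 3 0 ?f x))"
    using False by simp
   have "cmod (LINT x|m. T t ?f x) \<le> K * nrm B2 (T t ?f)"
    using int Tb f(2) by (intro order_trans[OF integral_norm_bound]) (auto simp: bounded_op_def)
   also have "... \<le> K * (opnorm B1 B2 (T t) * nrm B1 ?f)" by (intro mult_left_mono opnorm_bound[OF Tb B f(2)] K)
   also have "... \<le> K * (1 * nrm B1 ?f)" using r0(2)[OF False] t r K f0 by (intro mult_left_mono mult_right_mono) auto
   finally have 1: "cmod (LINT x|m. T t ?f x) \<le> K * nrm B1 ?f" by simp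
   have "cmod (LINT x|m. D 3 0 ?f x) \<le> K * nrm B2 (D 3 0 ?f)"
    using int Db[of 3 0] z f(2) by (intro order_trans[OF integral_norm_bound]) (auto simp: bounded_op_def)
   also have "... \<le> K * (abs K3 * nrm B1 ?f)"
    using order_trans[OF K3[OF f(2)] mult_right_mono[OF abs_ge_self[of K3] f0]] K by (intro mult_left_mono) auto
   finally have 2: "cmod (LINT x|m. D 3 0 ?f x) \<le> K * (abs K3 * nrm B1 ?f)" .
   have "abs (Re (LINT x|m. D 2 t ?f x) - Re (LINT x|m. D 2 0 ?f x)) \<le> cmod ((LINT x|m. D 2 t ?f x) - (LINT x|m. D 2 0 ?f x))"
    using abs_Re_le_cmod[of "(LINT x|m. D 2 t ?f x) - (LINT x|m. D 2 0 ?f x)"] by simp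
   also have "... = abs t * cmod ((LINT x|m. T t ?f x) + (LINT x|m. D 3 0 ?f x))" unfolding eq norm_mult by simp
   also have "... \<le> abs t * (K * nrm B1 ?f + K * (abs K3 * nrm B1 ?f))"
    by (intro mult_left_mono order_trans[OF norm_triangle_ineq] add_mono 1 2) simp
   also have "... = B' * nrm B1 ?f * abs t" by (simp add: B'_def algebra_simps)
   finally show ?thesis .
  qed simp
  have "(LINT x|m. f x * (1 - cos (s * h x))^2) = (LINT x|m. 3 / 2 * (f x * cos (0 * h x)) - 2 * (f x * cos (s * h x)) + f x * cos (2 * s * h x) / 2)"
  proof (intro Bochner_Integration.integral_cong refl)
   fix x
   have d: "cos (2 * s * h x) = 2 * (cos (s * h x))^2 - 1" using cos_double_cos[of "s * h x"] by (simp add: mult.assoc)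
   show "f x * (1 - cos (s * h x))^2 = 3 / 2 * (f x * cos (0 * h x)) - 2 * (f x * cos (s * h x)) + f x * cos (2 * s * h x) / 2"
    unfolding d by (simp add: power2_eq_square right_diff_distrib left_diff_distrib diff_divide_distrib distrib_left)
  qed
  also have "... = 3 / 2 * \<phi> 0 - 2 * \<phi> s + \<phi> (2 * s) / 2" unfolding \<phi>_def using ic[of 0] ic[of s] ic[of "2 * s"] by simp
  also have "... \<le> 6 * (B' * nrm B1 ?f) * s ^ 3"
  proof (rule even_C3_combination[where r = r])
   show "(\<phi> has_real_derivative Re (LINT x|m. D 1 t ?f x)) (at t)" if "abs t < r" for t using dd[of 0 t] that unfolding \<phi>[abs_def] by simp
   show "((\<lambda>t. Re (LINT x|m. D 1 t ?f x)) has_real_derivative Re (LINT x|m. D 2 t ?f x)) (at t)" if "abs t < r" for t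
    using dd[of 1 t] that by (simp add: numeral_2_eq_2)
   show "\<phi> (- t) = \<phi> t" for t by (simp add: \<phi>_def)
   show "0 \<le> B' * nrm B1 ?f" using B' f0 by simp
  qed (use lip s in auto)
  finally show ?thesis .
 qed
 define E where "E = (K * abs R + 64 / (1 - cos 1)^2 * ((6 * (B' * abs R)) * (r / 2 / 2) ^ 3)) / mom (r / 2 / 2)"
 show ?thesis
 proof (intro exI[of _ E] allI impI)
  fix f assume f': "(\<forall>x. 0 \<le> f x) \<and> cr f \<in> elems B1 \<and> nrm B1 (cr f) \<le> R"
  then have f: "\<And>x. 0 \<le> (f x :: real)" "cr f \<in> elems B1" "nrm B1 (cr f) \<le> abs R" by auto
  have fi: "integrable m f" using int1[OF f(2)] integrable_Re by fastforce
  have If: "(LINT x|m. f x) \<le> K * abs R"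
  proof -
   have "(LINT x|m. f x) = (LINT x|m. norm (complex_of_real (f x)))" using f(1) by simp
   also have "... \<le> K * nrm B1 (cr f)" using int1[OF f(2)] by blast
   also have "... \<le> K * abs R" using f(3) K by (rule mult_left_mono)
   finally show ?thesis .
  qed
  have cb: "(LINT x|m. f x * (1 - cos (s * h x))^2) \<le> 6 * (B' * abs R) * s ^ 3" if s: "0 < s" "s < r / 2" for s
  proof -
   have "6 * (B' * nrm B1 (cr f)) * s ^ 3 \<le> 6 * (B' * abs R) * s ^ 3" using f(3) B' s by (intro mult_right_mono mult_left_mono) auto
   then show ?thesis using cosb[OF f(1,2) s(1)] s(2) by simp
  qed
  have r2: "0 < r / 2" using r by simp
  note mb = mom_bound_of_cos[OF fi f(1) h_meas r2 cb]
  have "mom (r / 2 / 2) \<ge> 0" by simp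
  with If have "((LINT x|m. f x) + 64 / (1 - cos 1)^2 * ((6 * (B' * abs R)) * (r / 2 / 2) ^ 3)) / mom (r / 2 / 2) \<le> E"
   unfolding E_def by (intro divide_right_mono add_right_mono) auto
  with mb show "integrable m (\<lambda>x. f x * mom (h x)) \<and> (LINT x|m. f x * mom (h x)) \<le> E" by (blast intro: order_trans)
 qed
qed

text \<open>The limit \<open>\<rho>\<close> of the nonnegative functions \<open>L\<^sup>n 1\<close> is within distance \<open>\<parallel>L\<^sup>n 1 - \<rho>\<parallel>\<^sub>1\<close> of the
  nonnegative function \<open>max 0 (Re \<rho>)\<close>.\<close>

lemma invariant_density:
 assumes Y: "banach_space m Y" and one: "(\<lambda>_. 1) \<in> elems Y" and t: "t \<in> \<Theta>" and LY: "bounded_op m Y Y (L t)"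
  and int: "\<And>f. f \<in> elems Y ==> integrable m f \<and> (LINT x|m. norm (f x)) \<le> K * nrm Y f" and K: "0 \<le> K"
  and mean_zero: "\<And>f. [|f \<in> elems Y; AE x in m. L t f x = f x; (LINT x|m. f x) = 0|] ==> nrm Y f = 0"
  and conv: "\<And>\<rho> n. [|\<rho> \<in> elems Y; AE x in m. L t \<rho> x = \<rho> x; (LINT x|m. \<rho> x) = 1|] ==>
   (\<lambda>x. (L t ^^ n) (\<lambda>_. 1) x - \<rho> x) \<in> elems Y \<and> nrm Y (\<lambda>x. (L t ^^ n) (\<lambda>_. 1) x - \<rho> x) \<le> B * \<eta> ^ n" and \<eta>: "0 < \<eta>" "\<eta> < 1"
  and ev: "op_eigenvalue m Y (L t) 1"
 obtains r where "\<And>x. 0 \<le> r x" "cr r \<in> elems Y" "AE x in m. L t (cr r) x = of_real (r x)" "(LINT x|m. r x) = 1"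
proof -
 obtain v where v: "v \<in> elems Y" "\<not> (AE x in m. v x = 0)" "AE x in m. L t v x = v x" using ev by (auto simp: op_eigenvalue_def)
 define I where "I = (LINT x|m. v x)"
 \<comment> \<open>An eigenvector of mean zero would be null by \<open>mean_zero\<close>, so the
   given one can be normalised.\<close>
 have I: "I \<noteq> 0" using mean_zero[OF v(1,3)] banach_spaceD(3)[OF Y v(1)] v(2) by (auto simp: I_def)
 define \<rho> where "\<rho> x = inverse I * v x" for x
 interpret Y: complete_seminormed "elems Y" "nrm Y" by (rule banach_space_seminormed[OF Y])
 have \<rho>: "\<rho> \<in> elems Y" using Y.scl_mem[OF v(1), of "inverse I"] by (simp add: \<rho>_def[abs_def] scl_def)
 have "AE x in m. L t \<rho> x = inverse I * L t v x" using LY v(1) unfolding bounded_op_def \<rho>_def[abs_def] by blast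
 then have \<rho>_inv: "AE x in m. L t \<rho> x = \<rho> x" using v(3) by eventually_elim (simp add: \<rho>_def)
 have \<rho>1: "(LINT x|m. \<rho> x) = 1" unfolding \<rho>_def using I by (simp add: I_def)
 have \<rho>i: "integrable m \<rho>" using int[OF \<rho>] by blast
 note [measurable] = borel_measurable_integrable[OF \<rho>i]
 define r where "r x = max 0 (Re (\<rho> x))" for x
 have [measurable]: "r \<in> borel_measurable m" unfolding r_def by measurable
 \<comment> \<open>Among nonnegative reals, \<open>max 0 (Re z)\<close> is the closest to
   \<open>z\<close>.\<close>
 have near: "cmod (z - of_real (max 0 (Re z))) \<le> cmod (z - of_real p)" if "0 \<le> p" for z p
 proof -
  have "abs (Re z - max 0 (Re z)) \<le> abs (Re z - p)" using that by (auto simp: max_def)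
  then have "(Re z - max 0 (Re z))^2 \<le> (Re z - p)^2" by (rule abs_le_square_iff[THEN iffD1])
  then show ?thesis by (simp add: cmod_def)
 qed
 have i1: "integrable m (\<lambda>_. 1 :: real)" by simp
 have ri: "integrable m (\<lambda>x. \<rho> x - of_real (r x))"
  by (rule dominated[OF \<rho>i]) (use near[of 0] in \<open>auto simp: r_def\<close>)
 have le: "(LINT x|m. norm (\<rho> x - of_real (r x))) \<le> K * (B * \<eta> ^ n)" for n
 proof -
  note pd = push_density[OF nonsing[OF t] i1, of n, simplified]
  note c = conv[OF \<rho> \<rho>_inv \<rho>1, of n]
  have di: "integrable m (\<lambda>x. (L t ^^ n) (\<lambda>_. 1) x - \<rho> x)" using int c by blast
  have "(LINT x|m. norm (\<rho> x - of_real (r x))) \<le> (LINT x|m. norm ((L t ^^ n) (\<lambda>_. 1) x - \<rho> x))"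
  proof (intro integral_mono_AE integrable_norm ri di)
   show "AE x in m. cmod (\<rho> x - of_real (r x)) \<le> cmod ((L t ^^ n) (\<lambda>_. 1) x - \<rho> x)" using pd(3)
   proof eventually_elim
    case (elim x)
    then show ?case using near[OF pd(2)[of x], of "\<rho> x"] by (simp add: r_def norm_minus_commute)
   qed
  qed
  also have "... \<le> K * nrm Y (\<lambda>x. (L t ^^ n) (\<lambda>_. 1) x - \<rho> x)" using int c by blast
  also have "... \<le> K * (B * \<eta> ^ n)" using c K by (intro mult_left_mono) auto
  finally show ?thesis .
 qed
 have "(\<lambda>n. K * (B * \<eta> ^ n)) \<longlonglongrightarrow> K * (B * 0)" using \<eta> by (intro tendsto_intros LIMSEQ_power_zero) simp
 then have "(LINT x|m. norm (\<rho> x - of_real (r x))) \<le> 0" using le by (intro LIMSEQ_le_const) auto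
 then have "(LINT x|m. norm (\<rho> x - of_real (r x))) = 0" by (simp add: order_antisym)
 then have ae: "AE x in m. \<rho> x = of_real (r x)"
  using integral_nonneg_eq_0_iff_AE[of m "\<lambda>x. norm (\<rho> x - of_real (r x))"] integrable_norm[OF ri] by simp
 have rm: "cr r \<in> borel_measurable m" by measurable
 have rY: "cr r \<in> elems Y" by (rule banach_spaceD(4)[OF Y \<rho> rm ae])
 have "AE x in m. L t \<rho> x = L t (cr r) x" using int[OF rY] by (intro transfer_cong_AE[OF nonsing[OF t] \<rho>i _ ae]) auto
 then have inv: "AE x in m. L t (cr r) x = of_real (r x)" using \<rho>_inv ae by eventually_elim simp
 have "complex_of_real (LINT x|m. r x) = (LINT x|m. complex_of_real (r x))" by (rule integral_complex_of_real[symmetric])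
 also have "... = (LINT x|m. \<rho> x)" using ae by (intro integral_cong_AE) auto
 finally have r1: "(LINT x|m. r x) = 1" using \<rho>1 by (simp add: of_real_eq_1_iff)
 have r0: "0 \<le> r x" for x by (simp add: r_def)
 show thesis by (rule that[OF r0 rY inv r1])
qed

end

section \<open>From the assumptions to the family with uniform gaps, and the theorem\<close>

lemma (in prob_space) integrable_of_norm2:
 "f \<in> borel_measurable M \<and> sqi M f \<and> norm2 M f \<le> c ==> integrable M f \<and> (LINT x|M. norm (f x)) \<le> c"
 by (blast intro: integrable_of_square(1) order_trans[OF integrable_of_square(2)])

text \<open>\<open>X 0\<close> is the strong space for dynamics and invariant densities,
  \<open>X 6\<close> (the space \<open>X_3\<close> of the chain) the space for initial densities,
  and \<open>X 8\<close> the weak space in both perturbation arguments. The two rates are merged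
  into one \<open>\<eta>\<close> and everything is measured in L^2 through the embedding of
  \<open>X 8\<close>.\<close>

lemma (in twisted_family) gapped_family_of_assumptions:
 assumes h3: "integrable m (\<lambda>x. abs (h x) ^ 3)" and p0: "2 \<le> p0"
  and A: "assumption_A m \<Theta> G (\<lambda>_. h) p0 (X 0) (X 8)" and B: "assumption_B m \<Theta> G (\<lambda>_. h) X" and C: "assumption_C m \<Theta> G (\<lambda>_. h) X"
 obtains \<rho> \<delta> K C \<eta> where "gapped_family m \<Theta> G h (X 0) (X 6) \<rho> \<delta> K C \<eta>"
proof -
 have bs: "banach_space m (X i)" and one: "(\<lambda>_. 1) \<in> elems (X i)" if "i \<le> 8" for i using B that unfolding assumption_B_def by blast+
 have emb1: "embeds (X i) (X (Suc i))" if "i < 8" for i using B that unfolding assumption_B_def by blast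
 have emb: "embeds (X i) (X j)" if "i \<le> j" "j \<le> 8" for i j using that
 proof (induction j rule: dec_induct)
  case base show ?case by (rule embeds_refl)
 next
  case (step k)
  then show ?case by (intro embeds_trans[OF step.IH emb1 bs bs]) auto
 qed
 have WL: "embeds (X 8) (Lp m p0)" using A unfolding assumption_A_def by blast
 obtain \<delta>A where \<delta>A: "\<delta>A > 0"
  and Ab: "\<forall>t\<in>\<Theta> \<inter> {-\<delta>A<..<\<delta>A}. \<forall>s. bounded_op m (X 0) (X 0) (Q t s) \<and> bounded_op m (X 8) (X 8) (Q t s)"
  and Ac: "op_continuous_on m (X 0) (X 8) ((\<Theta> \<inter> {-\<delta>A<..<\<delta>A}) \<times> UNIV) (\<lambda>(t, s). Q t s)"
  and Aalt: "same_space (X 0) (X 8) \<or> (\<exists>c C \<kappa>. 0 < c \<and> 0 < C \<and> 0 < \<kappa> \<and> \<kappa> < 1 \<and>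
   (\<forall>\<psi>\<in>elems (X 0). \<forall>n. \<forall>t\<in>\<Theta>. \<forall>s. abs t \<le> \<delta>A \<and> abs s \<le> \<delta>A \<longrightarrow>
    (Q t s ^^ n) \<psi> \<in> elems (X 0) \<and> nrm (X 0) ((Q t s ^^ n) \<psi>) \<le> c * \<kappa> ^ n * nrm (X 0) \<psi> + C ^ n * nrm (X 8) \<psi>))"
  using A unfolding assumption_A_def by (elim conjE exE) (rule that; assumption)
 obtain \<delta>B where \<delta>B: "\<delta>B > 0"
  and Bb: "\<forall>a\<le>3. \<forall>t\<in>\<Theta> \<inter> {-\<delta>B<..<\<delta>B}. \<forall>s. bounded_op m (X (2*a)) (X (2*a)) (Q t s) \<and> bounded_op m (X (2*a+1)) (X (2*a+1)) (Q t s)"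
  and Bd: "\<forall>t\<in>\<Theta> \<inter> {-\<delta>B<..<\<delta>B}. \<forall>a\<le>2. \<forall>j\<in>{1..3-a}.
    (\<forall>n. op_higher_derivative m (X (2*a+1)) (X (2*(a+j))) j {-\<delta>B<..<\<delta>B}
        (\<lambda>s. Q t s ^^ n) (\<lambda>s \<phi>. (Q t s ^^ n) (\<lambda>x. (\<i> * of_real (birkhoff_sum (G t) h n x)) ^ j * \<phi> x))) \<and>
    op_continuous_on m (X (2*a+1)) (X (2*(a+j))) {-\<delta>B<..<\<delta>B} (\<lambda>s \<phi>. Q t s (\<lambda>x. (\<i> * of_real (h x)) ^ j * \<phi> x))"
  and Balt: "same_space (X 0) (X 7) \<or>
    ((\<forall>a\<le>3. op_continuous_on m (X (2*a)) (X (2*a+1)) ((\<Theta> \<inter> {-\<delta>B<..<\<delta>B}) \<times> UNIV) (\<lambda>(t, s). Q t s)) \<and>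
    (\<exists>c C \<kappa>. 0 < c \<and> 0 < C \<and> 0 < \<kappa> \<and> \<kappa> < 1 \<and>
     (\<forall>i\<le>7. \<forall>\<psi>\<in>elems (X i). \<forall>n. \<forall>t\<in>\<Theta>. \<forall>s. abs t \<le> \<delta>B \<and> abs s \<le> \<delta>B \<longrightarrow>
       (Q t s ^^ n) \<psi> \<in> elems (X i) \<and>
       nrm (X i) ((Q t s ^^ n) \<psi>) \<le> c * \<kappa> ^ n * nrm (X i) \<psi> + C ^ n * nrm (X 8) \<psi>)))"
  using B unfolding assumption_B_def by (elim conjE exE) (rule that; assumption)
 obtain \<kappa> \<delta>C where \<kappa>: "0 < \<kappa>" "\<kappa> < 1" and \<delta>C: "\<delta>C > 0"
  and ev: "\<forall>t\<in>\<Theta> \<inter> {-\<delta>C<..<\<delta>C}. op_eigenvalue m (X 0) (L t) 1" and gap: "\<forall>i\<le>7. spectral_gap m (X i) (L 0) \<kappa>"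
  using C unfolding assumption_C_def by (elim conjE exE) (rule that; assumption)
 obtain K8 where K8: "0 < K8" "\<And>f. f \<in> elems (X 8) ==> f \<in> borel_measurable m \<and> sqi m f \<and> norm2 m f \<le> K8 * nrm (X 8) f"
  using embeds_Lp_norm2[OF bs WL p0] by auto
 have L2: "\<exists>K>0. \<forall>f\<in>elems (X i). f \<in> borel_measurable m \<and> sqi m f \<and> norm2 m f \<le> K * nrm (X i) f"
  if i: "i \<le> 8" for i
 proof -
  obtain K where K: "0 < K" "elems (X i) \<subseteq> elems (X 8)" "\<And>f. f \<in> elems (X i) ==> nrm (X 8) f \<le> K * nrm (X i) f"
   using embedsE[OF emb[OF i order_refl] bs[OF i]] by blast
  have "norm2 m f \<le> K8 * K * nrm (X i) f" if "f \<in> elems (X i)" for f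
   using order_trans[OF conjunct2[OF conjunct2[OF K8(2)]] mult_left_mono[OF K(3)[OF that]]] K8(1) K(2) that by (simp add: mult.assoc subset_iff)
  then show ?thesis using K K8 by (intro exI[of _ "K8 * K"]) auto
 qed
 then obtain k where k: "\<And>i. i \<le> 8 ==> 0 < k i"
   "\<And>i f. [|i \<le> 8; f \<in> elems (X i)|] ==> f \<in> borel_measurable m \<and> sqi m f \<and> norm2 m f \<le> k i * nrm (X i) f" by metis
 define K where "K = Max (k ` {..8})"
 have kK: "k i \<le> K" if "i \<le> 8" for i using that by (auto simp: K_def)
 have K: "0 < K" using less_le_trans[OF k(1) kK] by blast
 have N: "0 \<le> nrm (X i) f" if "f \<in> elems (X i)" "i \<le> 8" for f i using banach_spaceD(2)[OF bs[OF that(2)] that(1)] .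
 have KX: "f \<in> borel_measurable m \<and> sqi m f \<and> norm2 m f \<le> K * nrm (X i) f" if "f \<in> elems (X i)" "i \<le> 8" for f i
  using k(2)[OF that(2,1)] mult_right_mono[OF kK N[OF that]] that(2) by force
 note K0 = K KX[of _ 0, simplified] and K6 = K KX[of _ 6, simplified]
 have KI: "integrable m f \<and> (LINT x|m. norm (f x)) \<le> K * nrm (X i) f" if "f \<in> elems (X i)" "i \<le> 8" for f i
  by (rule integrable_of_norm2[OF KX[OF that]])
 have W: "norm2 m (\<lambda>x. f x - g x) \<le> e * a" if "f \<in> elems (X 0)" "g \<in> elems (X 0)" "nrm (X 8) (f - g) \<le> e / K * a" for f g e a
 proof -
  interpret X8: complete_seminormed "elems (X 8)" "nrm (X 8)" by (rule banach_space_seminormed[OF bs]) simp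
  have "f - g \<in> elems (X 8)" using that emb[of 0 8] by (intro X8.diff_mem) (auto simp: embeds_def)
  then have "norm2 m (f - g) \<le> K * nrm (X 8) (f - g)" using KX by blast
  also have "... \<le> K * (e / K * a)" using that(3) K by (intro mult_left_mono) auto
  finally show ?thesis using K by (simp add: fun_diff_def)
 qed
 have LW: "bounded_op m (X 8) (X 8) (L 0)" using Ab zero_mem \<delta>A Q_zero[OF zero_mem] by (metis IntI greaterThanLessThan_iff neg_less_0_iff_less)
 have Qb0: "bounded_op m (X 0) (X 0) (Q t s)" if "t \<in> \<Theta>" "abs t < \<delta>A" for t s using bspec[OF Ab, of t] that by (auto simp: abs_less_iff)
 have Qb6: "bounded_op m (X 6) (X 6) (Q t s)" if "t \<in> \<Theta>" "abs t < \<delta>B" for t s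
  using bspec[OF mp[OF spec[OF Bb, of 3]], of t] that by (auto simp: abs_less_iff)
 obtain \<delta>0 M0 \<eta>0 where \<delta>0A: "\<delta>0 \<le> \<delta>A" and U: "uniformly_gapped m \<Theta> G h (X 0) (X 8) \<delta>0 M0 \<eta>0"
  using uniform_gap[OF bs bs one emb WL p0 \<delta>A Qb0 LW near_zero_continuity[OF Ac \<delta>A bs bs] Aalt, of \<kappa>] gap \<kappa> by auto
 note \<delta>0 = uniformly_gapped.gap_const(1)[OF U] \<delta>0A and M0 = uniformly_gapped.gap_const(2)[OF U]
  and \<eta>0 = uniformly_gapped.gap_const(3,4)[OF U] and g1 = uniformly_gapped.gap_pow[OF U] and g2 = uniformly_gapped.gap_mean_zero[OF U]
  and g3 = uniformly_gapped.gap_invariant[OF U] and g4 = uniformly_gapped.gap_decay[OF U] and g5 = uniformly_gapped.gap_close[OF U]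
 have diff_eq: "(L t ^^ n) f - c \<odot> \<rho> = (\<lambda>x. (L t ^^ n) f x - c * \<rho> x)" for t n f c \<rho> by (simp add: fun_eq_iff)
 have gap0: "(\<lambda>x. (L t ^^ n) f x - (LINT x|m. f x) * \<rho> x) \<in> elems (X 0) \<and>
   nrm (X 0) (\<lambda>x. (L t ^^ n) f x - (LINT x|m. f x) * \<rho> x) \<le> M0 * \<eta>0 ^ n * nrm (X 0) f"
  if "t \<in> \<Theta>" "abs t < \<delta>0" "\<rho> \<in> elems (X 0)" "AE x in m. L t \<rho> x = \<rho> x" "(LINT x|m. \<rho> x) = 1" "f \<in> elems (X 0)" for t \<rho> n f
  using g4[OF that, of n] unfolding diff_eq .
 obtain \<delta>6 M6 \<eta>6 where \<delta>6: "0 < \<delta>6" and M6: "0 < M6" and \<eta>6: "0 < \<eta>6" "\<eta>6 < 1"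
  and gap6: "\<And>t \<rho> n f. [|t \<in> \<Theta>; abs t < \<delta>6; \<rho> \<in> elems (X 0); AE x in m. L t \<rho> x = \<rho> x; (LINT x|m. \<rho> x) = 1; f \<in> elems (X 6)|] ==>
   norm2 m (\<lambda>x. (L t ^^ n) f x - (LINT x|m. f x) * \<rho> x) \<le> M6 * \<eta>6 ^ n * nrm (X 6) f"
 \<comment> \<open>If the chain collapses from \<open>X 0\<close> to \<open>X 7\<close>, decay on
   \<open>X 6\<close> is inherited from \<open>X 0\<close>. Otherwise the Lasota-Yorke inequality on
   \<open>X 6\<close> is available and the perturbation argument is run a second time.\<close>
 proof (cases "same_space (X 0) (X 7)")
  case True
  obtain K7 where K7: "0 < K7" "elems (X 6) \<subseteq> elems (X 7)" "\<And>f. f \<in> elems (X 6) ==> nrm (X 7) f \<le> K7 * nrm (X 6) f"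
   using embedsE[OF emb bs, of 6 7] by auto
  have "norm2 m (\<lambda>x. (L t ^^ n) f x - (LINT x|m. f x) * \<rho> x) \<le> K * M0 * K7 * \<eta>0 ^ n * nrm (X 6) f"
   if *: "t \<in> \<Theta>" "abs t < \<delta>0" "\<rho> \<in> elems (X 0)" "AE x in m. L t \<rho> x = \<rho> x" "(LINT x|m. \<rho> x) = 1" and f: "f \<in> elems (X 6)" for t \<rho> n f
  proof -
   have f0: "f \<in> elems (X 0)" "nrm (X 0) f \<le> K7 * nrm (X 6) f" using f K7 True by (auto simp: same_space_def)
   have "norm2 m (\<lambda>x. (L t ^^ n) f x - (LINT x|m. f x) * \<rho> x) \<le> K * (M0 * \<eta>0 ^ n * nrm (X 0) f)"
    using gap0[OF * f0(1), of n] K0 by (meson mult_left_mono less_imp_le order_trans)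
   also have "... \<le> K * (M0 * \<eta>0 ^ n * (K7 * nrm (X 6) f))" using f0(2) K M0 \<eta>0 by (intro mult_left_mono) auto
   finally show ?thesis by (simp add: mult_ac)
  qed
  then show thesis using that[of \<delta>0 "K * M0 * K7" \<eta>0] \<delta>0 K M0 K7 \<eta>0 by auto
 next
  case False
  then have Bc: "op_continuous_on m (X 6) (X 7) ((\<Theta> \<inter> {-\<delta>B<..<\<delta>B}) \<times> UNIV) (\<lambda>(t, s). Q t s)"
   using Balt spec[where x = 3 and P = "\<lambda>a. a \<le> 3 \<longrightarrow> op_continuous_on m (X (2*a)) (X (2*a+1)) ((\<Theta> \<inter> {-\<delta>B<..<\<delta>B}) \<times> UNIV) (\<lambda>(t, s). Q t s)"]
   by auto
  have LY: "same_space (X 6) (X 8) \<or> (\<exists>c C \<kappa>. 0 < c \<and> 0 < C \<and> 0 < \<kappa> \<and> \<kappa> < 1 \<and>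
   (\<forall>\<psi>\<in>elems (X 6). \<forall>n. \<forall>t\<in>\<Theta>. \<forall>s. abs t \<le> \<delta>B \<and> abs s \<le> \<delta>B \<longrightarrow>
    (Q t s ^^ n) \<psi> \<in> elems (X 6) \<and> nrm (X 6) ((Q t s ^^ n) \<psi>) \<le> c * \<kappa> ^ n * nrm (X 6) \<psi> + C ^ n * nrm (X 8) \<psi>))"
  proof -
   from Balt False obtain c C \<kappa> where "0 < c \<and> 0 < C \<and> 0 < \<kappa> \<and> \<kappa> < 1 \<and>
     (\<forall>i\<le>7. \<forall>\<psi>\<in>elems (X i). \<forall>n. \<forall>t\<in>\<Theta>. \<forall>s. abs t \<le> \<delta>B \<and> abs s \<le> \<delta>B \<longrightarrow>
       (Q t s ^^ n) \<psi> \<in> elems (X i) \<and>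
       nrm (X i) ((Q t s ^^ n) \<psi>) \<le> c * \<kappa> ^ n * nrm (X i) \<psi> + C ^ n * nrm (X 8) \<psi>)" by blast
   then have "0 < c \<and> 0 < C \<and> 0 < \<kappa> \<and> \<kappa> < 1 \<and> (\<forall>\<psi>\<in>elems (X 6). \<forall>n. \<forall>t\<in>\<Theta>. \<forall>s. abs t \<le> \<delta>B \<and> abs s \<le> \<delta>B \<longrightarrow>
    (Q t s ^^ n) \<psi> \<in> elems (X 6) \<and> nrm (X 6) ((Q t s ^^ n) \<psi>) \<le> c * \<kappa> ^ n * nrm (X 6) \<psi> + C ^ n * nrm (X 8) \<psi>)"
    by (elim conjE, intro conjI) (assumption | erule allE[where x = 6], simp)+
   then show ?thesis by blast
  qed
  \<comment> \<open>Continuity is assumed from \<open>X 6\<close> to \<open>X 7\<close>; the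
    embedding of \<open>X 7\<close> into \<open>X 8\<close> turns it into closeness in the weak norm
    used by \<open>uniform_gap\<close>.\<close>
  have close: "\<forall>\<^sub>F p in near_zero. \<forall>f\<in>elems (X 6). nrm (X 8) (Q (fst p) (snd p) f - L 0 f) \<le> e * nrm (X 6) f" if e: "e > 0" for e
  proof -
   obtain K7 where K7: "0 < K7" "elems (X 7) \<subseteq> elems (X 8)" "\<And>f. f \<in> elems (X 7) ==> nrm (X 8) f \<le> K7 * nrm (X 7) f"
    using embedsE[OF emb bs, of 7 8] by auto
   have K7': "elems (X 6) \<subseteq> elems (X 7)" using emb[of 6 7] by (simp add: embeds_def)
   interpret X7: complete_seminormed "elems (X 7)" "nrm (X 7)" by (rule banach_space_seminormed[OF bs]) simp
   have dom: "\<forall>\<^sub>F p in near_zero. fst p \<in> \<Theta> \<and> abs (fst p) < \<delta>B" by (rule near_zeroI[OF \<delta>B]) auto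
   have "e / K7 > 0" using e K7 by simp
   have b6: "banach_space m (X 6)" and b7: "banach_space m (X 7)" by (simp_all add: bs)
   from near_zero_continuity[OF Bc \<delta>B b6 b7 \<open>e / K7 > 0\<close>] dom show ?thesis
   proof (eventually_elim, intro ballI)
    case (elim p)
    fix f assume f: "f \<in> elems (X 6)"
    have "Q (fst p) (snd p) f \<in> elems (X 6)" "L 0 f \<in> elems (X 6)"
     using Qb6[of "fst p" "snd p"] Qb6[of 0 0] elim(2) \<delta>B zero_mem Q_zero[OF zero_mem] f by (auto simp: bounded_op_def)
    then have "Q (fst p) (snd p) f - L 0 f \<in> elems (X 7)" using K7' by (intro X7.diff_mem) auto
    then have "nrm (X 8) (Q (fst p) (snd p) f - L 0 f) \<le> K7 * nrm (X 7) (Q (fst p) (snd p) f - L 0 f)" by (rule K7(3))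
    also have "... \<le> K7 * (e / K7 * nrm (X 6) f)" using bspec[OF elim(1) f] K7 by (intro mult_left_mono) auto
    finally show "nrm (X 8) (Q (fst p) (snd p) f - L 0 f) \<le> e * nrm (X 6) f" using K7 by simp
   qed
  qed
  have b: "banach_space m (X 6)" "banach_space m (X 8)" "(\<lambda>_. 1) \<in> elems (X 6)" "embeds (X 6) (X 8)" "spectral_gap m (X 6) (L 0) \<kappa>"
   using bs one emb gap by simp_all
  obtain \<delta>0 M \<eta> where V: "uniformly_gapped m \<Theta> G h (X 6) (X 8) \<delta>0 M \<eta>"
   using uniform_gap[OF b(1-4) WL p0 \<delta>B Qb6 LW close LY b(5) \<kappa>] by blast
  note h = uniformly_gapped.gap_const[OF V] uniformly_gapped.gap_decay[OF V]
  have X06: "elems (X 0) \<subseteq> elems (X 6)" using emb[of 0 6] by (auto simp: embeds_def)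
  have "norm2 m (\<lambda>x. (L t ^^ n) f x - (LINT x|m. f x) * \<rho> x) \<le> K * M * \<eta> ^ n * nrm (X 6) f"
   if *: "t \<in> \<Theta>" "abs t < \<delta>0" "\<rho> \<in> elems (X 0)" "AE x in m. L t \<rho> x = \<rho> x" "(LINT x|m. \<rho> x) = 1" and f: "f \<in> elems (X 6)" for t \<rho> n f
  proof -
   have "\<rho> \<in> elems (X 6)" using * X06 by blast
   note h' = h(5)[OF *(1,2) this *(4,5) f, of n, unfolded diff_eq]
   have "norm2 m (\<lambda>x. (L t ^^ n) f x - (LINT x|m. f x) * \<rho> x) \<le> K * (M * \<eta> ^ n * nrm (X 6) f)"
    using h' K6 by (meson mult_left_mono less_imp_le order_trans)
   then show ?thesis by (simp add: mult.assoc)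
  qed
  then show thesis using that[of \<delta>0 "K * M" \<eta>] h(1-4) K by auto
 qed
 define \<delta> where "\<delta> = min (min (min \<delta>0 \<delta>6) (min \<delta>B \<delta>C)) 1"
 have \<delta>: "0 < \<delta>" "\<delta> \<le> \<delta>0" "\<delta> \<le> \<delta>6" "\<delta> \<le> \<delta>B" "\<delta> \<le> \<delta>C" "\<delta> \<le> 1" using \<delta>0 \<delta>6 \<delta>B \<delta>C by (auto simp: \<delta>_def)
 have ex: "\<exists>r. (\<forall>x. 0 \<le> r x) \<and> (t \<in> \<Theta> \<and> abs t < \<delta> \<longrightarrow> (cr r) \<in> elems (X 0) \<and>
   (AE x in m. L t (cr r) x = of_real (r x)) \<and> (LINT x|m. r x) = (1 :: real))" for t
 proof (cases "t \<in> \<Theta> \<and> abs t < \<delta>")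
  case True
  then have t: "t \<in> \<Theta>" "abs t < \<delta>0" "abs t < \<delta>A" "abs t < \<delta>C" using \<delta> \<delta>0(2) by auto
  have LY: "bounded_op m (X 0) (X 0) (L t)" using Qb0[OF t(1,3), of 0] by (simp add: Q_zero[OF t(1)])
  have conv: "(\<lambda>x. (L t ^^ n) (\<lambda>_. 1) x - \<rho> x) \<in> elems (X 0) \<and> nrm (X 0) (\<lambda>x. (L t ^^ n) (\<lambda>_. 1) x - \<rho> x) \<le> M0 * nrm (X 0) (\<lambda>_. 1) * \<eta>0 ^ n"
   if "\<rho> \<in> elems (X 0)" "AE x in m. L t \<rho> x = \<rho> x" "(LINT x|m. \<rho> x) = 1" for \<rho> n
   using gap0[OF t(1,2) that one, of n] by (simp add: prob_space mult_ac)
  have ev': "op_eigenvalue m (X 0) (L t) 1" using ev t by (auto simp: abs_less_iff)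
  show ?thesis by (rule invariant_density[OF bs one t(1) LY KI _ g2[OF t(1,2)] conv \<eta>0 ev']) (use K in auto)
 qed auto
 obtain \<rho> where rr: "\<forall>t. (\<forall>x. 0 \<le> \<rho> t x) \<and> (t \<in> \<Theta> \<and> abs t < \<delta> \<longrightarrow> (cr (\<rho> t)) \<in> elems (X 0) \<and>
   (AE x in m. L t (cr (\<rho> t)) x = of_real (\<rho> t x)) \<and> (LINT x|m. \<rho> t x) = (1 :: real))" by (rule exE[OF choice[OF allI[OF ex]]])
 have \<rho>: "\<And>t x. 0 \<le> \<rho> t x"
  "\<And>t. [|t \<in> \<Theta>; abs t < \<delta>|] ==> (cr (\<rho> t)) \<in> elems (X 0)"
  "\<And>t. [|t \<in> \<Theta>; abs t < \<delta>|] ==> AE x in m. L t (cr (\<rho> t)) x = of_real (\<rho> t x)"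
  "\<And>t. [|t \<in> \<Theta>; abs t < \<delta>|] ==> (LINT x|m. \<rho> t x) = 1" using rr by simp_all
 \<comment> \<open>The eighth root of the slower of the two rates puts both decays in the form
   \<open>\<eta>^(8 n)\<close>.\<close>
 define \<eta> where "\<eta> = root 8 (max \<eta>0 \<eta>6)"
 have \<eta>8: "\<eta> ^ 8 = max \<eta>0 \<eta>6" using \<eta>0 by (simp add: \<eta>_def real_root_pow_pos2)
 have \<eta>: "0 < \<eta>" "\<eta> < 1" using \<eta>0 \<eta>6 by (auto simp: \<eta>_def)
 have \<eta>0le: "\<eta>0 ^ n \<le> \<eta> ^ (8 * n)" and \<eta>6le: "\<eta>6 ^ n \<le> \<eta> ^ (8 * n)" for n unfolding power_mult \<eta>8 using \<eta>0 \<eta>6 by (auto intro!: power_mono)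
 define M where "M = max (max 1 K * M0) M6"
 have M: "0 < M" "M0 \<le> M" "K * M0 \<le> M" "M6 \<le> M"
 proof -
  have "1 * M0 \<le> max 1 K * M0" "K * M0 \<le> max 1 K * M0" using M0 by (intro mult_right_mono; simp)+
  then show "0 < M" "M0 \<le> M" "K * M0 \<le> M" "M6 \<le> M" using M6 by (auto simp: M_def)
 qed
 note N0 = N[of _ 0, simplified] and N6 = N[of _ 6, simplified]
 have \<rho>c1: "(LINT x|m. complex_of_real (\<rho> t x)) = 1" if "t \<in> \<Theta>" "abs t < \<delta>" for t using \<rho>(4)[OF that] by simp
 have h2: "integrable m (\<lambda>x. (h x)^2)"
 proof (rule dominated[of m "\<lambda>x. 1 + abs (h x) ^ 3"])
  have "y^2 \<le> 1 + abs y ^ 3" for y :: real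
  proof (cases "abs y \<le> 1")
   case True
   then have "y^2 \<le> 1" by (simp add: abs_square_le_1)
   then show ?thesis by (rule order_trans) simp
  next
   case False
   then have "abs y ^ 2 \<le> abs y ^ 3" by (intro power_increasing) auto
   then show ?thesis by simp
  qed
  then show "AE x in m. norm ((h x)^2) \<le> norm (1 + abs (h x) ^ 3)" by (intro AE_I2) (simp add: abs_of_nonneg)
 qed (use h3 in auto)
 have pc: "\<forall>\<^sub>F t in inf (nhds 0) (principal \<Theta>). \<forall>f\<in>elems (X 0). norm2 m (\<lambda>x. (L t ^^ n) f x - (L 0 ^^ n) f x) \<le> e * nrm (X 0) f"
  if e: "e > 0" for n e
 proof -
  have "e / K > 0" using e K by simp
  from near_zeroD[OF g5[OF this, of n]] obtain \<delta>1 where \<delta>1: "\<delta>1 > 0"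
   and c: "\<And>t s. [|t \<in> \<Theta>; abs t < \<delta>1; abs s < \<delta>1|] ==> \<forall>f\<in>elems (X 0). nrm (X 8) ((Q t s ^^ n) f - (L 0 ^^ n) f) \<le> e / K * nrm (X 0) f"
   by (metis fst_conv snd_conv)
  have "\<forall>\<^sub>F t in nhds (0 :: real). abs t < min \<delta>0 \<delta>1"
   unfolding eventually_nhds_metric using \<delta>0 \<delta>1 by (intro exI[of _ "min \<delta>0 \<delta>1"]) (auto simp: dist_real_def)
  then show ?thesis unfolding eventually_inf_principal
  proof (eventually_elim, intro impI ballI)
   case (elim t)
   fix f assume t: "t \<in> \<Theta>" and f: "f \<in> elems (X 0)"
   have "(L t ^^ n) f \<in> elems (X 0)" "(L 0 ^^ n) f \<in> elems (X 0)"
    using g1[OF t _ _ f, of 0 n] g1[OF zero_mem _ _ f, of 0 n] elim \<delta>0 by (auto simp: Q_zero[OF t] Q_zero[OF zero_mem])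
   then show "norm2 m (\<lambda>x. (L t ^^ n) f x - (L 0 ^^ n) f x) \<le> e * nrm (X 0) f"
    using bspec[OF c[OF t, of 0] f] elim \<delta>1 by (intro W) (auto simp: Q_zero[OF t])
  qed
 qed
 have cl: "\<forall>\<^sub>F t in inf (nhds 0) (principal \<Theta>). \<forall>f\<in>elems (X 0). norm2 m (\<lambda>x. Q t u f x - Q 0 u f x) \<le> e * nrm (X 0) f"
  if e: "e > 0" for u e
 proof -
  let ?S = "(\<Theta> \<inter> {-\<delta>A<..<\<delta>A}) \<times> (UNIV :: real set)"
  have p: "(0, u) \<in> ?S" using zero_mem \<delta>A by simp
  have e': "e / K > 0" using e K by simp
  have X8b: "banach_space m (X 8)" and X0b: "banach_space m (X 0)" by (simp_all add: bs)
  have lim: "((\<lambda>t. (t, u)) \<longlongrightarrow> (0, u)) (nhds 0)" by (intro tendsto_intros filterlim_ident)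
  from op_continuous_close[OF Ac p e' X0b X8b]
  have "\<forall>\<^sub>F q in nhds (0, u). q \<in> ?S \<longrightarrow> (\<forall>f\<in>elems (X 0). nrm (X 8) ((case q of (t, s) \<Rightarrow> Q t s) f - (case (0, u) of (t, s) \<Rightarrow> Q t s) f) \<le> e / K * nrm (X 0) f)"
   unfolding eventually_inf_principal .
  from eventually_compose_filterlim[OF this lim]
  have ev1: "\<forall>\<^sub>F t in nhds 0. (t, u) \<in> ?S \<longrightarrow> (\<forall>f\<in>elems (X 0). nrm (X 8) (Q t u f - Q 0 u f) \<le> e / K * nrm (X 0) f)" unfolding prod.case .
  have "\<forall>\<^sub>F t in nhds (0 :: real). abs t < \<delta>A" unfolding eventually_nhds_metric using \<delta>A by (intro exI[of _ \<delta>A]) (auto simp: dist_real_def)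
  with ev1 show ?thesis unfolding eventually_inf_principal
  proof (eventually_elim, intro impI ballI)
   case (elim t)
   fix f assume t: "t \<in> \<Theta>" and f: "f \<in> elems (X 0)"
   have "Q t u f \<in> elems (X 0)" "Q 0 u f \<in> elems (X 0)"
    using Qb0[OF t, of u] Qb0[OF zero_mem, of u] elim \<delta>A f by (auto simp: bounded_op_def)
   then show "norm2 m (\<lambda>x. Q t u f x - Q 0 u f x) \<le> e * nrm (X 0) f" using elim t f by (intro W) (auto simp: abs_less_iff)
  qed
 qed
 \<comment> \<open>The smoothness used is that of one application of the operator from
   \<open>X 1\<close> to \<open>X 6\<close>, the case \<open>a = 0\<close>, \<open>j = 3\<close>,
   \<open>n = 1\<close> of the differentiability assumption at parameter 0; densities in
   \<open>X 0\<close> are first viewed in \<open>X 1\<close>.\<close>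
 have mo: "\<exists>D. \<forall>f. (\<forall>x. 0 \<le> f x) \<and> cr f \<in> elems (X 0) \<and> nrm (X 0) (cr f) \<le> R \<longrightarrow>
    integrable m (\<lambda>x. f x * mom (h x)) \<and> (LINT x|m. f x * mom (h x)) \<le> D" for R
 proof -
  have d: "op_higher_derivative m (X 1) (X 6) 3 {-\<delta>B<..<\<delta>B} (\<lambda>s. Q 0 s ^^ 1) (\<lambda>s \<phi>. (Q 0 s ^^ 1) (\<lambda>x. (\<i> * of_real (birkhoff_sum (G 0) h 1 x)) ^ 3 * \<phi> x))"
  proof -
   have 1: "0 \<in> \<Theta> \<inter> {-\<delta>B<..<\<delta>B}" using zero_mem \<delta>B by simp
   have 2: "(3 :: nat) \<in> {1..3 - 0}" by simp
   from spec[OF conjunct1[OF bspec[OF mp[OF spec[OF bspec[OF Bd 1], of 0]] 2]], of 1] show ?thesis by simp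
  qed
  obtain K01 where K01: "0 < K01" "elems (X 0) \<subseteq> elems (X 1)" "\<And>f. f \<in> elems (X 0) ==> nrm (X 1) f \<le> K01 * nrm (X 0) f"
   using embedsE[OF emb bs, of 0 1] by auto
  obtain D where D: "\<forall>f. (\<forall>x. 0 \<le> f x) \<and> cr f \<in> elems (X 1) \<and> nrm (X 1) (cr f) \<le> K01 * R \<longrightarrow>
    integrable m (\<lambda>x. f x * mom (h x)) \<and> (LINT x|m. f x * mom (h x)) \<le> D"
   using moment_of_C3[OF bs bs KI KI less_imp_le[OF K] d \<delta>B, of "K01 * R"] by auto
  show ?thesis
  proof (intro exI[of _ D] allI impI)
   fix f :: "'x \<Rightarrow> real" assume f: "(\<forall>x. 0 \<le> f x) \<and> cr f \<in> elems (X 0) \<and> nrm (X 0) (cr f) \<le> R"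
   have "nrm (X 1) (cr f) \<le> K01 * R" using order_trans[OF K01(3) mult_left_mono] f K01(1) by auto
   then show "integrable m (\<lambda>x. f x * mom (h x)) \<and> (LINT x|m. f x * mom (h x)) \<le> D" using D f K01(2) by blast
  qed
 qed
 have "gapped_family m \<Theta> G h (X 0) (X 6) \<rho> \<delta> K M \<eta>"
 proof (unfold_locales)
  show "0 < K" "(\<lambda>_. 1) \<in> elems (X 0)" "banach_space m (X 0)" by (simp_all add: one bs K)
  show "f \<in> borel_measurable m \<and> integrable m (\<lambda>x. (cmod (f x))^2) \<and> norm2 m f \<le> K * nrm (X 0) f" if "f \<in> elems (X 0)" for f
   by (rule KX[OF that]) simp
  show "f \<in> borel_measurable m \<and> integrable m (\<lambda>x. (cmod (f x))^2) \<and> norm2 m f \<le> K * nrm (X 6) f" if "f \<in> elems (X 6)" for f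
   by (rule KX[OF that]) simp
  show "(Q t s ^^ n) f \<in> elems (X 0) \<and> nrm (X 0) ((Q t s ^^ n) f) \<le> M * nrm (X 0) f"
   if "t \<in> \<Theta>" "abs t < \<delta>" "abs s < \<delta>" "f \<in> elems (X 0)" for t s f n
  proof -
   have "M0 * nrm (X 0) f \<le> M * nrm (X 0) f" using N0[OF that(4)] M by (intro mult_right_mono) auto
   then show ?thesis using g1[OF that(1) _ _ that(4), of s n] that(2,3) \<delta>(2) by auto
  qed
  show "(L t ^^ n) f \<in> elems (X 6)" if "t \<in> \<Theta>" "abs t < \<delta>" "f \<in> elems (X 6)" for t f n
  proof (induction n)
   case (Suc n)
   then show ?case using Qb6[OF that(1), of 0] that(2) \<delta>(4) by (auto simp: Q_zero[OF that(1)] bounded_op_def)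
  qed (use that in simp)
  show "nrm (X 0) (cr (\<rho> t)) \<le> M" if "t \<in> \<Theta>" "abs t < \<delta>" for t
   using g3[OF that(1) _ \<rho>(2,3)[OF that] \<rho>c1[OF that]] that(2) \<delta>(2) M(2) by linarith
  have strong: "rem \<rho> t n f \<in> elems (X 0) \<and>
   nrm (X 0) (rem \<rho> t n f) \<le> M0 * \<eta> ^ (8 * n) * nrm (X 0) f"
   if "t \<in> \<Theta>" "abs t < \<delta>" "f \<in> elems (X 0)" for t f n
  proof -
   have "M0 * \<eta>0 ^ n * nrm (X 0) f \<le> M0 * \<eta> ^ (8 * n) * nrm (X 0) f"
    using N0[OF that(3)] M0 by (intro mult_right_mono mult_left_mono \<eta>0le) auto
   then show ?thesis using gap0[OF that(1) _ \<rho>(2,3)[OF that(1,2)] \<rho>c1[OF that(1,2)] that(3), of n] that(2) \<delta>(2) by auto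
  qed
  show "norm2 m (rem \<rho> t n f) \<le> M * \<eta> ^ (8 * n) * nrm (X 0) f"
   if "t \<in> \<Theta>" "abs t < \<delta>" "f \<in> elems (X 0)" for t f n
  proof -
   note s = strong[OF that, of n]
   have "norm2 m (rem \<rho> t n f) \<le> K * (M0 * \<eta> ^ (8 * n) * nrm (X 0) f)"
    using s K0 by (meson mult_left_mono less_imp_le order_trans)
   also have "... = K * M0 * (\<eta> ^ (8 * n) * nrm (X 0) f)" by simp
   also have "... \<le> M * (\<eta> ^ (8 * n) * nrm (X 0) f)" using M(3) \<eta> N0[OF that(3)] by (intro mult_right_mono) auto
   finally show ?thesis by (simp add: mult.assoc)
  qed
  show "rem \<rho> t n f \<in> elems (X 0) \<and>
   nrm (X 0) (rem \<rho> t n f) \<le> M * \<eta> ^ (8 * n) * nrm (X 0) f"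
   if "t \<in> \<Theta>" "abs t < \<delta>" "f \<in> elems (X 0)" for t f n
  proof -
   have "M0 * \<eta> ^ (8 * n) * nrm (X 0) f \<le> M * \<eta> ^ (8 * n) * nrm (X 0) f" using N0[OF that(3)] M \<eta> by (intro mult_right_mono) auto
   then show ?thesis using strong[OF that, of n] by auto
  qed
  show "norm2 m (rem \<rho> t n f) \<le> M * \<eta> ^ (8 * n) * nrm (X 6) f"
   if "t \<in> \<Theta>" "abs t < \<delta>" "f \<in> elems (X 6)" for t f n
  proof -
   have "M6 * \<eta>6 ^ n * nrm (X 6) f \<le> M * \<eta> ^ (8 * n) * nrm (X 6) f"
    using N6[OF that(3)] M M6 \<eta> \<eta>6 by (intro mult_right_mono mult_mono \<eta>6le) auto
   then show ?thesis using gap6[OF that(1) _ \<rho>(2,3)[OF that(1,2)] \<rho>c1[OF that(1,2)] that(3), of n] that(2) \<delta>(3) by auto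
  qed
 qed (use \<delta> \<eta> M \<rho> h2 pc cl mo in auto)
 then show thesis by (rule that)
qed

lemma has_prob_densityD:
 assumes "has_prob_density m \<mu> \<rho>"
 shows "integrable m \<rho>" "(LINT x|m. \<rho> x) = 1" "0 \<le> \<rho> x" "\<mu> = density m (\<lambda>x. ennreal (\<rho> x))"
proof -
 have \<rho> [measurable]: "\<rho> \<in> borel_measurable m" and pos: "\<And>x. 0 \<le> \<rho> x" and \<mu>: "\<mu> = density m (\<lambda>x. ennreal (\<rho> x))" and p: "prob_space \<mu>"
  using assms by (auto simp: has_prob_density_def)
 have "(\<integral>\<^sup>+x. ennreal (\<rho> x) \<partial>m) = emeasure \<mu> (space \<mu>)" unfolding \<mu> by (simp add: emeasure_density cong: nn_integral_cong)
 also have "... = 1" by (rule prob_space.emeasure_space_1[OF p])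
 finally have nn: "(\<integral>\<^sup>+x. ennreal (\<rho> x) \<partial>m) = 1" .
 show i: "integrable m \<rho>" by (rule integrableI_nonneg) (use pos nn in auto)
 show "(LINT x|m. \<rho> x) = 1" using nn_integral_eq_integral[OF i] pos nn by simp
 show "0 \<le> \<rho> x" "\<mu> = density m (\<lambda>x. ennreal (\<rho> x))" by (rule pos \<mu>)+
qed

lemma tendsto_zero_of_uniform:
 fixes F Q :: "nat \<Rightarrow> real \<Rightarrow> real"
 assumes "\<And>e. e > 0 ==> \<forall>\<^sub>F n in sequentially. \<forall>z. abs (F n z - c z) \<le> e" "\<And>e. e > 0 ==> \<forall>\<^sub>F n in sequentially. \<forall>z. abs (Q n z - c z) \<le> e"
 shows "(\<lambda>n. SUP z. abs (F n z - Q n z)) \<longlonglongrightarrow> 0"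
proof (rule tendstoI)
 fix e :: real assume e: "e > 0"
 then have "e / 4 > 0" by simp
 from assms(1)[OF this] assms(2)[OF this]
 show "\<forall>\<^sub>F n in sequentially. dist (SUP z. abs (F n z - Q n z)) 0 < e"
 proof eventually_elim
  case (elim n)
  have le: "abs (F n z - Q n z) \<le> e / 2" for z using spec[OF elim(1), of z] spec[OF elim(2), of z] by linarith
  have "bdd_above (range (\<lambda>z. abs (F n z - Q n z)))" using le by (intro bdd_aboveI[of _ "e / 2"]) auto
  then have "0 \<le> (SUP z. abs (F n z - Q n z))" by (intro cSUP_upper2[of _ _ 0]) auto
  moreover have "(SUP z. abs (F n z - Q n z)) \<le> e / 2" using le by (intro cSUP_least) auto
  ultimately show ?case using e by simp
 qed
qed

theorem mainTheorem4:
  fixes m \<mu> :: "'x::metric_space measure"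
    and g :: "'x \<Rightarrow> 'x"
    and h \<rho> :: "'x \<Rightarrow> real"
    and ghat :: "'x list \<Rightarrow> 'x \<Rightarrow> 'x"
    and \<mu>star :: "'x list \<Rightarrow> 'x measure"
    and \<rho>star :: "'x list \<Rightarrow> 'x \<Rightarrow> real"
  assumes "prob_space m" and "sets m = sets borel"
    and "g \<in> borel_measurable borel"
    and "h \<in> borel_measurable m" and "integrable m (\<lambda>x. \<bar>h x\<bar> ^ 3)"
    and "has_prob_density m \<mu> \<rho>"
    and "\<And>d. d \<noteq> [] \<Longrightarrow> ghat d \<in> borel_measurable borel"
    and "\<And>d. d \<noteq> [] \<Longrightarrow> has_prob_density m (\<mu>star d) (\<rho>star d)"
    and "\<not> cohomologous_to_constant_L2 m g h"
    and "AE x0 in \<mu>. \<exists>(N::nat) \<theta> G \<Theta> p0 X.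
           \<theta> \<longlonglongrightarrow> 0 \<and> G 0 = g \<and> (\<forall>n\<ge>N. G (\<theta> n) = ghat (sample g n x0)) \<and>
           \<Theta> = {\<theta> n |n. n \<ge> N} \<union> {0} \<and> (\<forall>t\<in>\<Theta>. nonsingular m (G t)) \<and>
           2 \<le> p0 \<and>
           assumption_A m \<Theta> G (\<lambda>_. h) p0 (X 0) (X 8) \<and>
           assumption_B m \<Theta> G (\<lambda>_. h) X \<and>
           assumption_C m \<Theta> G (\<lambda>_. h) X \<and>
           assumption_D m \<Theta> (\<lambda>_. h) X \<and>
           (\<exists>i\<le>8. embeds (X i) (X 6) \<and> embeds (X 6) (X 7) \<and>
              (\<lambda>x. complex_of_real (\<rho> x)) \<in> elems (X i) \<and>
              (\<forall>\<^sub>F n in sequentially. (\<lambda>x. complex_of_real (\<rho>star (sample g n x0) x)) \<in> elems (X i)) \<and>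
              (\<lambda>n. nrm (X i) (\<lambda>x. complex_of_real (\<rho>star (sample g n x0) x - \<rho> x))) \<longlonglongrightarrow> 0)"
  shows "AE x0 in \<mu>.
           (\<lambda>n. SUP z. \<bar>measure \<mu> {x \<in> space \<mu>. T_stat \<mu> g h n x \<le> z}
                        - measure (\<mu>star (sample g n x0))
                            {y \<in> space (\<mu>star (sample g n x0)).
                               T_stat (\<mu>star (sample g n x0)) (ghat (sample g n x0)) h n y \<le> z}\<bar>)
             \<longlonglongrightarrow> 0"
proof -
 interpret m: prob_space m by (rule assms(1))
 note dens = has_prob_densityD[OF assms(6)]
 show ?thesis using assms(10)
 proof eventually_elim
  case (elim x0)
  then obtain N \<theta> G \<Theta> p0 X i where \<theta>: "\<theta> \<longlonglongrightarrow> 0" and G0: "G 0 = g" and Gn: "\<forall>n\<ge>N. G (\<theta> n) = ghat (sample g n x0)"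
   and \<Theta>: "\<Theta> = {\<theta> n |n. n \<ge> N} \<union> {0}" and ns: "\<forall>t\<in>\<Theta>. nonsingular m (G t)" and p0: "2 \<le> p0"
   and A: "assumption_A m \<Theta> G (\<lambda>_. h) p0 (X 0) (X 8)" and B: "assumption_B m \<Theta> G (\<lambda>_. h) X" and C: "assumption_C m \<Theta> G (\<lambda>_. h) X"
   and i: "i \<le> 8" and emb: "embeds (X i) (X 6)" and \<rho>i: "cr \<rho> \<in> elems (X i)"
   and \<rho>si: "\<forall>\<^sub>F n in sequentially. (cr (\<rho>star (sample g n x0))) \<in> elems (X i)"
   and lim: "(\<lambda>n. nrm (X i) (\<lambda>x. complex_of_real (\<rho>star (sample g n x0) x - \<rho> x))) \<longlonglongrightarrow> 0" by (elim exE conjE) (rule that; assumption)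
  have "twisted_family m \<Theta> G h" by unfold_locales (use \<Theta> ns assms(4) in auto)
  then interpret twisted_family m \<Theta> G h .
  obtain r \<delta> K C' \<eta> where "gapped_family m \<Theta> G h (X 0) (X 6) r \<delta> K C' \<eta>"
   by (rule gapped_family_of_assumptions[OF assms(5) p0 A B C], rule that)
  then interpret gapped_family m \<Theta> G h "X 0" "X 6" r \<delta> K C' \<eta> .
  obtain D where sys: "\<And>\<theta>. [|\<theta> \<in> \<Theta>; abs \<theta> < \<delta>|] ==> mixing_system (\<nu> \<theta>) (G \<theta>) h D \<eta> \<delta>" by (rule mixing_system_\<nu>, rule that)
  have v: "mixing_system.s (\<nu> 0) (G 0) h \<noteq> 0" by (rule variance_pos_of_not_cohomologous[OF sys[OF zero]]) (use assms(9) G0 in simp)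
  have bi: "banach_space m (X i)" using B i unfolding assumption_B_def by simp
  interpret Xi: complete_seminormed "elems (X i)" "nrm (X i)" by (rule banach_space_seminormed[OF bi])
  obtain E where E: "0 < E" "elems (X i) \<subseteq> elems (X 6)" "\<And>f. f \<in> elems (X i) ==> nrm (X 6) f \<le> E * nrm (X i) f"
   using embedsE[OF emb bi] by blast
  let ?r = "\<lambda>x. complex_of_real (\<rho> x)"
  \<comment> \<open>Norm convergence puts the bootstrap densities eventually within distance 1 of
    \<open>\<rho>\<close> in \<open>X i\<close>; the embedding constant \<open>E\<close> then places
    them and \<open>\<rho>\<close> in one ball of \<open>X 6\<close>.\<close>
  define R where "R = E * (1 + nrm (X i) ?r)"
  have Rr: "nrm (X 6) ?r \<le> R" using E(3)[OF \<rho>i] E(1) by (simp add: R_def algebra_simps)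
  let ?s = "\<lambda>n. sample g n x0"
  have ne: "?s n \<noteq> []" if "n > 0" for n using that by (simp add: sample_def)
  have boot: "\<forall>\<^sub>F n in sequentially. (\<forall>x. 0 \<le> \<rho>star (?s n) x) \<and> (cr (\<rho>star (?s n))) \<in> elems (X 6) \<and>
    nrm (X 6) (cr (\<rho>star (?s n))) \<le> R \<and> (LINT x|m. \<rho>star (?s n) x) = 1"
  proof -
   have "\<forall>\<^sub>F n in sequentially. nrm (X i) (\<lambda>x. complex_of_real (\<rho>star (?s n) x - \<rho> x)) < 1" using lim by (intro order_tendstoD) auto
   then show ?thesis using \<rho>si eventually_gt_at_top[of 0]
   proof eventually_elim
    case (elim n)
    note d = has_prob_densityD[OF assms(8)[OF ne[OF elim(3)]]]
    let ?q = "\<lambda>x. complex_of_real (\<rho>star (?s n) x)"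
    have eq: "(\<lambda>x. complex_of_real (\<rho>star (?s n) x - \<rho> x)) = ?q - ?r" by (simp add: fun_eq_iff)
    have "nrm (X i) ((?q - ?r) + ?r) \<le> nrm (X i) (?q - ?r) + nrm (X i) ?r" by (intro Xi.N_add Xi.diff_mem elim(2) \<rho>i)
    also have "(?q - ?r) + ?r = ?q" by simp
    finally have "nrm (X i) ?q \<le> 1 + nrm (X i) ?r" using elim(1) unfolding eq by linarith
    then have "nrm (X 6) ?q \<le> R" using order_trans[OF E(3)[OF elim(2)] mult_left_mono] E(1) by (simp add: R_def)
    then show ?case using d(2,3) elim(2) E(2) by blast
   qed
  qed
  have orig: "\<forall>\<^sub>F n in sequentially. (\<forall>x. 0 \<le> \<rho> x) \<and> ?r \<in> elems (X 6) \<and> nrm (X 6) ?r \<le> R \<and> (LINT x|m. \<rho> x) = 1"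
   using dens(2,3) \<rho>i E(2) Rr by (intro always_eventually allI) auto
  \<comment> \<open>The original system is treated as the array with constant parameter 0, the
    bootstrap as the array along \<open>\<theta>\<close>, so one central limit theorem covers
    both.\<close>
  have t0: "filterlim (\<lambda>_. 0 :: real) param sequentially" using zero(1) by (auto simp: filterlim_inf filterlim_principal)
  have t1: "filterlim \<theta> param sequentially" using \<theta> unfolding filterlim_inf filterlim_principal eventually_sequentially \<Theta> by auto
  \<comment> \<open>The limit is expressed by the variance at parameter 0 alone: the variances along
    \<open>\<theta>\<close> have already been replaced by it inside \<open>initial_clt\<close>, so
    both comparisons are with the same function.\<close>
  define c where "c z = cdf std_normal_distribution (z / sqrt (mixing_system.s (\<nu> 0) (G 0) h))" for z
  show ?case
  proof (rule tendsto_zero_of_uniform[where c = c])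
   fix e :: real assume e: "e > 0"
   show "\<forall>\<^sub>F n in sequentially. \<forall>z. abs (measure \<mu> {x \<in> space \<mu>. T_stat \<mu> g h n x \<le> z} - c z) \<le> e"
   proof -
    have "\<forall>\<^sub>F n in sequentially. \<forall>z. abs (measure (density m \<rho>) {x \<in> space (density m \<rho>). T_stat (density m \<rho>) (G 0) h n x \<le> z} - c z) \<le> e"
     unfolding c_def by (rule initial_clt[OF sys t0 orig v e])
    then show ?thesis unfolding dens(4)[symmetric] G0 .
   qed
   have bclt: "\<forall>\<^sub>F n in sequentially. \<forall>z. \<bar>measure (density m (\<rho>star (?s n))) {x \<in> space (density m (\<rho>star (?s n))).
     T_stat (density m (\<rho>star (?s n))) (G (\<theta> n)) h n x \<le> z} - c z\<bar> \<le> e" unfolding c_def by (rule initial_clt[OF sys t1 boot v e])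
   show "\<forall>\<^sub>F n in sequentially. \<forall>z. abs (measure (\<mu>star (?s n)) {y \<in> space (\<mu>star (?s n)). T_stat (\<mu>star (?s n)) (ghat (?s n)) h n y \<le> z} - c z) \<le> e"
    using bclt eventually_ge_at_top[of N] eventually_gt_at_top[of 0]
   proof eventually_elim
    case (elim n)
    have "\<mu>star (?s n) = density m (\<lambda>x. ennreal (\<rho>star (?s n) x))" by (rule has_prob_densityD(4)[OF assms(8)[OF ne[OF elim(3)]]])
    moreover have "ghat (?s n) = G (\<theta> n)" using Gn elim(2) by simp
    ultimately show ?case using elim(1) unfolding c_def by simp
   qed
  qed
 qed
qed

end
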